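(* Let $\mathbf{P}_\Sigma$ be a complete simplicial toric variety with a semiample anticanonical degree, such that the minimal lattice generators $e_1,\dots,e_n$ of the 1-dimensional cones of $\Sigma$ lie on the boundary of the reflexive polytope $\Delta^\circ$ and include all lattice points of one of the edges $\Gamma^*\subset\Delta^\circ$. Let $e_{i_0},e_{i_1},\dots,e_{i_{k+1}}$ be the lattice points of $\Gamma^*$ in consecutive order. Then the morphism $$\phi_{\Gamma^*}:\mathbf{P}_\Sigma\rightarrow\mathbf{P}_{\Sigma(\Gamma^* )}$$ given in homogeneous coordinates by $$s_j=x_{i_0}x_{i_1}\cdots x_{i_{j-1}}\ (j=1,\dots,k+1),\qquad t_j=x_{i_{j+1}}x_{i_{j+2}}\cdots x_{i_{k+1}}\ (j=0,\dots,k),\qquad y_i=x_i\ (e_i\notin\Gamma^* )$$ is a well defined embedding. Moreover, the image of $\mathbf{P}_\Sigma$ is a quasismooth complete intersection in $\mathbf{P}_{\Sigma(\Gamma^* )}$ given by the equations $$s_{j+1}t_j=s_jt_{j-1},\qquad j=1,\dots,k.$$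
   Context: **Toric varieties.** $N$ is a lattice of rank $d$, $M=\mathrm{Hom}(N,\mathbb{Z})$, $N_{\mathbb R}=N\otimes\mathbb R$, $M_{\mathbb R}=M\otimes\mathbb R$, and $\langle\,,\,\rangle$ is the pairing. Let $\Sigma$ be a fan in $N_{\mathbb R}$ whose 1-dimensional cones span $N_{\mathbb R}$ and have minimal integral generators $e_1,\dots,e_n$. Let $x_1,\dots,x_n$ be the corresponding coordinates on $\mathbb C^n$, $B(\Sigma)=\langle\prod_{e_i\notin\sigma}x_i:\sigma\in\Sigma\rangle\subset\mathbb C[x_1,\dots,x_n]$, and $G(\Sigma)=\{(x_i)\in(\mathbb C^* )^n:\prod_{i}x_i^{\langle m,e_i\rangle}=1\ \forall m\in M\}$. The toric variety is the categorical quotient $\mathbf P_\Sigma=(\mathbb C^n\setminus\mathbf V(B(\Sigma)))/G(\Sigma)$ over $\mathbb C$ (a geometric quotient if $\Sigma$ is simplicial), and the $x_i$ are its homogeneous coordinates, graded by the Chow group $A_{d-1}(\mathbf P_\Sigma)$ with $\deg x_i=[D_i]$, $D_i=\{x_i=0\}$. The anticanonical degree is $\beta=[\sum_iD_i]$. It is semiample if $\mathcal O(\sum_i D_i)$ is a line bundle generated by global sections. **Polytopes.** $\Delta=\{m\in M_{\mathbb R}:\langle m,e_i\rangle\ge-1\ \forall i\}$ and $\Delta^\circ=\{n\in N_{\mathbb R}:\langle m,n\rangle\ge-1\ \forall m\in\Delta\}$. When $\beta$ is semiample and $\Sigma$ is complete, $\Delta$ is reflexive (its vertices are lattice points, its only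 interior lattice point is $0$, and the same holds for $\Delta^\circ$), all $e_i$ lie on the boundary of $\Delta^\circ$, and $\Sigma$ is a subdivision of the fan whose cones are the cones over the faces of $\Delta^\circ$. **The fan $\Sigma(\Gamma^* )$.** Let $\Gamma^*$ be an edge of $\Delta^\circ$ all of whose lattice points are among $e_1,\dots,e_n$, ordered consecutively along $\Gamma^*$ as $e_{i_0},e_{i_1},\dots,e_{i_{k+1}}$ (so $e_{i_1},\dots,e_{i_k}$ are the interior lattice points). Let $v_1,\dots,v_k$ be the standard basis of $\mathbb Z^k$. In $N\oplus\mathbb Z^k$ put $\tilde e_{s_j}=v_j$ for $j=1,\dots,k$; $\tilde e_{s_{k+1}}=e_{i_0}-v_1-\cdots-v_k$; $\tilde e_{t_{j-1}}=v_j+\frac1{k+1}(e_{i_{k+1}}-e_{i_0})$ for $j=1,\dots,k$; $\tilde e_{t_k}=e_{i_0}-v_1-\cdots-v_k+\frac1{k+1}(e_{i_{k+1}}-e_{i_0})$; and $\tilde e_i=e_i$ for $e_i\notin\Gamma^*$. $\Sigma(\Gamma^* )$ is the simplicial fan in $N_{\mathbb R}\oplus\mathbb R^k$ consisting of the following cones, for $\sigma\in\Sigma$, together with all their faces (where $\sigma\cap\Gamma^*$ is recorded by the generators $e_i$ of $\sigma$ lying in $\Gamma^*$): (i) $\sigma$ (viewed as $\sigma\oplus\mathbf 0$), if $\sigma\cap\Gamma^*=\emptyset$; (ii) the cone generated by the $e_i\in\sigma\setminus\{e_{i_j}\}$ and $\tilde e_{t_0},\dots,\tilde e_{t_{j-1}},\tilde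 e_{s_{j+1}},\dots,\tilde e_{s_{k+1}}$, if $e_{i_j}$ is the only generator of $\sigma$ in $\Gamma^*$; (iii) the cone generated by the $e_i\in\sigma$ with $e_i\notin\Gamma^*$ and $\tilde e_{t_0},\dots,\tilde e_{t_j},\tilde e_{s_{j+1}},\dots,\tilde e_{s_{k+1}}$, if the generators of $\sigma$ in $\Gamma^*$ are exactly $e_{i_j},e_{i_{j+1}}$. The homogeneous coordinates of $\mathbf P_{\Sigma(\Gamma^* )}=(\mathbb C^{n+k}\setminus\mathbf V(B(\Sigma(\Gamma^* ))))/G(\Sigma(\Gamma^* ))$ corresponding to $\tilde e_{s_j},\tilde e_{t_j},\tilde e_i$ are denoted $s_j$ ($1\le j\le k+1$), $t_j$ ($0\le j\le k$), $y_i$ ($e_i\notin\Gamma^*$). **Quasismooth.** A complete intersection in a simplicial toric variety defined by homogeneous polynomials $f_1,\dots,f_s$ in the homogeneous coordinates is quasismooth if the Jacobian matrix of $f_1,\dots,f_s$ with respect to all homogeneous coordinates has maximal rank $s$ at every common zero of $f_1,\dots,f_s$ in the complement of the zero set of the irrelevant ideal $B$. *)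

theory Defs
  imports "HOL-Analysis.Analysis" "HOL-Analysis.Finite_Function_Topology"
begin

section \<open>Varieties as spaces with regular functions\<close>

text \<open>
  A complex variety is given by its Zariski topology and, for every open set \<open>U\<close>, the functions
  regular on \<open>U\<close>.  Functions are total in HOL: only the values on \<open>U\<close> are relevant for
  membership in \<open>reg X U\<close>.
\<close>

record 'p variety =
  zar :: "'p topology"
  reg :: "'p set \<Rightarrow> ('p \<Rightarrow> complex) set"

definition points :: "'p variety \<Rightarrow> 'p set" where
  "points X = topspace (zar X)"

definition morphism :: "'p variety \<Rightarrow> 'q variety \<Rightarrow> ('p \<Rightarrow> 'q) \<Rightarrow> bool" where
  "morphism X Y \<phi> \<longleftrightarrow>
     continuous_map (zar X) (zar Y) \<phi> \<and>
     (\<forall>V f. openin (zar Y) V \<longrightarrow> f \<in> reg Y V \<longrightarrow> f \<circ> \<phi> \<in> reg X {p \<in> points X. \<phi> p \<in> V})"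

definition isomorphism :: "'p variety \<Rightarrow> 'q variety \<Rightarrow> ('p \<Rightarrow> 'q) \<Rightarrow> bool" where
  "isomorphism X Y \<phi> \<longleftrightarrow>
     morphism X Y \<phi> \<and>
     (\<exists>\<psi>. morphism Y X \<psi> \<and> (\<forall>p\<in>points X. \<psi> (\<phi> p) = p) \<and> (\<forall>q\<in>points Y. \<phi> (\<psi> q) = q))"

text \<open>The reduced induced structure: regular functions are locally restrictions from \<open>Y\<close>.\<close>

definition subvariety :: "'q variety \<Rightarrow> 'q set \<Rightarrow> 'q variety" where
  "subvariety Y Z =
     \<lparr>zar = subtopology (zar Y) Z,
      reg = (\<lambda>U. {f. \<forall>p\<in>U. \<exists>V g. openin (zar Y) V \<and> p \<in> V \<and> g \<in> reg Y V \<and>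
                                (\<forall>q\<in>V \<inter> U. f q = g q)})\<rparr>"

definition closed_embedding :: "'p variety \<Rightarrow> 'q variety \<Rightarrow> ('p \<Rightarrow> 'q) \<Rightarrow> bool" where
  "closed_embedding X Y \<phi> \<longleftrightarrow>
     morphism X Y \<phi> \<and>
     closedin (zar Y) (\<phi> ` points X) \<and>
     isomorphism X (subvariety Y (\<phi> ` points X)) \<phi>"

definition irreducible_closed :: "'p topology \<Rightarrow> 'p set \<Rightarrow> bool" where
  "irreducible_closed T C \<longleftrightarrow>
     closedin T C \<and> C \<noteq> {} \<and>
     (\<forall>A B. closedin T A \<longrightarrow> closedin T B \<longrightarrow> C \<subseteq> A \<union> B \<longrightarrow> C \<subseteq> A \<or> C \<subseteq> B)"

definition irreducible_chain :: "'p topology \<Rightarrow> nat \<Rightarrow> bool" where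
  "irreducible_chain T n \<longleftrightarrow>
     (\<exists>c. (\<forall>i\<le>n. irreducible_closed T (c i)) \<and> (\<forall>i<n. c i \<subset> c (Suc i)))"

definition has_krull_dim :: "'p topology \<Rightarrow> nat \<Rightarrow> bool" where
  "has_krull_dim T n \<longleftrightarrow> irreducible_chain T n \<and> (\<forall>m. irreducible_chain T m \<longrightarrow> m \<le> n)"

definition quotient_top :: "'a topology \<Rightarrow> ('a \<Rightarrow> 'b) \<Rightarrow> 'b topology" where
  "quotient_top T f = topology (\<lambda>U. U \<subseteq> f ` topspace T \<and> openin T {x \<in> topspace T. f x \<in> U})"

lemma openin_quotient_top:
  "openin (quotient_top T f) U \<longleftrightarrow>
     U \<subseteq> f ` topspace T \<and> openin T {x \<in> topspace T. f x \<in> U}"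
proof -
  have "istopology (\<lambda>U. U \<subseteq> f ` topspace T \<and> openin T {x \<in> topspace T. f x \<in> U})"
    unfolding istopology_def
  proof (intro conjI allI impI; (elim conjE)?)
    fix S U
    assume "openin T {x \<in> topspace T. f x \<in> S}" "openin T {x \<in> topspace T. f x \<in> U}"
    then have "openin T ({x \<in> topspace T. f x \<in> S} \<inter> {x \<in> topspace T. f x \<in> U})" by blast
    also have "{x \<in> topspace T. f x \<in> S} \<inter> {x \<in> topspace T. f x \<in> U}
                 = {x \<in> topspace T. f x \<in> S \<inter> U}" by blast
    finally show "openin T {x \<in> topspace T. f x \<in> S \<inter> U}" .
  next
    fix K
    assume "\<forall>S\<in>K. S \<subseteq> f ` topspace T \<and> openin T {x \<in> topspace T. f x \<in> S}"
    then have "openin T (\<Union>S\<in>K. {x \<in> topspace T. f x \<in> S})" by blast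
    also have "(\<Union>S\<in>K. {x \<in> topspace T. f x \<in> S}) = {x \<in> topspace T. f x \<in> \<Union>K}" by blast
    finally show "openin T {x \<in> topspace T. f x \<in> \<Union>K}" .
  qed blast+
  then show ?thesis
    by (simp add: quotient_top_def)
qed

lemma quotient_map_quotient_top: "quotient_map T (quotient_top T f) f"
proof -
  have "{x \<in> topspace T. f x \<in> f ` topspace T} = topspace T" by blast
  then have "openin (quotient_top T f) (f ` topspace T)"
    by (simp add: openin_quotient_top)
  then have "topspace (quotient_top T f) = f ` topspace T"
    by (metis openin_quotient_top openin_subset openin_topspace subset_antisym)
  then show ?thesis
    by (auto simp: quotient_map_def openin_quotient_top)
qed


section \<open>Polynomials and regular functions on affine space\<close>

text \<open>Coordinates are indexed by an arbitrary type; exponents are finitely supported functions.\<close>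

type_synonym 'v mpoly = "('v \<Rightarrow>\<^sub>0 nat) \<Rightarrow>\<^sub>0 complex"

definition var :: "'v \<Rightarrow> 'v mpoly" where
  "var u = Poly_Mapping.single (Poly_Mapping.single u 1) 1"

definition polys :: "'v set \<Rightarrow> 'v mpoly set" where
  "polys R = {p. \<forall>a\<in>Poly_Mapping.keys p. Poly_Mapping.keys a \<subseteq> R}"

definition peval :: "'v mpoly \<Rightarrow> ('v \<Rightarrow> complex) \<Rightarrow> complex" where
  "peval p x = (\<Sum>a\<in>Poly_Mapping.keys p.
     Poly_Mapping.lookup p a * (\<Prod>u\<in>Poly_Mapping.keys a. x u ^ Poly_Mapping.lookup a u))"

definition partial :: "'v \<Rightarrow> 'v mpoly \<Rightarrow> ('v \<Rightarrow> complex) \<Rightarrow> complex" where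
  "partial u p x = deriv (\<lambda>z. peval p (x(u := z))) (x u)"

definition affine_space :: "'v set \<Rightarrow> ('v \<Rightarrow> complex) set" where
  "affine_space R = R \<rightarrow>\<^sub>E UNIV"

definition zariski :: "'v set \<Rightarrow> ('v \<Rightarrow> complex) topology" where
  "zariski R = topology_generated_by {{x \<in> affine_space R. peval p x \<noteq> 0} | p. p \<in> polys R}"

definition regular_on :: "'v set \<Rightarrow> ('v \<Rightarrow> complex) set \<Rightarrow> (('v \<Rightarrow> complex) \<Rightarrow> complex) \<Rightarrow> bool" where
  "regular_on R W F \<longleftrightarrow>
     (\<forall>x\<in>W. \<exists>V. \<exists>p\<in>polys R. \<exists>q\<in>polys R.
        openin (zariski R) V \<and> x \<in> V \<and> V \<subseteq> W \<and>
        (\<forall>y\<in>V. peval q y \<noteq> 0 \<and> F y = peval p y / peval q y))"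


section \<open>Lattices and fans\<close>

text \<open>
  A lattice \<open>N\<close> is a subset of a real vector space, with \<open>N\<^sub>\<real> = span N\<close>.  Every homomorphism from
  \<open>N\<close> to the integers is the restriction of a bounded linear functional, so the dual lattice \<open>M\<close>
  is represented by the functionals that are integral on \<open>N\<close>; if \<open>span N = UNIV\<close> this
  representation is unique and \<open>M\<^sub>\<real>\<close> is the whole dual space.
\<close>

definition is_lattice :: "'v::real_vector set \<Rightarrow> bool" where
  "is_lattice N \<longleftrightarrow>
     (\<exists>B. finite B \<and> independent B \<and> N = {\<Sum>b\<in>B. real_of_int (c b) *\<^sub>R b | c. True})"

definition dual_lattice :: "'v::real_normed_vector set \<Rightarrow> ('v \<Rightarrow>\<^sub>L real) set" where
  "dual_lattice N = {m. \<forall>u\<in>N. blinfun_apply m u \<in> \<int>}"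

definition is_fan :: "'v::real_vector set \<Rightarrow> 'v set set \<Rightarrow> bool" where
  "is_fan N \<Sigma> \<longleftrightarrow>
     finite \<Sigma> \<and> \<Sigma> \<noteq> {} \<and>
     (\<forall>\<sigma>\<in>\<Sigma>. (\<exists>S. finite S \<and> S \<subseteq> N \<and> \<sigma> = convex_cone hull S) \<and> \<sigma> \<inter> uminus ` \<sigma> = {0}) \<and>
     (\<forall>\<sigma>\<in>\<Sigma>. \<forall>\<tau>. \<tau> face_of \<sigma> \<longrightarrow> \<tau> \<noteq> {} \<longrightarrow> \<tau> \<in> \<Sigma>) \<and>
     (\<forall>\<sigma>\<in>\<Sigma>. \<forall>\<tau>\<in>\<Sigma>. (\<sigma> \<inter> \<tau>) face_of \<sigma> \<and> (\<sigma> \<inter> \<tau>) face_of \<tau>)"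

definition simplicial_fan :: "'v::real_vector set set \<Rightarrow> bool" where
  "simplicial_fan \<Sigma> \<longleftrightarrow> (\<forall>\<sigma>\<in>\<Sigma>. \<exists>S. finite S \<and> independent S \<and> \<sigma> = convex_cone hull S)"

definition complete_fan :: "'v::real_vector set \<Rightarrow> 'v set set \<Rightarrow> bool" where
  "complete_fan N \<Sigma> \<longleftrightarrow> \<Union>\<Sigma> = span N"

text \<open>The minimal lattice generators of the one-dimensional cones.\<close>

definition ray_gens :: "'v::real_vector set \<Rightarrow> 'v set set \<Rightarrow> 'v set" where
  "ray_gens N \<Sigma> =
     {u \<in> N. u \<noteq> 0 \<and> convex_cone hull {u} \<in> \<Sigma> \<and> (\<forall>c. 0 < c \<longrightarrow> c < 1 \<longrightarrow> c *\<^sub>R u \<notin> N)}"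


section \<open>Toric varieties by homogeneous coordinates\<close>

text \<open>
  The homogeneous coordinates are indexed by the ray generators themselves.  The set
  \<open>semistable N \<Sigma>\<close> is the complement of the zero set of the irrelevant ideal.
\<close>

definition semistable :: "'v::real_vector set \<Rightarrow> 'v set set \<Rightarrow> ('v \<Rightarrow> complex) set" where
  "semistable N \<Sigma> =
     affine_space (ray_gens N \<Sigma>) - {x. \<forall>\<sigma>\<in>\<Sigma>. (\<Prod>u\<in>ray_gens N \<Sigma> - \<sigma>. x u) = 0}"

definition torus_group :: "'v::real_normed_vector set \<Rightarrow> 'v set set \<Rightarrow> ('v \<Rightarrow> complex) set" where
  "torus_group N \<Sigma> =
     {g \<in> ray_gens N \<Sigma> \<rightarrow>\<^sub>E (UNIV - {0}).
        \<forall>m\<in>dual_lattice N. (\<Prod>u\<in>ray_gens N \<Sigma>. g u powi \<lfloor>blinfun_apply m u\<rfloor>) = 1}"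

definition act :: "'v set \<Rightarrow> ('v \<Rightarrow> complex) \<Rightarrow> ('v \<Rightarrow> complex) \<Rightarrow> 'v \<Rightarrow> complex" where
  "act R g x = (\<lambda>u\<in>R. g u * x u)"

definition orbit ::
  "'v::real_normed_vector set \<Rightarrow> 'v set set \<Rightarrow> ('v \<Rightarrow> complex) \<Rightarrow> ('v \<Rightarrow> complex) set" where
  "orbit N \<Sigma> x = (\<lambda>g. act (ray_gens N \<Sigma>) g x) ` torus_group N \<Sigma>"

definition cox_preimage ::
  "'v::real_normed_vector set \<Rightarrow> 'v set set \<Rightarrow> ('v \<Rightarrow> complex) set set \<Rightarrow> ('v \<Rightarrow> complex) set" where
  "cox_preimage N \<Sigma> U = {x \<in> semistable N \<Sigma>. orbit N \<Sigma> x \<in> U}"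

text \<open>
  The geometric quotient (hence the toric variety only for simplicial fans): its points are the
  orbits, with the quotient topology, and the regular functions on \<open>U\<close> are the invariant regular
  functions on the preimage of \<open>U\<close>.
\<close>

definition toric_variety ::
  "'v::real_normed_vector set \<Rightarrow> 'v set set \<Rightarrow> ('v \<Rightarrow> complex) set variety" where
  "toric_variety N \<Sigma> =
     \<lparr>zar = quotient_top (subtopology (zariski (ray_gens N \<Sigma>)) (semistable N \<Sigma>)) (orbit N \<Sigma>),
      reg = (\<lambda>U. {f. regular_on (ray_gens N \<Sigma>) (cox_preimage N \<Sigma> U) (f \<circ> orbit N \<Sigma>)})\<rparr>"

text \<open>
  Linear equivalence of the torus invariant divisors with coefficients \<open>a\<close> and \<open>b\<close>, that is,
  equality of their classes in the Chow group; it determines the grading of polynomials.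
\<close>

definition same_class ::
  "'v::real_normed_vector set \<Rightarrow> 'v set set \<Rightarrow> ('v \<Rightarrow> int) \<Rightarrow> ('v \<Rightarrow> int) \<Rightarrow> bool" where
  "same_class N \<Sigma> a b \<longleftrightarrow>
     (\<exists>m\<in>dual_lattice N. \<forall>u\<in>ray_gens N \<Sigma>. real_of_int (a u - b u) = blinfun_apply m u)"

definition homogeneous :: "'v::real_normed_vector set \<Rightarrow> 'v set set \<Rightarrow> 'v mpoly \<Rightarrow> bool" where
  "homogeneous N \<Sigma> p \<longleftrightarrow>
     p \<in> polys (ray_gens N \<Sigma>) \<and>
     (\<forall>a\<in>Poly_Mapping.keys p. \<forall>b\<in>Poly_Mapping.keys p.
        same_class N \<Sigma> (\<lambda>u. int (Poly_Mapping.lookup a u)) (\<lambda>u. int (Poly_Mapping.lookup b u)))"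

text \<open>
  Sections over \<open>U\<close> of the sheaf \<open>\<O>(D)\<close>, \<open>D = \<Sum> a\<^sub>u D\<^sub>u\<close>, in homogeneous coordinates: regular
  functions on the preimage of \<open>U\<close> of degree \<open>[D]\<close>.  A section \<open>F\<close> corresponds to the rational
  function \<open>F / \<Prod> x\<^sub>u ^ a\<^sub>u\<close>.
\<close>

definition divisor_sections ::
  "'v::real_normed_vector set \<Rightarrow> 'v set set \<Rightarrow> ('v \<Rightarrow> int) \<Rightarrow> ('v \<Rightarrow> complex) set set
     \<Rightarrow> (('v \<Rightarrow> complex) \<Rightarrow> complex) set" where
  "divisor_sections N \<Sigma> a U =
     {F. regular_on (ray_gens N \<Sigma>) (cox_preimage N \<Sigma> U) F \<and>
         (\<forall>g\<in>torus_group N \<Sigma>. \<forall>x\<in>cox_preimage N \<Sigma> U.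
            F (act (ray_gens N \<Sigma>) g x) = (\<Prod>u\<in>ray_gens N \<Sigma>. g u powi a u) * F x)}"

text \<open>\<open>\<O>(D)\<close> restricted to \<open>U\<close> is free of rank one with generator \<open>s\<close>.\<close>

definition local_frame ::
  "'v::real_normed_vector set \<Rightarrow> 'v set set \<Rightarrow> ('v \<Rightarrow> int) \<Rightarrow> ('v \<Rightarrow> complex) set set
     \<Rightarrow> (('v \<Rightarrow> complex) \<Rightarrow> complex) \<Rightarrow> bool" where
  "local_frame N \<Sigma> a U s \<longleftrightarrow>
     s \<in> divisor_sections N \<Sigma> a U \<and>
     (\<forall>V. openin (zar (toric_variety N \<Sigma>)) V \<longrightarrow> V \<subseteq> U \<longrightarrow>
        (\<forall>F\<in>divisor_sections N \<Sigma> a V. \<exists>f\<in>reg (toric_variety N \<Sigma>) V.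
           \<forall>x\<in>cox_preimage N \<Sigma> V. F x = f (orbit N \<Sigma> x) * s x) \<and>
        (\<forall>f\<in>reg (toric_variety N \<Sigma>) V.
           (\<forall>x\<in>cox_preimage N \<Sigma> V. f (orbit N \<Sigma> x) * s x = 0) \<longrightarrow> (\<forall>p\<in>V. f p = 0)))"

definition is_line_bundle ::
  "'v::real_normed_vector set \<Rightarrow> 'v set set \<Rightarrow> ('v \<Rightarrow> int) \<Rightarrow> bool" where
  "is_line_bundle N \<Sigma> a \<longleftrightarrow>
     (\<forall>p\<in>points (toric_variety N \<Sigma>).
        \<exists>U s. openin (zar (toric_variety N \<Sigma>)) U \<and> p \<in> U \<and> local_frame N \<Sigma> a U s)"

definition globally_generated ::
  "'v::real_normed_vector set \<Rightarrow> 'v set set \<Rightarrow> ('v \<Rightarrow> int) \<Rightarrow> bool" where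
  "globally_generated N \<Sigma> a \<longleftrightarrow>
     (\<forall>p V F. openin (zar (toric_variety N \<Sigma>)) V \<longrightarrow> p \<in> V \<longrightarrow> F \<in> divisor_sections N \<Sigma> a V \<longrightarrow>
        (\<exists>W. \<exists>r::nat. \<exists>s f. openin (zar (toric_variety N \<Sigma>)) W \<and> p \<in> W \<and> W \<subseteq> V \<and>
           (\<forall>i<r. s i \<in> divisor_sections N \<Sigma> a (points (toric_variety N \<Sigma>))
                  \<and> f i \<in> reg (toric_variety N \<Sigma>) W) \<and>
           (\<forall>x\<in>cox_preimage N \<Sigma> W. F x = (\<Sum>i<r. f i (orbit N \<Sigma> x) * s i x))))"

definition semiample_anticanonical ::
  "'v::real_normed_vector set \<Rightarrow> 'v set set \<Rightarrow> bool" where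
  "semiample_anticanonical N \<Sigma> \<longleftrightarrow>
     is_line_bundle N \<Sigma> (\<lambda>_. 1) \<and> globally_generated N \<Sigma> (\<lambda>_. 1)"


section \<open>Complete intersections\<close>

definition zero_locus ::
  "'v::real_normed_vector set \<Rightarrow> 'v set set \<Rightarrow> nat \<Rightarrow> (nat \<Rightarrow> 'v mpoly)
     \<Rightarrow> ('v \<Rightarrow> complex) set set" where
  "zero_locus N \<Sigma> s f =
     orbit N \<Sigma> ` {x \<in> semistable N \<Sigma>. \<forall>j\<in>{1..s}. peval (f j) x = 0}"

definition complete_intersection ::
  "'v::real_normed_vector set \<Rightarrow> 'v set set \<Rightarrow> nat \<Rightarrow> (nat \<Rightarrow> 'v mpoly)
     \<Rightarrow> ('v \<Rightarrow> complex) set set \<Rightarrow> bool" where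
  "complete_intersection N \<Sigma> s f Z \<longleftrightarrow>
     (\<forall>j\<in>{1..s}. homogeneous N \<Sigma> (f j)) \<and>
     Z = zero_locus N \<Sigma> s f \<and>
     (\<exists>n. has_krull_dim (zar (toric_variety N \<Sigma>)) (n + s) \<and>
          has_krull_dim (subtopology (zar (toric_variety N \<Sigma>)) Z) n)"

text \<open>The Jacobian matrix has rank \<open>s\<close> iff its \<open>s\<close> rows are linearly independent.\<close>

definition jacobian_full_rank ::
  "'v set \<Rightarrow> nat \<Rightarrow> (nat \<Rightarrow> 'v mpoly) \<Rightarrow> ('v \<Rightarrow> complex) \<Rightarrow> bool" where
  "jacobian_full_rank R s f x \<longleftrightarrow>
     (\<forall>c::nat \<Rightarrow> complex.
        (\<forall>u\<in>R. (\<Sum>j\<in>{1..s}. c j * partial u (f j) x) = 0) \<longrightarrow> (\<forall>j\<in>{1..s}. c j = 0))"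

definition quasismooth_complete_intersection ::
  "'v::real_normed_vector set \<Rightarrow> 'v set set \<Rightarrow> nat \<Rightarrow> (nat \<Rightarrow> 'v mpoly)
     \<Rightarrow> ('v \<Rightarrow> complex) set set \<Rightarrow> bool" where
  "quasismooth_complete_intersection N \<Sigma> s f Z \<longleftrightarrow>
     complete_intersection N \<Sigma> s f Z \<and>
     (\<forall>x\<in>semistable N \<Sigma>. (\<forall>j\<in>{1..s}. peval (f j) x = 0) \<longrightarrow>
        jacobian_full_rank (ray_gens N \<Sigma>) s f x)"


section \<open>Reflexive polytopes\<close>

definition anticanonical_polytope ::
  "'v::real_normed_vector set \<Rightarrow> 'v set set \<Rightarrow> ('v \<Rightarrow>\<^sub>L real) set" where
  "anticanonical_polytope N \<Sigma> = {m. \<forall>u\<in>ray_gens N \<Sigma>. blinfun_apply m u \<ge> -1}"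

definition polar_polytope :: "('v::real_normed_vector \<Rightarrow>\<^sub>L real) set \<Rightarrow> 'v set" where
  "polar_polytope \<Delta> = {u. \<forall>m\<in>\<Delta>. blinfun_apply m u \<ge> -1}"

definition interior_zero_lattice_polytope :: "'v::real_normed_vector set \<Rightarrow> 'v set \<Rightarrow> bool" where
  "interior_zero_lattice_polytope L P \<longleftrightarrow>
     polytope P \<and> {v. v extreme_point_of P} \<subseteq> L \<and> interior P \<inter> L = {0}"

definition reflexive :: "'v::euclidean_space set \<Rightarrow> ('v \<Rightarrow>\<^sub>L real) set \<Rightarrow> bool" where
  "reflexive N \<Delta> \<longleftrightarrow>
     interior_zero_lattice_polytope (dual_lattice N) \<Delta> \<and>
     interior_zero_lattice_polytope N (polar_polytope \<Delta>)"


section \<open>The fan associated with an edge\<close>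

text \<open>
  The lattice \<open>N \<oplus> \<int>\<^sup>k\<close>, the second factor being the integral vectors supported on \<open>{1..k}\<close>.
\<close>

definition lifted_lattice :: "'v set \<Rightarrow> nat \<Rightarrow> ('v \<times> (nat \<Rightarrow>\<^sub>0 real)) set" where
  "lifted_lattice N k =
     N \<times> {w. Poly_Mapping.keys w \<subseteq> {1..k} \<and> (\<forall>j. Poly_Mapping.lookup w j \<in> \<int>)}"

text \<open>
  \<open>s_gen e k j\<close> (\<open>1 \<le> j \<le> k + 1\<close>) and \<open>t_gen e k j\<close> (\<open>0 \<le> j \<le> k\<close>) are the generators for the
  coordinates \<open>s\<^sub>j\<close> and \<open>t\<^sub>j\<close>, where \<open>e 0, \<dots>, e (k + 1)\<close> are the lattice points of the edge.
\<close>

definition s_gen :: "(nat \<Rightarrow> 'v::real_vector) \<Rightarrow> nat \<Rightarrow> nat \<Rightarrow> 'v \<times> (nat \<Rightarrow>\<^sub>0 real)" where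
  "s_gen e k j =
     (if j \<le> k then (0, Poly_Mapping.single j 1)
      else (e 0, - (\<Sum>l\<in>{1..k}. Poly_Mapping.single l 1)))"

definition t_gen :: "(nat \<Rightarrow> 'v::real_vector) \<Rightarrow> nat \<Rightarrow> nat \<Rightarrow> 'v \<times> (nat \<Rightarrow>\<^sub>0 real)" where
  "t_gen e k j = s_gen e k (j + 1) + ((1 / real (k + 1)) *\<^sub>R (e (k + 1) - e 0), 0)"

definition lifted_cones ::
  "'v::real_vector set \<Rightarrow> 'v set set \<Rightarrow> 'v set \<Rightarrow> (nat \<Rightarrow> 'v) \<Rightarrow> nat
     \<Rightarrow> ('v \<times> (nat \<Rightarrow>\<^sub>0 real)) set set" where
  "lifted_cones N \<Sigma> \<Gamma> e k =
     {\<sigma> \<times> {0} | \<sigma>. \<sigma> \<in> \<Sigma> \<and> ray_gens N \<Sigma> \<inter> \<sigma> \<inter> \<Gamma> = {}} \<union>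
     {convex_cone hull ((\<lambda>u. (u, 0)) ` (ray_gens N \<Sigma> \<inter> \<sigma> - {e j})
         \<union> t_gen e k ` {0..<j} \<union> s_gen e k ` {j + 1..k + 1}) | \<sigma> j.
       \<sigma> \<in> \<Sigma> \<and> j \<le> k + 1 \<and> ray_gens N \<Sigma> \<inter> \<sigma> \<inter> \<Gamma> = {e j}} \<union>
     {convex_cone hull ((\<lambda>u. (u, 0)) ` (ray_gens N \<Sigma> \<inter> \<sigma> - \<Gamma>)
         \<union> t_gen e k ` {0..j} \<union> s_gen e k ` {j + 1..k + 1}) | \<sigma> j.
       \<sigma> \<in> \<Sigma> \<and> j \<le> k \<and> ray_gens N \<Sigma> \<inter> \<sigma> \<inter> \<Gamma> = {e j, e (j + 1)}}"

definition edge_fan ::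
  "'v::real_vector set \<Rightarrow> 'v set set \<Rightarrow> 'v set \<Rightarrow> (nat \<Rightarrow> 'v) \<Rightarrow> nat
     \<Rightarrow> ('v \<times> (nat \<Rightarrow>\<^sub>0 real)) set set" where
  "edge_fan N \<Sigma> \<Gamma> e k = {\<tau>. \<tau> \<noteq> {} \<and> (\<exists>\<sigma>\<in>lifted_cones N \<Sigma> \<Gamma> e k. \<tau> face_of \<sigma>)}"

text \<open>The ordering condition is vacuous if the edge has no interior lattice points (\<open>k = 0\<close>).\<close>

definition consecutive_lattice_points ::
  "'v::real_vector set \<Rightarrow> 'v set \<Rightarrow> (nat \<Rightarrow> 'v) \<Rightarrow> nat \<Rightarrow> bool" where
  "consecutive_lattice_points N \<Gamma> e k \<longleftrightarrow>
     bij_betw e {0..k + 1} (\<Gamma> \<inter> N) \<and>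
     (\<forall>a b c. a < b \<longrightarrow> b < c \<longrightarrow> c \<le> k + 1 \<longrightarrow> e b \<in> open_segment (e a) (e c))"

end

theory Submission
  imports Defs
begin

text \<open>
  The \<open>2 k + 2\<close> new coordinates come in pairs \<open>s\<^sub>i\<^sub>+\<^sub>1, t\<^sub>i\<close> (\<open>i \<le> k\<close>), and every \<open>s\<^sub>i\<^sub>+\<^sub>1 t\<^sub>i\<close>
  pulls back to the product of all coordinates of the edge; the equations say that these \<open>k + 1\<close>
  products agree.  On the chart of a cone of the lifted fan there is an index \<open>j\<close> such that \<open>s\<^sub>i\<^sub>+\<^sub>1\<close>
  (\<open>i < j\<close>) and \<open>t\<^sub>i\<close> (\<open>i > j\<close>) are invertible.  There the coordinates of the edge are recovered as
  quotients of consecutive \<open>s\<close>'s up to \<open>j\<close> and of consecutive \<open>t\<close>'s beyond, which gives an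
  equivariant local inverse of the morphism on the zero locus.  Every element of the lifted torus
  group satisfies the equations, so the two groups correspond to each other and the local inverses
  descend to the quotients; regular functions extend because an invariant regular function is a
  quotient of two polynomials of equal weight.  The same invertible coordinates force a linear
  relation between the rows of the Jacobian matrix to be trivial.

  For the codimension one needs the Krull dimension of both quotients.  Chains of the required length
  come from coordinate subspaces of a chart, and a longer chain would give more
  algebraically independent invariant functions than the rank of the lattice allows.
\<close>

section \<open>Polynomial functions\<close>

text \<open>The shift in \<open>t_gen\<close> is a lattice vector: consecutive lattice points of the
  edge are equally spaced, so \<open>(e (k + 1) - e 0) / (k + 1)\<close> is the common step
  \<open>\<delta>\<close>. Hence picking one generator from each pair, \<open>q\<close> of them of
  type t, and summing gives \<open>(e q, 0)\<close>. This identity controls the lifted fan: it turns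
  relations among lifted generators into relations among the rays of a simplicial cone, and it
  decides which generators a lifted cone contains, which is what semistability asks. The obstacle in
  the quotient is that regular functions are only local fractions, whose numerators and denominators
  need not be homogeneous. Weights repair this: a stable space of polynomials with a member that is
  nonzero at a point has a semi-invariant member that is nonzero there. The same principle extends
  functions from the image and produces the functions that separate the members of a chain. The rays
  of a chart span the lattice rationally but may generate a proper sublattice, so weights can be
  trivialised only up to a multiple \<open>M\<close>; passing to \<open>M\<close>-th powers keeps
  the zeros, which is all that chains see.\<close>

definition mon :: "('v \<Rightarrow>\<^sub>0 nat) \<Rightarrow> ('v \<Rightarrow> complex) \<Rightarrow> complex" where
  "mon a x = (\<Prod>u\<in>Poly_Mapping.keys a. x u ^ Poly_Mapping.lookup a u)"

lemma mon_superset: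
  assumes "finite A" "Poly_Mapping.keys a \<subseteq> A"
  shows "mon a x = (\<Prod>u\<in>A. x u ^ Poly_Mapping.lookup a u)"
  unfolding mon_def using assms
  by (intro prod.mono_neutral_left) (auto simp: in_keys_iff)

lemma mon_add: "mon (a + b) x = mon a x * mon b x"
proof -
  let ?A = "Poly_Mapping.keys a \<union> Poly_Mapping.keys b"
  have "mon (a + b) x = (\<Prod>u\<in>?A. x u ^ Poly_Mapping.lookup (a + b) u)"
    by (rule mon_superset) (auto simp: keys_add)
  moreover have "mon a x = (\<Prod>u\<in>?A. x u ^ Poly_Mapping.lookup a u)"
    by (rule mon_superset) auto
  moreover have "mon b x = (\<Prod>u\<in>?A. x u ^ Poly_Mapping.lookup b u)"
    by (rule mon_superset) auto
  ultimately show ?thesis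
    by (simp add: lookup_add power_add prod.distrib)
qed

lemma mon_0 [simp]: "mon 0 x = 1"
  by (simp add: mon_def)

lemma mon_single [simp]: "mon (Poly_Mapping.single u n) x = x u ^ n"
  by (simp add: mon_def)

lemma mon_mult: "mon a (\<lambda>u. x u * y u) = mon a x * mon a y"
  by (simp add: mon_def power_mult_distrib prod.distrib)

lemma mon_cong: "(\<And>u. u \<in> Poly_Mapping.keys a \<Longrightarrow> x u = y u) \<Longrightarrow> mon a x = mon a y"
  by (simp add: mon_def)

lemma peval_mon: "peval p x = (\<Sum>a\<in>Poly_Mapping.keys p. Poly_Mapping.lookup p a * mon a x)"
  by (simp add: peval_def mon_def)

lemma peval_superset:
  assumes "finite A" "Poly_Mapping.keys p \<subseteq> A"
  shows "peval p x = (\<Sum>a\<in>A. Poly_Mapping.lookup p a * mon a x)"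
  unfolding peval_mon using assms
  by (intro sum.mono_neutral_left) (auto simp: in_keys_iff)

lemma peval_0 [simp]: "peval 0 x = 0"
  by (simp add: peval_mon)

lemma peval_single [simp]: "peval (Poly_Mapping.single a c) x = c * mon a x"
  by (simp add: peval_mon)

lemma peval_1 [simp]: "peval 1 x = 1"
  by (simp add: peval_mon)

lemma peval_var [simp]: "peval (var u) x = x u"
  by (simp add: var_def)

lemma peval_add [simp]: "peval (p + q) x = peval p x + peval q x"
  unfolding peval_mon
  by (rule setsum_keys_plus_distrib) (simp_all add: algebra_simps)

lemma peval_uminus [simp]: "peval (- p) x = - peval p x"
proof -
  have "peval (- p) x + peval p x = 0"
    by (metis add.commute peval_0 peval_add right_minus)
  then show ?thesis
    by (simp add: eq_neg_iff_add_eq_0)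
qed

lemma peval_diff [simp]: "peval (p - q) x = peval p x - peval q x"
  by (metis diff_conv_add_uminus peval_add peval_uminus)

lemma peval_sum: "peval (\<Sum>i\<in>I. p i) x = (\<Sum>i\<in>I. peval (p i) x)"
  by (induction I rule: infinite_finite_induct) auto

lemma mpoly_expand: "(p :: 'v mpoly) = (\<Sum>a\<in>Poly_Mapping.keys p. Poly_Mapping.single a (Poly_Mapping.lookup p a))"
  by (rule poly_mapping_eqI) (auto simp: lookup_sum lookup_single when_def in_keys_iff)

lemma peval_mult [simp]: "peval (p * q) x = peval p x * peval q x"
proof -
  have "p * q = (\<Sum>a\<in>Poly_Mapping.keys p. \<Sum>b\<in>Poly_Mapping.keys q.
      Poly_Mapping.single (a + b) (Poly_Mapping.lookup p a * Poly_Mapping.lookup q b))"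
    by (subst mpoly_expand[of p], subst mpoly_expand[of q]) (simp add: sum_product mult_single)
  then show ?thesis
    by (simp add: peval_sum mon_add) (simp add: peval_mon sum_product mult_ac)
qed

lemma peval_power [simp]: "peval (p ^ n) x = peval p x ^ n"
  by (induction n) auto

lemma peval_prod: "peval (\<Prod>i\<in>I. p i) x = (\<Prod>i\<in>I. peval (p i) x)"
  by (induction I rule: infinite_finite_induct) auto

lemma polys_0 [intro]: "0 \<in> polys R"
  by (simp add: polys_def)

lemma polys_single: "Poly_Mapping.keys a \<subseteq> R \<Longrightarrow> Poly_Mapping.single a c \<in> polys R"
  by (simp add: polys_def)

lemma polys_1 [intro]: "1 \<in> polys R"
  by (simp add: polys_def)

lemma polys_const [intro]: "Poly_Mapping.single 0 c \<in> polys R"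
  by (rule polys_single) simp

lemma polys_var: "u \<in> R \<Longrightarrow> var u \<in> polys R"
  unfolding var_def by (rule polys_single) auto

lemma polys_add [intro]: "p \<in> polys R \<Longrightarrow> q \<in> polys R \<Longrightarrow> p + q \<in> polys R"
  unfolding polys_def using keys_add[of p q] by blast

lemma polys_uminus [intro]: "p \<in> polys R \<Longrightarrow> - p \<in> polys R"
  by (simp add: polys_def)

lemma polys_diff [intro]: "p \<in> polys R \<Longrightarrow> q \<in> polys R \<Longrightarrow> p - q \<in> polys R"
  by (metis diff_conv_add_uminus polys_add polys_uminus)

lemma polys_mult [intro]:
  assumes "p \<in> polys R" "q \<in> polys R"
  shows "p * q \<in> polys R"
  unfolding polys_def
proof safe
  fix c u assume "c \<in> Poly_Mapping.keys (p * q)" and u: "u \<in> Poly_Mapping.keys c"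
  then obtain a b where "c = a + b" "a \<in> Poly_Mapping.keys p" "b \<in> Poly_Mapping.keys q"
    using keys_mult[of p q] by blast
  with u assms show "u \<in> R"
    using keys_add[of a b] unfolding polys_def by blast
qed

lemma polys_sum: "(\<And>i. i \<in> I \<Longrightarrow> p i \<in> polys R) \<Longrightarrow> (\<Sum>i\<in>I. p i) \<in> polys R"
  by (induction I rule: infinite_finite_induct) auto

lemma polys_prod: "(\<And>i. i \<in> I \<Longrightarrow> p i \<in> polys R) \<Longrightarrow> (\<Prod>i\<in>I. p i) \<in> polys R"
  by (induction I rule: infinite_finite_induct) auto

lemma polys_power: "p \<in> polys R \<Longrightarrow> p ^ n \<in> polys R"
  by (induction n) auto

lemma peval_cong:
  assumes "p \<in> polys R" "\<And>u. u \<in> R \<Longrightarrow> x u = y u"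
  shows "peval p x = peval p y"
  unfolding peval_mon using assms
  by (intro sum.cong refl arg_cong2[where f="(*)"] mon_cong) (auto simp: polys_def)

text \<open>Polynomial functions as a predicate closed under arithmetic: polynomiality follows from
  introduction rules, with no polynomial to be written down.\<close>

definition polyfun :: "'v set \<Rightarrow> (('v \<Rightarrow> complex) \<Rightarrow> complex) \<Rightarrow> bool" where
  "polyfun R F \<longleftrightarrow> (\<exists>p\<in>polys R. F = peval p)"

lemma polyfun_peval: "p \<in> polys R \<Longrightarrow> polyfun R (peval p)"
  by (auto simp: polyfun_def)

lemma polyfun_const: "polyfun R (\<lambda>x. c)"
  unfolding polyfun_def by (intro bexI[of _ "Poly_Mapping.single 0 c"]) (simp_all add: polys_const fun_eq_iff)

lemma polyfun_var: "u \<in> R \<Longrightarrow> polyfun R (\<lambda>x. x u)"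
  unfolding polyfun_def by (intro bexI[of _ "var u"]) (simp_all add: polys_var fun_eq_iff)

lemma polyfun_add: "polyfun R F \<Longrightarrow> polyfun R G \<Longrightarrow> polyfun R (\<lambda>x. F x + G x)"
  unfolding polyfun_def
proof safe
  fix p q assume "p \<in> polys R" "q \<in> polys R"
  then show "\<exists>r\<in>polys R. (\<lambda>x. peval p x + peval q x) = peval r"
    by (intro bexI[of _ "p + q"]) (simp_all add: polys_add fun_eq_iff)
qed

lemma polyfun_diff: "polyfun R F \<Longrightarrow> polyfun R G \<Longrightarrow> polyfun R (\<lambda>x. F x - G x)"
  unfolding polyfun_def
proof safe
  fix p q assume "p \<in> polys R" "q \<in> polys R"
  then show "\<exists>r\<in>polys R. (\<lambda>x. peval p x - peval q x) = peval r"
    by (intro bexI[of _ "p - q"]) (simp_all add: polys_diff fun_eq_iff)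
qed

lemma polyfun_mult: "polyfun R F \<Longrightarrow> polyfun R G \<Longrightarrow> polyfun R (\<lambda>x. F x * G x)"
  unfolding polyfun_def
proof safe
  fix p q assume "p \<in> polys R" "q \<in> polys R"
  then show "\<exists>r\<in>polys R. (\<lambda>x. peval p x * peval q x) = peval r"
    by (intro bexI[of _ "p * q"]) (simp_all add: polys_mult fun_eq_iff)
qed

lemma polyfun_sum: "(\<And>i. i \<in> I \<Longrightarrow> polyfun R (F i)) \<Longrightarrow> polyfun R (\<lambda>x. \<Sum>i\<in>I. F i x)"
  by (induction I rule: infinite_finite_induct) (simp_all add: polyfun_const polyfun_add)

lemma polyfun_prod: "(\<And>i. i \<in> I \<Longrightarrow> polyfun R (F i)) \<Longrightarrow> polyfun R (\<lambda>x. \<Prod>i\<in>I. F i x)"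
  by (induction I rule: infinite_finite_induct) (simp_all add: polyfun_const polyfun_mult)

lemma polyfun_power: "polyfun R F \<Longrightarrow> polyfun R (\<lambda>x. F x ^ n)"
  by (induction n) (simp_all add: polyfun_const polyfun_mult)

lemma polyfun_mon: "Poly_Mapping.keys a \<subseteq> R \<Longrightarrow> polyfun R (mon a)"
  unfolding polyfun_def by (intro bexI[of _ "Poly_Mapping.single a 1"]) (simp_all add: polys_single fun_eq_iff)

lemma peval_line:
  fixes a b :: "'v \<Rightarrow> complex"
  shows "\<exists>P. \<forall>t. peval p (\<lambda>u. a u + t * (b u - a u)) = poly P t"
proof -
  define Q where "Q = (\<Sum>m\<in>Poly_Mapping.keys p. [:Poly_Mapping.lookup p m:] *
    (\<Prod>u\<in>Poly_Mapping.keys m. [:a u, b u - a u:] ^ Poly_Mapping.lookup m u))"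
  have "peval p (\<lambda>u. a u + t * (b u - a u)) = poly Q t" for t
    by (simp add: Q_def peval_def poly_sum poly_prod)
  then show ?thesis by blast
qed

lemma polyfun_line:
  assumes "polyfun R F"
  obtains P where "\<And>t. F (\<lambda>u\<in>R. a u + t * (b u - a u)) = poly P t"
proof -
  obtain p where p: "p \<in> polys R" "F = peval p"
    using assms by (auto simp: polyfun_def)
  obtain P where "\<And>t. peval p (\<lambda>u. a u + t * (b u - a u)) = poly P t"
    using peval_line by blast
  moreover have "peval p (\<lambda>u\<in>R. a u + t * (b u - a u)) = peval p (\<lambda>u. a u + t * (b u - a u))" for t
    by (rule peval_cong[OF p(1)]) auto
  ultimately show ?thesis using that p by metis
qed

text \<open>Restriction to a line turns irreducibility of linear subspaces into the one-variable case.\<close>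

lemma polyfun_prod_nonzero_on_line:
  assumes F: "polyfun R F" "F a \<noteq> 0" and G: "polyfun R G" "G b \<noteq> 0"
    and H: "polyfun R H" "H c \<noteq> 0"
    and abc: "a \<in> affine_space R" "b \<in> affine_space R" "c \<in> {a, b}"
  obtains t where "F (\<lambda>u\<in>R. a u + t * (b u - a u)) \<noteq> 0" "G (\<lambda>u\<in>R. a u + t * (b u - a u)) \<noteq> 0"
    "H (\<lambda>u\<in>R. a u + t * (b u - a u)) \<noteq> 0"
proof -
  let ?l = "\<lambda>t. (\<lambda>u\<in>R. a u + t * (b u - a u))"
  have a: "?l 0 = a"
    using abc(1) by (intro ext) (auto simp: affine_space_def PiE_def extensional_def)
  have b: "?l 1 = b"
    using abc(2) by (intro ext) (auto simp: affine_space_def PiE_def extensional_def)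
  obtain P where P: "\<And>t. F (?l t) = poly P t" using polyfun_line[OF F(1)] by metis
  obtain Q where Q: "\<And>t. G (?l t) = poly Q t" using polyfun_line[OF G(1)] by metis
  obtain S where S: "\<And>t. H (?l t) = poly S t" using polyfun_line[OF H(1)] by metis
  \<comment> \<open>Each polynomial is nonzero because it has a nonzero value at an end of the
    segment, \<open>t = 0\<close> or \<open>t = 1\<close>; the third function is allowed either
    end.\<close>
  have "P \<noteq> 0" using P[of 0] F(2) a by auto
  moreover have "Q \<noteq> 0" using Q[of 1] G(2) b by auto
  moreover have "S \<noteq> 0" using S[of 0] S[of 1] H(2) a b abc(3) by auto
  ultimately have "P * Q * S \<noteq> 0" by simp
  then obtain t where "poly (P * Q * S) t \<noteq> 0"
    using poly_all_0_iff_0 by blast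
  then show ?thesis using that[of t] P Q S by auto
qed


section \<open>The Zariski topology and regular functions\<close>

lemma openin_zariski_basic: "polyfun R f \<Longrightarrow> openin (zariski R) {x \<in> affine_space R. f x \<noteq> 0}"
  unfolding zariski_def by (rule topology_generated_by_Basis) (auto simp: polyfun_def)

lemma topspace_zariski [simp]: "topspace (zariski R) = affine_space R"
proof
  show "topspace (zariski R) \<subseteq> affine_space R"
    unfolding zariski_def by auto
  show "affine_space R \<subseteq> topspace (zariski R)"
    using openin_subset[OF openin_zariski_basic[OF polyfun_const[of R 1]]] by auto
qed

text \<open>The sets \<open>f \<noteq> 0\<close> are a base and not merely a subbase, since
  \<open>f * g\<close> cuts out the intersection of two of them.\<close>

lemma openin_zariski_iff:
  "openin (zariski R) V \<longleftrightarrow> V \<subseteq> affine_space R \<and>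
     (\<forall>x\<in>V. \<exists>f\<in>polys R. peval f x \<noteq> 0 \<and> (\<forall>y\<in>affine_space R. peval f y \<noteq> 0 \<longrightarrow> y \<in> V))"
proof
  assume V: "openin (zariski R) V"
  have "generate_topology_on {{x \<in> affine_space R. peval p x \<noteq> 0} |p. p \<in> polys R} V"
    using V unfolding zariski_def openin_topology_generated_by_iff .
  then have "\<forall>x\<in>V. \<exists>f\<in>polys R. peval f x \<noteq> 0 \<and> (\<forall>y\<in>affine_space R. peval f y \<noteq> 0 \<longrightarrow> y \<in> V)"
  proof induction
    case (Int A B)
    show ?case
    proof
      fix x assume x: "x \<in> A \<inter> B"
      obtain f where f: "f \<in> polys R" "peval f x \<noteq> 0" "\<forall>y\<in>affine_space R. peval f y \<noteq> 0 \<longrightarrow> y \<in> A"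
        using Int x by blast
      obtain g where g: "g \<in> polys R" "peval g x \<noteq> 0" "\<forall>y\<in>affine_space R. peval g y \<noteq> 0 \<longrightarrow> y \<in> B"
        using Int x by blast
      show "\<exists>f\<in>polys R. peval f x \<noteq> 0 \<and> (\<forall>y\<in>affine_space R. peval f y \<noteq> 0 \<longrightarrow> y \<in> A \<inter> B)"
        using f g by (intro bexI[of _ "f * g"]) (auto simp: polys_mult)
    qed
  next
    case (UN K)
    show ?case
    proof
      fix x assume "x \<in> \<Union>K"
      then obtain A where A: "A \<in> K" "x \<in> A" by blast
      then obtain f where "f \<in> polys R" "peval f x \<noteq> 0"
          "\<forall>y\<in>affine_space R. peval f y \<noteq> 0 \<longrightarrow> y \<in> A"
        using UN by blast
      with A(1) show "\<exists>f\<in>polys R. peval f x \<noteq> 0 \<and> (\<forall>y\<in>affine_space R. peval f y \<noteq> 0 \<longrightarrow> y \<in> \<Union>K)"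
        by (intro bexI[of _ f]) auto
    qed
  next
    case (Basis s)
    then obtain p where "p \<in> polys R" "s = {x \<in> affine_space R. peval p x \<noteq> 0}"
      by blast
    then show ?case by auto
  qed simp
  then show "V \<subseteq> affine_space R \<and>
     (\<forall>x\<in>V. \<exists>f\<in>polys R. peval f x \<noteq> 0 \<and> (\<forall>y\<in>affine_space R. peval f y \<noteq> 0 \<longrightarrow> y \<in> V))"
    using openin_subset[OF V] by simp
next
  assume V: "V \<subseteq> affine_space R \<and>
     (\<forall>x\<in>V. \<exists>f\<in>polys R. peval f x \<noteq> 0 \<and> (\<forall>y\<in>affine_space R. peval f y \<noteq> 0 \<longrightarrow> y \<in> V))"
  show "openin (zariski R) V"
  proof (subst openin_subopen, intro ballI)
    fix x assume "x \<in> V"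
    then obtain f where f: "f \<in> polys R" "peval f x \<noteq> 0" "\<forall>y\<in>affine_space R. peval f y \<noteq> 0 \<longrightarrow> y \<in> V"
      using V by blast
    have "openin (zariski R) {x \<in> affine_space R. peval f x \<noteq> 0}"
      by (intro openin_zariski_basic polyfun_peval f)
    then show "\<exists>T. openin (zariski R) T \<and> x \<in> T \<and> T \<subseteq> V"
      using V \<open>x \<in> V\<close> f by (intro exI[of _ "{x \<in> affine_space R. peval f x \<noteq> 0}"]) auto
  qed
qed

lemma openin_zariskiD:
  assumes "openin (zariski R) V" "x \<in> V"
  obtains f where "f \<in> polys R" "peval f x \<noteq> 0" "\<And>y. y \<in> affine_space R \<Longrightarrow> peval f y \<noteq> 0 \<Longrightarrow> y \<in> V"
  using assms unfolding openin_zariski_iff by blast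

text \<open>The neighbourhood is taken to be a principal open set \<open>f \<noteq> 0\<close>, so
  local data at a point are three polynomials, and arithmetic of regular functions becomes
  arithmetic of these triples.\<close>

definition fraction_near ::
  "'v set \<Rightarrow> ('v \<Rightarrow> complex) set \<Rightarrow> (('v \<Rightarrow> complex) \<Rightarrow> complex) \<Rightarrow> ('v \<Rightarrow> complex)
     \<Rightarrow> 'v mpoly \<Rightarrow> 'v mpoly \<Rightarrow> 'v mpoly \<Rightarrow> bool" where
  "fraction_near R W F x f p q \<longleftrightarrow>
     f \<in> polys R \<and> p \<in> polys R \<and> q \<in> polys R \<and> x \<in> affine_space R \<and> peval f x \<noteq> 0 \<and>
     (\<forall>y\<in>affine_space R. peval f y \<noteq> 0 \<longrightarrow> y \<in> W \<and> peval q y \<noteq> 0 \<and> F y = peval p y / peval q y)"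

lemma regular_on_iff:
  "regular_on R W F \<longleftrightarrow> (\<forall>x\<in>W. \<exists>f p q. fraction_near R W F x f p q)"
proof
  assume reg: "regular_on R W F"
  show "\<forall>x\<in>W. \<exists>f p q. fraction_near R W F x f p q"
  proof
    fix x assume "x \<in> W"
    then obtain V p q where V: "p \<in> polys R" "q \<in> polys R" "openin (zariski R) V" "x \<in> V" "V \<subseteq> W"
      "\<forall>y\<in>V. peval q y \<noteq> 0 \<and> F y = peval p y / peval q y"
      using reg unfolding regular_on_def by meson
    then have "x \<in> affine_space R"
      using openin_subset by fastforce
    moreover obtain f where "f \<in> polys R" "peval f x \<noteq> 0"
      "\<And>y. y \<in> affine_space R \<Longrightarrow> peval f y \<noteq> 0 \<Longrightarrow> y \<in> V"
      using openin_zariskiD[OF V(3,4)] by blast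
    ultimately have "fraction_near R W F x f p q"
      using V unfolding fraction_near_def by auto
    then show "\<exists>f p q. fraction_near R W F x f p q" by blast
  qed
next
  assume *: "\<forall>x\<in>W. \<exists>f p q. fraction_near R W F x f p q"
  show "regular_on R W F"
    unfolding regular_on_def
  proof
    fix x assume "x \<in> W"
    then obtain f p q where "fraction_near R W F x f p q"
      using * by blast
    then have f: "f \<in> polys R" "p \<in> polys R" "q \<in> polys R" "x \<in> affine_space R" "peval f x \<noteq> 0"
       "\<forall>y\<in>affine_space R. peval f y \<noteq> 0 \<longrightarrow> y \<in> W \<and> peval q y \<noteq> 0 \<and> F y = peval p y / peval q y"
      unfolding fraction_near_def by blast+
    have "openin (zariski R) {x \<in> affine_space R. peval f x \<noteq> 0}"
      by (intro openin_zariski_basic polyfun_peval f)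
    then show "\<exists>V. \<exists>p\<in>polys R. \<exists>q\<in>polys R. openin (zariski R) V \<and> x \<in> V \<and> V \<subseteq> W \<and>
        (\<forall>y\<in>V. peval q y \<noteq> 0 \<and> F y = peval p y / peval q y)"
      using f by (intro exI[of _ "{x \<in> affine_space R. peval f x \<noteq> 0}"] bexI[of _ p] bexI[of _ q]) auto
  qed
qed

lemma regular_onE:
  assumes "regular_on R W F" "x \<in> W"
  obtains f p q where "fraction_near R W F x f p q"
  using assms unfolding regular_on_iff by blast

lemma regular_on_imp_openin: "regular_on R W F \<Longrightarrow> openin (zariski R) W"
  unfolding regular_on_def by (subst openin_subopen) blast

lemma regular_on_cong:
  assumes "regular_on R W F" "\<And>x. x \<in> W \<Longrightarrow> F x = G x"
  shows "regular_on R W G"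
  unfolding regular_on_iff
proof
  fix x assume "x \<in> W"
  then obtain f p q where "fraction_near R W F x f p q"
    using regular_onE[OF assms(1)] by blast
  then have "fraction_near R W G x f p q"
    using assms(2) unfolding fraction_near_def by auto
  then show "\<exists>f p q. fraction_near R W G x f p q" by blast
qed

lemma regular_on_local:
  assumes "\<And>x. x \<in> W \<Longrightarrow> \<exists>V G. x \<in> V \<and> V \<subseteq> W \<and> regular_on R V G \<and> (\<forall>y\<in>V. F y = G y)"
  shows "regular_on R W F"
  unfolding regular_on_iff
proof
  fix x assume "x \<in> W"
  then obtain V G where V: "x \<in> V" "V \<subseteq> W" "regular_on R V G" "\<forall>y\<in>V. F y = G y"
    using assms by blast
  then obtain f p q where "fraction_near R V G x f p q"
    using regular_onE[OF V(3)] by blast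
  then have "fraction_near R W F x f p q"
    using V(2,4) unfolding fraction_near_def by auto
  then show "\<exists>f p q. fraction_near R W F x f p q" by blast
qed

lemma regular_on_subset:
  assumes "regular_on R W F" "openin (zariski R) V" "V \<subseteq> W"
  shows "regular_on R V F"
  unfolding regular_on_def
proof
  fix x assume "x \<in> V"
  with assms(3) have "x \<in> W" by blast
  then obtain V' p q where *: "p \<in> polys R" "q \<in> polys R" "openin (zariski R) V'" "x \<in> V'" "V' \<subseteq> W"
      "\<forall>y\<in>V'. peval q y \<noteq> 0 \<and> F y = peval p y / peval q y"
    using assms(1) unfolding regular_on_def by meson
  then show "\<exists>V'. \<exists>p\<in>polys R. \<exists>q\<in>polys R. openin (zariski R) V' \<and> x \<in> V' \<and> V' \<subseteq> V \<and>
        (\<forall>y\<in>V'. peval q y \<noteq> 0 \<and> F y = peval p y / peval q y)"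
    using assms(2) \<open>x \<in> V\<close> by (intro exI[of _ "V' \<inter> V"] bexI[of _ p] bexI[of _ q]) auto
qed

lemma regular_on_polyfun:
  assumes "openin (zariski R) W" "polyfun R F"
  shows "regular_on R W F"
proof -
  obtain p where "p \<in> polys R" "F = peval p"
    using assms by (auto simp: polyfun_def)
  then show ?thesis
    unfolding regular_on_def using assms(1)
    by (intro ballI exI[of _ W] bexI[of _ p] bexI[of _ 1]) auto
qed

lemma regular_on_add:
  assumes "regular_on R W F" "regular_on R W G"
  shows "regular_on R W (\<lambda>x. F x + G x)"
  unfolding regular_on_iff
proof
  fix x assume "x \<in> W"
  obtain f p q where f: "fraction_near R W F x f p q"
    by (rule regular_onE[OF assms(1) \<open>x \<in> W\<close>])
  obtain f' p' q' where f': "fraction_near R W G x f' p' q'"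
    by (rule regular_onE[OF assms(2) \<open>x \<in> W\<close>])
  have "fraction_near R W (\<lambda>x. F x + G x) x (f * f') (p * q' + p' * q) (q * q')"
    using f f' unfolding fraction_near_def by (auto simp: polys_mult polys_add add_frac_eq)
  then show "\<exists>f p q. fraction_near R W (\<lambda>x. F x + G x) x f p q" by blast
qed

lemma regular_on_mult:
  assumes "regular_on R W F" "regular_on R W G"
  shows "regular_on R W (\<lambda>x. F x * G x)"
  unfolding regular_on_iff
proof
  fix x assume "x \<in> W"
  obtain f p q where f: "fraction_near R W F x f p q"
    by (rule regular_onE[OF assms(1) \<open>x \<in> W\<close>])
  obtain f' p' q' where f': "fraction_near R W G x f' p' q'"
    by (rule regular_onE[OF assms(2) \<open>x \<in> W\<close>])
  have "fraction_near R W (\<lambda>x. F x * G x) x (f * f') (p * p') (q * q')"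
    using f f' unfolding fraction_near_def by (auto simp: polys_mult polys_add)
  then show "\<exists>f p q. fraction_near R W (\<lambda>x. F x * G x) x f p q" by blast
qed

lemma regular_on_inverse:
  assumes "regular_on R W F" "\<And>x. x \<in> W \<Longrightarrow> F x \<noteq> 0"
  shows "regular_on R W (\<lambda>x. inverse (F x))"
  unfolding regular_on_iff
proof
  fix x assume "x \<in> W"
  obtain f p q where f: "fraction_near R W F x f p q"
    by (rule regular_onE[OF assms(1) \<open>x \<in> W\<close>])
  have "fraction_near R W (\<lambda>x. inverse (F x)) x f q p"
    using f assms(2) unfolding fraction_near_def by (fastforce simp: field_simps)
  then show "\<exists>f p q. fraction_near R W (\<lambda>x. inverse (F x)) x f p q" by blast
qed

lemma regular_on_divide:
  assumes "regular_on R W F" "regular_on R W G" "\<And>x. x \<in> W \<Longrightarrow> G x \<noteq> 0"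
  shows "regular_on R W (\<lambda>x. F x / G x)"
  unfolding divide_inverse by (intro regular_on_mult regular_on_inverse assms)

lemma regular_on_const: "openin (zariski R) W \<Longrightarrow> regular_on R W (\<lambda>x. c)"
  by (intro regular_on_polyfun polyfun_const)

lemma regular_on_sum:
  assumes "openin (zariski R) W" "\<And>i. i \<in> I \<Longrightarrow> regular_on R W (F i)"
  shows "regular_on R W (\<lambda>x. \<Sum>i\<in>I. F i x)"
  using assms(2)
  by (induction I rule: infinite_finite_induct) (simp_all add: regular_on_const regular_on_add assms(1))

lemma regular_on_prod:
  assumes "openin (zariski R) W" "\<And>i. i \<in> I \<Longrightarrow> regular_on R W (F i)"
  shows "regular_on R W (\<lambda>x. \<Prod>i\<in>I. F i x)"
  using assms(2)
  by (induction I rule: infinite_finite_induct) (simp_all add: regular_on_const regular_on_mult assms(1))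

lemma regular_on_power:
  assumes "regular_on R W F"
  shows "regular_on R W (\<lambda>x. F x ^ n)"
  by (induction n)
    (simp_all add: regular_on_const regular_on_mult regular_on_imp_openin[OF assms] assms)

lemma regular_on_powi:
  assumes "regular_on R W F" "\<And>x. x \<in> W \<Longrightarrow> F x \<noteq> 0"
  shows "regular_on R W (\<lambda>x. F x powi n)"
  unfolding power_int_def using assms
  by (cases "0 \<le> n") (simp_all add: regular_on_power regular_on_inverse)

lemma regular_on_nonzero_openin:
  assumes "regular_on R W F"
  shows "openin (zariski R) {x \<in> W. F x \<noteq> 0}"
  unfolding openin_zariski_iff
proof safe
  fix x assume x: "x \<in> W" "F x \<noteq> 0"
  obtain f p q where f: "fraction_near R W F x f p q"
    by (rule regular_onE[OF assms \<open>x \<in> W\<close>])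
  then show "\<exists>f\<in>polys R. peval f x \<noteq> 0 \<and> (\<forall>y\<in>affine_space R. peval f y \<noteq> 0 \<longrightarrow> y \<in> {x \<in> W. F x \<noteq> 0})"
    using x unfolding fraction_near_def by (intro bexI[of _ "f * p"]) (auto simp: polys_mult)
qed (use openin_subset[OF regular_on_imp_openin[OF assms]] in auto)

lemma regular_on_polyfun_compose:
  fixes \<Psi> :: "('w \<Rightarrow> complex) \<Rightarrow> 'v \<Rightarrow> complex"
  assumes W': "openin (zariski R') W'" and \<Psi>: "\<And>u. u \<in> R \<Longrightarrow> regular_on R' W' (\<lambda>y. \<Psi> y u)"
    and p: "p \<in> polys R"
  shows "regular_on R' W' (\<lambda>y. peval p (\<Psi> y))"
proof -
  have "regular_on R' W' (\<lambda>y. \<Prod>u\<in>Poly_Mapping.keys a. \<Psi> y u ^ Poly_Mapping.lookup a u)"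
    if "a \<in> Poly_Mapping.keys p" for a
    by (rule regular_on_prod[OF W'], rule regular_on_power, rule \<Psi>)
      (use that p in \<open>auto simp: polys_def\<close>)
  then have "regular_on R' W' (\<lambda>y. \<Sum>a\<in>Poly_Mapping.keys p. Poly_Mapping.lookup p a *
      (\<Prod>u\<in>Poly_Mapping.keys a. \<Psi> y u ^ Poly_Mapping.lookup a u))"
    by (intro regular_on_sum[OF W'] regular_on_mult[OF regular_on_const[OF W']])
  then show ?thesis
    by (simp only: peval_def)
qed

lemma regular_preimage_openin:
  fixes \<Psi> :: "('w \<Rightarrow> complex) \<Rightarrow> 'v \<Rightarrow> complex"
  assumes W': "openin (zariski R') W'" and \<Psi>: "\<And>u. u \<in> R \<Longrightarrow> regular_on R' W' (\<lambda>y. \<Psi> y u)"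
    and \<Psi>a: "\<And>y. y \<in> W' \<Longrightarrow> \<Psi> y \<in> affine_space R" and V: "openin (zariski R) V"
  shows "openin (zariski R') {y \<in> W'. \<Psi> y \<in> V}"
proof (subst openin_subopen, intro ballI)
  fix y assume y: "y \<in> {y \<in> W'. \<Psi> y \<in> V}"
  obtain f where f: "f \<in> polys R" "peval f (\<Psi> y) \<noteq> 0"
    "\<And>z. z \<in> affine_space R \<Longrightarrow> peval f z \<noteq> 0 \<Longrightarrow> z \<in> V"
    using openin_zariskiD[OF V, of "\<Psi> y"] y by blast
  have "openin (zariski R') {y \<in> W'. peval f (\<Psi> y) \<noteq> 0}"
    by (rule regular_on_nonzero_openin[OF regular_on_polyfun_compose[OF W' \<Psi> f(1)]])
  then show "\<exists>T. openin (zariski R') T \<and> y \<in> T \<and> T \<subseteq> {y \<in> W'. \<Psi> y \<in> V}"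
    using y f \<Psi>a by (intro exI[of _ "{y \<in> W'. peval f (\<Psi> y) \<noteq> 0}"]) auto
qed

lemma regular_on_compose:
  fixes \<Psi> :: "('w \<Rightarrow> complex) \<Rightarrow> 'v \<Rightarrow> complex"
  assumes W': "openin (zariski R') W'" and \<Psi>: "\<And>u. u \<in> R \<Longrightarrow> regular_on R' W' (\<lambda>y. \<Psi> y u)"
    and \<Psi>a: "\<And>y. y \<in> W' \<Longrightarrow> \<Psi> y \<in> affine_space R"
    and F: "regular_on R W F" and W: "\<And>y. y \<in> W' \<Longrightarrow> \<Psi> y \<in> W"
  shows "regular_on R' W' (\<lambda>y. F (\<Psi> y))"
proof (rule regular_on_local)
  fix y assume y: "y \<in> W'"
  obtain f p q where "fraction_near R W F (\<Psi> y) f p q"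
    by (rule regular_onE[OF F W[OF y]])
  then have f: "f \<in> polys R" "p \<in> polys R" "q \<in> polys R" "peval f (\<Psi> y) \<noteq> 0"
    and fpq: "\<And>z. z \<in> affine_space R \<Longrightarrow> peval f z \<noteq> 0 \<Longrightarrow> peval q z \<noteq> 0"
      "\<And>z. z \<in> affine_space R \<Longrightarrow> peval f z \<noteq> 0 \<Longrightarrow> F z = peval p z / peval q z"
    unfolding fraction_near_def by blast+
  define V where "V = {y \<in> W'. peval f (\<Psi> y) \<noteq> 0}"
  have V: "openin (zariski R') V"
    unfolding V_def by (rule regular_on_nonzero_openin[OF regular_on_polyfun_compose[OF W' \<Psi> f(1)]])
  have \<Psi>V: "regular_on R' V (\<lambda>y. \<Psi> y u)" if "u \<in> R" for u
    by (rule regular_on_subset[OF \<Psi>[OF that] V]) (auto simp: V_def)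
  have "regular_on R' V (\<lambda>y. peval p (\<Psi> y) / peval q (\<Psi> y))"
    by (rule regular_on_divide[OF regular_on_polyfun_compose[OF V \<Psi>V f(2)]
          regular_on_polyfun_compose[OF V \<Psi>V f(3)]])
      (use fpq(1)[OF \<Psi>a] in \<open>auto simp: V_def\<close>)
  moreover have "\<forall>y\<in>V. F (\<Psi> y) = peval p (\<Psi> y) / peval q (\<Psi> y)"
    by (auto simp: V_def intro!: fpq(2) \<Psi>a)
  ultimately show "\<exists>V G. y \<in> V \<and> V \<subseteq> W' \<and> regular_on R' V G \<and> (\<forall>y\<in>V. F (\<Psi> y) = G y)"
    using y f(4) by (intro exI[of _ V] exI[of _ "\<lambda>y. peval p (\<Psi> y) / peval q (\<Psi> y)"]) (auto simp: V_def)
qed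

text \<open>A nonempty open set is dense, because affine space is irreducible: on the line from
  \<open>x\<close> to \<open>w\<close> the difference \<open>F - G\<close> and a polynomial that is
  zero outside \<open>W\<close> would be nonzero at a common point.\<close>

lemma polyfun_eq_on_open:
  assumes W: "openin (zariski R) W" "w \<in> W" and F: "polyfun R F" "polyfun R G"
    and eq: "\<And>x. x \<in> W \<Longrightarrow> F x = G x" and x: "x \<in> affine_space R"
  shows "F x = G x"
proof (rule ccontr)
  assume ne: "F x \<noteq> G x"
  obtain f where f: "f \<in> polys R" "peval f w \<noteq> 0" "\<And>y. y \<in> affine_space R \<Longrightarrow> peval f y \<noteq> 0 \<Longrightarrow> y \<in> W"
    using openin_zariskiD[OF W] by blast
  have w: "w \<in> affine_space R"
    using openin_subset[OF W(1)] W(2) by auto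
  have D: "polyfun R (\<lambda>y. F y - G y)" by (rule polyfun_diff[OF F])
  have ne': "F x - G x \<noteq> 0" using ne by simp
  obtain t where t: "F (\<lambda>u\<in>R. x u + t * (w u - x u)) - G (\<lambda>u\<in>R. x u + t * (w u - x u)) \<noteq> 0"
      "peval f (\<lambda>u\<in>R. x u + t * (w u - x u)) \<noteq> 0"
    by (rule polyfun_prod_nonzero_on_line[OF D ne' polyfun_peval[OF f(1)] f(2) polyfun_const[of R 1] one_neq_zero x w insertI1])
  have "(\<lambda>u\<in>R. x u + t * (w u - x u)) \<in> affine_space R"
    by (simp add: affine_space_def)
  with t(2) f(3) eq t(1) show False by auto
qed


section \<open>Linear systems and weights\<close>

text \<open>Gaussian elimination by cross multiplication, without division. It therefore holds over
  any integral domain and is applied over the complex numbers for algebraic dependence and over the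
  integers for dual lattices.\<close>

lemma underdetermined_system:
  fixes A :: "'i \<Rightarrow> 'j \<Rightarrow> 'a::idom"
  assumes "finite J" "finite I" "card J < card I"
  shows "\<exists>c. (\<exists>i\<in>I. c i \<noteq> 0) \<and> (\<forall>j\<in>J. (\<Sum>i\<in>I. c i * A i j) = 0)"
  using assms
proof (induction J arbitrary: I A rule: finite_induct)
  case empty
  then have "I \<noteq> {}" by auto
  then show ?case by (intro exI[of _ "\<lambda>_. 1"]) auto
next
  case (insert j J)
  show ?case
  proof (cases "\<forall>i\<in>I. A i j = 0")
    case True
    have "card J < card I" using insert by simp
    then obtain c where "\<exists>i\<in>I. c i \<noteq> 0" "\<forall>j\<in>J. (\<Sum>i\<in>I. c i * A i j) = 0"
      using insert.IH[OF insert.prems(1)] by blast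
    with True show ?thesis by (intro exI[of _ c]) simp
  next
    case False
    then obtain i0 where i0: "i0 \<in> I" "A i0 j \<noteq> 0" by blast
    \<comment> \<open>Eliminates equation \<open>j\<close> with the pivot \<open>A i0 j\<close>: the
      unknown \<open>i0\<close> drops out and every coefficient of equation \<open>j\<close> becomes
      0.\<close>
    define A' where "A' i j' = A i0 j * A i j' - A i j * A i0 j'" for i j'
    have "card J < card (I - {i0})" using insert i0 by simp
    then obtain c where c: "\<exists>i\<in>I-{i0}. c i \<noteq> 0" "\<forall>j'\<in>J. (\<Sum>i\<in>I-{i0}. c i * A' i j') = 0"
      using insert.IH[of "I - {i0}" A'] insert.prems(1) by blast
    \<comment> \<open>Back substitution scaled by the pivot: the value at \<open>i0\<close> solves
      equation \<open>j\<close> exactly, and the other values are \<open>c\<close> times the nonzero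
      pivot.\<close>
    define d where "d i = (if i = i0 then - (\<Sum>i\<in>I-{i0}. c i * A i j) else A i0 j * c i)" for i
    have eq: "(\<Sum>i\<in>I. d i * A i j') = (\<Sum>i\<in>I-{i0}. c i * A' i j')" for j'
    proof -
      have "(\<Sum>i\<in>I. d i * A i j') = d i0 * A i0 j' + (\<Sum>i\<in>I-{i0}. d i * A i j')"
        using insert.prems(1) i0(1) by (rule sum.remove)
      also have "(\<Sum>i\<in>I-{i0}. d i * A i j') = (\<Sum>i\<in>I-{i0}. A i0 j * c i * A i j')"
        by (rule sum.cong) (auto simp: d_def)
      also have "d i0 * A i0 j' + \<dots> = (\<Sum>i\<in>I-{i0}. A i0 j * c i * A i j' - c i * A i j * A i0 j')"
        by (simp add: d_def sum_subtractf sum_distrib_right)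
      also have "\<dots> = (\<Sum>i\<in>I-{i0}. c i * A' i j')"
        by (rule sum.cong) (auto simp: A'_def algebra_simps)
      finally show ?thesis .
    qed
    have "(\<Sum>i\<in>I-{i0}. c i * A' i j) = 0"
      by (simp add: A'_def)
    then have "\<forall>j'\<in>insert j J. (\<Sum>i\<in>I. d i * A i j') = 0"
      using c(2) by (simp add: eq)
    moreover have "\<exists>i\<in>I. d i \<noteq> 0"
      using c(1) i0 by (auto simp: d_def)
    ultimately show ?thesis by blast
  qed
qed

text \<open>Applying \<open>(w g a - w g b) / (w g a0 - w g b)\<close> removes the weight of \<open>b\<close> and fixes that of \<open>a0\<close>.\<close>

lemma weight_component:
  fixes Q :: "('a \<Rightarrow> complex) \<Rightarrow> bool" and w :: "'g \<Rightarrow> 'a \<Rightarrow> complex"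
  assumes fin: "finite A" and Q: "Q c" and supp: "\<And>a. a \<notin> A \<Longrightarrow> c a = 0"
    and step: "\<And>c g y z. Q c \<Longrightarrow> g \<in> G \<Longrightarrow> Q (\<lambda>a. y * (w g a - z) * c a)"
  shows "Q (\<lambda>a. if \<forall>g\<in>G. w g a = w g a0 then c a else 0)"
  using Q supp
proof (induction "card {a\<in>A. c a \<noteq> 0 \<and> \<not> (\<forall>g\<in>G. w g a = w g a0)}" arbitrary: c rule: less_induct)
  case less
  let ?S = "\<lambda>c. {a\<in>A. c a \<noteq> 0 \<and> \<not> (\<forall>g\<in>G. w g a = w g a0)}"
  show ?case
  proof (cases "?S c = {}")
    case True
    then have "(\<lambda>a. if \<forall>g\<in>G. w g a = w g a0 then c a else 0) = c"
      using less.prems(2) by (intro ext) auto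
    then show ?thesis using less.prems(1) by simp
  next
    case False
    then obtain b g where b: "b \<in> A" "c b \<noteq> 0" "g \<in> G" "w g b \<noteq> w g a0" by blast
    define c' where "c' = (\<lambda>a. inverse (w g a0 - w g b) * (w g a - w g b) * c a)"
    have "Q c'"
      unfolding c'_def by (rule step[OF less.prems(1) b(3)])
    moreover have "?S c' \<subset> ?S c"
    proof
      show "?S c' \<subseteq> ?S c" by (auto simp: c'_def)
      show "?S c' \<noteq> ?S c" using b by (auto simp: c'_def)
    qed
    then have "card (?S c') < card (?S c)"
      using fin by (intro psubset_card_mono) auto
    moreover have "c' a = 0" if "a \<notin> A" for a
      using less.prems(2)[OF that] by (simp add: c'_def)
    ultimately have "Q (\<lambda>a. if \<forall>g\<in>G. w g a = w g a0 then c' a else 0)"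
      using less.hyps by blast
    moreover have "(\<lambda>a. if \<forall>g\<in>G. w g a = w g a0 then c' a else 0)
        = (\<lambda>a. if \<forall>g\<in>G. w g a = w g a0 then c a else 0)"
      using b by (intro ext) (auto simp: c'_def)
    ultimately show ?thesis by simp
  qed
qed


section \<open>The quotient by the torus group\<close>

text \<open>Stated for any normed space with finitely many rays, so that it applies to the base fan
  and also to the lifted fan, whose ambient space of finitely supported functions has infinite
  dimension.\<close>

locale cox_data =
  fixes N :: "'v::real_normed_vector set" and \<Sigma> :: "'v set set"
  assumes finite_rays: "finite (ray_gens N \<Sigma>)"
begin

abbreviation "R \<equiv> ray_gens N \<Sigma>"
abbreviation "U \<equiv> semistable N \<Sigma>"
abbreviation "G \<equiv> torus_group N \<Sigma>"
abbreviation "X \<equiv> toric_variety N \<Sigma>"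

text \<open>A finite product of coordinates is nonzero iff all factors are, so semistability says
  that the rays at which the point vanishes lie in a common cone.\<close>

lemma semistable_iff:
  "x \<in> U \<longleftrightarrow> x \<in> affine_space R \<and> (\<exists>\<sigma>\<in>\<Sigma>. \<forall>u\<in>R. x u = 0 \<longrightarrow> u \<in> \<sigma>)"
  using finite_rays unfolding semistable_def by auto

lemma U_affine: "x \<in> U \<Longrightarrow> x \<in> affine_space R"
  by (simp add: semistable_iff)

lemma openin_chart: "openin (zariski R) {x \<in> affine_space R. \<forall>u\<in>R - \<sigma>. x u \<noteq> 0}"
proof -
  have "openin (zariski R) {x \<in> affine_space R. (\<Prod>u\<in>R - \<sigma>. x u) \<noteq> 0}"
    by (intro openin_zariski_basic polyfun_prod polyfun_var) auto
  then show ?thesis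
    using finite_rays by simp
qed

lemma openin_U: "openin (zariski R) U"
proof -
  have "U = (\<Union>\<sigma>\<in>\<Sigma>. {x \<in> affine_space R. \<forall>u\<in>R - \<sigma>. x u \<noteq> 0})"
    by (rule set_eqI, simp add: semistable_iff, blast)
  moreover have "openin (zariski R) (\<Union>\<sigma>\<in>\<Sigma>. {x \<in> affine_space R. \<forall>u\<in>R - \<sigma>. x u \<noteq> 0})"
    by (intro openin_Union) (auto intro: openin_chart)
  ultimately show ?thesis by metis
qed

lemma torus_nonzero: "g \<in> G \<Longrightarrow> u \<in> R \<Longrightarrow> g u \<noteq> 0"
  unfolding torus_group_def by auto

lemma torus_char: "g \<in> G \<Longrightarrow> m \<in> dual_lattice N \<Longrightarrow> (\<Prod>u\<in>R. g u powi \<lfloor>blinfun_apply m u\<rfloor>) = 1"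
  unfolding torus_group_def by blast

lemma torusI:
  assumes "g \<in> extensional R" "\<And>u. u \<in> R \<Longrightarrow> g u \<noteq> 0"
    "\<And>m. m \<in> dual_lattice N \<Longrightarrow> (\<Prod>u\<in>R. g u powi \<lfloor>blinfun_apply m u\<rfloor>) = 1"
  shows "g \<in> G"
  using assms unfolding torus_group_def by (auto simp: PiE_def)

lemma torus_one: "(\<lambda>u\<in>R. 1) \<in> G"
  by (rule torusI) auto

lemma torus_mult:
  assumes "g \<in> G" "h \<in> G"
  shows "(\<lambda>u\<in>R. g u * h u) \<in> G"
proof (rule torusI)
  fix m assume m: "m \<in> dual_lattice N"
  have "(\<Prod>u\<in>R. (\<lambda>u\<in>R. g u * h u) u powi \<lfloor>blinfun_apply m u\<rfloor>)
      = (\<Prod>u\<in>R. g u powi \<lfloor>blinfun_apply m u\<rfloor>) * (\<Prod>u\<in>R. h u powi \<lfloor>blinfun_apply m u\<rfloor>)"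
    by (simp add: power_int_mult_distrib prod.distrib)
  then show "(\<Prod>u\<in>R. (\<lambda>u\<in>R. g u * h u) u powi \<lfloor>blinfun_apply m u\<rfloor>) = 1"
    using torus_char[OF assms(1) m] torus_char[OF assms(2) m] by simp
qed (use torus_nonzero assms in auto)

lemma torus_inverse:
  assumes "g \<in> G"
  shows "(\<lambda>u\<in>R. inverse (g u)) \<in> G"
proof (rule torusI)
  fix m assume m: "m \<in> dual_lattice N"
  have "(\<Prod>u\<in>R. (\<lambda>u\<in>R. inverse (g u)) u powi \<lfloor>blinfun_apply m u\<rfloor>)
      = inverse (\<Prod>u\<in>R. g u powi \<lfloor>blinfun_apply m u\<rfloor>)"
    by (simp add: power_int_inverse prod_inversef[symmetric])
  then show "(\<Prod>u\<in>R. (\<lambda>u\<in>R. inverse (g u)) u powi \<lfloor>blinfun_apply m u\<rfloor>) = 1"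
    using torus_char[OF assms m] by simp
qed (use torus_nonzero assms in auto)

lemma act_apply: "u \<in> R \<Longrightarrow> act R g x u = g u * x u"
  by (simp add: act_def)

lemma act_affine [simp]: "act R g x \<in> affine_space R"
  by (simp add: act_def affine_space_def)

lemma act_act: "act R g (act R h x) = act R (\<lambda>u\<in>R. g u * h u) x"
  by (auto simp: act_def restrict_def)

lemma affine_eqI: "x \<in> affine_space R \<Longrightarrow> y \<in> affine_space R \<Longrightarrow> (\<And>u. u \<in> R \<Longrightarrow> x u = y u) \<Longrightarrow> x = y"
  unfolding affine_space_def by (rule PiE_ext)

lemma act_one: "x \<in> affine_space R \<Longrightarrow> act R (\<lambda>u\<in>R. 1) x = x"
  by (rule affine_eqI) (auto simp: act_apply)

lemma act_inverse:
  assumes "g \<in> G" "x \<in> affine_space R"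
  shows "act R (\<lambda>u\<in>R. inverse (g u)) (act R g x) = x"
  by (rule affine_eqI) (use assms torus_nonzero[OF assms(1)] in \<open>auto simp: act_apply\<close>)

lemma act_U:
  assumes "g \<in> G" "x \<in> U"
  shows "act R g x \<in> U"
  using assms torus_nonzero[OF assms(1)] unfolding semistable_iff by (auto simp: act_apply)

lemma orbit_eqI:
  assumes "g \<in> G" "x \<in> affine_space R"
  shows "orbit N \<Sigma> (act R g x) = orbit N \<Sigma> x"
proof -
  have "orbit N \<Sigma> (act R h y) \<subseteq> orbit N \<Sigma> y" if "h \<in> G" for h y
    unfolding orbit_def using torus_mult[OF _ that] by (auto simp: act_act)
  from this[OF assms(1), of x] this[OF torus_inverse[OF assms(1)], of "act R g x"]
  show ?thesis by (simp add: act_inverse[OF assms])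
qed

lemma orbit_refl: "x \<in> affine_space R \<Longrightarrow> x \<in> orbit N \<Sigma> x"
  unfolding orbit_def using act_one torus_one by (metis image_eqI)

lemma orbit_eq_iff:
  assumes "x \<in> affine_space R" "y \<in> affine_space R"
  shows "orbit N \<Sigma> x = orbit N \<Sigma> y \<longleftrightarrow> (\<exists>g\<in>G. y = act R g x)"
proof
  assume "orbit N \<Sigma> x = orbit N \<Sigma> y"
  then have "y \<in> orbit N \<Sigma> x"
    using orbit_refl[OF assms(2)] by simp
  then show "\<exists>g\<in>G. y = act R g x"
    unfolding orbit_def by auto
next
  assume "\<exists>g\<in>G. y = act R g x"
  then show "orbit N \<Sigma> x = orbit N \<Sigma> y"
    using orbit_eqI[OF _ assms(1)] by auto
qed

lemma topspace_U: "topspace (subtopology (zariski R) U) = U"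
  using U_affine by auto

lemma points_X: "points X = orbit N \<Sigma> ` U"
  using quotient_imp_surjective_map[OF quotient_map_quotient_top[of "subtopology (zariski R) U" "orbit N \<Sigma>"]]
  unfolding points_def toric_variety_def by (simp add: topspace_U del: topspace_subtopology)

lemma topspace_X: "topspace (zar X) = orbit N \<Sigma> ` U"
  using points_X unfolding points_def .

lemma cox_preimage_eq: "cox_preimage N \<Sigma> A = {x \<in> U. orbit N \<Sigma> x \<in> A}"
  by (simp add: cox_preimage_def)

lemma openin_X: "openin (zar X) A \<longleftrightarrow> A \<subseteq> orbit N \<Sigma> ` U \<and> openin (zariski R) (cox_preimage N \<Sigma> A)"
  unfolding toric_variety_def cox_preimage_eq
  by (simp add: openin_quotient_top topspace_U openin_open_subtopology[OF openin_U] del: topspace_subtopology)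

lemma closedin_X:
  "closedin (zar X) C \<longleftrightarrow> C \<subseteq> orbit N \<Sigma> ` U \<and> openin (zariski R) (U - cox_preimage N \<Sigma> C)"
proof -
  have "cox_preimage N \<Sigma> (orbit N \<Sigma> ` U - C) = U - cox_preimage N \<Sigma> C"
    by (auto simp: cox_preimage_eq)
  then show ?thesis
    by (auto simp: closedin_def openin_X topspace_X)
qed

text \<open>These are the saturated sets of the quotient map; \<open>preimage_image\<close> makes
  them correspond to subsets of the quotient.\<close>

definition invariant :: "('v \<Rightarrow> complex) set \<Rightarrow> bool" where
  "invariant W \<longleftrightarrow> W \<subseteq> U \<and> (\<forall>g\<in>G. \<forall>x\<in>W. act R g x \<in> W)"

lemma invariant_preimage: "invariant (cox_preimage N \<Sigma> A)"
  unfolding invariant_def cox_preimage_eq by (auto simp: act_U orbit_eqI U_affine)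

lemma preimage_image:
  assumes "invariant W"
  shows "cox_preimage N \<Sigma> (orbit N \<Sigma> ` W) = W"
proof
  show "W \<subseteq> cox_preimage N \<Sigma> (orbit N \<Sigma> ` W)"
    using assms unfolding invariant_def cox_preimage_eq by auto
  show "cox_preimage N \<Sigma> (orbit N \<Sigma> ` W) \<subseteq> W"
  proof
    fix x assume "x \<in> cox_preimage N \<Sigma> (orbit N \<Sigma> ` W)"
    then obtain w where w: "w \<in> W" "x \<in> U" "orbit N \<Sigma> w = orbit N \<Sigma> x"
      unfolding cox_preimage_eq by auto
    then have "w \<in> U" using assms unfolding invariant_def by blast
    with w obtain g where "g \<in> G" "x = act R g w"
      using orbit_eq_iff U_affine by blast
    with w(1) assms show "x \<in> W"
      unfolding invariant_def by blast
  qed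
qed

lemma openin_X_image: "invariant W \<Longrightarrow> openin (zariski R) W \<Longrightarrow> openin (zar X) (orbit N \<Sigma> ` W)"
  by (auto simp: openin_X preimage_image invariant_def)

lemma closedin_X_image: "invariant W \<Longrightarrow> openin (zariski R) (U - W) \<Longrightarrow> closedin (zar X) (orbit N \<Sigma> ` W)"
  by (auto simp: closedin_X preimage_image invariant_def)

lemma reg_X: "f \<in> reg X A \<longleftrightarrow> regular_on R (cox_preimage N \<Sigma> A) (f \<circ> orbit N \<Sigma>)"
  by (simp add: toric_variety_def)

lemma mon_act:
  assumes "Poly_Mapping.keys a \<subseteq> R"
  shows "mon a (act R g x) = mon a g * mon a x"
proof -
  have "mon a (act R g x) = mon a (\<lambda>u. g u * x u)"
    by (rule mon_cong) (use assms in \<open>auto simp: act_apply\<close>)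
  then show ?thesis by (simp add: mon_mult)
qed

lemma polyfun_act:
  assumes "p \<in> polys R"
  shows "polyfun R (\<lambda>x. peval p (act R g x))"
proof -
  have eq: "(\<lambda>x. peval p (act R g x)) = (\<lambda>x. \<Sum>a\<in>Poly_Mapping.keys p. (Poly_Mapping.lookup p a * mon a g) * mon a x)"
    using assms by (intro ext) (auto simp: peval_mon mon_act polys_def intro!: sum.cong)
  have "polyfun R (\<lambda>x. \<Sum>a\<in>Poly_Mapping.keys p. (Poly_Mapping.lookup p a * mon a g) * mon a x)"
    by (rule polyfun_sum, rule polyfun_mult[OF polyfun_const], rule polyfun_mon)
      (use assms in \<open>auto simp: polys_def\<close>)
  then show ?thesis by (simp only: eq)
qed

text \<open>Homogeneity in the class of the monomial \<open>b\<close>, expressed through the action: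
  the weight is the character by which \<open>mon b\<close> transforms. Two polynomials with the
  same \<open>b\<close> have an invariant quotient.\<close>

definition semi_invariant :: "('v \<Rightarrow>\<^sub>0 nat) \<Rightarrow> 'v mpoly \<Rightarrow> bool" where
  "semi_invariant b q \<longleftrightarrow> Poly_Mapping.keys b \<subseteq> R \<and> q \<in> polys R \<and>
     (\<forall>g\<in>G. \<forall>x\<in>affine_space R. peval q (act R g x) = mon b g * peval q x)"

lemma semi_invariant_mon_nonzero:
  assumes "semi_invariant b q" "g \<in> G"
  shows "mon b g \<noteq> 0"
  using assms torus_nonzero finite_keys unfolding semi_invariant_def mon_def by auto

text \<open>The value \<open>peval p x\<close> is the sum of the values of the weight components of
  \<open>p\<close>, so one component is nonzero at \<open>x\<close>; the hypothesis
  \<open>step\<close> lets \<open>weight_component\<close> carry \<open>P\<close> over to it.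
  \<open>P\<close> stays abstract because it serves two spaces: functions vanishing on a closed set,
  and denominators of a regular function.\<close>

lemma semi_invariant_component:
  assumes p: "p \<in> polys R" and P: "P (peval p)" and x: "peval p x \<noteq> 0"
    and step: "\<And>F F' g y z. P F \<Longrightarrow> g \<in> G \<Longrightarrow>
        (\<forall>x\<in>affine_space R. F' x = y * (F (act R g x) - z * F x)) \<Longrightarrow> P F'"
  obtains q b where "semi_invariant b q" "P (peval q)" "peval q x \<noteq> 0"
proof -
  define A where "A = Poly_Mapping.keys p"
  define w where "w g a = mon a g" for g and a :: "'v \<Rightarrow>\<^sub>0 nat"
  define h where "h a = (\<lambda>g\<in>G. w g a)" for a
  have fin: "finite A" and AR: "\<And>a. a \<in> A \<Longrightarrow> Poly_Mapping.keys a \<subseteq> R"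
    using p by (auto simp: A_def polys_def)
  have h_iff: "h a = h b \<longleftrightarrow> (\<forall>g\<in>G. w g a = w g b)" for a b
    by (auto simp: h_def restrict_def fun_eq_iff)
  \<comment> \<open>Monomials are grouped by \<open>h\<close>, their character on \<open>G\<close>;
    \<open>b\<close> will represent a group with nonzero contribution.\<close>
  have "peval p x = (\<Sum>k\<in>h ` A. \<Sum>a\<in>{a \<in> A. h a = k}. Poly_Mapping.lookup p a * mon a x)"
    unfolding peval_mon A_def[symmetric] by (rule sum.image_gen[OF fin])
  then obtain k where "k \<in> h ` A" "(\<Sum>a\<in>{a \<in> A. h a = k}. Poly_Mapping.lookup p a * mon a x) \<noteq> 0"
    using x by (metis (no_types, lifting) sum.neutral)
  then obtain b where b: "b \<in> A" "(\<Sum>a\<in>{a \<in> A. h a = h b}. Poly_Mapping.lookup p a * mon a x) \<noteq> 0"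
    by blast
  define Q where "Q c = P (\<lambda>x. \<Sum>a\<in>A. c a * mon a x)" for c
  define c where "c a = (if \<forall>g\<in>G. w g a = w g b then Poly_Mapping.lookup p a else 0)" for a
  have "Q c"
    unfolding c_def
  proof (rule weight_component[OF fin, where G=G and w=w])
    show "Q (Poly_Mapping.lookup p)"
      using P unfolding Q_def peval_mon[abs_def] A_def .
  next
    fix c g y z assume "Q c" and g: "g \<in> G"
    then have "P (\<lambda>x. \<Sum>a\<in>A. c a * mon a x)" by (simp add: Q_def)
    then have "P (\<lambda>x. \<Sum>a\<in>A. y * (w g a - z) * c a * mon a x)"
    proof (rule step[OF _ g], safe)
      fix x assume "x \<in> affine_space R"
      have "(\<Sum>a\<in>A. c a * mon a (act R g x)) = (\<Sum>a\<in>A. c a * (w g a * mon a x))"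
        by (rule sum.cong) (auto simp: mon_act AR w_def)
      then show "(\<Sum>a\<in>A. y * (w g a - z) * c a * mon a x) =
           y * ((\<Sum>a\<in>A. c a * mon a (act R g x)) - z * (\<Sum>a\<in>A. c a * mon a x))"
        by (simp add: sum_distrib_left flip: sum_subtractf) (simp add: algebra_simps)
    qed
    then show "Q (\<lambda>a. y * (w g a - z) * c a)" by (simp add: Q_def)
  qed (auto simp: A_def in_keys_iff)
  define q where "q = (\<Sum>a\<in>A. Poly_Mapping.single a (c a))"
  have q: "peval q = (\<lambda>x. \<Sum>a\<in>A. c a * mon a x)"
    by (auto simp: q_def peval_sum)
  have "P (peval q)"
    using \<open>Q c\<close> by (simp add: Q_def q)
  moreover have "peval q x \<noteq> 0"
  proof -
    have "peval q x = (\<Sum>a\<in>{a \<in> A. h a = h b}. Poly_Mapping.lookup p a * mon a x)"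
      unfolding q using fin by (intro sum.mono_neutral_cong_right) (auto simp: c_def h_iff)
    then show ?thesis using b by simp
  qed
  moreover have "semi_invariant b q"
    unfolding semi_invariant_def
  proof (intro conjI ballI)
    show "Poly_Mapping.keys b \<subseteq> R" using b AR by blast
    show "q \<in> polys R" unfolding q_def by (intro polys_sum polys_single AR)
    fix g x assume g: "g \<in> G" and "x \<in> affine_space R"
    have "c a * mon a (act R g x) = mon b g * (c a * mon a x)" if "a \<in> A" for a
      using g by (auto simp: c_def mon_act AR that w_def)
    then have "(\<Sum>a\<in>A. c a * mon a (act R g x)) = (\<Sum>a\<in>A. mon b g * (c a * mon a x))"
      by (intro sum.cong refl)
    then show "peval q (act R g x) = mon b g * peval q x"
      by (simp add: q sum_distrib_left)
  qed
  ultimately show ?thesis using that by blast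
qed

text \<open>The denominators \<open>F\<close> for which \<open>H * F\<close> is a polynomial on
  \<open>W\<close> form a space stable under \<open>G\<close>, because \<open>H\<close> is
  invariant. It contains the local denominator at \<open>x\<close>, hence a semi-invariant one that
  is nonzero at \<open>x\<close>; the numerator has the same weight on \<open>W\<close>, and by
  density everywhere.\<close>

lemma invariant_regular_fraction:
  assumes W: "invariant W" "x \<in> W" and H: "regular_on R W H"
    and inv: "\<And>g x. g \<in> G \<Longrightarrow> x \<in> W \<Longrightarrow> H (act R g x) = H x"
  obtains p q b where "semi_invariant b p" "semi_invariant b q" "peval q x \<noteq> 0"
    "\<And>x. x \<in> W \<Longrightarrow> H x * peval q x = peval p x"
proof -
  note oW = regular_on_imp_openin[OF H]
  have Wa: "y \<in> affine_space R" if "y \<in> W" for y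
    using W(1) that U_affine unfolding invariant_def by blast
  obtain f p q where "fraction_near R W H x f p q"
    by (rule regular_onE[OF H W(2)])
  then have f: "f \<in> polys R" "p \<in> polys R" "q \<in> polys R" "peval f x \<noteq> 0"
    and fpq: "\<And>y. y \<in> affine_space R \<Longrightarrow> peval f y \<noteq> 0 \<Longrightarrow> y \<in> W"
     "\<And>y. y \<in> affine_space R \<Longrightarrow> peval f y \<noteq> 0 \<Longrightarrow> peval q y \<noteq> 0"
     "\<And>y. y \<in> affine_space R \<Longrightarrow> peval f y \<noteq> 0 \<Longrightarrow> H y = peval p y / peval q y"
    unfolding fraction_near_def by blast+
  define P where "P F \<longleftrightarrow> (\<exists>r\<in>polys R. \<forall>y\<in>W. H y * F y = peval r y)" for F
  \<comment> \<open>The fraction found near \<open>x\<close> is valid on all of \<open>W\<close>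
    once the denominator is cleared.\<close>
  have "\<forall>y\<in>W. H y * peval q y = peval p y"
  proof
    fix y assume y: "y \<in> W"
    obtain f2 p2 q2 where "fraction_near R W H y f2 p2 q2"
      by (rule regular_onE[OF H y])
    then have f2: "f2 \<in> polys R" "p2 \<in> polys R" "q2 \<in> polys R" "peval f2 y \<noteq> 0"
      and fpq2: "\<And>y. y \<in> affine_space R \<Longrightarrow> peval f2 y \<noteq> 0 \<Longrightarrow> peval q2 y \<noteq> 0"
       "\<And>y. y \<in> affine_space R \<Longrightarrow> peval f2 y \<noteq> 0 \<Longrightarrow> H y = peval p2 y / peval q2 y"
      unfolding fraction_near_def by blast+
    have o: "openin (zariski R) {y \<in> affine_space R. peval f y \<noteq> 0}"
      "openin (zariski R) {y \<in> affine_space R. peval f2 y \<noteq> 0}"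
      by (intro openin_zariski_basic polyfun_peval f f2)+
    \<comment> \<open>The factor \<open>f2\<close> makes the identity true also where
      \<open>f2\<close> vanishes, so it holds on the whole open set \<open>f \<noteq> 0\<close>;
      density carries it to \<open>y\<close>, where \<open>f2\<close> can be cancelled.\<close>
    have "peval (f2 * (p * q2 - p2 * q)) y = peval 0 y"
    proof (rule polyfun_eq_on_open[OF o(1), where F="peval (f2 * (p * q2 - p2 * q))" and G="peval 0"])
      fix z assume "z \<in> {y \<in> affine_space R. peval f y \<noteq> 0}"
      then have "peval f2 z \<noteq> 0 \<Longrightarrow> peval p z * peval q2 z = peval p2 z * peval q z"
        using fpq(2,3)[of z] fpq2[of z] by (auto simp: field_simps)
      then show "peval (f2 * (p * q2 - p2 * q)) z = peval 0 z"
        by auto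
    qed (use f f2 W(2) y Wa in \<open>auto intro!: polyfun_peval\<close>)
    then have "peval p y * peval q2 y = peval p2 y * peval q y"
      using f2(4) by simp
    then show "H y * peval q y = peval p y"
    proof -
      assume "peval p y * peval q2 y = peval p2 y * peval q y"
      moreover have "H y * peval q2 y = peval p2 y"
        using fpq2[OF Wa[OF y] f2(4)] by simp
      ultimately have "(H y * peval q y) * peval q2 y = peval p y * peval q2 y"
        by (simp add: mult_ac)
      then show ?thesis using fpq2(1)[OF Wa[OF y] f2(4)] by simp
    qed
  qed
  then have "P (peval q)"
    unfolding P_def using f by blast
  have qx: "peval q x \<noteq> 0"
    using fpq(2)[OF Wa[OF W(2)] f(4)] .
  obtain q' b where q': "semi_invariant b q'" "P (peval q')" "peval q' x \<noteq> 0"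
  proof (rule semi_invariant_component[where P=P, OF f(3) \<open>P (peval q)\<close> qx])
    fix F F' g y z
    assume "P F" and g: "g \<in> G" and F': "\<forall>x\<in>affine_space R. F' x = y * (F (act R g x) - z * F x)"
    then obtain r where r: "r \<in> polys R" "\<forall>y\<in>W. H y * F y = peval r y"
      unfolding P_def by blast
    have "polyfun R (\<lambda>x. y * (peval r (act R g x) - z * peval r x))"
      by (intro polyfun_mult polyfun_const polyfun_diff polyfun_act polyfun_peval r)
    then obtain s where s: "s \<in> polys R" "(\<lambda>x. y * (peval r (act R g x) - z * peval r x)) = peval s"
      unfolding polyfun_def by blast
    have "H x * F' x = peval s x" if "x \<in> W" for x
    proof -
      have "act R g x \<in> W" using W(1) g that unfolding invariant_def by blast
      then have "H x * F (act R g x) = peval r (act R g x)"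
        using r(2) inv[OF g that] by metis
      moreover have "H x * F x = peval r x"
        using r(2) that by blast
      moreover have "F' x = y * (F (act R g x) - z * F x)"
        using F' Wa[OF that] by blast
      then have "H x * F' x = y * (H x * F (act R g x) - z * (H x * F x))"
        by (simp only: right_diff_distrib mult_ac)
      ultimately have "H x * F' x = y * (peval r (act R g x) - z * peval r x)"
        by (simp only:)
      then show ?thesis using s(2) by metis
    qed
    then show "P F'" unfolding P_def using s(1) by blast
  qed (use that in blast)
  from q'(2) obtain p' where p': "p' \<in> polys R" "\<forall>y\<in>W. H y * peval q' y = peval p' y"
    unfolding P_def by blast
  have "semi_invariant b p'"
    unfolding semi_invariant_def
  proof (intro conjI ballI)
    show "Poly_Mapping.keys b \<subseteq> R" using q'(1) by (simp add: semi_invariant_def)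
    fix g y assume g: "g \<in> G" and y: "y \<in> affine_space R"
    show "peval p' (act R g y) = mon b g * peval p' y"
    proof (rule polyfun_eq_on_open[OF oW W(2) polyfun_act[OF p'(1)]])
      show "polyfun R (\<lambda>y. mon b g * peval p' y)"
        by (intro polyfun_mult polyfun_const polyfun_peval p')
      fix z assume z: "z \<in> W"
      then have "act R g z \<in> W" using W(1) g unfolding invariant_def by blast
      then have "peval p' (act R g z) = H z * peval q' (act R g z)"
        using p'(2) inv[OF g z] by metis
      also have "\<dots> = mon b g * peval p' z"
        using q'(1) g Wa[OF z] p'(2) z unfolding semi_invariant_def by (simp flip: p'(2))
      finally show "peval p' (act R g z) = mon b g * peval p' z" .
    qed (fact y)
  qed (fact p')
  then show ?thesis
    using that q' p' by blast
qed

end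

section \<open>Algebraic independence along chains\<close>

text \<open>
  If \<open>F i\<close> vanishes on \<open>D i\<close> but not on the next, larger set, then \<open>F 0, \<dots>, F (m - 1)\<close> are
  algebraically independent: a relation is divided by powers of the last function, and then
  restricted to \<open>D (m - 1)\<close>, where only the terms of lowest degree survive.
\<close>

lemma prime_chain_independent:
  fixes D :: "nat \<Rightarrow> 'x set" and F :: "nat \<Rightarrow> 'x \<Rightarrow> complex" and A :: "(nat \<Rightarrow> nat) set"
  assumes ne: "D 0 \<noteq> {}" and mono: "\<And>i. i < m \<Longrightarrow> D i \<subseteq> D (Suc i)"
    and F0: "\<And>i x. i < m \<Longrightarrow> x \<in> D i \<Longrightarrow> F i x = 0"
    and F1: "\<And>i. i < m \<Longrightarrow> \<exists>x\<in>D (Suc i). F i x \<noteq> 0"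
    and Alg: "\<And>c. Alg (\<lambda>x. c)" "\<And>i. i < m \<Longrightarrow> Alg (F i)"
      "\<And>f g. Alg f \<Longrightarrow> Alg g \<Longrightarrow> Alg (\<lambda>x. f x + g x)" "\<And>f g. Alg f \<Longrightarrow> Alg g \<Longrightarrow> Alg (\<lambda>x. f x * g x)"
    and prime: "\<And>i f g. i \<le> m \<Longrightarrow> Alg f \<Longrightarrow> Alg g \<Longrightarrow> (\<forall>x\<in>D i. f x * g x = 0) \<Longrightarrow>
        (\<forall>x\<in>D i. f x = 0) \<or> (\<forall>x\<in>D i. g x = 0)"
    and A: "finite A" "inj_on (\<lambda>a. restrict a {..<m}) A"
    and zero: "\<forall>x\<in>D m. (\<Sum>a\<in>A. c a * (\<Prod>i<m. F i x ^ a i)) = 0"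
  shows "\<forall>a\<in>A. c a = 0"
  using mono F0 F1 Alg(2) prime A zero
proof (induction m arbitrary: A)
  case 0
  show ?case
  proof
    fix a assume a: "a \<in> A"
    \<comment> \<open>All exponent functions agree on the empty index set, so injectivity leaves a
      single exponent, and the relation at a point of \<open>D 0\<close> reads
      \<open>c a = 0\<close>.\<close>
    have "A = {a}"
      using 0(7) a by (auto simp: inj_on_def)
    then show "c a = 0"
      using 0(8) ne by auto
  qed
next
  case (Suc n)
  \<comment> \<open>Coefficients are killed in the order of the exponent \<open>j\<close> of the
    last function: when \<open>j\<close> is reached, all terms with a smaller exponent are gone, and
    \<open>F n ^ j\<close> divides the relation with quotient \<open>H\<close>.\<close>
  have "\<forall>a\<in>A. a n = j \<longrightarrow> c a = 0" for j
  proof (induction j rule: less_induct)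
    case (less j)
    define H where "H x = (\<Sum>a\<in>{a\<in>A. j \<le> a n}. c a * (\<Prod>i<n. F i x ^ a i) * F n x ^ (a n - j))" for x
    have pow: "Alg (\<lambda>x. F i x ^ k)" if "i < Suc n" for i k
      by (induction k) (simp_all add: Alg(1) Alg(4) Suc.prems(4)[OF that])
    have prod: "Alg (\<lambda>x. \<Prod>i\<in>I. F i x ^ a i)" if "I \<subseteq> {..<Suc n}" for I a
      using that by (induction I rule: infinite_finite_induct) (simp_all add: Alg(1) Alg(4) pow)
    have sum: "Alg (\<lambda>x. \<Sum>a\<in>I. c a * (\<Prod>i<n. F i x ^ a i) * F n x ^ (a n - j))" for I
      by (induction I rule: infinite_finite_induct) (simp_all add: Alg(1,3,4) pow prod)
    have "\<forall>x\<in>D (Suc n). F n x ^ j * H x = 0"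
    proof
      fix x assume x: "x \<in> D (Suc n)"
      have "F n x ^ j * H x = (\<Sum>a\<in>{a\<in>A. j \<le> a n}. c a * (\<Prod>i<Suc n. F i x ^ a i))"
        unfolding H_def sum_distrib_left
        by (rule sum.cong) (auto simp: mult_ac simp flip: power_add)
      also have "\<dots> = (\<Sum>a\<in>A. c a * (\<Prod>i<Suc n. F i x ^ a i))"
        using less.IH Suc.prems(6) by (intro sum.mono_neutral_left) (auto simp: not_le)
      finally show "F n x ^ j * H x = 0"
        using Suc.prems(8) x by simp
    qed
    moreover have "Alg H"
      unfolding H_def[abs_def] by (rule sum)
    ultimately have "(\<forall>x\<in>D (Suc n). F n x ^ j = 0) \<or> (\<forall>x\<in>D (Suc n). H x = 0)"
      using Suc.prems(5)[of "Suc n" "\<lambda>x. F n x ^ j" H] pow[of n j] by blast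
    moreover have "\<not> (\<forall>x\<in>D (Suc n). F n x ^ j = 0)"
      using Suc.prems(3)[of n] by auto
    ultimately have H0: "\<forall>x\<in>D (Suc n). H x = 0" by blast
    have "\<forall>a\<in>{a\<in>A. a n = j}. c a = 0"
    proof (rule Suc.IH)
      show "inj_on (\<lambda>a. restrict a {..<n}) {a \<in> A. a n = j}"
      proof (rule inj_onI)
        fix a b assume ab: "a \<in> {a \<in> A. a n = j}" "b \<in> {a \<in> A. a n = j}"
          and eq: "restrict a {..<n} = restrict b {..<n}"
        have "restrict a {..<Suc n} = restrict b {..<Suc n}"
        proof
          fix i
          show "restrict a {..<Suc n} i = restrict b {..<Suc n} i"
            using ab fun_cong[OF eq, of i] by (cases "i = n") (auto simp: restrict_def split: if_splits)
        qed
        then show "a = b"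
          using Suc.prems(7) ab unfolding inj_on_def by blast
      qed
      show "\<forall>x\<in>D n. (\<Sum>a\<in>{a \<in> A. a n = j}. c a * (\<Prod>i<n. F i x ^ a i)) = 0"
      proof
        fix x assume x: "x \<in> D n"
        then have "F n x = 0" using Suc.prems(2)[of n] by simp
        \<comment> \<open>Only the exponent exactly \<open>j\<close> survives on \<open>D n\<close>:
          the last factor is \<open>0 ^ (a n - j)\<close> there, with
          \<open>0 ^ 0 = 1\<close>.\<close>
        then have "H x = (\<Sum>a\<in>{a \<in> A. a n = j}. c a * (\<Prod>i<n. F i x ^ a i))"
          unfolding H_def using Suc.prems(6)
          by (intro sum.mono_neutral_cong_right) auto
        moreover have "x \<in> D (Suc n)" using Suc.prems(1)[of n] x by auto
        ultimately show "(\<Sum>a\<in>{a \<in> A. a n = j}. c a * (\<Prod>i<n. F i x ^ a i)) = 0"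
          using H0 by simp
      qed
    qed (use Suc.prems in auto)
    then show ?case by blast
  qed
  then show ?case by blast
qed

text \<open>The bound is on each exponent separately, not on the total degree, so the admissible
  exponents form a box with \<open>(K + 1) ^ card S\<close> elements.\<close>

definition deg_bounded :: "'v set \<Rightarrow> nat \<Rightarrow> 'v mpoly \<Rightarrow> bool" where
  "deg_bounded S K q \<longleftrightarrow> q \<in> polys S \<and> (\<forall>b\<in>Poly_Mapping.keys q. \<forall>u. Poly_Mapping.lookup b u \<le> K)"

lemma deg_bounded_mult:
  assumes "deg_bounded S K q" "deg_bounded S L r"
  shows "deg_bounded S (K + L) (q * r)"
  unfolding deg_bounded_def
proof safe
  fix b u assume "b \<in> Poly_Mapping.keys (q * r)"
  then obtain b1 b2 where "b = b1 + b2" "b1 \<in> Poly_Mapping.keys q" "b2 \<in> Poly_Mapping.keys r"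
    using keys_mult[of q r] by blast
  then show "Poly_Mapping.lookup b u \<le> K + L"
    using assms unfolding deg_bounded_def by (auto simp: lookup_add intro: add_mono)
qed (use assms in \<open>auto simp: deg_bounded_def\<close>)

lemma deg_bounded_1: "deg_bounded S 0 1"
  by (auto simp: deg_bounded_def)

lemma deg_bounded_power: "deg_bounded S K q \<Longrightarrow> deg_bounded S (n * K) (q ^ n)"
  by (induction n) (simp_all add: deg_bounded_1 deg_bounded_mult)

lemma deg_bounded_prod:
  assumes "finite I" "\<And>i. i \<in> I \<Longrightarrow> deg_bounded S (K i) (q i)"
  shows "deg_bounded S (\<Sum>i\<in>I. K i) (\<Prod>i\<in>I. q i)"
  using assms by (induction I rule: finite_induct) (simp_all add: deg_bounded_1 deg_bounded_mult)

lemma deg_bounded_mono: "deg_bounded S K q \<Longrightarrow> K \<le> L \<Longrightarrow> deg_bounded S L q"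
  unfolding deg_bounded_def using le_trans by blast

lemma deg_bounded_exists:
  assumes "q \<in> polys S"
  shows "\<exists>K. deg_bounded S K q"
proof -
  define K where "K = (\<Sum>b\<in>Poly_Mapping.keys q. \<Sum>u\<in>Poly_Mapping.keys b. Poly_Mapping.lookup b u)"
  have "Poly_Mapping.lookup b u \<le> K" if b: "b \<in> Poly_Mapping.keys q" for b u
  proof (cases "u \<in> Poly_Mapping.keys b")
    case True
    have "Poly_Mapping.lookup b u \<le> (\<Sum>u\<in>Poly_Mapping.keys b. Poly_Mapping.lookup b u)"
      using True by (intro member_le_sum) auto
    also have "\<dots> \<le> K"
      unfolding K_def using b
      by (intro member_le_sum[of b _ "\<lambda>b. \<Sum>u\<in>Poly_Mapping.keys b. Poly_Mapping.lookup b u"]) auto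
    finally show ?thesis .
  qed (simp add: in_keys_iff)
  then show ?thesis using assms unfolding deg_bounded_def by blast
qed

lemma card_exponent_box:
  assumes "finite S"
  shows "finite {b :: 'v \<Rightarrow>\<^sub>0 nat. Poly_Mapping.keys b \<subseteq> S \<and> (\<forall>u. Poly_Mapping.lookup b u \<le> K)}" (is "finite ?B")
    and "card {b :: 'v \<Rightarrow>\<^sub>0 nat. Poly_Mapping.keys b \<subseteq> S \<and> (\<forall>u. Poly_Mapping.lookup b u \<le> K)} \<le> (K + 1) ^ card S"
proof -
  let ?h = "\<lambda>b. restrict (Poly_Mapping.lookup b) S"
  have inj: "inj_on ?h ?B"
  proof (rule inj_onI)
    fix b c assume b: "b \<in> ?B" and c: "c \<in> ?B" and eq: "?h b = ?h c"
    show "b = c"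
    proof (rule poly_mapping_eqI)
      fix u
      show "Poly_Mapping.lookup b u = Poly_Mapping.lookup c u"
      proof (cases "u \<in> S")
        case False
        then have "u \<notin> Poly_Mapping.keys b" "u \<notin> Poly_Mapping.keys c"
          using b c by auto
        then show ?thesis by (simp add: in_keys_iff)
      qed (use fun_cong[OF eq, of u] in simp)
    qed
  qed
  have sub: "?h ` ?B \<subseteq> S \<rightarrow>\<^sub>E {..K}" by auto
  have fin: "finite (S \<rightarrow>\<^sub>E {..K})" using assms by (intro finite_PiE) auto
  show "finite ?B" by (rule inj_on_finite[OF inj sub fin])
  show "card ?B \<le> (K + 1) ^ card S"
    using card_inj_on_le[OF inj sub fin] assms by (simp add: card_PiE)
qed

text \<open>Counting: the products of the \<open>p i\<close> with exponents up to \<open>L\<close>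
  number \<open>(L + 1) ^ m\<close>, while they live in a space of polynomials whose dimension grows
  only like the power \<open>card S < m\<close> of \<open>L\<close>. For large \<open>L\<close> they
  are linearly dependent.\<close>

lemma algebraic_dependence:
  fixes p :: "nat \<Rightarrow> 'v mpoly"
  assumes S: "finite S" "card S < m" and p: "\<And>i. i < m \<Longrightarrow> p i \<in> polys S"
  obtains A c where "finite A" "inj_on (\<lambda>a. restrict a {..<m}) A" "\<exists>a\<in>A. c a \<noteq> 0"
    "\<And>x. (\<Sum>a\<in>A. c a * (\<Prod>i<m. peval (p i) x ^ a i)) = 0"
proof -
  have "\<forall>i. \<exists>K. i < m \<longrightarrow> deg_bounded S K (p i)"
    using deg_bounded_exists p by blast
  then obtain k where k: "\<And>i. i < m \<Longrightarrow> deg_bounded S (k i) (p i)" by metis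
  define D where "D = (\<Sum>i<m. k i)"
  have kD: "deg_bounded S D (p i)" if "i < m" for i
    using k[OF that] by (rule deg_bounded_mono) (auto simp: D_def that intro: member_le_sum)
  \<comment> \<open>Chosen to make the count work: \<open>K + 1 \<le> C * (L + 1)\<close> and
    \<open>L = C ^ card S\<close>, so the box has at most \<open>L * (L + 1) ^ card S\<close>
    elements, fewer than \<open>(L + 1) ^ m\<close>.\<close>
  define C where "C = m * D + 1"
  define L where "L = C ^ card S"
  define K where "K = m * (L * D)"
  define A where "A = {..<m} \<rightarrow>\<^sub>E {..L}"
  define P where "P a = (\<Prod>i<m. p i ^ a i)" for a
  define B where "B = {b :: 'v \<Rightarrow>\<^sub>0 nat. Poly_Mapping.keys b \<subseteq> S \<and> (\<forall>u. Poly_Mapping.lookup b u \<le> K)}"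
  have finA: "finite A" unfolding A_def by (intro finite_PiE) auto
  have injA: "inj_on (\<lambda>a. restrict a {..<m}) A"
    unfolding A_def inj_on_def by (metis PiE_restrict)
  have P: "deg_bounded S K (P a)" if "a \<in> A" for a
  proof (rule deg_bounded_mono)
    show "deg_bounded S (\<Sum>i<m. a i * D) (P a)"
      unfolding P_def by (intro deg_bounded_prod deg_bounded_power kD) auto
    have "(\<Sum>i<m. a i * D) \<le> (\<Sum>i<m. L * D)"
      using that unfolding A_def by (intro sum_mono mult_right_mono) auto
    then show "(\<Sum>i<m. a i * D) \<le> K" by (simp add: K_def)
  qed
  have "K + 1 \<le> C * (L + 1)"
    by (simp add: K_def C_def algebra_simps)
  then have "(K + 1) ^ card S \<le> (C * (L + 1)) ^ card S"
    by (rule power_mono) simp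
  also have "\<dots> = L * (L + 1) ^ card S"
    by (simp only: L_def power_mult_distrib)
  also have "\<dots> < (L + 1) ^ Suc (card S)" by simp
  also have "\<dots> \<le> (L + 1) ^ m"
    using S(2) by (intro power_increasing) auto
  also have "\<dots> = card A"
    by (simp add: A_def card_PiE)
  finally have "card B < card A"
    using card_exponent_box(2)[OF S(1), of K] unfolding B_def by linarith
  moreover have finB: "finite B"
    unfolding B_def by (rule card_exponent_box[OF S(1)])
  ultimately obtain c where c: "\<exists>a\<in>A. c a \<noteq> 0" "\<forall>b\<in>B. (\<Sum>a\<in>A. c a * Poly_Mapping.lookup (P a) b) = 0"
    using underdetermined_system[of B A "\<lambda>a b. Poly_Mapping.lookup (P a) b"] finA by blast
  have "(\<Sum>a\<in>A. c a * (\<Prod>i<m. peval (p i) x ^ a i)) = 0" for x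
  proof -
    have "peval (P a) x = (\<Sum>b\<in>B. Poly_Mapping.lookup (P a) b * mon b x)" if "a \<in> A" for a
      using P[OF that] by (intro peval_superset[OF finB]) (auto simp: B_def deg_bounded_def polys_def)
    then have "(\<Sum>a\<in>A. c a * (\<Prod>i<m. peval (p i) x ^ a i))
        = (\<Sum>a\<in>A. c a * (\<Sum>b\<in>B. Poly_Mapping.lookup (P a) b * mon b x))"
      by (intro sum.cong) (auto simp: P_def peval_prod)
    also have "\<dots> = (\<Sum>a\<in>A. \<Sum>b\<in>B. c a * Poly_Mapping.lookup (P a) b * mon b x)"
      by (simp add: sum_distrib_left mult_ac)
    also have "\<dots> = (\<Sum>b\<in>B. (\<Sum>a\<in>A. c a * Poly_Mapping.lookup (P a) b) * mon b x)"
      by (subst sum.swap) (simp add: sum_distrib_right)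
    also have "\<dots> = 0" using c(2) by simp
    finally show ?thesis .
  qed
  with that finA injA c(1) show ?thesis by blast
qed


section \<open>Dual lattices\<close>

lemma dual_lattice_sum:
  assumes "\<And>i. i \<in> I \<Longrightarrow> m i \<in> dual_lattice N"
  shows "(\<Sum>i\<in>I. real_of_int (c i) *\<^sub>R m i) \<in> dual_lattice N"
  unfolding dual_lattice_def
proof safe
  fix u assume "u \<in> N"
  then have "real_of_int (c i) * blinfun_apply (m i) u \<in> \<int>" if "i \<in> I" for i
    using assms[OF that] unfolding dual_lattice_def by (intro Ints_mult) auto
  then show "blinfun_apply (\<Sum>i\<in>I. real_of_int (c i) *\<^sub>R m i) u \<in> \<int>"
    by (simp add: blinfun.sum_left blinfun.scaleR_left Ints_sum)
qed

lemma dual_lattice_floor: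
  "m \<in> dual_lattice N \<Longrightarrow> u \<in> N \<Longrightarrow> real_of_int \<lfloor>blinfun_apply m u\<rfloor> = blinfun_apply m u"
  unfolding dual_lattice_def by (auto elim!: Ints_cases)

text \<open>For each \<open>u\<close> in \<open>S\<close>, an integral functional vanishing on the
  rest of \<open>S\<close> comes from a system with \<open>card B\<close> unknowns and
  \<open>card B - 1\<close> equations. If it vanished at \<open>u\<close> too, it would vanish on
  \<open>span S\<close>, hence on all \<open>\<beta> b\<close>, and its coefficients would be 0. The
  abstract dual system \<open>l\<close>, \<open>\<beta>\<close> covers both the base and the lifted
  lattice.\<close>

lemma dual_lattice_multiples:
  fixes N :: "'a::real_normed_vector set"
  assumes B: "finite B" and l: "\<And>b. b \<in> B \<Longrightarrow> l b \<in> dual_lattice N"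
    and \<beta>: "\<And>b. b \<in> B \<Longrightarrow> \<beta> b \<in> span S"
      "\<And>b b'. b \<in> B \<Longrightarrow> b' \<in> B \<Longrightarrow> blinfun_apply (l b) (\<beta> b') = (if b = b' then 1 else 0)"
    and S: "S \<subseteq> N" "finite S" "card S = card B"
  obtains M :: nat where "M > 0"
    "\<And>b :: 'a \<Rightarrow> nat. \<exists>m\<in>dual_lattice N. \<forall>u\<in>S. blinfun_apply m u = real (M * b u)"
proof -
  have "\<exists>m\<in>dual_lattice N. blinfun_apply m u \<noteq> 0 \<and> (\<forall>v\<in>S - {u}. blinfun_apply m v = 0)" if u: "u \<in> S" for u
  proof -
    have "card (S - {u}) < card B"
      using u S(2,3) by (metis card_Diff1_less)
    then obtain c :: "'b \<Rightarrow> int" where c: "\<exists>b\<in>B. c b \<noteq> 0"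
        "\<forall>v\<in>S - {u}. (\<Sum>b\<in>B. c b * \<lfloor>blinfun_apply (l b) v\<rfloor>) = 0"
      using underdetermined_system[of "S - {u}" B "\<lambda>b v. \<lfloor>blinfun_apply (l b) v\<rfloor>"] B S(2) by blast
    define m where "m = (\<Sum>b\<in>B. real_of_int (c b) *\<^sub>R l b)"
    have m: "m \<in> dual_lattice N"
      unfolding m_def by (rule dual_lattice_sum[OF l])
    have apply_m: "blinfun_apply m v = (\<Sum>b\<in>B. real_of_int (c b) * blinfun_apply (l b) v)" for v
      by (simp add: m_def blinfun.sum_left blinfun.scaleR_left)
    have zero: "blinfun_apply m v = 0" if "v \<in> S - {u}" for v
    proof -
      have "blinfun_apply m v = (\<Sum>b\<in>B. real_of_int (c b * \<lfloor>blinfun_apply (l b) v\<rfloor>))"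
        unfolding apply_m using that S(1) by (intro sum.cong) (auto simp: dual_lattice_floor[OF l])
      also have "\<dots> = real_of_int (\<Sum>b\<in>B. c b * \<lfloor>blinfun_apply (l b) v\<rfloor>)" by simp
      also have "(\<Sum>b\<in>B. c b * \<lfloor>blinfun_apply (l b) v\<rfloor>) = 0"
        using c(2) that by blast
      finally show ?thesis by simp
    qed
    have "blinfun_apply m u \<noteq> 0"
    proof
      assume "blinfun_apply m u = 0"
      then have "blinfun_apply m v = 0" if "v \<in> S" for v
        using zero that by (cases "v = u") auto
      then have "blinfun_apply m v = 0" if "v \<in> span S" for v
        using linear_eq_0_on_span[OF bounded_linear.linear[OF blinfun.bounded_linear_right]] that by blast
      moreover have "blinfun_apply m (\<beta> b) = c b" if "b \<in> B" for b
      proof -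
        have "blinfun_apply m (\<beta> b) = (\<Sum>b'\<in>B. if b' = b then real_of_int (c b') else 0)"
          unfolding apply_m by (rule sum.cong) (auto simp: \<beta>(2) that)
        then show ?thesis using B that by simp
      qed
      ultimately show False using c(1) \<beta>(1) by fastforce
    qed
    with m zero show ?thesis by blast
  qed
  then obtain m where m: "\<And>u. u \<in> S \<Longrightarrow> m u \<in> dual_lattice N" "\<And>u. u \<in> S \<Longrightarrow> blinfun_apply (m u) u \<noteq> 0"
    "\<And>u v. u \<in> S \<Longrightarrow> v \<in> S \<Longrightarrow> v \<noteq> u \<Longrightarrow> blinfun_apply (m u) v = 0"
    by (metis Diff_iff singletonD)
  define k where "k u = \<lfloor>blinfun_apply (m u) u\<rfloor>" for u
  have k: "blinfun_apply (m u) u = real_of_int (k u)" if "u \<in> S" for u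
    unfolding k_def by (rule dual_lattice_floor[OF m(1)[OF that] subsetD[OF S(1) that], symmetric])
  \<comment> \<open>A common multiple of the diagonal values \<open>k u\<close>. In the coefficients
    below, the sign and the omitted factor at \<open>u\<close> make the value at \<open>u\<close>
    equal to \<open>M * b u\<close>.\<close>
  define M where "M = nat (\<Prod>u\<in>S. \<bar>k u\<bar>)"
  have k0: "k u \<noteq> 0" if "u \<in> S" for u
    using m(2)[OF that] k[OF that] by auto
  then have pos: "(\<Prod>u\<in>S. \<bar>k u\<bar>) > 0"
    by (intro prod_pos) auto
  have "\<exists>m\<in>dual_lattice N. \<forall>u\<in>S. blinfun_apply m u = real (M * b u)" for b :: "'a \<Rightarrow> nat"
  proof (intro bexI ballI)
    let ?c = "\<lambda>u. int (b u) * sgn (k u) * (\<Prod>v\<in>S - {u}. \<bar>k v\<bar>)"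
    show "(\<Sum>u\<in>S. real_of_int (?c u) *\<^sub>R m u) \<in> dual_lattice N"
      by (rule dual_lattice_sum[OF m(1)])
    fix u assume u: "u \<in> S"
    have "blinfun_apply (\<Sum>u\<in>S. real_of_int (?c u) *\<^sub>R m u) u
        = (\<Sum>v\<in>S. real_of_int (?c v) * blinfun_apply (m v) u)"
      by (simp only: blinfun.sum_left blinfun.scaleR_left real_scaleR_def)
    also have "\<dots> = (\<Sum>v\<in>S. if v = u then real_of_int (?c u * k u) else 0)"
      by (rule sum.cong) (use u m(3) k in auto)
    also have "\<dots> = real_of_int (?c u * k u)"
      using S(2) u by simp
    also have "?c u * k u = int (b u) * (\<Prod>v\<in>S. \<bar>k v\<bar>)"
      by (subst prod.remove[OF S(2) u]) (simp add: abs_sgn mult_ac)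
    finally show "blinfun_apply (\<Sum>u\<in>S. real_of_int (?c u) *\<^sub>R m u) u = real (M * b u)"
      using pos by (simp add: M_def)
  qed
  moreover have "M > 0" using pos by (simp add: M_def)
  ultimately show ?thesis using that by blast
qed

section \<open>The dimension of a toric variety\<close>

context cox_data
begin

lemma rays_subset_lattice: "R \<subseteq> N"
  by (auto simp: ray_gens_def)

text \<open>On logarithms a character condition is a linear equation, solved by expressing the rays
  outside \<open>S\<close> through \<open>S\<close>. Logarithms can be multiplied by reals, so the
  real coefficients of a spanning set are good enough.\<close>

lemma torus_prescribed:
  assumes S: "S \<subseteq> R" "R \<subseteq> span S" and z: "\<And>u. u \<in> R - S \<Longrightarrow> z u \<noteq> 0"
  obtains g where "g \<in> G" "\<And>u. u \<in> R - S \<Longrightarrow> g u = z u"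
proof -
  have finS: "finite S" using S(1) finite_rays finite_subset by blast
  have "\<forall>u. \<exists>a. u \<in> R \<longrightarrow> u = (\<Sum>v\<in>S. a v *\<^sub>R v)"
    using S(2) span_finite[OF finS] by (auto simp: subset_iff)
  then obtain a where a: "\<And>u. u \<in> R \<Longrightarrow> u = (\<Sum>v\<in>S. a u v *\<^sub>R v)" by metis
  \<comment> \<open>The values on \<open>S\<close> balance the prescribed ones: for \<open>u\<close>
    outside \<open>S\<close> the value of \<open>m\<close> at \<open>u\<close> is the combination of
    its values on \<open>S\<close> with coefficients \<open>a u\<close>, so the sum of
    \<open>\<zeta>\<close> weighted by \<open>m\<close> is 0 for every \<open>m\<close>.\<close>
  define \<zeta> where "\<zeta> u = (if u \<in> S then - (\<Sum>u'\<in>R - S. of_real (a u' u) * Ln (z u')) else Ln (z u))" for u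
  define g where "g = (\<lambda>u\<in>R. exp (\<zeta> u))"
  have "g \<in> G"
  proof (rule torusI)
    fix m assume m: "m \<in> dual_lattice N"
    have "(\<Prod>u\<in>R. g u powi \<lfloor>blinfun_apply m u\<rfloor>) = (\<Prod>u\<in>R. exp (of_real (blinfun_apply m u) * \<zeta> u))"
    proof (rule prod.cong)
      fix u assume "u \<in> R"
      then have "complex_of_real (blinfun_apply m u) = of_int \<lfloor>blinfun_apply m u\<rfloor>"
        using dual_lattice_floor[OF m, of u] rays_subset_lattice
        by (metis of_real_of_int_eq subsetD)
      then show "g u powi \<lfloor>blinfun_apply m u\<rfloor> = exp (of_real (blinfun_apply m u) * \<zeta> u)"
        using \<open>u \<in> R\<close> by (simp add: g_def exp_power_int)
    qed simp
    also have "\<dots> = exp (\<Sum>u\<in>R. of_real (blinfun_apply m u) * \<zeta> u)"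
      by (simp add: exp_sum finite_rays)
    also have "(\<Sum>u\<in>R. of_real (blinfun_apply m u) * \<zeta> u) = 0"
    proof -
      have "(\<Sum>u\<in>R. of_real (blinfun_apply m u) * \<zeta> u)
          = (\<Sum>u\<in>R - S. of_real (blinfun_apply m u) * Ln (z u))
           + (\<Sum>v\<in>S. of_real (blinfun_apply m v) * \<zeta> v)"
        using sum.subset_diff[OF S(1) finite_rays, of "\<lambda>u. of_real (blinfun_apply m u) * \<zeta> u"]
        by (simp add: \<zeta>_def)
      also have "(\<Sum>v\<in>S. of_real (blinfun_apply m v) * \<zeta> v)
          = - (\<Sum>v\<in>S. \<Sum>u\<in>R - S. of_real (blinfun_apply m v) * of_real (a u v) * Ln (z u))"
        by (simp add: \<zeta>_def sum_distrib_left sum_negf mult_ac)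
      also have "(\<Sum>v\<in>S. \<Sum>u\<in>R - S. of_real (blinfun_apply m v) * of_real (a u v) * Ln (z u))
          = (\<Sum>u\<in>R - S. of_real (\<Sum>v\<in>S. a u v * blinfun_apply m v) * Ln (z u))"
        by (subst sum.swap) (simp add: sum_distrib_right mult.commute[of "of_real (blinfun_apply m _)"])
      also have "\<dots> = (\<Sum>u\<in>R - S. of_real (blinfun_apply m u) * Ln (z u))"
      proof (rule sum.cong)
        fix u assume "u \<in> R - S"
        then have "blinfun_apply m u = blinfun_apply m (\<Sum>v\<in>S. a u v *\<^sub>R v)"
          using a by (intro arg_cong[of _ _ "blinfun_apply m"]) auto
        then have "blinfun_apply m u = (\<Sum>v\<in>S. a u v * blinfun_apply m v)"
          by (simp add: blinfun.sum_right blinfun.scaleR_right)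
        then show "of_real (\<Sum>v\<in>S. a u v * blinfun_apply m v) * Ln (z u) = of_real (blinfun_apply m u) * Ln (z u)"
          by simp
      qed simp
      finally show ?thesis by simp
    qed
    finally show "(\<Prod>u\<in>R. g u powi \<lfloor>blinfun_apply m u\<rfloor>) = 1" by simp
  qed (auto simp: g_def)
  moreover have "g u = z u" if "u \<in> R - S" for u
    using that z[OF that] by (simp add: g_def \<zeta>_def)
  ultimately show ?thesis using that by blast
qed

text \<open>Coordinate subspaces \<open>W T\<close> with \<open>T\<close> inside one cone are
  irreducible, since a line joining two of their points leaves \<open>W T\<close> only by leaving
  \<open>U\<close>. The point that vanishes exactly on \<open>T\<close> shows that they are nonempty
  and distinct.\<close>

lemma chain_lower_bound:
  assumes \<sigma>: "\<sigma> \<in> \<Sigma>" "card (R \<inter> \<sigma>) = D"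
  shows "irreducible_chain (zar X) D"
proof -
  define W where "W T = {x \<in> U. \<forall>u\<in>T. x u = 0}" for T
  have inv: "invariant (W T)" if "T \<subseteq> R" for T
    using that unfolding invariant_def W_def by (auto simp: act_U act_apply subset_iff)
  have point: "(\<lambda>u\<in>R. if u \<in> T then 0 else 1) \<in> U" if "T \<subseteq> R \<inter> \<sigma>" for T
    unfolding semistable_iff using that \<sigma>(1)
    by (auto simp: affine_space_def split: if_splits)
  have irr: "irreducible_closed (zar X) (orbit N \<Sigma> ` W T)" if T: "T \<subseteq> R \<inter> \<sigma>" for T
    unfolding irreducible_closed_def
  proof (intro conjI allI impI)
    have "openin (zariski R) (\<Union>u\<in>T. {x \<in> U. x u \<noteq> 0})"
      using T by (intro openin_Union)
        (auto intro!: regular_on_nonzero_openin regular_on_polyfun openin_U polyfun_var)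
    moreover have "(\<Union>u\<in>T. {x \<in> U. x u \<noteq> 0}) = U - W T"
      by (auto simp: W_def)
    ultimately have "openin (zariski R) (U - W T)" by simp
    then show "closedin (zar X) (orbit N \<Sigma> ` W T)"
      using T by (intro closedin_X_image inv) auto
    have "(\<lambda>u\<in>R. if u \<in> T then 0 else 1) \<in> W T"
      using point[OF T] T by (auto simp: W_def)
    then show "orbit N \<Sigma> ` W T \<noteq> {}" by blast
    fix A B assume A: "closedin (zar X) A" and B: "closedin (zar X) B"
      and sub: "orbit N \<Sigma> ` W T \<subseteq> A \<union> B"
    show "orbit N \<Sigma> ` W T \<subseteq> A \<or> orbit N \<Sigma> ` W T \<subseteq> B"
    proof (rule ccontr)
      assume "\<not> (orbit N \<Sigma> ` W T \<subseteq> A \<or> orbit N \<Sigma> ` W T \<subseteq> B)"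
      then obtain a b where ab: "a \<in> W T" "orbit N \<Sigma> a \<notin> A" "b \<in> W T" "orbit N \<Sigma> b \<notin> B"
        by blast
      have aU: "a \<in> U - cox_preimage N \<Sigma> A" "b \<in> U - cox_preimage N \<Sigma> B"
        using ab by (auto simp: W_def cox_preimage_eq)
      obtain f where f: "f \<in> polys R" "peval f a \<noteq> 0"
          "\<And>y. y \<in> affine_space R \<Longrightarrow> peval f y \<noteq> 0 \<Longrightarrow> y \<in> U - cox_preimage N \<Sigma> A"
        using openin_zariskiD[of R "U - cox_preimage N \<Sigma> A" a] A aU unfolding closedin_X by blast
      obtain g where g: "g \<in> polys R" "peval g b \<noteq> 0"
          "\<And>y. y \<in> affine_space R \<Longrightarrow> peval g y \<noteq> 0 \<Longrightarrow> y \<in> U - cox_preimage N \<Sigma> B"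
        using openin_zariskiD[of R "U - cox_preimage N \<Sigma> B" b] B aU unfolding closedin_X by blast
      have aff: "a \<in> affine_space R" "b \<in> affine_space R"
        using ab by (auto simp: W_def U_affine)
      obtain t where t: "peval f (\<lambda>u\<in>R. a u + t * (b u - a u)) \<noteq> 0"
          "peval g (\<lambda>u\<in>R. a u + t * (b u - a u)) \<noteq> 0"
        by (rule polyfun_prod_nonzero_on_line[OF polyfun_peval[OF f(1)] f(2) polyfun_peval[OF g(1)] g(2)
              polyfun_const[of R 1] one_neq_zero aff insertI1])
      define y where "y = (\<lambda>u\<in>R. a u + t * (b u - a u))"
      have "y \<in> affine_space R" by (simp add: y_def affine_space_def)
      with t f(3) g(3) have y: "y \<in> U - cox_preimage N \<Sigma> A" "y \<in> U - cox_preimage N \<Sigma> B"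
        by (auto simp: y_def)
      moreover have "y \<in> W T"
        using y ab T by (auto simp: W_def y_def subset_iff)
      ultimately show False
        using sub by (auto simp: cox_preimage_eq)
    qed
  qed
  obtain h where h: "bij_betw h {..<D} (R \<inter> \<sigma>)"
    using ex_bij_betw_nat_finite[of "R \<inter> \<sigma>"] \<sigma>(2) finite_rays by (auto simp: atLeast0LessThan)
  \<comment> \<open>One coordinate is released at a time: \<open>T 0\<close> is the whole set
    \<open>R \<inter> \<sigma>\<close> and \<open>T D\<close> is empty, so the sets
    \<open>W (T i)\<close> grow with \<open>i\<close>.\<close>
  define T where "T i = h ` {..<D - i}" for i
  have T: "T i \<subseteq> R \<inter> \<sigma>" for i
    using h by (auto simp: T_def bij_betw_def)
  show ?thesis
    unfolding irreducible_chain_def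
  proof (intro exI[of _ "\<lambda>i. orbit N \<Sigma> ` W (T i)"] conjI allI impI)
    fix i assume i: "i < D"
    have "W (T i) \<subseteq> W (T (Suc i))" by (auto simp: W_def T_def)
    moreover have "orbit N \<Sigma> ` W (T i) \<noteq> orbit N \<Sigma> ` W (T (Suc i))"
    proof
      assume "orbit N \<Sigma> ` W (T i) = orbit N \<Sigma> ` W (T (Suc i))"
      then have eq: "W (T i) = W (T (Suc i))"
        using preimage_image[OF inv] T by (metis le_inf_iff)
      let ?x = "(\<lambda>u\<in>R. if u \<in> T (Suc i) then 0 else 1 :: complex)"
      have "?x \<in> W (T (Suc i))"
        using point[OF T] T[of "Suc i"] by (auto simp: W_def)
      then have "?x \<in> W (T i)" by (simp add: eq)
      moreover have "h (D - Suc i) \<in> T i"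
        using i by (auto simp: T_def)
      ultimately have "?x (h (D - Suc i)) = 0" unfolding W_def by blast
      moreover have "h (D - Suc i) \<in> R"
        using T[of i] \<open>h (D - Suc i) \<in> T i\<close> by blast
      ultimately have "h (D - Suc i) \<in> T (Suc i)"
        by (auto split: if_splits)
      then obtain j where j: "j < D - Suc i" "h (D - Suc i) = h j" by (auto simp: T_def)
      have "inj_on h {..<D}" using h by (simp add: bij_betw_def)
      moreover have "j \<in> {..<D}" "D - Suc i \<in> {..<D}" using i j(1) by simp_all
      ultimately have "D - Suc i = j" using j(2) by (metis inj_onD)
      then show False using j(1) by simp
    qed
    ultimately show "orbit N \<Sigma> ` W (T i) \<subset> orbit N \<Sigma> ` W (T (Suc i))" by blast
  qed (intro irr T)
qed

text \<open>Setting the coordinates outside \<open>S\<close> to 1, which the torus group achieves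
  where they are nonzero, leaves a polynomial in the variables from \<open>S\<close>.\<close>

lemma subst_polys:
  assumes "p \<in> polys R"
  shows "\<exists>q\<in>polys S. \<forall>x. (\<forall>u\<in>R - S. x u = 1) \<longrightarrow> peval q x = peval p x"
proof -
  define q where "q = (\<Sum>a\<in>Poly_Mapping.keys p. Poly_Mapping.single 0 (Poly_Mapping.lookup p a) *
      (\<Prod>u\<in>Poly_Mapping.keys a \<inter> S. var u ^ Poly_Mapping.lookup a u))"
  have "q \<in> polys S"
    unfolding q_def by (intro polys_sum polys_mult polys_const polys_prod polys_power polys_var) auto
  moreover have "peval q x = peval p x" if x: "\<forall>u\<in>R - S. x u = 1" for x
    unfolding q_def peval_def[of p] peval_sum
  proof (rule sum.cong)
    fix a assume a: "a \<in> Poly_Mapping.keys p"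
    have "(\<Prod>u\<in>Poly_Mapping.keys a. x u ^ Poly_Mapping.lookup a u)
        = (\<Prod>u\<in>Poly_Mapping.keys a \<inter> S. x u ^ Poly_Mapping.lookup a u)"
    proof (intro prod.mono_neutral_right ballI)
      fix u assume "u \<in> Poly_Mapping.keys a - Poly_Mapping.keys a \<inter> S"
      then have "u \<in> R - S" using a assms unfolding polys_def by blast
      then show "x u ^ Poly_Mapping.lookup a u = 1" using x by simp
    qed auto
    then show "peval (Poly_Mapping.single 0 (Poly_Mapping.lookup p a) *
           (\<Prod>u\<in>Poly_Mapping.keys a \<inter> S. var u ^ Poly_Mapping.lookup a u)) x =
         Poly_Mapping.lookup p a * (\<Prod>u\<in>Poly_Mapping.keys a. x u ^ Poly_Mapping.lookup a u)"
      by (simp add: peval_prod)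
  qed simp
  ultimately show ?thesis by blast
qed

text \<open>Otherwise \<open>C'\<close> would be covered by \<open>C\<close> and the complement of
  the open set, against irreducibility. So a strict inclusion stays strict on any chart that meets
  the larger set.\<close>

lemma irreducible_chain_step:
  assumes "irreducible_closed (zar X) C'" "closedin (zar X) C" "C \<subset> C'"
    and V: "invariant V" "openin (zariski R) V" and ne: "cox_preimage N \<Sigma> C' \<inter> V \<noteq> {}"
  shows "\<exists>x\<in>cox_preimage N \<Sigma> C' \<inter> V. x \<notin> cox_preimage N \<Sigma> C"
proof (rule ccontr)
  assume no: "\<not> (\<exists>x\<in>cox_preimage N \<Sigma> C' \<inter> V. x \<notin> cox_preimage N \<Sigma> C)"
  have C': "C' \<subseteq> orbit N \<Sigma> ` U"
    using assms(1) unfolding irreducible_closed_def closedin_X by blast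
  have "closedin (zar X) (topspace (zar X) - orbit N \<Sigma> ` V)"
    by (intro closedin_diff closedin_topspace openin_X_image V)
  moreover have "C' \<subseteq> C \<union> (topspace (zar X) - orbit N \<Sigma> ` V)"
  proof
    fix p assume "p \<in> C'"
    then obtain x where x: "x \<in> U" "p = orbit N \<Sigma> x" using C' by blast
    show "p \<in> C \<union> (topspace (zar X) - orbit N \<Sigma> ` V)"
    proof (cases "p \<in> orbit N \<Sigma> ` V")
      case True
      then have "x \<in> V"
        using preimage_image[OF V(1)] x by (auto simp: cox_preimage_eq)
      then show ?thesis using no x \<open>p \<in> C'\<close> by (auto simp: cox_preimage_eq)
    qed (use x in \<open>auto simp: topspace_X\<close>)
  qed
  ultimately have "C' \<subseteq> C \<or> C' \<subseteq> topspace (zar X) - orbit N \<Sigma> ` V"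
    using assms(1,2) unfolding irreducible_closed_def by blast
  moreover have "\<not> C' \<subseteq> topspace (zar X) - orbit N \<Sigma> ` V"
    using ne by (auto simp: cox_preimage_eq)
  ultimately show False using assms(3) by blast
qed

text \<open>
  A homogeneous polynomial becomes invariant on a chart after taking a power and dividing by a
  Laurent monomial in the invertible coordinates.
\<close>

lemma semi_invariant_to_invariant:
  assumes f: "semi_invariant b f" and m: "m \<in> dual_lattice N" and S: "S \<subseteq> R"
    and mS: "\<And>u. u \<in> S \<Longrightarrow> blinfun_apply m u = real (M * Poly_Mapping.lookup b u)"
  shows "\<exists>r :: 'v \<Rightarrow> int. \<forall>g\<in>G. \<forall>x\<in>affine_space R.
    peval f (act R g x) ^ M / (\<Prod>u\<in>R - S. act R g x u powi r u)
      = peval f x ^ M / (\<Prod>u\<in>R - S. x u powi r u)"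
proof -
  \<comment> \<open>The exponent vector \<open>M * b - m\<close>. It has the same character on
    \<open>G\<close> as \<open>M * b\<close>, because that of \<open>m\<close> is trivial, and it is
    0 on \<open>S\<close>, so only coordinates outside \<open>S\<close> occur.\<close>
  define r where "r u = int (M * Poly_Mapping.lookup b u) - \<lfloor>blinfun_apply m u\<rfloor>" for u
  have r0: "r u = 0" if "u \<in> S" for u
  proof -
    have "\<lfloor>blinfun_apply m u\<rfloor> = int (M * Poly_Mapping.lookup b u)"
      unfolding mS[OF that] by (rule floor_of_nat)
    then show ?thesis by (simp add: r_def)
  qed
  have "peval f (act R g x) ^ M / (\<Prod>u\<in>R - S. act R g x u powi r u)
      = peval f x ^ M / (\<Prod>u\<in>R - S. x u powi r u)" if g: "g \<in> G" and x: "x \<in> affine_space R" for g x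
  proof -
    have "mon b g = (\<Prod>u\<in>R. g u ^ Poly_Mapping.lookup b u)"
      using f by (intro mon_superset finite_rays) (simp add: semi_invariant_def)
    then have "mon b g ^ M = (\<Prod>u\<in>R. g u powi int (M * Poly_Mapping.lookup b u))"
      by (simp add: prod_power_distrib power_mult[symmetric] mult.commute del: of_nat_mult)
    also have "\<dots> = (\<Prod>u\<in>R. g u powi \<lfloor>blinfun_apply m u\<rfloor> * g u powi r u)"
      by (rule prod.cong) (use torus_nonzero[OF g] in \<open>auto simp: r_def simp flip: power_int_add\<close>)
    also have "\<dots> = (\<Prod>u\<in>R. g u powi r u)"
      using torus_char[OF g m] by (simp add: prod.distrib)
    also have "\<dots> = (\<Prod>u\<in>R - S. g u powi r u)"
      using finite_rays r0 by (intro prod.mono_neutral_right) auto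
    finally have eq: "mon b g ^ M = (\<Prod>u\<in>R - S. g u powi r u)" .
    have "(\<Prod>u\<in>R - S. act R g x u powi r u) = (\<Prod>u\<in>R - S. g u powi r u) * (\<Prod>u\<in>R - S. x u powi r u)"
      by (simp add: act_apply power_int_mult_distrib prod.distrib)
    moreover have "peval f (act R g x) ^ M = mon b g ^ M * peval f x ^ M"
      using f g x by (simp add: semi_invariant_def power_mult_distrib)
    moreover have "(\<Prod>u\<in>R - S. g u powi r u) \<noteq> 0"
      using torus_nonzero[OF g] finite_rays by auto
    ultimately show ?thesis
      by (simp add: eq)
  qed
  then show ?thesis by blast
qed

text \<open>Each step of a chain yields an invariant function on a chart, and these functions are
  algebraically independent. But every orbit in the chart contains a point whose coordinates outside
  the basis \<open>S\<close> are 1, so their values are polynomials in \<open>card S = dim R\<close>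
  variables there, and \<open>dim R + 1\<close> such polynomials are dependent.\<close>

lemma chain_upper_bound:
  assumes ind: "\<And>\<sigma>. \<sigma> \<in> \<Sigma> \<Longrightarrow> independent (R \<inter> \<sigma>)"
    and dual: "\<And>S. S \<subseteq> R \<Longrightarrow> independent S \<Longrightarrow> R \<subseteq> span S \<Longrightarrow>
        \<exists>M>0. \<forall>b :: 'v \<Rightarrow> nat. \<exists>m\<in>dual_lattice N. \<forall>u\<in>S. blinfun_apply m u = real (M * b u)"
    and chain: "irreducible_chain (zar X) n"
  shows "n \<le> dim R"
proof (rule ccontr)
  assume "\<not> n \<le> dim R"
  define m where "m = Suc (dim R)"
  have mn: "m \<le> n" using \<open>\<not> n \<le> dim R\<close> by (simp add: m_def)
  obtain C where C: "\<And>i. i \<le> n \<Longrightarrow> irreducible_closed (zar X) (C i)" "\<And>i. i < n \<Longrightarrow> C i \<subset> C (Suc i)"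
    using chain unfolding irreducible_chain_def by blast
  define E where "E i = cox_preimage N \<Sigma> (C i)" for i
  have C0: "C 0 \<noteq> {}" "C 0 \<subseteq> orbit N \<Sigma> ` U"
    using C(1)[of 0] unfolding irreducible_closed_def closedin_X by auto
  \<comment> \<open>The chart is chosen around a point of the smallest member, so that it meets
    every member of the chain.\<close>
  then obtain x0 where x0: "x0 \<in> E 0"
    by (auto simp: E_def cox_preimage_eq)
  have EU: "E i \<subseteq> U" for i by (auto simp: E_def cox_preimage_eq)
  obtain \<sigma> where \<sigma>: "\<sigma> \<in> \<Sigma>" "\<forall>u\<in>R. x0 u = 0 \<longrightarrow> u \<in> \<sigma>"
    using x0 EU semistable_iff by blast
  define V where "V = {x \<in> affine_space R. \<forall>u\<in>R - \<sigma>. x u \<noteq> 0}"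
  have oV: "openin (zariski R) V" unfolding V_def by (rule openin_chart)
  have VU: "V \<subseteq> U"
  proof
    fix x assume "x \<in> V"
    then have "x \<in> affine_space R \<and> (\<exists>\<sigma>\<in>\<Sigma>. \<forall>u\<in>R. x u = 0 \<longrightarrow> u \<in> \<sigma>)"
      using \<sigma>(1) unfolding V_def by blast
    then show "x \<in> U" by (simp only: semistable_iff)
  qed
  have iV: "invariant V"
    unfolding invariant_def using VU by (auto simp: V_def act_apply torus_nonzero)
  obtain S where S: "R \<inter> \<sigma> \<subseteq> S" "S \<subseteq> R" "independent S" "R \<subseteq> span S"
    using maximal_independent_subset_extend[OF _ ind[OF \<sigma>(1)], of R] by blast
  have finS: "finite S" using S(2) finite_rays finite_subset by blast
  have cardS: "card S = dim R"
    using basis_card_eq_dim[OF S(2,4,3)] .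
  define D where "D i = E i \<inter> V" for i
  have D0: "x0 \<in> D 0"
  proof -
    have "x0 \<in> affine_space R" using x0 EU U_affine by blast
    with \<sigma>(2) have "x0 \<in> V" unfolding V_def by blast
    with x0 show ?thesis by (simp add: D_def)
  qed
  have Dmono: "D i \<subseteq> D (Suc i)" if "i < m" for i
    using C(2)[of i] that mn by (auto simp: D_def E_def cox_preimage_eq)
  have Dne: "D i \<noteq> {}" if "i \<le> m" for i
    using that
  proof (induction i)
    case 0 then show ?case using D0 by auto
  next
    case (Suc i) then show ?case using Dmono[of i] by auto
  qed
  have "\<exists>f b. semi_invariant b f \<and> (\<forall>y\<in>E i. peval f y = 0) \<and> (\<exists>x\<in>D (Suc i). peval f x \<noteq> 0)" if i: "i < m" for i
  proof -
    have clo: "closedin (zar X) (C i)"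
      using C(1)[of i] i mn by (auto simp: irreducible_closed_def)
    obtain x where x: "x \<in> D (Suc i)" "x \<notin> E i"
      using irreducible_chain_step[OF C(1) clo C(2) iV oV] Dne[of "Suc i"] i mn
      by (auto simp: D_def E_def)
    have "openin (zariski R) (U - E i)" "x \<in> U - E i"
      using clo x EU by (auto simp: closedin_X E_def D_def)
    then obtain p where p: "p \<in> polys R" "peval p x \<noteq> 0"
        "\<And>y. y \<in> affine_space R \<Longrightarrow> peval p y \<noteq> 0 \<Longrightarrow> y \<in> U - E i"
      using openin_zariskiD by blast
    \<comment> \<open>The functions vanishing on \<open>E i\<close> are stable under the group, so
      this space has a semi-invariant member that is nonzero at \<open>x\<close>.\<close>
    define P where "P F \<longleftrightarrow> (\<forall>y\<in>E i. F y = 0)" for F :: "('v \<Rightarrow> complex) \<Rightarrow> complex"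
    have Pp: "P (peval p)"
      unfolding P_def using p(3) EU U_affine by blast
    obtain f b where "semi_invariant b f" "P (peval f)" "peval f x \<noteq> 0"
    proof (rule semi_invariant_component[where P=P, OF p(1) Pp p(2)])
      fix F F' g y z
      assume F: "P F" and g: "g \<in> G" and F': "\<forall>x\<in>affine_space R. F' x = y * (F (act R g x) - z * F x)"
      have "act R g x \<in> E i" if "x \<in> E i" for x
        using invariant_preimage[of "C i"] g that unfolding invariant_def E_def by blast
      then show "P F'"
        using F F' EU U_affine unfolding P_def by (metis (no_types) diff_self mult_zero_right subsetD)
    qed (use that in blast)
    then show ?thesis using x by (auto simp: P_def)
  qed
  then obtain f b where f: "\<And>i. i < m \<Longrightarrow> semi_invariant (b i) (f i)"
      "\<And>i y. i < m \<Longrightarrow> y \<in> E i \<Longrightarrow> peval (f i) y = 0"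
      "\<And>i. i < m \<Longrightarrow> \<exists>x\<in>D (Suc i). peval (f i) x \<noteq> 0"
    by metis
  obtain M :: nat where M: "M > 0"
      "\<And>b :: 'v \<Rightarrow> nat. \<exists>m\<in>dual_lattice N. \<forall>u\<in>S. blinfun_apply m u = real (M * b u)"
    using dual[OF S(2,3,4)] by blast
  define Inv where "Inv i r \<longleftrightarrow> (\<forall>g\<in>G. \<forall>x\<in>affine_space R.
    peval (f i) (act R g x) ^ M / (\<Prod>u\<in>R - S. act R g x u powi r u)
      = peval (f i) x ^ M / (\<Prod>u\<in>R - S. x u powi r u))" for i and r :: "'v \<Rightarrow> int"
  have "\<exists>r. Inv i r" if i: "i < m" for i
  proof -
    obtain mm where "mm \<in> dual_lattice N" "\<forall>u\<in>S. blinfun_apply mm u = real (M * Poly_Mapping.lookup (b i) u)"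
      using M(2)[of "Poly_Mapping.lookup (b i)"] by blast
    then show ?thesis
      unfolding Inv_def using semi_invariant_to_invariant[OF f(1)[OF i] _ S(2)] by blast
  qed
  then obtain r where r: "\<And>i. i < m \<Longrightarrow> Inv i (r i)" by metis
  define F where "F i x = peval (f i) x ^ M / (\<Prod>u\<in>R - S. x u powi r i u)" for i x
  have F_inv: "F i (act R g x) = F i x" if "i < m" "g \<in> G" "x \<in> V" for i g x
    unfolding F_def using r[OF that(1)] that(2,3) unfolding Inv_def V_def by blast
  have V_nz: "x u \<noteq> 0" if "x \<in> V" "u \<in> R - S" for x u
    using that S(1) by (auto simp: V_def)
  have F_reg: "regular_on R V (F i)" if "i < m" for i
    unfolding F_def[abs_def]
  proof (rule regular_on_divide)
    show "regular_on R V (\<lambda>x. peval (f i) x ^ M)"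
      using f(1)[OF that] by (intro regular_on_power regular_on_polyfun[OF oV] polyfun_peval)
        (simp add: semi_invariant_def)
    have "regular_on R V (\<lambda>x. x u powi r i u)" if "u \<in> R - S" for u
      by (rule regular_on_powi[OF regular_on_polyfun[OF oV polyfun_var]]) (use that V_nz in auto)
    then show "regular_on R V (\<lambda>x. \<Prod>u\<in>R - S. x u powi r i u)"
      by (rule regular_on_prod[OF oV])
    show "(\<Prod>u\<in>R - S. x u powi r i u) \<noteq> 0" if "x \<in> V" for x
      using V_nz[OF that] finite_rays by auto
  qed
  \<comment> \<open>The ring of the chart: regular invariant functions. Irreducibility of
    \<open>C i\<close> will make vanishing on \<open>D i\<close> a prime condition in it.\<close>
  define Alg where "Alg H \<longleftrightarrow> regular_on R V H \<and> (\<forall>g\<in>G. \<forall>x\<in>V. H (act R g x) = H x)" for H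
  have FD: "F i x \<noteq> 0 \<longleftrightarrow> peval (f i) x \<noteq> 0" if "x \<in> V" for i x
    using V_nz[OF that] finite_rays M(1) by (auto simp: F_def)
  \<comment> \<open>At a normalised point the Laurent denominator of \<open>F i\<close> is 1, so
    there \<open>F i\<close> is a polynomial in the coordinates from \<open>S\<close>.\<close>
  define Sub where "Sub i q \<longleftrightarrow> q \<in> polys S \<and>
      (\<forall>x. (\<forall>u\<in>R - S. x u = 1) \<longrightarrow> peval q x = peval (f i ^ M) x)" for i q
  have "\<exists>q. Sub i q" if "i < m" for i
  proof -
    have "f i ^ M \<in> polys R"
      using f(1)[OF that] by (intro polys_power) (simp add: semi_invariant_def)
    then show ?thesis using subst_polys[of "f i ^ M" S] unfolding Sub_def by blast
  qed
  then obtain q where q: "\<And>i. i < m \<Longrightarrow> Sub i (q i)" by metis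
  have qS: "q i \<in> polys S" if "i < m" for i
    using q[OF that] by (simp add: Sub_def)
  have "card S < m" by (simp add: cardS m_def)
  then obtain A c where A: "finite A" "inj_on (\<lambda>a. restrict a {..<m}) A" "\<exists>a\<in>A. c a \<noteq> 0"
    "\<And>x. (\<Sum>a\<in>A. c a * (\<Prod>i<m. peval (q i) x ^ a i)) = 0"
    using algebraic_dependence[of S m q, OF finS _ qS] by blast
  have "\<forall>a\<in>A. c a = 0"
  proof (rule prime_chain_independent[where D=D and F=F and m=m and Alg=Alg])
    show "D 0 \<noteq> {}" using D0 by auto
    show "D i \<subseteq> D (Suc i)" if "i < m" for i by (rule Dmono[OF that])
    show "F i x = 0" if "i < m" "x \<in> D i" for i x
      using FD[of x i] f(2)[OF that(1)] that(2) by (auto simp: D_def)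
    show "\<exists>x\<in>D (Suc i). F i x \<noteq> 0" if "i < m" for i
      using f(3)[OF that] FD by (auto simp: D_def)
    show "Alg (\<lambda>x. c)" for c by (simp add: Alg_def regular_on_const oV)
    show "Alg (F i)" if "i < m" for i using F_reg F_inv that by (simp add: Alg_def)
    show "Alg (\<lambda>x. f x + g x)" if "Alg f" "Alg g" for f g
      using that by (simp add: Alg_def regular_on_add)
    show "Alg (\<lambda>x. f x * g x)" if "Alg f" "Alg g" for f g
      using that by (simp add: Alg_def regular_on_mult)
    show "(\<forall>x\<in>D i. f x = 0) \<or> (\<forall>x\<in>D i. g x = 0)"
      if i: "i \<le> m" and f: "Alg f" and g: "Alg g" and fg: "\<forall>x\<in>D i. f x * g x = 0" for i f g
    proof -
      \<comment> \<open>If \<open>f * g\<close> vanishes on \<open>D i\<close>, then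
        \<open>C i\<close> lies in the union of the closed complements of the images of
        \<open>f \<noteq> 0\<close> and \<open>g \<noteq> 0\<close>, hence in one of them.\<close>
      define Vf where "Vf f = {x \<in> V. f x \<noteq> 0}" for f :: "('v \<Rightarrow> complex) \<Rightarrow> complex"
      have inv: "invariant (Vf f)" if "Alg f" for f
        using that iV by (auto simp: Vf_def invariant_def Alg_def)
      have clo: "closedin (zar X) (topspace (zar X) - orbit N \<Sigma> ` Vf f)" if "Alg f" for f
        using that unfolding Vf_def
        by (intro closedin_diff closedin_topspace openin_X_image inv[OF that, unfolded Vf_def]
            regular_on_nonzero_openin) (auto simp: Alg_def)
      have Ci: "irreducible_closed (zar X) (C i)" using C(1) i mn by auto
      have sub: "C i \<subseteq> (topspace (zar X) - orbit N \<Sigma> ` Vf f) \<union> (topspace (zar X) - orbit N \<Sigma> ` Vf g)"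
      proof
        fix p assume p: "p \<in> C i"
        have pt: "p \<in> topspace (zar X)"
          using Ci p closedin_subset unfolding irreducible_closed_def by blast
        show "p \<in> (topspace (zar X) - orbit N \<Sigma> ` Vf f) \<union> (topspace (zar X) - orbit N \<Sigma> ` Vf g)"
        proof (rule ccontr)
          assume "\<not> ?thesis"
          then have pfg: "p \<in> orbit N \<Sigma> ` Vf f" "p \<in> orbit N \<Sigma> ` Vf g" using pt by auto
          then obtain x where x: "x \<in> Vf f" "p = orbit N \<Sigma> x" by blast
          then have "x \<in> cox_preimage N \<Sigma> (orbit N \<Sigma> ` Vf g)"
            using pfg VU by (auto simp: cox_preimage_eq Vf_def)
          then have "x \<in> Vf g" by (simp add: preimage_image[OF inv[OF g]])
          moreover have "x \<in> D i"
            using x p VU by (auto simp: D_def E_def cox_preimage_eq Vf_def)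
          ultimately show False using fg x(1) by (auto simp: Vf_def)
        qed
      qed
      then have "C i \<subseteq> topspace (zar X) - orbit N \<Sigma> ` Vf f \<or> C i \<subseteq> topspace (zar X) - orbit N \<Sigma> ` Vf g"
        using Ci clo[OF f] clo[OF g] unfolding irreducible_closed_def by blast
      moreover have "\<forall>x\<in>D i. f x = 0" if "C i \<subseteq> topspace (zar X) - orbit N \<Sigma> ` Vf f" for f
        using that by (auto simp: D_def E_def cox_preimage_eq Vf_def)
      ultimately show ?thesis by blast
    qed
    show "\<forall>x\<in>D m. (\<Sum>a\<in>A. c a * (\<Prod>i<m. F i x ^ a i)) = 0"
    proof
      fix x assume "x \<in> D m"
      then have x: "x \<in> V" by (simp add: D_def)
      obtain g where g: "g \<in> G" "\<And>u. u \<in> R - S \<Longrightarrow> g u = inverse (x u)"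
        using torus_prescribed[OF S(2,4), of "\<lambda>u. inverse (x u)"] V_nz[OF x] by auto
      define y where "y = act R g x"
      have y1: "\<forall>u\<in>R - S. y u = 1"
        using g(2) V_nz[OF x] by (simp add: y_def act_apply)
      have "F i x = peval (q i) y" if "i < m" for i
      proof -
        have "F i x = F i y" using F_inv[OF that g(1) x] by (simp add: y_def)
        also have "\<dots> = peval (q i) y"
          using y1 q[OF that] by (simp add: F_def Sub_def)
        finally show ?thesis .
      qed
      then have "(\<Sum>a\<in>A. c a * (\<Prod>i<m. F i x ^ a i)) = (\<Sum>a\<in>A. c a * (\<Prod>i<m. peval (q i) y ^ a i))"
        by simp
      then show "(\<Sum>a\<in>A. c a * (\<Prod>i<m. F i x ^ a i)) = 0" using A(4) by simp
    qed
  qed (fact A)+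
  with A(3) show False by blast
qed

end

section \<open>Krull dimension under homeomorphisms\<close>

lemma irreducible_closed_homeomorphic:
  assumes h: "homeomorphic_map T T' f" and C: "irreducible_closed T C"
  shows "irreducible_closed T' (f ` C)"
proof -
  have C': "closedin T C" "C \<noteq> {}" using C by (auto simp: irreducible_closed_def)
  note CT = closedin_subset[OF C'(1)]
  show ?thesis
    unfolding irreducible_closed_def
  proof (intro conjI allI impI)
    show "closedin T' (f ` C)"
      using homeomorphic_map_closedness_eq[OF h] C' CT by blast
    show "f ` C \<noteq> {}" using C' by blast
    fix A B assume A: "closedin T' A" and B: "closedin T' B" and sub: "f ` C \<subseteq> A \<union> B"
    have cont: "continuous_map T T' f" using h homeomorphic_imp_continuous_map by blast
    have "closedin T {x \<in> topspace T. f x \<in> A}" "closedin T {x \<in> topspace T. f x \<in> B}"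
      using closedin_continuous_map_preimage[OF cont] A B by auto
    moreover have "C \<subseteq> {x \<in> topspace T. f x \<in> A} \<union> {x \<in> topspace T. f x \<in> B}"
      using sub CT by auto
    ultimately have "C \<subseteq> {x \<in> topspace T. f x \<in> A} \<or> C \<subseteq> {x \<in> topspace T. f x \<in> B}"
      using C unfolding irreducible_closed_def by blast
    then show "f ` C \<subseteq> A \<or> f ` C \<subseteq> B" by blast
  qed
qed

lemma irreducible_chain_homeomorphic:
  assumes h: "homeomorphic_map T T' f" and c: "irreducible_chain T k"
  shows "irreducible_chain T' k"
proof -
  obtain C where C: "\<And>i. i \<le> k \<Longrightarrow> irreducible_closed T (C i)" "\<And>i. i < k \<Longrightarrow> C i \<subset> C (Suc i)"
    using c unfolding irreducible_chain_def by blast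
  have "f ` C i \<subset> f ` C (Suc i)" if "i < k" for i
  proof -
    have "inj_on f (topspace T)" using h by (simp add: homeomorphic_eq_everything_map)
    moreover have "C (Suc i) \<subseteq> topspace T"
      using C(1)[of "Suc i"] that closedin_subset by (auto simp: irreducible_closed_def)
    ultimately show ?thesis
      using C(2)[OF that] by (metis image_strict_mono inj_on_subset)
  qed
  then show ?thesis
    unfolding irreducible_chain_def using irreducible_closed_homeomorphic[OF h C(1)]
    by (intro exI[of _ "\<lambda>i. f ` C i"]) auto
qed

lemma has_krull_dim_homeomorphic:
  assumes f: "homeomorphic_map T T' f" and dim: "has_krull_dim T n"
  shows "has_krull_dim T' n"
proof -
  obtain g where "homeomorphic_maps T T' f g"
    using f by (auto simp: homeomorphic_map_maps)
  then have g: "homeomorphic_map T' T g"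
    by (simp add: homeomorphic_maps_map)
  have "irreducible_chain T' n"
    using dim by (intro irreducible_chain_homeomorphic[OF f]) (simp add: has_krull_dim_def)
  moreover have "m \<le> n" if "irreducible_chain T' m" for m
    using dim irreducible_chain_homeomorphic[OF g that] unfolding has_krull_dim_def by blast
  ultimately show ?thesis unfolding has_krull_dim_def by blast
qed

section \<open>Cones and their faces\<close>

lemma convex_cone_sum:
  "convex_cone C \<Longrightarrow> (\<And>i. i \<in> I \<Longrightarrow> x i \<in> C) \<Longrightarrow> (\<Sum>i\<in>I. x i) \<in> C"
  by (induction I rule: infinite_finite_induct) (simp_all add: convex_cone_contains_0 convex_cone_add)

lemma convex_cone_hull_finite:
  assumes "finite S"
  shows "convex_cone hull S = {\<Sum>s\<in>S. c s *\<^sub>R s | c. \<forall>s\<in>S. 0 \<le> c s}" (is "_ = ?H")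
proof
  show "convex_cone hull S \<subseteq> ?H"
  proof (rule hull_minimal)
    show "S \<subseteq> ?H"
    proof
      fix s assume "s \<in> S"
      then have "s = (\<Sum>s'\<in>S. (if s' = s then 1 else 0) *\<^sub>R s')"
        using assms by (simp add: if_distrib[of "\<lambda>c. c *\<^sub>R _"] cong: if_cong)
      then show "s \<in> ?H" by (intro CollectI exI[of _ "\<lambda>s'. if s' = s then 1 else 0"]) auto
    qed
    show "convex_cone ?H"
      unfolding convex_cone_iff
    proof (intro conjI ballI allI impI)
      show "0 \<in> ?H" by (intro CollectI exI[of _ "\<lambda>_. 0"]) auto
      fix x y assume "x \<in> ?H" "y \<in> ?H"
      then obtain c d where cd: "x = (\<Sum>s\<in>S. c s *\<^sub>R s)" "\<forall>s\<in>S. 0 \<le> c s" "y = (\<Sum>s\<in>S. d s *\<^sub>R s)" "\<forall>s\<in>S. 0 \<le> d s"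
        by blast
      then show "x + y \<in> ?H"
        by (intro CollectI exI[of _ "\<lambda>s. c s + d s"]) (auto simp: scaleR_left_distrib sum.distrib)
    next
      fix x and t :: real assume "x \<in> ?H" "0 \<le> t"
      then obtain c where "x = (\<Sum>s\<in>S. c s *\<^sub>R s)" "\<forall>s\<in>S. 0 \<le> c s" by blast
      then show "t *\<^sub>R x \<in> ?H"
        using \<open>0 \<le> t\<close> by (intro CollectI exI[of _ "\<lambda>s. t * c s"]) (auto simp: scaleR_sum_right)
    qed
  qed
  have "(\<Sum>s\<in>S. c s *\<^sub>R s) \<in> convex_cone hull S" if "\<forall>s\<in>S. 0 \<le> c s" for c
    using that by (intro convex_cone_sum[OF convex_cone_convex_cone_hull] convex_cone_hull_mul hull_inc) auto
  then show "?H \<subseteq> convex_cone hull S" by blast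
qed

lemma convex_cone_hull_sing: "convex_cone hull {u} = {c *\<^sub>R u | c. 0 \<le> c}"
proof -
  have "\<exists>c. a *\<^sub>R u = c u *\<^sub>R u \<and> 0 \<le> c u" if "0 \<le> a" for a
    using that by (intro exI[of _ "\<lambda>_. a"]) auto
  then show ?thesis by (auto simp: convex_cone_hull_finite)
qed

lemma convex_cone_hull_sing_scale: "0 < c \<Longrightarrow> convex_cone hull {c *\<^sub>R u} = convex_cone hull {u}"
proof -
  assume c: "0 < c"
  have "\<exists>d. a *\<^sub>R u = d *\<^sub>R c *\<^sub>R u \<and> 0 \<le> d" if "0 \<le> a" for a
    using that c by (intro exI[of _ "a / c"]) auto
  moreover have "\<exists>d. a *\<^sub>R c *\<^sub>R u = d *\<^sub>R u \<and> 0 \<le> d" if "0 \<le> a" for a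
    using that c by (intro exI[of _ "a * c"]) auto
  ultimately show ?thesis
    unfolding convex_cone_hull_sing by blast
qed

text \<open>The face condition speaks of open segments: \<open>x + y\<close> is the midpoint of
  \<open>2 x\<close> and \<open>2 y\<close>, and then \<open>2 x\<close> is the midpoint of
  \<open>x\<close> and \<open>3 x\<close>. The cases \<open>x = y\<close> and \<open>x = 0\<close>
  are separate because the segment degenerates.\<close>

lemma face_of_cone_summand:
  assumes F: "F face_of C" and C: "convex_cone C" and xy: "x \<in> C" "y \<in> C" "x + y \<in> F"
  shows "x \<in> F"
proof -
  have "2 *\<^sub>R x \<in> F"
  proof (cases "x = y")
    case True
    then show ?thesis using xy by (simp add: scaleR_2)
  next
    case False
    have "x + y \<in> open_segment (2 *\<^sub>R x) (2 *\<^sub>R y)"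
      unfolding in_segment using False by (intro conjI exI[of _ "1/2"]) auto
    then show ?thesis
      using face_ofD[OF F] C xy by (simp add: convex_cone_scaleR)
  qed
  show ?thesis
  proof (cases "x = 0")
    case False
    have "3 *\<^sub>R x - x \<noteq> 0" using False scaleR_cancel_right[of 3 x 1] by simp
    then have "2 *\<^sub>R x \<in> open_segment x (3 *\<^sub>R x)"
      unfolding in_segment by (intro conjI exI[of _ "1/2"]) (auto simp flip: scaleR_add_left)
    then show ?thesis
      using face_ofD[OF F] C xy \<open>2 *\<^sub>R x \<in> F\<close> by (meson convex_cone_scaleR zero_le_numeral)
  qed (use \<open>2 *\<^sub>R x \<in> F\<close> in auto)
qed

lemma face_of_cone_scale:
  assumes F: "F face_of C" and C: "convex_cone C" and x: "x \<in> C" "c *\<^sub>R x \<in> F" "0 < c"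
  shows "x \<in> F"
proof (cases "1 \<le> c")
  case True
  have "x + (c - 1) *\<^sub>R x \<in> F" using x by (simp add: algebra_simps)
  then show ?thesis
    using True x by (intro face_of_cone_summand[OF F C x(1), of "(c - 1) *\<^sub>R x"] convex_cone_scaleR C) auto
next
  case False
  show ?thesis
  proof (cases "x = 0")
    case False
    have zero: "0 \<in> C" by (rule convex_cone_contains_0[OF C])
    have "c *\<^sub>R x \<in> open_segment 0 x"
      unfolding in_segment using False \<open>\<not> 1 \<le> c\<close> x(3) by (intro conjI exI[of _ c]) auto
    then show ?thesis using face_ofD[OF F _ zero x(1) x(2)] by blast
  qed (use x in auto)
qed

text \<open>In an expression of \<open>u\<close> by the generators some summand is nonzero, and a
  face contains the summands of its elements; that generator therefore lies on the ray of
  \<open>u\<close>.\<close>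

lemma ray_face_generator:
  assumes S: "finite S" and F: "convex_cone hull {u} face_of convex_cone hull S" and u: "u \<noteq> 0"
  obtains s c where "s \<in> S" "0 < c" "u = c *\<^sub>R s"
proof -
  have "u \<in> convex_cone hull {u}" by (simp add: hull_inc)
  then have "u \<in> convex_cone hull S" using face_of_imp_subset[OF F] by blast
  then obtain c where c: "u = (\<Sum>s\<in>S. c s *\<^sub>R s)" "\<forall>s\<in>S. 0 \<le> c s"
    unfolding convex_cone_hull_finite[OF S] by blast
  have "\<exists>s\<in>S. c s *\<^sub>R s \<noteq> 0"
  proof (rule ccontr)
    assume "\<not> ?thesis"
    then have "u = 0" unfolding c(1) by (intro sum.neutral) blast
    with u show False by simp
  qed
  then obtain s where s: "s \<in> S" "c s *\<^sub>R s \<noteq> 0" by blast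
  then have cs: "0 < c s" "s \<noteq> 0" using c(2) by (auto simp: less_le)
  have sC: "s \<in> convex_cone hull S" using s by (simp add: hull_inc)
  define r where "r = (\<Sum>s'\<in>S - {s}. c s' *\<^sub>R s')"
  have r: "r \<in> convex_cone hull S"
    unfolding r_def using c(2)
    by (intro convex_cone_sum[OF convex_cone_convex_cone_hull] convex_cone_hull_mul hull_inc) auto
  have "c s *\<^sub>R s + r = u"
    unfolding c(1) r_def by (rule sum.remove[symmetric, OF S s(1)])
  then have "c s *\<^sub>R s + r \<in> convex_cone hull {u}"
    using \<open>u \<in> convex_cone hull {u}\<close> by simp
  then have "c s *\<^sub>R s \<in> convex_cone hull {u}"
    using face_of_cone_summand[OF F convex_cone_convex_cone_hull convex_cone_hull_mul[OF sC] r] cs(1) by simp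
  then have "s \<in> convex_cone hull {u}"
    using face_of_cone_scale[OF F convex_cone_convex_cone_hull sC] cs by blast
  then obtain d where d: "s = d *\<^sub>R u" "0 \<le> d" unfolding convex_cone_hull_sing by blast
  then have "0 < d" using cs by (cases "d = 0") auto
  moreover from this have "u = inverse d *\<^sub>R s" unfolding d(1) by simp
  ultimately show ?thesis using s(1) by (intro that[of s "inverse d"]) simp_all
qed

text \<open>Independence provides a linear functional that is 0 at \<open>s\<close> and 1 at the
  other generators; it is nonnegative on the cone and vanishes there exactly on the ray.\<close>

lemma independent_ray_face:
  assumes S: "finite S" "independent S" "s \<in> S"
  shows "convex_cone hull {s} face_of convex_cone hull S"
proof -
  obtain f where f: "linear f" "\<forall>x\<in>S. f x = (if x = s then 0 else 1::real)"
    using linear_independent_extend[OF S(2), of "\<lambda>x. if x = s then 0 else 1::real"] by blast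
  have f_eval: "f (\<Sum>x\<in>S. c x *\<^sub>R x) = (\<Sum>x\<in>S - {s}. c x)" for c
  proof -
    have "f (\<Sum>x\<in>S. c x *\<^sub>R x) = (\<Sum>x\<in>S. c x * f x)"
      using f(1) by (simp add: linear_sum linear_cmul)
    also have "\<dots> = (\<Sum>x\<in>S - {s}. c x)"
      using S f(2) by (intro sum.mono_neutral_cong_right) auto
    finally show ?thesis .
  qed
  have pos: "0 \<le> f x" if "x \<in> convex_cone hull S" for x
    using that unfolding convex_cone_hull_finite[OF S(1)] by (auto simp: f_eval intro!: sum_nonneg)
  have zero: "x \<in> convex_cone hull {s}" if x: "x \<in> convex_cone hull S" "f x = 0" for x
  proof -
    obtain c where c: "x = (\<Sum>x\<in>S. c x *\<^sub>R x)" "\<forall>x\<in>S. 0 \<le> c x"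
      using x unfolding convex_cone_hull_finite[OF S(1)] by blast
    then have "(\<Sum>y\<in>S - {s}. c y) = 0" using x(2) by (simp add: f_eval)
    then have "\<forall>y\<in>S - {s}. c y = 0"
      using S(1) c(2) by (subst (asm) sum_nonneg_eq_0_iff) auto
    then have "x = c s *\<^sub>R s"
      unfolding c(1) using S by (subst sum.remove[of _ s]) auto
    then show ?thesis using c(2) S(3) unfolding convex_cone_hull_sing by blast
  qed
  have "a \<in> convex_cone hull {s} \<and> b \<in> convex_cone hull {s}"
    if ab: "a \<in> convex_cone hull S" "b \<in> convex_cone hull S" "x \<in> convex_cone hull {s}"
      and seg: "x \<in> open_segment a b" for a b x
  proof -
    obtain t where t: "0 < t" "t < 1" "x = (1 - t) *\<^sub>R a + t *\<^sub>R b"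
      using seg by (auto simp: in_segment)
    obtain c where "x = c *\<^sub>R s" using ab(3) unfolding convex_cone_hull_sing by blast
    then have "f x = 0"
      using S(3) f by (simp add: linear_cmul)
    then have *: "(1 - t) * f a + t * f b = 0"
      using f(1) by (simp add: t(3) linear_add linear_cmul)
    moreover have "0 \<le> (1 - t) * f a" "0 \<le> t * f b" using pos[OF ab(1)] pos[OF ab(2)] t by auto
    ultimately have "(1 - t) * f a = 0" "t * f b = 0" by linarith+
    then have "f a = 0" "f b = 0" using t by auto
    then show ?thesis using zero ab by blast
  qed
  moreover have "convex_cone hull {s} \<subseteq> convex_cone hull S" using S(3) by (intro hull_mono) auto
  ultimately show ?thesis
    unfolding face_of_def using convex_convex_cone_hull[of "{s}"] by blast
qed


section \<open>Lattices\<close>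

text \<open>A lattice basis with its dual basis. The coordinate functionals \<open>f b\<close> live
  on the whole space, so that they can later serve as elements of the dual lattice.\<close>

definition lattice_coords :: "'v::real_vector set \<Rightarrow> 'v set \<Rightarrow> ('v \<Rightarrow> 'v \<Rightarrow> real) \<Rightarrow> bool" where
  "lattice_coords N B f \<longleftrightarrow> finite B \<and> independent B \<and> B \<subseteq> N \<and> N \<subseteq> span B \<and>
    (\<forall>b. linear (f b)) \<and> (\<forall>b\<in>B. \<forall>b'\<in>B. f b b' = (if b = b' then 1 else 0)) \<and>
    (\<forall>b\<in>B. \<forall>x\<in>N. f b x \<in> \<int>) \<and> (\<forall>x\<in>span B. (\<forall>b\<in>B. f b x = 0) \<longrightarrow> x = 0)"

lemma lattice_coordsD:
  assumes "lattice_coords N B f"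
  shows "finite B" "independent B" "B \<subseteq> N" "N \<subseteq> span B" "linear (f b)"
    "b \<in> B \<Longrightarrow> b' \<in> B \<Longrightarrow> f b b' = (if b = b' then 1 else 0)"
    "b \<in> B \<Longrightarrow> x \<in> N \<Longrightarrow> f b x \<in> \<int>"
    "x \<in> span B \<Longrightarrow> (\<And>b. b \<in> B \<Longrightarrow> f b x = 0) \<Longrightarrow> x = 0"
  using assms by (simp_all add: lattice_coords_def)

lemma lattice_coordinates:
  assumes "is_lattice N"
  shows "\<exists>B f. lattice_coords N B f"
proof -
  obtain B where B: "finite B" "independent B" "N = {\<Sum>b\<in>B. real_of_int (c b) *\<^sub>R b | c. True}"
    using assms unfolding is_lattice_def by blast
  have "\<forall>b. \<exists>g. linear g \<and> (\<forall>x\<in>B. g x = (if b = x then 1 else 0::real))"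
    by (intro allI linear_independent_extend[OF B(2)])
  from choice[OF this] obtain f where
    f: "\<And>b. linear (f b)" "\<And>b x. x \<in> B \<Longrightarrow> f b x = (if b = x then 1 else 0::real)"
    by blast
  have coord: "f b (\<Sum>x\<in>B. c x *\<^sub>R x) = c b" if "b \<in> B" for b c
  proof -
    have "f b (\<Sum>x\<in>B. c x *\<^sub>R x) = (\<Sum>x\<in>B. c x * f b x)"
      using f(1) by (simp add: linear_sum linear_cmul)
    also have "\<dots> = (\<Sum>x\<in>B. if b = x then c x else 0)"
      by (rule sum.cong) (auto simp: f(2))
    finally show ?thesis using B(1) that by simp
  qed
  have "B \<subseteq> N"
  proof
    fix b assume "b \<in> B"
    then have "b = (\<Sum>x\<in>B. real_of_int (if x = b then 1 else 0) *\<^sub>R x)"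
      using B(1) by (simp add: if_distrib[of real_of_int] if_distrib[of "\<lambda>c. c *\<^sub>R _"] cong: if_cong)
    then show "b \<in> N"
      unfolding B(3) mem_Collect_eq by (intro exI[of _ "\<lambda>x. if x = b then 1 else 0"] conjI TrueI)
  qed
  moreover have "N \<subseteq> span B" unfolding B(3) by (auto intro!: span_sum intro: span_scale span_base)
  moreover have "f b x \<in> \<int>" if "b \<in> B" "x \<in> N" for b x
    using that coord unfolding B(3) by auto
  moreover have "x = 0" if x: "x \<in> span B" "\<forall>b\<in>B. f b x = 0" for x
  proof -
    obtain c where "x = (\<Sum>b\<in>B. c b *\<^sub>R b)"
      using x(1) unfolding span_finite[OF B(1)] by blast
    then show ?thesis using x(2) coord by simp
  qed
  ultimately show ?thesis
    unfolding lattice_coords_def using B(1,2) f by (intro exI[of _ B] exI[of _ f]) auto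
qed

lemma lattice_combination:
  assumes "is_lattice N" "x \<in> N" "y \<in> N"
  shows "real_of_int a *\<^sub>R x + real_of_int b *\<^sub>R y \<in> N"
proof -
  obtain B where B: "N = {\<Sum>b\<in>B. real_of_int (c b) *\<^sub>R b | c. True}"
    using assms(1) unfolding is_lattice_def by blast
  obtain c d where "x = (\<Sum>b\<in>B. real_of_int (c b) *\<^sub>R b)" "y = (\<Sum>b\<in>B. real_of_int (d b) *\<^sub>R b)"
    using assms(2,3) B by auto
  then have "real_of_int a *\<^sub>R x + real_of_int b *\<^sub>R y = (\<Sum>u\<in>B. real_of_int (a * c u + b * d u) *\<^sub>R u)"
    by (simp add: scaleR_sum_right sum.distrib scaleR_left_distrib)
  then show ?thesis
    unfolding B mem_Collect_eq by (intro exI[of _ "\<lambda>u. a * c u + b * d u"] conjI TrueI)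
qed

text \<open>Some coordinate of \<open>s\<close> is nonzero, and on lattice points \<open>c s\<close>
  with \<open>0 < c \<le> 1\<close> it takes bounded integer values; so there are finitely many of
  them, and the shortest is primitive.\<close>

lemma ray_gen_exists:
  assumes N: "is_lattice N" and s: "s \<in> N" "s \<noteq> 0" "convex_cone hull {s} \<in> \<Sigma>"
  obtains c where "0 < c" "c *\<^sub>R s \<in> ray_gens N \<Sigma>"
proof -
  obtain B f where B: "lattice_coords N B f"
    using lattice_coordinates[OF N] by blast
  note lin = lattice_coordsD(5)[OF B] and int = lattice_coordsD(7)[OF B]
  obtain b where b: "b \<in> B" "f b s \<noteq> 0"
    using s lattice_coordsD(8)[OF B subsetD[OF lattice_coordsD(4)[OF B] s(1)]] by blast
  define K where "K = {c. 0 < c \<and> c \<le> 1 \<and> c *\<^sub>R s \<in> N}"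
  define h where "h c = \<lfloor>c * f b s\<rfloor>" for c
  have h: "real_of_int (h c) = c * f b s" if "c \<in> K" for c
  proof -
    have "f b (c *\<^sub>R s) \<in> \<int>" using int[OF b(1)] that by (simp add: K_def)
    then have "c * f b s \<in> \<int>" by (simp add: linear_cmul[OF lin])
    then show ?thesis by (auto simp: h_def elim!: Ints_cases)
  qed
  have "inj_on h K"
  proof (rule inj_onI)
    fix c d assume cd: "c \<in> K" "d \<in> K" "h c = h d"
    have "c * f b s = d * f b s" using h[OF cd(1)] h[OF cd(2)] unfolding cd(3) by linarith
    then show "c = d" using b(2) by (metis mult_right_cancel)
  qed
  moreover have "h ` K \<subseteq> {- \<lceil>\<bar>f b s\<bar>\<rceil>..\<lceil>\<bar>f b s\<bar>\<rceil>}"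
  proof
    fix z assume "z \<in> h ` K"
    then obtain c where c: "c \<in> K" "z = h c" by blast
    have "\<bar>real_of_int z\<bar> = c * \<bar>f b s\<bar>" using h[OF c(1)] c by (simp add: abs_mult K_def)
    also have "\<dots> \<le> 1 * \<bar>f b s\<bar>" using c(1) by (intro mult_right_mono) (auto simp: K_def)
    finally have "\<bar>real_of_int z\<bar> \<le> \<bar>f b s\<bar>" by simp
    also have "\<dots> \<le> real_of_int \<lceil>\<bar>f b s\<bar>\<rceil>" by (rule le_of_int_ceiling)
    finally have "\<bar>z\<bar> \<le> \<lceil>\<bar>f b s\<bar>\<rceil>" by linarith
    then show "z \<in> {- \<lceil>\<bar>f b s\<bar>\<rceil>..\<lceil>\<bar>f b s\<bar>\<rceil>}" by auto
  qed
  ultimately have finK: "finite K" by (meson finite_atLeastAtMost_int inj_on_finite)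
  have "1 \<in> K" using s by (simp add: K_def)
  then have Min: "Min K \<in> K" "\<And>c. c \<in> K \<Longrightarrow> Min K \<le> c" using finK by (auto intro: Min_in)
  have "Min K *\<^sub>R s \<in> ray_gens N \<Sigma>"
    unfolding ray_gens_def
  proof (intro CollectI conjI allI impI)
    show "Min K *\<^sub>R s \<in> N" "Min K *\<^sub>R s \<noteq> 0" using Min(1) s by (auto simp: K_def)
    show "convex_cone hull {Min K *\<^sub>R s} \<in> \<Sigma>"
      using Min(1) s by (simp add: K_def convex_cone_hull_sing_scale)
    fix c :: real assume c: "0 < c" "c < 1"
    show "c *\<^sub>R Min K *\<^sub>R s \<notin> N"
    proof
      assume "c *\<^sub>R Min K *\<^sub>R s \<in> N"
      then have "c * Min K \<in> K" using c Min(1) by (auto simp: K_def intro: mult_le_one)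
      then have "Min K \<le> c * Min K" by (rule Min(2))
      then show False using c Min(1) by (simp add: K_def)
    qed
  qed
  then show ?thesis using that Min(1) by (auto simp: K_def)
qed


section \<open>Complete simplicial fans\<close>

lemma ray_gens_unique:
  assumes "u \<in> ray_gens N \<Sigma>" "v \<in> ray_gens N \<Sigma>" "v = c *\<^sub>R u" "0 < c"
  shows "v = u"
proof (rule ccontr)
  assume "v \<noteq> u"
  then have "c \<noteq> 1" using assms by auto
  then consider "c < 1" | "inverse c < 1" using assms(4) by (metis inverse_less_1_iff linorder_cases not_less_iff_gr_or_eq)
  then show False
  proof cases
    case 1
    then show False using assms unfolding ray_gens_def by blast
  next
    case 2
    have "u = inverse c *\<^sub>R v" using assms by simp
    then show False using assms 2 unfolding ray_gens_def by (metis (mono_tags, lifting) inverse_positive_iff_positive mem_Collect_eq)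
  qed
qed

locale complete_simplicial =
  fixes N :: "'v::euclidean_space set" and \<Sigma> :: "'v set set"
  assumes lattice: "is_lattice N" and spanN: "span N = UNIV"
    and fan: "is_fan N \<Sigma>" and complete: "complete_fan N \<Sigma>" and simplicial: "simplicial_fan \<Sigma>"
begin

lemma finite_fan: "finite \<Sigma>" using fan by (simp add: is_fan_def)

lemma fan_generated:
  assumes "\<sigma> \<in> \<Sigma>"
  obtains S where "finite S" "S \<subseteq> N" "\<sigma> = convex_cone hull S"
  using fan assms unfolding is_fan_def by meson

lemma convex_cone_fan: "\<sigma> \<in> \<Sigma> \<Longrightarrow> convex_cone \<sigma>"
  using fan_generated convex_cone_convex_cone_hull by metis

lemma fan_face: "\<sigma> \<in> \<Sigma> \<Longrightarrow> \<tau> face_of \<sigma> \<Longrightarrow> \<tau> \<noteq> {} \<Longrightarrow> \<tau> \<in> \<Sigma>"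
  using fan unfolding is_fan_def by meson

lemma fan_Int_face: "\<sigma> \<in> \<Sigma> \<Longrightarrow> \<tau> \<in> \<Sigma> \<Longrightarrow> (\<sigma> \<inter> \<tau>) face_of \<tau>"
  using fan unfolding is_fan_def by meson

lemma fan_simplicial:
  assumes "\<sigma> \<in> \<Sigma>"
  obtains S where "finite S" "independent S" "\<sigma> = convex_cone hull S"
  using simplicial assms unfolding simplicial_fan_def by meson

lemma finite_ray_gens: "finite (ray_gens N \<Sigma>)"
proof -
  have "inj_on (\<lambda>u. convex_cone hull {u}) (ray_gens N \<Sigma>)"
  proof (rule inj_onI)
    fix u v assume uv: "u \<in> ray_gens N \<Sigma>" "v \<in> ray_gens N \<Sigma>" "convex_cone hull {u} = convex_cone hull {v}"
    then have "v \<in> convex_cone hull {u}" by (simp add: hull_inc)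
    then obtain c where c: "v = c *\<^sub>R u" "0 \<le> c" unfolding convex_cone_hull_sing by blast
    moreover have "v \<noteq> 0" using uv by (simp add: ray_gens_def)
    ultimately have "0 < c" by (cases "c = 0") auto
    then show "u = v" using ray_gens_unique[OF uv(1,2) c(1)] by simp
  qed
  moreover have "(\<lambda>u. convex_cone hull {u}) ` ray_gens N \<Sigma> \<subseteq> \<Sigma>" by (auto simp: ray_gens_def)
  ultimately show ?thesis using finite_fan by (meson inj_on_finite)
qed

sublocale cox_data N \<Sigma> by unfold_locales (rule finite_ray_gens)

lemma ray_face:
  assumes "u \<in> R" "\<sigma> \<in> \<Sigma>" "u \<in> \<sigma>"
  shows "convex_cone hull {u} face_of \<sigma>"
proof -
  have "convex_cone hull {u} \<subseteq> \<sigma>"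
    using assms by (intro hull_minimal convex_cone_fan) auto
  moreover have "convex_cone hull {u} \<inter> \<sigma> face_of \<sigma>"
    using assms by (intro fan_Int_face) (auto simp: ray_gens_def)
  ultimately show ?thesis by (simp add: Int_absorb2)
qed

text \<open>The rays of a simplicial cone are positive multiples of its independent generators,
  distinct rays of distinct generators. A dependence among the rays would give one among the
  generators.\<close>

lemma independent_cone_rays:
  assumes "\<sigma> \<in> \<Sigma>"
  shows "independent (R \<inter> \<sigma>)"
proof -
  obtain S where S: "finite S" "independent S" "\<sigma> = convex_cone hull S"
    by (rule fan_simplicial[OF assms])
  have "\<exists>s c. s \<in> S \<and> 0 < c \<and> u = c *\<^sub>R s" if "u \<in> R \<inter> \<sigma>" for u
  proof -
    have "convex_cone hull {u} face_of convex_cone hull S"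
      using ray_face[OF _ assms, of u] that S(3) by simp
    moreover have "u \<noteq> 0" using that by (simp add: ray_gens_def)
    ultimately show ?thesis using ray_face_generator[OF S(1)] by blast
  qed
  then have "\<forall>u\<in>R \<inter> \<sigma>. \<exists>p. fst p \<in> S \<and> 0 < snd p \<and> u = snd p *\<^sub>R fst p"
    by (metis fst_conv snd_conv)
  from bchoice[OF this] obtain p where
    p: "\<forall>u\<in>R \<inter> \<sigma>. fst (p u) \<in> S \<and> 0 < snd (p u) \<and> u = snd (p u) *\<^sub>R fst (p u)" ..
  define s where "s u = fst (p u)" for u
  define c where "c u = snd (p u)" for u
  have s: "s u \<in> S \<and> 0 < c u \<and> u = c u *\<^sub>R s u" if "u \<in> R \<inter> \<sigma>" for u
    using p that unfolding s_def c_def by blast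
  have ne: "s u \<noteq> s v" if uv: "u \<in> R \<inter> \<sigma>" "v \<in> R \<inter> \<sigma>" "u \<noteq> v" for u v
  proof
    assume eq: "s u = s v"
    have "v = (c v / c u) *\<^sub>R u"
    proof -
      have su: "u = c u *\<^sub>R s u" "v = c v *\<^sub>R s u" "0 < c u" using s[OF uv(1)] s[OF uv(2)] eq by simp_all
      have "(c v / c u) *\<^sub>R u = (c v / c u) *\<^sub>R (c u *\<^sub>R s u)"
        by (rule arg_cong[OF su(1), of "\<lambda>z. (c v / c u) *\<^sub>R z"])
      also have "\<dots> = c v *\<^sub>R s u" using su(3) by simp
      finally show ?thesis using su(2) by simp
    qed
    moreover have "0 < c v / c u" using s uv by simp
    ultimately show False using ray_gens_unique[of u N \<Sigma> v] uv by blast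
  qed
  show ?thesis
    unfolding dependent_def
  proof
    assume "\<exists>u\<in>R \<inter> \<sigma>. u \<in> span (R \<inter> \<sigma> - {u})"
    then obtain u where u: "u \<in> R \<inter> \<sigma>" "u \<in> span (R \<inter> \<sigma> - {u})" by blast
    have "R \<inter> \<sigma> - {u} \<subseteq> span (S - {s u})"
    proof
      fix v assume v: "v \<in> R \<inter> \<sigma> - {u}"
      then have "s v \<in> S - {s u}" using s[of v] ne[of v u] u by blast
      then have "c v *\<^sub>R s v \<in> span (S - {s u})" by (intro span_scale span_base)
      then show "v \<in> span (S - {s u})" using s[of v] v by simp
    qed
    then have "u \<in> span (S - {s u})"
      using u(2) span_minimal[OF _ subspace_span] by blast
    then have "inverse (c u) *\<^sub>R u \<in> span (S - {s u})" by (rule span_scale)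
    moreover have "inverse (c u) *\<^sub>R u = s u"
    proof -
      have su: "u = c u *\<^sub>R s u" "0 < c u" using s[OF u(1)] by blast+
      have "inverse (c u) *\<^sub>R u = inverse (c u) *\<^sub>R (c u *\<^sub>R s u)"
        by (rule arg_cong[OF su(1), of "\<lambda>z. inverse (c u) *\<^sub>R z"])
      also have "\<dots> = s u" using su(2) by simp
      finally show ?thesis .
    qed
    ultimately show False
      using S(2) s[OF u(1)] unfolding dependent_def by auto
  qed
qed

text \<open>Two generating sets cooperate: independence of \<open>S\<close> makes each of its
  members span a face, and as \<open>T\<close> consists of lattice points this ray contains a
  lattice point, hence a primitive one.\<close>

lemma cone_eq_hull_rays:
  assumes "\<sigma> \<in> \<Sigma>"
  shows "\<sigma> = convex_cone hull (R \<inter> \<sigma>)"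
proof
  show "convex_cone hull (R \<inter> \<sigma>) \<subseteq> \<sigma>"
    by (intro hull_minimal convex_cone_fan assms) auto
  obtain S where S: "finite S" "independent S" "\<sigma> = convex_cone hull S"
    by (rule fan_simplicial[OF assms])
  obtain T where T: "finite T" "T \<subseteq> N" "\<sigma> = convex_cone hull T"
    by (rule fan_generated[OF assms])
  have "S \<subseteq> convex_cone hull (R \<inter> \<sigma>)"
  proof
    fix s assume s: "s \<in> S"
    have face: "convex_cone hull {s} face_of \<sigma>"
      unfolding S(3) by (rule independent_ray_face[OF S(1,2) s])
    have s0: "s \<noteq> 0" using S(2) s dependent_zero by blast
    obtain t c where t: "t \<in> T" "0 < c" "s = c *\<^sub>R t"
      using ray_face_generator[OF T(1), of s] face s0 unfolding T(3) by blast
    have t0: "t \<noteq> 0" using t s0 by auto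
    have "convex_cone hull {t} \<in> \<Sigma>"
      using fan_face[OF assms face] t convex_cone_hull_sing_scale[of c t]
      by (simp add: convex_cone_hull_nonempty)
    then obtain d where d: "0 < d" "d *\<^sub>R t \<in> R"
      using ray_gen_exists[OF lattice _ t0] t T(2) by blast
    have "t \<in> \<sigma>" unfolding T(3) using t by (simp add: hull_inc)
    then have "d *\<^sub>R t \<in> R \<inter> \<sigma>"
      using d convex_cone_fan[OF assms] by (simp add: convex_cone_scaleR)
    then have "(c / d) *\<^sub>R (d *\<^sub>R t) \<in> convex_cone hull (R \<inter> \<sigma>)"
      using t d by (intro convex_cone_hull_mul hull_inc) auto
    then show "s \<in> convex_cone hull (R \<inter> \<sigma>)" using t d by simp
  qed
  then show "\<sigma> \<subseteq> convex_cone hull (R \<inter> \<sigma>)"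
    unfolding S(3)[symmetric] by (subst S(3)) (intro hull_minimal; (assumption | rule convex_cone_convex_cone_hull))
qed

text \<open>The complement of the union of the full cones is open, since these are finitely many
  closed sets, and by completeness it lies in a finite union of proper subspaces, which has empty
  interior. So it is empty.\<close>

lemma mem_full_cone: "\<exists>\<sigma>\<in>\<Sigma>. x \<in> \<sigma> \<and> card (R \<inter> \<sigma>) = DIM('v)"
proof -
  define full where "full = {\<sigma>\<in>\<Sigma>. card (R \<inter> \<sigma>) = DIM('v)}"
  define L where "L \<A> = (\<Union>\<sigma>\<in>\<A>. span (R \<inter> \<sigma>))" for \<A>
  have "closed (L \<A>) \<and> interior (L \<A>) = {}" if "finite \<A>" "\<A> \<subseteq> \<Sigma> - full" for \<A>
    using that
  proof (induction \<A> rule: finite_induct)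
    case empty
    then show ?case by (simp add: L_def)
  next
    case (insert \<sigma> \<A>)
    have \<sigma>: "\<sigma> \<in> \<Sigma>" "card (R \<inter> \<sigma>) \<noteq> DIM('v)" using insert by (auto simp: full_def)
    have "dim (R \<inter> \<sigma>) < DIM('v)"
      using independent_bound[OF independent_cone_rays[OF \<sigma>(1)]] \<sigma>(2)
      by (simp add: dim_eq_card_independent[OF independent_cone_rays[OF \<sigma>(1)]])
    then have "interior (span (R \<inter> \<sigma>)) = {}"
      by (intro empty_interior_lowdim) simp
    moreover have "L (insert \<sigma> \<A>) = L \<A> \<union> span (R \<inter> \<sigma>)" by (auto simp: L_def)
    ultimately show ?case
      using insert interior_closed_Un_empty_interior[of "L \<A>" "span (R \<inter> \<sigma>)"] by (simp add: closed_Un)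
  qed
  then have L: "closed (L (\<Sigma> - full))" "interior (L (\<Sigma> - full)) = {}"
    using finite_fan by auto
  have "closed (\<Union>full)"
  proof (rule closed_Union)
    show "finite full" using finite_fan by (simp add: full_def)
    show "\<forall>\<sigma>\<in>full. closed \<sigma>"
    proof
      fix \<sigma> assume "\<sigma> \<in> full"
      then have "\<sigma> \<in> \<Sigma>" by (simp add: full_def)
      then obtain S where "finite S" "S \<subseteq> N" "\<sigma> = convex_cone hull S"
        by (rule fan_generated)
      then show "closed \<sigma>" by (simp add: closed_convex_cone_hull)
    qed
  qed
  moreover have "- \<Union>full \<subseteq> L (\<Sigma> - full)"
  proof
    fix x assume x: "x \<in> - \<Union>full"
    have "x \<in> \<Union>\<Sigma>" using complete spanN unfolding complete_fan_def by simp
    then obtain \<sigma> where \<sigma>: "\<sigma> \<in> \<Sigma> - full" "x \<in> \<sigma>" using x by auto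
    then have "x \<in> convex_cone hull (R \<inter> \<sigma>)" using cone_eq_hull_rays by blast
    moreover have "convex_cone hull (R \<inter> \<sigma>) \<subseteq> span (R \<inter> \<sigma>)"
      by (intro hull_minimal span_superset convex_cone_span)
    ultimately show "x \<in> L (\<Sigma> - full)" using \<sigma> by (auto simp: L_def)
  qed
  ultimately have "- \<Union>full \<subseteq> interior (L (\<Sigma> - full))"
    by (intro interior_maximal) auto
  then show ?thesis using L by (auto simp: full_def)
qed

end

section \<open>The lattice points of the edge\<close>

locale fan_with_edge = complete_simplicial N \<Sigma> for N :: "'v::euclidean_space set" and \<Sigma> +
  fixes \<Gamma> :: "'v set" and e :: "nat \<Rightarrow> 'v" and k :: nat
  assumes convex_edge: "convex \<Gamma>" and edge_rays: "\<Gamma> \<inter> N \<subseteq> ray_gens N \<Sigma>"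
    and consecutive: "consecutive_lattice_points N \<Gamma> e k"
begin

lemma e_bij: "bij_betw e {0..k + 1} (\<Gamma> \<inter> N)"
  using consecutive by (simp add: consecutive_lattice_points_def)

lemma e_between: "a < b \<Longrightarrow> b < c \<Longrightarrow> c \<le> k + 1 \<Longrightarrow> e b \<in> open_segment (e a) (e c)"
  using consecutive by (simp add: consecutive_lattice_points_def)

lemma e_mem: "j \<le> k + 1 \<Longrightarrow> e j \<in> \<Gamma> \<and> e j \<in> N \<and> e j \<in> R"
  using e_bij edge_rays by (auto simp: bij_betw_def)

lemma e_inj: "i \<le> k + 1 \<Longrightarrow> j \<le> k + 1 \<Longrightarrow> e i = e j \<longleftrightarrow> i = j"
  using e_bij by (auto simp: bij_betw_def inj_on_def)

lemma edge_points: "u \<in> \<Gamma> \<Longrightarrow> u \<in> N \<Longrightarrow> \<exists>j\<le>k + 1. u = e j"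
proof -
  assume "u \<in> \<Gamma>" "u \<in> N"
  then have "u \<in> e ` {0..k + 1}" using e_bij by (simp add: bij_betw_def)
  then show ?thesis by auto
qed

lemma R_edge: "u \<in> R \<Longrightarrow> u \<in> \<Gamma> \<Longrightarrow> \<exists>j\<le>k + 1. u = e j"
  using edge_points rays_subset_lattice by blast

text \<open>By the consecutive order, a further lattice point of the edge lies beyond an end of the
  segment, whereas points inside are closer to both ends than the ends are to each other.\<close>

lemma no_point_between:
  assumes "j \<le> k" "p \<in> N" "p \<in> open_segment (e j) (e (j + 1))"
  shows False
proof -
  have "e j \<in> \<Gamma>" "e (j + 1) \<in> \<Gamma>" using assms(1) e_mem by simp_all
  then have "p \<in> \<Gamma>"
    using assms(3) convex_edge by (meson convex_contains_open_segment subsetD)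
  then obtain i where i: "i \<le> k + 1" "p = e i" using edge_points assms(2) by blast
  have d: "dist p (e j) < dist (e j) (e (j + 1))" "dist p (e (j + 1)) < dist (e j) (e (j + 1))"
    using dist_in_open_segment[OF assms(3)] by auto
  consider "i < j" | "i = j" | "i = j + 1" | "j + 1 < i" by linarith
  then show False
  proof cases
    case 1
    then have "e j \<in> open_segment (e i) (e (j + 1))" using assms(1) by (intro e_between) auto
    then show False using dist_in_open_segment[of "e j"] d i by (fastforce simp: dist_commute)
  next
    case 4
    then have "e (j + 1) \<in> open_segment (e j) (e i)" using i by (intro e_between) auto
    then show False using dist_in_open_segment[of "e (j + 1)"] d i by (fastforce simp: dist_commute)
  qed (use assms(3) i in \<open>auto simp: open_segment_def\<close>)
qed

text \<open>If two neighbouring gaps differed, the reflection of the far end of the shorter gap in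
  the middle point would be a lattice point strictly inside the longer gap.\<close>

lemma equal_gaps:
  assumes "j + 2 \<le> k + 1"
  shows "e (j + 2) - e (j + 1) = e (j + 1) - e j"
proof -
  have "e (j + 1) \<in> open_segment (e j) (e (j + 2))" using assms by (intro e_between) auto
  then obtain t where t: "0 < t" "t < 1" "e (j + 1) = (1 - t) *\<^sub>R e j + t *\<^sub>R e (j + 2)"
    by (auto simp: in_segment)
  define d where "d = e (j + 2) - e j"
  have ne: "e j \<noteq> e (j + 1)" "e (j + 1) \<noteq> e (j + 2)" using assms by (auto simp: e_inj)
  have e1: "e (j + 1) = e j + t *\<^sub>R d" and e2: "e (j + 2) = e j + d"
    using t(3) by (simp_all add: d_def algebra_simps)
  have N: "2 *\<^sub>R e (j + 1) - e j \<in> N" "2 *\<^sub>R e (j + 1) - e (j + 2) \<in> N"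
    using lattice_combination[OF lattice, of "e (j + 1)" "e j" 2 "-1"]
      lattice_combination[OF lattice, of "e (j + 1)" "e (j + 2)" 2 "-1"] assms e_mem by simp_all
  have "\<not> t < 1/2"
  proof
    assume "t < 1/2"
    \<comment> \<open>Position of the reflected point within the second gap: on the scale where the
      three lattice points sit at \<open>0\<close>, \<open>t\<close> and \<open>1\<close>, it sits
      at \<open>2 t\<close>.\<close>
    define r where "r = t / (1 - t)"
    have r: "0 < r" "r < 1" "(1 - t) * r = t" using t \<open>t < 1/2\<close> by (auto simp: r_def field_simps)
    have "2 *\<^sub>R e (j + 1) - e j = (1 - r) *\<^sub>R e (j + 1) + r *\<^sub>R e (j + 2)"
    proof -
      have "(1 - r) *\<^sub>R e (j + 1) + r *\<^sub>R e (j + 2) = e j + (t + (1 - t) * r) *\<^sub>R d"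
        unfolding e1 e2 by (simp add: algebra_simps)
      also have "\<dots> = 2 *\<^sub>R e (j + 1) - e j"
        unfolding e1 r(3) by (simp add: algebra_simps scaleR_2)
      finally show ?thesis by simp
    qed
    then have "2 *\<^sub>R e (j + 1) - e j \<in> open_segment (e (j + 1)) (e (j + 1 + 1))"
      unfolding in_segment using ne r by (intro conjI exI[of _ r]) auto
    then show False using no_point_between[of "j + 1"] N assms by auto
  qed
  moreover have "\<not> 1/2 < t"
  proof
    assume "1/2 < t"
    define r where "r = (2 * t - 1) / t"
    have r: "0 < r" "r < 1" "t * r = 2 * t - 1" using t \<open>1/2 < t\<close> by (auto simp: r_def field_simps)
    have "2 *\<^sub>R e (j + 1) - e (j + 2) = (1 - r) *\<^sub>R e j + r *\<^sub>R e (j + 1)"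
    proof -
      have "(1 - r) *\<^sub>R e j + r *\<^sub>R e (j + 1) = e j + (t * r) *\<^sub>R d"
        unfolding e1 by (simp add: algebra_simps)
      also have "\<dots> = 2 *\<^sub>R e (j + 1) - e (j + 2)"
        unfolding e1 e2 r(3) by (simp add: algebra_simps scaleR_2)
      finally show ?thesis by simp
    qed
    then have "2 *\<^sub>R e (j + 1) - e (j + 2) \<in> open_segment (e j) (e (j + 1))"
      unfolding in_segment using ne r by (intro conjI exI[of _ r]) auto
    then show False using no_point_between[of j] N assms by auto
  qed
  ultimately have "t = 1/2" by linarith
  then have "2 *\<^sub>R e (j + 1) = e j + e (j + 2)"
    unfolding e1 e2 by (simp add: algebra_simps scaleR_2)
  then show ?thesis by (simp add: algebra_simps scaleR_2)
qed

definition \<delta> :: 'v where "\<delta> = e 1 - e 0"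

lemma e_Suc: "j \<le> k \<Longrightarrow> e (Suc j) = e j + \<delta>"
proof (induction j)
  case 0
  then show ?case by (simp add: \<delta>_def)
next
  case (Suc j)
  then have "e (Suc j) = e j + \<delta>" by simp
  moreover have "e (j + 2) - e (j + 1) = e (j + 1) - e j" using Suc.prems by (intro equal_gaps) simp
  ultimately show ?case by (simp add: algebra_simps)
qed

lemma e_eq: "j \<le> k + 1 \<Longrightarrow> e j = e 0 + real j *\<^sub>R \<delta>"
  by (induction j) (simp_all add: e_Suc algebra_simps)

lemma \<delta>_lattice: "\<delta> \<in> N"
  using lattice_combination[OF lattice, of "e 1" "e 0" 1 "-1"] e_mem[of 0] e_mem[of 1] by (simp add: \<delta>_def)

text \<open>The rational multiple in the definition of \<open>t_gen\<close> is the lattice step, so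
  the t generators are integral.\<close>

lemma \<delta>_eq: "(1 / real (k + 1)) *\<^sub>R (e (k + 1) - e 0) = \<delta>"
  by (subst e_eq[of "k + 1"]) auto

text \<open>A ray \<open>e (a + 1)\<close> strictly between \<open>e a\<close> and
  \<open>e b\<close> would be a positive combination of them, lying in the cone and contradicting
  the independence of its rays.\<close>

lemma cone_edge_consecutive:
  assumes \<sigma>: "\<sigma> \<in> \<Sigma>" and ab: "a < b" "b \<le> k + 1" "e a \<in> \<sigma>" "e b \<in> \<sigma>"
  shows "b = a + 1"
proof (rule ccontr)
  assume "b \<noteq> a + 1"
  then have "e (a + 1) \<in> open_segment (e a) (e b)" using ab by (intro e_between) auto
  then obtain t where t: "e (a + 1) = (1 - t) *\<^sub>R e a + t *\<^sub>R e b" "0 < t" "t < 1"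
    by (auto simp: in_segment)
  have "e (a + 1) \<in> \<sigma>"
    unfolding t(1) using t ab convex_cone_fan[OF \<sigma>]
    by (intro convex_cone_add convex_cone_scaleR) auto
  moreover have "e (a + 1) \<in> span (R \<inter> \<sigma> - {e (a + 1)})"
    unfolding t(1)
    by (intro span_add span_scale span_base)
      (use ab \<open>b \<noteq> a + 1\<close> e_mem e_inj t(1) in \<open>auto simp flip: t(1)\<close>)
  moreover have "e (a + 1) \<in> R" using ab e_mem by simp
  ultimately show False
    using independent_cone_rays[OF \<sigma>] unfolding dependent_def by blast
qed

text \<open>The index \<open>j\<close> at which the lift of a cone switches from the \<open>t\<close> to the \<open>s\<close> coordinates.\<close>

lemma cone_edge_cases:
  assumes \<sigma>: "\<sigma> \<in> \<Sigma>"
  obtains "R \<inter> \<sigma> \<inter> \<Gamma> = {}"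
    | j where "j \<le> k + 1" "R \<inter> \<sigma> \<inter> \<Gamma> = {e j}"
    | j where "j \<le> k" "R \<inter> \<sigma> \<inter> \<Gamma> = {e j, e (j + 1)}"
proof -
  define J where "J = {j. j \<le> k + 1 \<and> e j \<in> \<sigma>}"
  have eq: "R \<inter> \<sigma> \<inter> \<Gamma> = e ` J"
    using R_edge e_mem by (auto simp: J_def)
  show ?thesis
  proof (cases "J = {}")
    case True
    then show ?thesis using that(1) eq by simp
  next
    case False
    define j where "j = Min J"
    have finJ: "finite J" by (rule finite_subset[of _ "{..k + 1}"]) (auto simp: J_def)
    have j: "j \<in> J" "\<And>i. i \<in> J \<Longrightarrow> j \<le> i" using finJ False by (auto simp: j_def)
    have "i = j \<or> i = j + 1" if "i \<in> J" for i
      using cone_edge_consecutive[OF \<sigma>, of j i] j that by (cases "i = j") (force simp: J_def)+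
    then have "J = {j} \<or> J = {j, j + 1}" using j(1) by blast
    then show ?thesis
    proof
      assume "J = {j}"
      then show ?thesis using that(2)[of j] eq j(1) by (auto simp: J_def)
    next
      assume J: "J = {j, j + 1}"
      then have "j + 1 \<in> J" by simp
      then have "j \<le> k" by (simp add: J_def)
      then show ?thesis using that(3)[of j] eq J by simp
    qed
  qed
qed

end

section \<open>The lifted fan\<close>

lemma lookup_scaleR: "Poly_Mapping.lookup (c *\<^sub>R w) l = c *\<^sub>R Poly_Mapping.lookup w l"
proof -
  have "{n. c *\<^sub>R Poly_Mapping.lookup w n \<noteq> 0} \<subseteq> Poly_Mapping.keys w"
    by (auto simp: in_keys_iff)
  then have "finite {n. c *\<^sub>R Poly_Mapping.lookup w n \<noteq> 0}"
    by (rule finite_subset) simp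
  then show ?thesis by (simp add: scaleR_poly_mapping_def)
qed

lemma hull_lifted:
  "convex_cone hull ((\<lambda>u. (u, 0)) ` S) = (convex_cone hull S) \<times> {0 :: 'b::real_vector}"
proof -
  have "linear (\<lambda>u::'a::real_vector. (u, 0 :: 'b))" by (rule linearI) auto
  from convex_cone_hull_linear_image[OF this, of S] show ?thesis by auto
qed

context fan_with_edge
begin

abbreviation "N' \<equiv> lifted_lattice N k"
abbreviation "\<Sigma>' \<equiv> edge_fan N \<Sigma> \<Gamma> e k"
abbreviation "R' \<equiv> ray_gens N' \<Sigma>'"

text \<open>The generators of the coordinates \<open>s\<^sub>i\<^sub>+\<^sub>1\<close> and \<open>t\<^sub>i\<close> are paired by the index \<open>i \<le> k\<close>.\<close>

definition sg :: "nat \<Rightarrow> 'v \<times> (nat \<Rightarrow>\<^sub>0 real)" where "sg i = s_gen e k (i + 1)"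
definition tg :: "nat \<Rightarrow> 'v \<times> (nat \<Rightarrow>\<^sub>0 real)" where "tg i = t_gen e k i"

lemma tg_eq: "tg i = sg i + (\<delta>, 0)"
  unfolding tg_def sg_def t_gen_def \<delta>_eq by simp

lemma fst_sg: "i \<le> k \<Longrightarrow> fst (sg i) = (if i = k then e 0 else 0)"
  by (auto simp: sg_def s_gen_def)

lemma lookup_snd_sg:
  assumes "i \<le> k" "l \<in> {1..k}"
  shows "Poly_Mapping.lookup (snd (sg i)) l = (if i = k then -1 else if l = i + 1 then 1 else 0)"
proof (cases "i = k")
  case True
  have "(\<Sum>j\<in>{1..k}. Poly_Mapping.lookup (Poly_Mapping.single j (1::real)) l) = (\<Sum>j\<in>{1..k}. if j = l then 1 else 0)"
    by (rule sum.cong) (auto simp: lookup_single when_def)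
  also have "\<dots> = 1" using assms(2) by simp
  finally show ?thesis using True by (simp add: sg_def s_gen_def lookup_sum)
next
  case False
  then show ?thesis using assms by (auto simp: sg_def s_gen_def lookup_single when_def)
qed

lemma keys_snd_sg: "i \<le> k \<Longrightarrow> Poly_Mapping.keys (snd (sg i)) \<subseteq> {1..k}"
proof (cases "i = k")
  case True
  have "Poly_Mapping.lookup (snd (sg i)) l = 0" if "l \<notin> {1..k}" for l
    using True that by (auto simp: sg_def s_gen_def lookup_sum lookup_single when_def intro!: sum.neutral)
  then show ?thesis unfolding subset_iff in_keys_iff by blast
qed (auto simp: sg_def s_gen_def)

lemma snd_sg_inj:
  assumes "i \<le> k" "j \<le> k" "snd (sg i) = snd (sg j)"
  shows "i = j"
proof (rule ccontr)
  assume ne: "i \<noteq> j"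
  have *: False if "i \<le> k" "j \<le> k" "snd (sg i) = snd (sg j)" "i < j" for i j
  proof -
    have "Poly_Mapping.lookup (snd (sg i)) (i + 1) = Poly_Mapping.lookup (snd (sg j)) (i + 1)"
      using that by simp
    then show False using that lookup_snd_sg[of i "i + 1"] lookup_snd_sg[of j "i + 1"]
      by (simp split: if_splits)
  qed
  show False using *[of i j] *[of j i] assms ne by (metis linorder_neqE_nat)
qed

lemma \<delta>_nonzero: "\<delta> \<noteq> 0"
  using e_inj[of 1 0] by (simp add: \<delta>_def)

lemma sg_inj: "i \<le> k \<Longrightarrow> j \<le> k \<Longrightarrow> sg i = sg j \<longleftrightarrow> i = j"
  using snd_sg_inj by metis

lemma tg_inj: "i \<le> k \<Longrightarrow> j \<le> k \<Longrightarrow> tg i = tg j \<longleftrightarrow> i = j"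
  using sg_inj by (simp add: tg_eq)

lemma sg_neq_tg: "i \<le> k \<Longrightarrow> j \<le> k \<Longrightarrow> sg i \<noteq> tg j"
proof
  assume ij: "i \<le> k" "j \<le> k" and eq: "sg i = tg j"
  then have "snd (sg i) = snd (sg j)" by (simp add: tg_eq)
  then have "i = j" using snd_sg_inj ij by blast
  then have "fst (sg i) = fst (sg i) + \<delta>" using eq by (metis tg_eq fst_add fst_conv)
  then show False using \<delta>_nonzero by simp
qed

text \<open>For \<open>k = 0\<close> nothing is lifted: \<open>sg 0\<close> and \<open>tg 0\<close>
  are then \<open>(e 0, 0)\<close> and \<open>(e 1, 0)\<close>. Only in this degenerate case does a
  new generator lie in the base space.\<close>

lemma snd_sg_zero:
  assumes "i \<le> k" "snd (sg i) = 0"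
  shows "k = 0"
proof (rule ccontr)
  assume k: "k \<noteq> 0"
  define l where "l = (if i = k then 1 else i + 1)"
  have "l \<in> {1..k}" using k assms(1) by (auto simp: l_def)
  then have "Poly_Mapping.lookup (snd (sg i)) l \<noteq> 0"
    using lookup_snd_sg[OF assms(1)] by (auto simp: l_def)
  then show False using assms(2) by simp
qed

lemma sg_zero_edge: "i \<le> k \<Longrightarrow> sg i = (p, 0) \<Longrightarrow> k = 0 \<and> p = e 0"
  using snd_sg_zero[of i] fst_sg[of i] by auto

lemma tg_zero_edge: "i \<le> k \<Longrightarrow> tg i = (p, 0) \<Longrightarrow> k = 0 \<and> p = e 1"
  using snd_sg_zero[of i] fst_sg[of i] by (auto simp: tg_eq \<delta>_def prod_eq_iff)

lemma sg_not_lifted: "i \<le> k \<Longrightarrow> u \<notin> \<Gamma> \<Longrightarrow> sg i \<noteq> (u, 0)"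
  using sg_zero_edge e_mem[of 0] by auto

lemma tg_not_lifted: "i \<le> k \<Longrightarrow> u \<notin> \<Gamma> \<Longrightarrow> tg i \<noteq> (u, 0)"
  using tg_zero_edge e_mem[of 1] by auto

lemma sum_sg:
  "(\<Sum>i\<le>k. m i *\<^sub>R sg i) = (m k *\<^sub>R e 0, \<Sum>l\<in>{1..k}. Poly_Mapping.single l (m (l - 1) - m k))"
proof (rule prod_eqI)
  have "fst (\<Sum>i\<le>k. m i *\<^sub>R sg i) = (\<Sum>i\<le>k. if i = k then m k *\<^sub>R e 0 else 0)"
    unfolding fst_sum by (rule sum.cong) (auto simp: fst_sg)
  then show "fst (\<Sum>i\<le>k. m i *\<^sub>R sg i) = fst (m k *\<^sub>R e 0, \<Sum>l\<in>{1..k}. Poly_Mapping.single l (m (l - 1) - m k))"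
    by simp
  show "snd (\<Sum>i\<le>k. m i *\<^sub>R sg i) = snd (m k *\<^sub>R e 0, \<Sum>l\<in>{1..k}. Poly_Mapping.single l (m (l - 1) - m k))"
  proof (rule poly_mapping_eqI)
    fix l
    have rhs: "Poly_Mapping.lookup (\<Sum>l\<in>{1..k}. Poly_Mapping.single l (m (l - 1) - m k)) l
        = (if l \<in> {1..k} then m (l - 1) - m k else 0)"
      by (simp add: lookup_sum lookup_single when_def)
    have lhs: "Poly_Mapping.lookup (snd (\<Sum>i\<le>k. m i *\<^sub>R sg i)) l = (\<Sum>i\<le>k. m i * Poly_Mapping.lookup (snd (sg i)) l)"
      by (simp add: snd_sum lookup_sum lookup_scaleR)
    show "Poly_Mapping.lookup (snd (\<Sum>i\<le>k. m i *\<^sub>R sg i)) l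
        = Poly_Mapping.lookup (snd (m k *\<^sub>R e 0, \<Sum>l\<in>{1..k}. Poly_Mapping.single l (m (l - 1) - m k))) l"
    proof (cases "l \<in> {1..k}")
      case True
      have "(\<Sum>i\<le>k. m i * Poly_Mapping.lookup (snd (sg i)) l)
          = (\<Sum>i\<le>k. (if i = l - 1 then m i else 0) + (if i = k then - m i else 0))"
        using True lookup_snd_sg[OF _ True] by (intro sum.cong) auto
      also have "\<dots> = m (l - 1) - m k"
      proof -
        have "l - 1 \<le> k" using True by auto
        then show ?thesis by (simp add: sum.distrib)
      qed
      finally show ?thesis unfolding lhs snd_conv rhs using True by simp
    next
      case False
      then have "Poly_Mapping.lookup (snd (sg i)) l = 0" if "i \<le> k" for i
        using keys_snd_sg[OF that] by (auto simp: in_keys_iff)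
      then have "(\<Sum>i\<le>k. m i * Poly_Mapping.lookup (snd (sg i)) l) = 0" by simp
      then show ?thesis unfolding lhs snd_conv rhs using False by (simp only: if_False)
    qed
  qed
qed

lemma sum_sg_const: "(\<Sum>i\<le>k. \<mu> *\<^sub>R sg i) = (\<mu> *\<^sub>R e 0, 0)"
  by (simp add: sum_sg)

text \<open>The components \<open>snd (sg i)\<close> are the standard basis vectors and minus their
  sum, so in every linear relation among them all coefficients are equal.\<close>

lemma sum_sg_snd_zero:
  assumes "snd (\<Sum>i\<le>k. m i *\<^sub>R sg i) = 0" "i \<le> k"
  shows "m i = m k"
proof (cases "i = k")
  case False
  have "Poly_Mapping.lookup (\<Sum>l\<in>{1..k}. Poly_Mapping.single l (m (l - 1) - m k)) (i + 1) = m i - m k"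
    using False assms(2) by (simp add: lookup_sum lookup_single when_def)
  then show ?thesis using assms(1) by (simp add: sum_sg)
qed simp

definition lgen :: "'v set \<Rightarrow> nat set \<Rightarrow> nat set \<Rightarrow> ('v \<times> (nat \<Rightarrow>\<^sub>0 real)) set" where
  "lgen P A B = (\<lambda>u. (u, 0)) ` P \<union> tg ` A \<union> sg ` B"

lemma lgen_disjoint:
  assumes "P \<subseteq> R - \<Gamma>" "A \<subseteq> {..k}" "B \<subseteq> {..k}"
  shows "((\<lambda>u. (u, 0)) ` P \<union> tg ` A) \<inter> sg ` B = {}" "(\<lambda>u. (u, 0)) ` P \<inter> tg ` A = {}"
    "inj_on tg A" "inj_on sg B" "inj_on (\<lambda>u. (u, 0 :: nat \<Rightarrow>\<^sub>0 real)) P" "finite P" "finite A" "finite B"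
proof -
  have ne_lifted: "sg i \<noteq> (u, 0)" if "i \<in> B" "u \<in> P" for i u
    using sg_not_lifted[of i u] assms that by blast
  have ne_tg: "sg i \<noteq> tg j" if "i \<in> B" "j \<in> A" for i j
    using sg_neq_tg[of i j] assms that by blast
  have tg_ne: "tg i \<noteq> (u, 0)" if "i \<in> A" "u \<in> P" for i u
    using tg_not_lifted[of i u] assms that by blast
  show "((\<lambda>u. (u, 0)) ` P \<union> tg ` A) \<inter> sg ` B = {}"
  proof (rule equals0I)
    fix x assume "x \<in> ((\<lambda>u. (u, 0)) ` P \<union> tg ` A) \<inter> sg ` B"
    then consider i u where "i \<in> B" "u \<in> P" "x = sg i" "x = (u, 0)"
      | i j where "i \<in> B" "j \<in> A" "x = sg i" "x = tg j"
      by (elim IntE UnE imageE)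
    then show False
    proof cases
      case (1 i u)
      then show False using ne_lifted[of i u] by metis
    next
      case (2 i j)
      then show False using ne_tg[of i j] by metis
    qed
  qed
  show "(\<lambda>u. (u, 0)) ` P \<inter> tg ` A = {}"
  proof (rule equals0I)
    fix x assume "x \<in> (\<lambda>u. (u, 0)) ` P \<inter> tg ` A"
    then obtain u i where "u \<in> P" "i \<in> A" "x = (u, 0)" "x = tg i" by (elim IntE imageE)
    with tg_ne show False by simp
  qed
  show "inj_on tg A" "inj_on sg B" "inj_on (\<lambda>u. (u, 0 :: nat \<Rightarrow>\<^sub>0 real)) P"
    using assms tg_inj sg_inj by (auto simp: inj_on_def subset_iff)
  show "finite P" "finite A" "finite B"
    using assms finite_rays by (auto intro: finite_subset)
qed

lemma lgen_sum:
  assumes "P \<subseteq> R - \<Gamma>" "A \<subseteq> {..k}" "B \<subseteq> {..k}"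
  shows "(\<Sum>x\<in>lgen P A B. f x) = (\<Sum>u\<in>P. f (u, 0)) + (\<Sum>i\<in>A. f (tg i)) + (\<Sum>i\<in>B. f (sg i))"
  using lgen_disjoint[OF assms] unfolding lgen_def by (simp add: sum.union_disjoint sum.reindex)

lemma lgen_prod:
  assumes "P \<subseteq> R - \<Gamma>" "A \<subseteq> {..k}" "B \<subseteq> {..k}"
  shows "(\<Prod>x\<in>lgen P A B. f x) = (\<Prod>u\<in>P. f (u, 0)) * (\<Prod>i\<in>A. f (tg i)) * (\<Prod>i\<in>B. f (sg i))"
  using lgen_disjoint[OF assms] unfolding lgen_def by (simp add: prod.union_disjoint prod.reindex)

lemma card_lgen:
  assumes "P \<subseteq> R - \<Gamma>" "A \<subseteq> {..k}" "B \<subseteq> {..k}"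
  shows "card (lgen P A B) = card P + card A + card B"
  using lgen_sum[OF assms, of "\<lambda>_. 1::nat"] by simp

lemma finite_lgen: "P \<subseteq> R - \<Gamma> \<Longrightarrow> A \<subseteq> {..k} \<Longrightarrow> B \<subseteq> {..k} \<Longrightarrow> finite (lgen P A B)"
  unfolding lgen_def using finite_rays
  by (intro finite_UnI finite_imageI) (auto intro: finite_subset)

text \<open>The three kinds of generating cones in one format: \<open>A\<close> and \<open>B\<close>
  are the pair indices at which the t and the s generator occur. As \<open>sg i\<close> is the s
  generator numbered \<open>i + 1\<close>, the range \<open>j + 1..k + 1\<close> becomes
  \<open>{j..k}\<close>. With one edge ray, \<open>A\<close> is empty for \<open>j = 0\<close> and
  \<open>B\<close> for \<open>j = k + 1\<close>.\<close>

definition lift_index :: "'v set \<Rightarrow> nat set \<Rightarrow> nat set \<Rightarrow> bool" where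
  "lift_index \<sigma> A B \<longleftrightarrow> \<sigma> \<in> \<Sigma> \<and>
    (R \<inter> \<sigma> \<inter> \<Gamma> = {} \<and> A = {} \<and> B = {} \<or>
     (\<exists>j\<le>k + 1. R \<inter> \<sigma> \<inter> \<Gamma> = {e j} \<and> A = {..<j} \<and> B = {j..k}) \<or>
     (\<exists>j\<le>k. R \<inter> \<sigma> \<inter> \<Gamma> = {e j, e (j + 1)} \<and> A = {..j} \<and> B = {j..k}))"

definition lift_gens :: "'v set \<Rightarrow> nat set \<Rightarrow> nat set \<Rightarrow> ('v \<times> (nat \<Rightarrow>\<^sub>0 real)) set" where
  "lift_gens \<sigma> A B = lgen (R \<inter> \<sigma> - \<Gamma>) A B"

lemma lift_index_subset: "lift_index \<sigma> A B \<Longrightarrow> A \<subseteq> {..k} \<and> B \<subseteq> {..k}"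
  unfolding lift_index_def by auto

lemma finite_lift_gens: "lift_index \<sigma> A B \<Longrightarrow> finite (lift_gens \<sigma> A B)"
  unfolding lift_gens_def using lift_index_subset by (intro finite_lgen) blast+

lemma lifted_cones_eq:
  "lifted_cones N \<Sigma> \<Gamma> e k = {convex_cone hull (lift_gens \<sigma> A B) | \<sigma> A B. lift_index \<sigma> A B}"
proof -
  have im: "tg ` {..<j} = t_gen e k ` {0..<j}" "tg ` {..j} = t_gen e k ` {0..j}"
    "sg ` {j..k} = s_gen e k ` {j + 1..k + 1}" for j
  proof -
    show "tg ` {..<j} = t_gen e k ` {0..<j}" "tg ` {..j} = t_gen e k ` {0..j}"
      unfolding tg_def by auto
    have "sg ` {j..k} = s_gen e k ` Suc ` {j..k}" unfolding sg_def image_image by simp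
    then show "sg ` {j..k} = s_gen e k ` {j + 1..k + 1}" by (simp only: image_Suc_atLeastAtMost Suc_eq_plus1)
  qed
  have g1: "convex_cone hull (lift_gens \<sigma> {} {}) = \<sigma> \<times> {0}" if "\<sigma> \<in> \<Sigma>" "R \<inter> \<sigma> \<inter> \<Gamma> = {}" for \<sigma>
  proof -
    have "R \<inter> \<sigma> - \<Gamma> = R \<inter> \<sigma>" using that by blast
    then show ?thesis
      using cone_eq_hull_rays[OF that(1)] by (simp add: lift_gens_def lgen_def hull_lifted)
  qed
  have g2: "lift_gens \<sigma> {..<j} {j..k} = (\<lambda>u. (u, 0)) ` (R \<inter> \<sigma> - {e j}) \<union> t_gen e k ` {0..<j} \<union> s_gen e k ` {j + 1..k + 1}"
    if "R \<inter> \<sigma> \<inter> \<Gamma> = {e j}" for \<sigma> j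
  proof -
    have "R \<inter> \<sigma> - \<Gamma> = R \<inter> \<sigma> - {e j}" using that by blast
    then show ?thesis by (simp only: lift_gens_def lgen_def im)
  qed
  have g3: "lift_gens \<sigma> {..j} {j..k} = (\<lambda>u. (u, 0)) ` (R \<inter> \<sigma> - \<Gamma>) \<union> t_gen e k ` {0..j} \<union> s_gen e k ` {j + 1..k + 1}" for \<sigma> j
    by (simp only: lift_gens_def lgen_def im)
  show ?thesis
  proof
    show "lifted_cones N \<Sigma> \<Gamma> e k \<subseteq> {convex_cone hull (lift_gens \<sigma> A B) | \<sigma> A B. lift_index \<sigma> A B}"
    proof
      fix \<tau> assume "\<tau> \<in> lifted_cones N \<Sigma> \<Gamma> e k"
      then consider \<sigma> where "\<sigma> \<in> \<Sigma>" "R \<inter> \<sigma> \<inter> \<Gamma> = {}" "\<tau> = \<sigma> \<times> {0}"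
        | \<sigma> j where "\<sigma> \<in> \<Sigma>" "j \<le> k + 1" "R \<inter> \<sigma> \<inter> \<Gamma> = {e j}" "\<tau> = convex_cone hull ((\<lambda>u. (u, 0)) ` (R \<inter> \<sigma> - {e j})
            \<union> t_gen e k ` {0..<j} \<union> s_gen e k ` {j + 1..k + 1})"
        | \<sigma> j where "\<sigma> \<in> \<Sigma>" "j \<le> k" "R \<inter> \<sigma> \<inter> \<Gamma> = {e j, e (j + 1)}" "\<tau> = convex_cone hull ((\<lambda>u. (u, 0)) ` (R \<inter> \<sigma> - \<Gamma>)
            \<union> t_gen e k ` {0..j} \<union> s_gen e k ` {j + 1..k + 1})"
        unfolding lifted_cones_def by blast
      then show "\<tau> \<in> {convex_cone hull (lift_gens \<sigma> A B) | \<sigma> A B. lift_index \<sigma> A B}"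
      proof cases
        case 1
        then have "\<tau> = convex_cone hull (lift_gens \<sigma> {} {})" "lift_index \<sigma> {} {}"
          by (simp_all add: g1 lift_index_def)
        then show ?thesis by blast
      next
        case 2
        have "\<tau> = convex_cone hull (lift_gens \<sigma> {..<j} {j..k})" unfolding g2[OF 2(3)] 2(4) ..
        moreover have "lift_index \<sigma> {..<j} {j..k}" unfolding lift_index_def using 2 by blast
        ultimately show ?thesis by blast
      next
        case 3
        have "\<tau> = convex_cone hull (lift_gens \<sigma> {..j} {j..k})" unfolding g3 3(4) ..
        moreover have "lift_index \<sigma> {..j} {j..k}" unfolding lift_index_def using 3 by blast
        ultimately show ?thesis by blast
      qed
    qed
    show "{convex_cone hull (lift_gens \<sigma> A B) | \<sigma> A B. lift_index \<sigma> A B} \<subseteq> lifted_cones N \<Sigma> \<Gamma> e k"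
    proof safe
      fix \<sigma> A B assume "lift_index \<sigma> A B"
      then consider "\<sigma> \<in> \<Sigma>" "R \<inter> \<sigma> \<inter> \<Gamma> = {}" "A = {}" "B = {}"
        | j where "\<sigma> \<in> \<Sigma>" "j \<le> k + 1" "R \<inter> \<sigma> \<inter> \<Gamma> = {e j}" "A = {..<j}" "B = {j..k}"
        | j where "\<sigma> \<in> \<Sigma>" "j \<le> k" "R \<inter> \<sigma> \<inter> \<Gamma> = {e j, e (j + 1)}" "A = {..j}" "B = {j..k}"
        unfolding lift_index_def by blast
      then show "convex_cone hull (lift_gens \<sigma> A B) \<in> lifted_cones N \<Sigma> \<Gamma> e k"
      proof cases
        case 1
        then show ?thesis unfolding lifted_cones_def using g1 by auto
      next
        case 2
        show ?thesis unfolding 2(4,5) g2[OF 2(3)] lifted_cones_def using 2(1-3) by blast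
      next
        case 3
        show ?thesis unfolding 3(4,5) g3 lifted_cones_def using 3(1-3) by blast
      qed
    qed
  qed
qed

lemma lift_index_exists:
  assumes "\<sigma> \<in> \<Sigma>"
  shows "\<exists>A B. lift_index \<sigma> A B"
proof (rule cone_edge_cases[OF assms])
  assume "R \<inter> \<sigma> \<inter> \<Gamma> = {}"
  then have "lift_index \<sigma> {} {}" using assms by (simp add: lift_index_def)
  then show ?thesis by blast
next
  fix j assume "j \<le> k + 1" "R \<inter> \<sigma> \<inter> \<Gamma> = {e j}"
  then have "lift_index \<sigma> {..<j} {j..k}" using assms unfolding lift_index_def by blast
  then show ?thesis by blast
next
  fix j assume "j \<le> k" "R \<inter> \<sigma> \<inter> \<Gamma> = {e j, e (j + 1)}"
  then have "lift_index \<sigma> {..j} {j..k}" using assms unfolding lift_index_def by blast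
  then show ?thesis by blast
qed

text \<open>
  Relations among the lifted generators of a cone reduce to relations among the generators of the
  cone itself, because a combination of the \<open>s\<close> and \<open>t\<close> generators in \<open>N \<oplus> 0\<close> has equal total
  weight \<open>\<mu>\<close> on all pairs.
\<close>

lemma edge_combination:
  fixes a b :: "nat \<Rightarrow> real"
  assumes \<sigma>: "lift_index \<sigma> A B" and a: "\<And>i. i \<notin> A \<Longrightarrow> a i = 0" and b: "\<And>i. i \<notin> B \<Longrightarrow> b i = 0"
    and \<mu>: "\<And>i. i \<le> k \<Longrightarrow> a i + b i = \<mu>"
  shows "\<exists>d. \<mu> *\<^sub>R e 0 + (\<Sum>i\<le>k. a i) *\<^sub>R \<delta> = (\<Sum>u\<in>R \<inter> \<sigma> \<inter> \<Gamma>. d u *\<^sub>R u) \<and>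
    ((\<forall>i. 0 \<le> a i \<and> 0 \<le> b i) \<longrightarrow> (\<forall>u\<in>R \<inter> \<sigma> \<inter> \<Gamma>. 0 \<le> d u)) \<and>
    ((\<forall>u\<in>R \<inter> \<sigma> \<inter> \<Gamma>. d u = 0) \<longrightarrow> (\<forall>i\<le>k. a i = 0 \<and> b i = 0))"
  using \<sigma> unfolding lift_index_def
proof (elim conjE disjE exE)
  assume *: "R \<inter> \<sigma> \<inter> \<Gamma> = {}" "A = {}" "B = {}"
  then have z: "a i = 0" "b i = 0" for i using a b by auto
  then have "\<mu> = 0" using \<mu>[of 0] by simp
  then show ?thesis using z * by (intro exI[of _ "\<lambda>_. 0"]) simp
next
  \<comment> \<open>One edge ray: \<open>A\<close> and \<open>B\<close> are complementary, so every
    pair puts its whole weight \<open>\<mu>\<close> on one generator; \<open>j\<close> of these are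
    of type t, and the sum is \<open>\<mu>\<close> times \<open>e j\<close>.\<close>
  fix j assume *: "j \<le> k + 1" "R \<inter> \<sigma> \<inter> \<Gamma> = {e j}" "A = {..<j}" "B = {j..k}"
  have ai: "a i = (if i < j then \<mu> else 0)" if "i \<le> k" for i
    using a[of i] b[of i] \<mu>[OF that] * that by auto
  have "(\<Sum>i\<le>k. a i) = (\<Sum>i<j. \<mu>)"
    using *(1) by (intro sum.mono_neutral_cong_right) (auto simp: ai)
  then have eq: "\<mu> *\<^sub>R e 0 + (\<Sum>i\<le>k. a i) *\<^sub>R \<delta> = \<mu> *\<^sub>R e j"
    using e_eq[OF *(1)] by (simp add: algebra_simps)
  have "0 \<le> \<mu>" if "\<forall>i. 0 \<le> a i \<and> 0 \<le> b i"
    using that \<mu>[of 0] by (metis add_nonneg_nonneg le0)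
  moreover have "a i = 0 \<and> b i = 0" if "\<mu> = 0" "i \<le> k" for i
    using ai[OF that(2)] \<mu>[OF that(2)] that(1) by (simp split: if_splits)
  ultimately show ?thesis
    unfolding *(2) using eq by (intro exI[of _ "\<lambda>_. \<mu>"]) simp
next
  \<comment> \<open>Two edge rays: the only pair with both generators is \<open>j\<close>, and its
    split of \<open>\<mu>\<close> into \<open>b j\<close> and \<open>a j\<close> gives the
    coefficients of \<open>e j\<close> and \<open>e (j + 1)\<close>.\<close>
  fix j assume *: "j \<le> k" "R \<inter> \<sigma> \<inter> \<Gamma> = {e j, e (j + 1)}" "A = {..j}" "B = {j..k}"
  have ai: "a i = (if i < j then \<mu> else if i = j then a j else 0)" if "i \<le> k" for i
    using a[of i] b[of i] \<mu>[OF that] * that by auto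
  have ne: "e j \<noteq> e (j + 1)" using * e_inj by simp
  have "(\<Sum>i\<le>k. a i) = (\<Sum>i<Suc j. a i)"
    using *(1) a *(3) by (intro sum.mono_neutral_right) auto
  also have "\<dots> = (\<Sum>i<j. a i) + a j" by simp
  also have "(\<Sum>i<j. a i) = (\<Sum>i<j. \<mu>)"
    using *(1) by (intro sum.cong) (auto simp: ai)
  finally have sa: "(\<Sum>i\<le>k. a i) = real j * \<mu> + a j" by simp
  have \<mu>j: "\<mu> = a j + b j" using \<mu>[OF *(1)] by simp
  have ej: "e j = e 0 + real j *\<^sub>R \<delta>" "e (j + 1) = e 0 + real j *\<^sub>R \<delta> + \<delta>"
    using e_eq[of j] e_Suc[of j] *(1) by simp_all
  have eq: "\<mu> *\<^sub>R e 0 + (\<Sum>i\<le>k. a i) *\<^sub>R \<delta> = b j *\<^sub>R e j + a j *\<^sub>R e (j + 1)"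
    unfolding sa ej \<mu>j by (simp add: algebra_simps)
  define d where "d u = (if u = e j then b j else a j)" for u
  have d: "d (e j) = b j" "d (e (j + 1)) = a j" using ne by (simp_all add: d_def)
  have "\<mu> *\<^sub>R e 0 + (\<Sum>i\<le>k. a i) *\<^sub>R \<delta> = (\<Sum>u\<in>R \<inter> \<sigma> \<inter> \<Gamma>. d u *\<^sub>R u)"
    unfolding eq *(2) using ne d by simp
  moreover have "(\<forall>i. 0 \<le> a i \<and> 0 \<le> b i) \<longrightarrow> (\<forall>u\<in>R \<inter> \<sigma> \<inter> \<Gamma>. 0 \<le> d u)"
    by (simp add: d_def)
  moreover have "(\<forall>u\<in>R \<inter> \<sigma> \<inter> \<Gamma>. d u = 0) \<longrightarrow> (\<forall>i\<le>k. a i = 0 \<and> b i = 0)"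
  proof
    assume "\<forall>u\<in>R \<inter> \<sigma> \<inter> \<Gamma>. d u = 0"
    then have z: "b j = 0" "a j = 0" using d unfolding *(2) by simp_all
    show "\<forall>i\<le>k. a i = 0 \<and> b i = 0"
    proof (intro allI impI)
      fix i assume "i \<le> k"
      then show "a i = 0 \<and> b i = 0" using ai[of i] \<mu>[of i] z \<mu>j by (simp split: if_splits)
    qed
  qed
  ultimately show ?thesis by blast
qed

text \<open>Adds the generators outside the edge to \<open>edge_combination\<close>. Nonnegativity
  of \<open>d\<close> will give cone membership, and the last clause linear independence.\<close>

lemma lift_combination:
  assumes \<sigma>: "lift_index \<sigma> A B" and x: "x = (\<Sum>y\<in>lift_gens \<sigma> A B. c y *\<^sub>R y)" and x0: "snd x = 0"
  shows "\<exists>d. fst x = (\<Sum>u\<in>R \<inter> \<sigma> - \<Gamma>. c (u, 0) *\<^sub>R u) + (\<Sum>u\<in>R \<inter> \<sigma> \<inter> \<Gamma>. d u *\<^sub>R u) \<and>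
    ((\<forall>y\<in>lift_gens \<sigma> A B. 0 \<le> c y) \<longrightarrow> (\<forall>u\<in>R \<inter> \<sigma> \<inter> \<Gamma>. 0 \<le> d u)) \<and>
    ((\<forall>u\<in>R \<inter> \<sigma> \<inter> \<Gamma>. d u = 0) \<longrightarrow> (\<forall>i\<in>A. c (tg i) = 0) \<and> (\<forall>i\<in>B. c (sg i) = 0))"
proof -
  define a where "a i = (if i \<in> A then c (tg i) else 0)" for i
  define b where "b i = (if i \<in> B then c (sg i) else 0)" for i
  note AB = lift_index_subset[OF \<sigma>]
  have "x = (\<Sum>u\<in>R \<inter> \<sigma> - \<Gamma>. c (u, 0) *\<^sub>R (u, 0)) + (\<Sum>i\<in>A. c (tg i) *\<^sub>R tg i) + (\<Sum>i\<in>B. c (sg i) *\<^sub>R sg i)"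
    unfolding x lift_gens_def using AB by (intro lgen_sum) auto
  also have "(\<Sum>i\<in>A. c (tg i) *\<^sub>R tg i) = (\<Sum>i\<le>k. a i *\<^sub>R tg i)"
    using AB by (intro sum.mono_neutral_cong_left) (auto simp: a_def)
  also have "(\<Sum>i\<in>B. c (sg i) *\<^sub>R sg i) = (\<Sum>i\<le>k. b i *\<^sub>R sg i)"
    using AB by (intro sum.mono_neutral_cong_left) (auto simp: b_def)
  also have "(\<Sum>i\<le>k. a i *\<^sub>R tg i) = (\<Sum>i\<le>k. a i *\<^sub>R sg i) + ((\<Sum>i\<le>k. a i) *\<^sub>R \<delta>, 0)"
  proof -
    have "(\<Sum>i\<le>k. a i *\<^sub>R tg i) = (\<Sum>i\<le>k. a i *\<^sub>R sg i) + (\<Sum>i\<le>k. a i) *\<^sub>R (\<delta>, 0)"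
      by (simp only: tg_eq scaleR_add_right sum.distrib scaleR_sum_left)
    then show ?thesis by simp
  qed
  finally have xeq: "x = (\<Sum>u\<in>R \<inter> \<sigma> - \<Gamma>. c (u, 0) *\<^sub>R (u, 0)) + ((\<Sum>i\<le>k. a i) *\<^sub>R \<delta>, 0)
      + (\<Sum>i\<le>k. (a i + b i) *\<^sub>R sg i)"
    by (simp add: scaleR_add_left sum.distrib algebra_simps)
  have fst_c: "fst (\<Sum>u\<in>R \<inter> \<sigma> - \<Gamma>. c (u, 0) *\<^sub>R (u, 0 :: nat \<Rightarrow>\<^sub>0 real)) = (\<Sum>u\<in>R \<inter> \<sigma> - \<Gamma>. c (u, 0) *\<^sub>R u)"
    by (simp add: fst_sum)
  have snd_c: "snd (\<Sum>u\<in>R \<inter> \<sigma> - \<Gamma>. c (u, 0) *\<^sub>R (u, 0 :: nat \<Rightarrow>\<^sub>0 real)) = 0"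
    by (simp add: snd_sum)
  define \<mu> where "\<mu> = a k + b k"
  have \<mu>: "a i + b i = \<mu>" if "i \<le> k" for i
  proof -
    have "snd x = snd (\<Sum>u\<in>R \<inter> \<sigma> - \<Gamma>. c (u, 0) *\<^sub>R (u, 0 :: nat \<Rightarrow>\<^sub>0 real)) + 0
        + snd (\<Sum>i\<le>k. (a i + b i) *\<^sub>R sg i)"
      unfolding xeq by (simp only: snd_add snd_conv)
    then have "snd (\<Sum>i\<le>k. (a i + b i) *\<^sub>R sg i) = 0"
      using x0 unfolding snd_c by simp
    then show ?thesis unfolding \<mu>_def using sum_sg_snd_zero[of "\<lambda>i. a i + b i"] that by blast
  qed
  have "fst x = (\<Sum>u\<in>R \<inter> \<sigma> - \<Gamma>. c (u, 0) *\<^sub>R u) + (\<mu> *\<^sub>R e 0 + (\<Sum>i\<le>k. a i) *\<^sub>R \<delta>)"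
  proof -
    have "(\<Sum>i\<le>k. (a i + b i) *\<^sub>R sg i) = (\<Sum>i\<le>k. \<mu> *\<^sub>R sg i)"
      by (rule sum.cong) (auto simp: \<mu>)
    then have "fst (\<Sum>i\<le>k. (a i + b i) *\<^sub>R sg i) = \<mu> *\<^sub>R e 0" by (simp add: sum_sg_const)
    moreover have "fst x = fst (\<Sum>u\<in>R \<inter> \<sigma> - \<Gamma>. c (u, 0) *\<^sub>R (u, 0 :: nat \<Rightarrow>\<^sub>0 real))
        + (\<Sum>i\<le>k. a i) *\<^sub>R \<delta> + fst (\<Sum>i\<le>k. (a i + b i) *\<^sub>R sg i)"
      unfolding xeq by (simp only: fst_add fst_conv)
    ultimately show ?thesis unfolding fst_c by (simp add: add_ac)
  qed
  moreover have "\<exists>d. \<mu> *\<^sub>R e 0 + (\<Sum>i\<le>k. a i) *\<^sub>R \<delta> = (\<Sum>u\<in>R \<inter> \<sigma> \<inter> \<Gamma>. d u *\<^sub>R u) \<and>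
    ((\<forall>i. 0 \<le> a i \<and> 0 \<le> b i) \<longrightarrow> (\<forall>u\<in>R \<inter> \<sigma> \<inter> \<Gamma>. 0 \<le> d u)) \<and>
    ((\<forall>u\<in>R \<inter> \<sigma> \<inter> \<Gamma>. d u = 0) \<longrightarrow> (\<forall>i\<le>k. a i = 0 \<and> b i = 0))"
    by (rule edge_combination[OF \<sigma>]) (simp_all add: a_def b_def \<mu>[unfolded a_def b_def])
  then obtain d where d: "\<mu> *\<^sub>R e 0 + (\<Sum>i\<le>k. a i) *\<^sub>R \<delta> = (\<Sum>u\<in>R \<inter> \<sigma> \<inter> \<Gamma>. d u *\<^sub>R u)"
    "(\<forall>i. 0 \<le> a i \<and> 0 \<le> b i) \<longrightarrow> (\<forall>u\<in>R \<inter> \<sigma> \<inter> \<Gamma>. 0 \<le> d u)"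
    "(\<forall>u\<in>R \<inter> \<sigma> \<inter> \<Gamma>. d u = 0) \<longrightarrow> (\<forall>i\<le>k. a i = 0 \<and> b i = 0)"
    by (elim exE conjE)
  moreover have "(\<forall>y\<in>lift_gens \<sigma> A B. 0 \<le> c y) \<longrightarrow> (\<forall>i. 0 \<le> a i \<and> 0 \<le> b i)"
    by (simp add: a_def b_def lift_gens_def lgen_def)
  moreover have "(\<forall>i\<le>k. a i = 0 \<and> b i = 0) \<longrightarrow> (\<forall>i\<in>A. c (tg i) = 0) \<and> (\<forall>i\<in>B. c (sg i) = 0)"
  proof (intro impI conjI ballI)
    assume z: "\<forall>i\<le>k. a i = 0 \<and> b i = 0"
    show "c (tg i) = 0" if "i \<in> A" for i
      using z[rule_format, of i] that AB by (auto simp: a_def)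
    show "c (sg i) = 0" if "i \<in> B" for i
      using z[rule_format, of i] that AB by (auto simp: b_def)
  qed
  ultimately show ?thesis by (intro exI[of _ d] conjI) (simp only:, blast+)
qed

lemma lift_hull_in_cone:
  assumes \<sigma>: "lift_index \<sigma> A B" and p: "(p, 0) \<in> convex_cone hull (lift_gens \<sigma> A B)"
  shows "p \<in> \<sigma>"
proof -
  have \<sigma>\<Sigma>: "\<sigma> \<in> \<Sigma>" using \<sigma> by (simp add: lift_index_def)
  obtain c where c: "(p, 0) = (\<Sum>y\<in>lift_gens \<sigma> A B. c y *\<^sub>R y)" "\<forall>y\<in>lift_gens \<sigma> A B. 0 \<le> c y"
    using p unfolding convex_cone_hull_finite[OF finite_lift_gens[OF \<sigma>]] by blast
  obtain d where d: "fst (p, 0 :: nat \<Rightarrow>\<^sub>0 real) = (\<Sum>u\<in>R \<inter> \<sigma> - \<Gamma>. c (u, 0) *\<^sub>R u) + (\<Sum>u\<in>R \<inter> \<sigma> \<inter> \<Gamma>. d u *\<^sub>R u)"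
      "(\<forall>y\<in>lift_gens \<sigma> A B. 0 \<le> c y) \<longrightarrow> (\<forall>u\<in>R \<inter> \<sigma> \<inter> \<Gamma>. 0 \<le> d u)"
    using lift_combination[OF \<sigma> c(1) snd_conv] by (elim exE conjE)
  have "0 \<le> c (u, 0)" if "u \<in> R \<inter> \<sigma> - \<Gamma>" for u
    using that c(2) by (auto simp: lift_gens_def lgen_def)
  then have "(\<Sum>u\<in>R \<inter> \<sigma> - \<Gamma>. c (u, 0) *\<^sub>R u) \<in> \<sigma>"
    using convex_cone_fan[OF \<sigma>\<Sigma>] by (intro convex_cone_sum convex_cone_scaleR) auto
  moreover have "(\<Sum>u\<in>R \<inter> \<sigma> \<inter> \<Gamma>. d u *\<^sub>R u) \<in> \<sigma>"
    using d(2) c(2) convex_cone_fan[OF \<sigma>\<Sigma>] by (intro convex_cone_sum convex_cone_scaleR) auto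
  ultimately show ?thesis
    using d(1) convex_cone_add[OF convex_cone_fan[OF \<sigma>\<Sigma>]] by simp
qed

text \<open>A relation has zero second component, so \<open>lift_combination\<close> turns it into a
  relation among the independent rays of \<open>\<sigma>\<close>; the vanishing of its coefficients
  forces the lifted ones to vanish.\<close>

lemma independent_lift_gens:
  assumes \<sigma>: "lift_index \<sigma> A B"
  shows "independent (lift_gens \<sigma> A B)"
proof -
  have \<sigma>\<Sigma>: "\<sigma> \<in> \<Sigma>" using \<sigma> by (simp add: lift_index_def)
  note fin = finite_lift_gens[OF \<sigma>]
  have "c y = 0" if c: "(\<Sum>y\<in>lift_gens \<sigma> A B. c y *\<^sub>R y) = 0" and y: "y \<in> lift_gens \<sigma> A B" for c y
  proof -
    obtain d where d: "fst (0 :: 'v \<times> (nat \<Rightarrow>\<^sub>0 real)) = (\<Sum>u\<in>R \<inter> \<sigma> - \<Gamma>. c (u, 0) *\<^sub>R u) + (\<Sum>u\<in>R \<inter> \<sigma> \<inter> \<Gamma>. d u *\<^sub>R u)"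
      "(\<forall>u\<in>R \<inter> \<sigma> \<inter> \<Gamma>. d u = 0) \<longrightarrow> (\<forall>i\<in>A. c (tg i) = 0) \<and> (\<forall>i\<in>B. c (sg i) = 0)"
      using lift_combination[OF \<sigma> c[symmetric] snd_zero] by (elim exE conjE)
    define d' where "d' u = (if u \<in> \<Gamma> then d u else c (u, 0))" for u
    have "(\<Sum>u\<in>R \<inter> \<sigma>. d' u *\<^sub>R u) = (\<Sum>u\<in>R \<inter> \<sigma> - \<Gamma>. d' u *\<^sub>R u) + (\<Sum>u\<in>R \<inter> \<sigma> \<inter> \<Gamma>. d' u *\<^sub>R u)"
      using finite_rays by (subst sum.union_disjoint[symmetric]) (auto intro!: sum.cong)
    also have "\<dots> = 0" using d(1) by (simp add: d'_def)
    finally have "\<forall>u\<in>R \<inter> \<sigma>. d' u = 0"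
      using independent_cone_rays[OF \<sigma>\<Sigma>] finite_rays
      by (subst (asm) dependent_finite) (auto simp: dependent_finite)
    then have d0: "d' u = 0" if "u \<in> R \<inter> \<sigma>" for u using that by blast
    have "\<forall>u\<in>R \<inter> \<sigma> \<inter> \<Gamma>. d u = 0" "\<forall>u\<in>R \<inter> \<sigma> - \<Gamma>. c (u, 0) = 0"
      using d0 by (fastforce simp: d'_def)+
    then show ?thesis using d(2) y by (auto simp: lift_gens_def lgen_def)
  qed
  then show ?thesis unfolding dependent_finite[OF fin] by blast
qed

end

section \<open>The Krull dimension of the base variety\<close>

lemma lattice_dual_multiples:
  fixes N :: "'v::euclidean_space set"
  assumes N: "is_lattice N" "span N = UNIV" and S: "S \<subseteq> N" "independent S" "span S = UNIV"
  shows "\<exists>M>0. \<forall>b :: 'v \<Rightarrow> nat. \<exists>m\<in>dual_lattice N. \<forall>u\<in>S. blinfun_apply m u = real (M * b u)"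
proof -
  obtain B f where B: "lattice_coords N B f"
    using lattice_coordinates[OF N(1)] by blast
  note D = lattice_coordsD[OF B]
  have spanB: "span B = UNIV"
    using span_mono[OF D(4)] N(2) by (simp add: span_span top.extremum_unique)
  have Blin: "blinfun_apply (Blinfun (f b)) = f b" for b
    using D(5)[of b] by (intro bounded_linear_Blinfun_apply) (simp add: linear_conv_bounded_linear)
  have "card S = DIM('v)" "card B = DIM('v)"
    using dim_eq_card_independent[OF S(2)] dim_eq_card_independent[OF D(2)]
      dim_eq_full[of S] dim_eq_full[of B] S(3) spanB by simp_all
  then have card: "card S = card B" by simp
  have l: "Blinfun (f b) \<in> dual_lattice N" if "b \<in> B" for b
    using D(7)[OF that] by (simp add: dual_lattice_def Blin)
  have b1: "b \<in> span S" for b by (simp add: S(3))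
  have b2: "blinfun_apply (Blinfun (f b)) b' = (if b = b' then 1 else 0)" if "b \<in> B" "b' \<in> B" for b b'
    using D(6)[OF that] by (simp add: Blin)
  obtain M :: nat where "M > 0"
    "\<And>b :: 'v \<Rightarrow> nat. \<exists>m\<in>dual_lattice N. \<forall>u\<in>S. blinfun_apply m u = real (M * b u)"
    using dual_lattice_multiples[where \<beta>="\<lambda>b. b" and l="\<lambda>b. Blinfun (f b)", OF D(1) l b1 b2 S(1) finiteI_independent[OF S(2)] card]
    by blast
  then show ?thesis by blast
qed

context complete_simplicial
begin

lemma full_cone_spans:
  assumes "\<sigma> \<in> \<Sigma>" "card (R \<inter> \<sigma>) = DIM('v)"
  shows "span (R \<inter> \<sigma>) = UNIV"
  using dim_eq_card_independent[OF independent_cone_rays[OF assms(1)]] assms(2) dim_eq_full[of "R \<inter> \<sigma>"] by simp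

lemma span_R: "span R = UNIV"
proof -
  obtain \<sigma> where "\<sigma> \<in> \<Sigma>" "card (R \<inter> \<sigma>) = DIM('v)" using mem_full_cone[of 0] by blast
  then have "span (R \<inter> \<sigma>) = UNIV" by (rule full_cone_spans)
  then show ?thesis using span_mono[of "R \<inter> \<sigma>" R] by auto
qed

lemma has_krull_dim_X: "has_krull_dim (zar X) DIM('v)"
  unfolding has_krull_dim_def
proof (intro conjI allI impI)
  obtain \<sigma> where "\<sigma> \<in> \<Sigma>" "card (R \<inter> \<sigma>) = DIM('v)" using mem_full_cone[of 0] by blast
  then show "irreducible_chain (zar X) DIM('v)" by (rule chain_lower_bound)
  fix m assume m: "irreducible_chain (zar X) m"
  have "m \<le> dim R"
  proof (rule chain_upper_bound[OF independent_cone_rays _ m])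
    fix S assume S: "S \<subseteq> R" "independent S" "R \<subseteq> span S"
    have "span S = UNIV"
      using span_mono[OF S(3)] span_R by (simp add: span_span top.extremum_unique)
    then show "\<exists>M>0. \<forall>b :: 'v \<Rightarrow> nat. \<exists>m\<in>dual_lattice N. \<forall>u\<in>S. blinfun_apply m u = real (M * b u)"
      using S rays_subset_lattice by (intro lattice_dual_multiples[OF lattice spanN]) auto
  qed
  also have "dim R = DIM('v)" using span_R by (simp add: dim_eq_full)
  finally show "m \<le> DIM('v)" .
qed

end

section \<open>The rays of the lifted fan and their incidence with its cones\<close>

context fan_with_edge
begin

text \<open>The s generators sum to \<open>(e 0, 0)\<close>, and each replacement of s by t adds one
  lattice step \<open>\<delta>\<close>; only the number of replacements matters.\<close>

lemma sum_pairs: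
  assumes "Q \<subseteq> {..k}"
  shows "(\<Sum>i\<le>k. if i \<in> Q then tg i else sg i) = (e (card Q), 0)"
proof -
  have "(\<Sum>i\<le>k. if i \<in> Q then tg i else sg i) = (\<Sum>i\<le>k. 1 *\<^sub>R sg i) + (\<Sum>i\<le>k. if i \<in> Q then (\<delta>, 0) else 0)"
    unfolding sum.distrib[symmetric] by (rule sum.cong) (auto simp: tg_eq)
  also have "(\<Sum>i\<le>k. if i \<in> Q then (\<delta>, 0) else 0) = (\<Sum>i\<in>Q. (\<delta>, 0 :: nat \<Rightarrow>\<^sub>0 real))"
    using assms by (intro sum.mono_neutral_cong_right) auto
  also have "\<dots> = (real (card Q) *\<^sub>R \<delta>, 0)"
    by (simp add: sum_constant_scaleR scaleR_prod_def)
  also have "(\<Sum>i\<le>k. 1 *\<^sub>R sg i) = (e 0, 0)"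
    unfolding sum_sg_const by simp
  finally have "(\<Sum>i\<le>k. if i \<in> Q then tg i else sg i) = (e 0 + real (card Q) *\<^sub>R \<delta>, 0)"
    by simp
  moreover have "card Q \<le> k + 1" using card_mono[OF _ assms] by simp
  ultimately show ?thesis using e_eq[of "card Q"] by simp
qed

lemma pairs_mem_cone:
  assumes "Q \<subseteq> {..k}" "convex_cone C" "\<And>i. i \<in> Q \<Longrightarrow> tg i \<in> C" "\<And>i. i \<le> k \<Longrightarrow> i \<notin> Q \<Longrightarrow> sg i \<in> C"
  shows "(e (card Q), 0) \<in> C"
  unfolding sum_pairs[OF assms(1), symmetric]
  by (rule convex_cone_sum[OF assms(2)]) (use assms(3,4) in auto)

lemma sg_lift_mem: "i \<in> B \<Longrightarrow> sg i \<in> convex_cone hull (lift_gens \<sigma> A B)"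
  by (rule hull_inc) (simp add: lift_gens_def lgen_def)

lemma tg_lift_mem: "i \<in> A \<Longrightarrow> tg i \<in> convex_cone hull (lift_gens \<sigma> A B)"
  by (rule hull_inc) (simp add: lift_gens_def lgen_def)

lemma lift_empty_snd:
  assumes "x \<in> convex_cone hull (lift_gens \<sigma> {} {})"
  shows "snd x = 0"
  using assms by (auto simp: lift_gens_def lgen_def hull_lifted)

text \<open>
  The sum over all pairs of one generator from each is a lattice point of the edge; exchanging the
  generator of one pair for its partner moves that point along the edge, out of the cone.
\<close>

lemma sg_mem_lift:
  assumes \<sigma>: "lift_index \<sigma> A B" and i: "i \<le> k" and s: "sg i \<in> convex_cone hull (lift_gens \<sigma> A B)"
  shows "i \<in> B"
proof (rule ccontr)
  assume nB: "i \<notin> B"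
  let ?C = "convex_cone hull (lift_gens \<sigma> A B)"
  have no: "j \<le> k + 1 \<Longrightarrow> (e j, 0) \<in> ?C \<Longrightarrow> e j \<in> R \<inter> \<sigma> \<inter> \<Gamma>" for j
    using lift_hull_in_cone[OF \<sigma>] e_mem by blast
  \<comment> \<open>Of the \<open>j\<close> t generators below \<open>j\<close>, the one at
    \<open>i\<close> is exchanged for \<open>sg i\<close>, so \<open>j - 1\<close> remain and the
    cone would contain \<open>(e (j - 1), 0)\<close>.\<close>
  have shift: False if j: "A \<supseteq> {..<j}" "B \<supseteq> {j..k}" "j \<le> k + 1" "e (j - 1) \<notin> R \<inter> \<sigma> \<inter> \<Gamma>" for j
  proof -
    have ij: "i < j" using j(2) nB i by (metis atLeastAtMost_iff not_le subsetD)
    have "(e (card ({..<j} - {i})), 0) \<in> ?C"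
    proof (rule pairs_mem_cone[OF _ convex_cone_convex_cone_hull])
      show "{..<j} - {i} \<subseteq> {..k}" using j(3) by auto
      show "tg l \<in> ?C" if "l \<in> {..<j} - {i}" for l using that j(1) by (intro tg_lift_mem) auto
      show "sg l \<in> ?C" if "l \<le> k" "l \<notin> {..<j} - {i}" for l
      proof (cases "l = i")
        case False
        then have "l \<in> B" using that j(2) by auto
        then show ?thesis by (rule sg_lift_mem)
      qed (use s in simp)
    qed
    moreover have "card ({..<j} - {i}) = j - 1" using ij by simp
    ultimately show False using no[of "j - 1"] j(3,4) by simp
  qed
  from \<sigma> show False
    unfolding lift_index_def
  proof (elim conjE disjE exE)
    assume *: "R \<inter> \<sigma> \<inter> \<Gamma> = {}" "A = {}" "B = {}"
    then have "snd (sg i) = 0" using s lift_empty_snd by blast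
    then have eq: "sg i = (e 0, 0)" using sg_zero_edge[OF i, of "fst (sg i)"] by (metis prod.collapse)
    have "(e 0, 0) \<in> ?C" using s unfolding eq .
    then have "e 0 \<in> R \<inter> \<sigma> \<inter> \<Gamma>" by (rule no[rotated]) simp
    then show False using *(1) by blast
  next
    fix j assume *: "j \<le> k + 1" "R \<inter> \<sigma> \<inter> \<Gamma> = {e j}" "A = {..<j}" "B = {j..k}"
    show False
    proof (rule shift[of j])
      have "0 < j" using * nB i by (cases j) auto
      then show "e (j - 1) \<notin> R \<inter> \<sigma> \<inter> \<Gamma>" using * e_inj[of "j - 1" j] by (cases j) simp_all
    qed (use * in auto)
  next
    fix j assume *: "j \<le> k" "R \<inter> \<sigma> \<inter> \<Gamma> = {e j, e (j + 1)}" "A = {..j}" "B = {j..k}"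
    show False
    proof (rule shift[of j])
      have "0 < j" using * nB i by (cases j) auto
      then show "e (j - 1) \<notin> R \<inter> \<sigma> \<inter> \<Gamma>" using * e_inj[of "j - 1" j] e_inj[of "j - 1" "j + 1"] by (cases j) simp_all
    qed (use * in auto)
  qed
qed

lemma tg_mem_lift:
  assumes \<sigma>: "lift_index \<sigma> A B" and i: "i \<le> k" and t: "tg i \<in> convex_cone hull (lift_gens \<sigma> A B)"
  shows "i \<in> A"
proof (rule ccontr)
  assume nA: "i \<notin> A"
  let ?C = "convex_cone hull (lift_gens \<sigma> A B)"
  have no: "j \<le> k + 1 \<Longrightarrow> (e j, 0) \<in> ?C \<Longrightarrow> e j \<in> R \<inter> \<sigma> \<inter> \<Gamma>" for j
    using lift_hull_in_cone[OF \<sigma>] e_mem by blast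
  \<comment> \<open>Here \<open>tg i\<close> replaces an s generator with \<open>j \<le> i\<close>,
    so the number of t generators rises to \<open>j + 1\<close>.\<close>
  have shift: False if j: "A \<supseteq> {..<j}" "B \<supseteq> {j..k}" "e (j + 1) \<notin> R \<inter> \<sigma> \<inter> \<Gamma>" for j
  proof -
    have ij: "j \<le> i" using j(1) nA by (metis lessThan_iff not_le subsetD)
    have "(e (card (insert i {..<j})), 0) \<in> ?C"
    proof (rule pairs_mem_cone[OF _ convex_cone_convex_cone_hull])
      show "insert i {..<j} \<subseteq> {..k}" using ij i by auto
      show "tg l \<in> ?C" if "l \<in> insert i {..<j}" for l
      proof (cases "l = i")
        case False
        then have "l \<in> A" using that j(1) by auto
        then show ?thesis by (rule tg_lift_mem)
      qed (use t in simp)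
      show "sg l \<in> ?C" if "l \<le> k" "l \<notin> insert i {..<j}" for l
        using that j(2) by (intro sg_lift_mem) auto
    qed
    moreover have "card (insert i {..<j}) = j + 1" using ij by simp
    ultimately show False using no[of "j + 1"] j(3) ij i by simp
  qed
  from \<sigma> show False
    unfolding lift_index_def
  proof (elim conjE disjE exE)
    assume *: "R \<inter> \<sigma> \<inter> \<Gamma> = {}" "A = {}" "B = {}"
    then have "snd (tg i) = 0" using t lift_empty_snd by blast
    then have eq: "tg i = (e 1, 0)" using tg_zero_edge[OF i, of "fst (tg i)"] by (metis prod.collapse)
    have "(e 1, 0) \<in> ?C" using t unfolding eq .
    then have "e 1 \<in> R \<inter> \<sigma> \<inter> \<Gamma>" by (rule no[rotated]) simp
    then show False using *(1) by blast
  next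
    fix j assume *: "j \<le> k + 1" "R \<inter> \<sigma> \<inter> \<Gamma> = {e j}" "A = {..<j}" "B = {j..k}"
    show False
    proof (rule shift[of j])
      have "j \<le> k" using * nA i by auto
      then show "e (j + 1) \<notin> R \<inter> \<sigma> \<inter> \<Gamma>" using * e_inj[of "j + 1" j] by simp
    qed (use * in auto)
  next
    fix j assume *: "j \<le> k" "R \<inter> \<sigma> \<inter> \<Gamma> = {e j, e (j + 1)}" "A = {..j}" "B = {j..k}"
    have ij: "j < i" using * nA by auto
    show False
    \<comment> \<open>At the overlapping pair the t generator is used, so the cut moves to
      \<open>j + 1\<close> and the forbidden point is \<open>e (j + 2)\<close>; it exists because
      \<open>j < i\<close> and \<open>i \<le> k\<close>.\<close>
    proof (rule shift[of "j + 1"])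
      show "e (j + 1 + 1) \<notin> R \<inter> \<sigma> \<inter> \<Gamma>"
        using * ij i e_inj[of "j + 2" j] e_inj[of "j + 2" "j + 1"] by simp
    qed (use * in auto)
  qed
qed

definition all_gens :: "('v \<times> (nat \<Rightarrow>\<^sub>0 real)) set" where
  "all_gens = lgen (R - \<Gamma>) {..k} {..k}"

lemma all_gens_cases:
  assumes "g \<in> all_gens"
  obtains u where "g = (u, 0)" "u \<in> R - \<Gamma>" | i where "g = tg i" "i \<le> k" | i where "g = sg i" "i \<le> k"
  using assms unfolding all_gens_def lgen_def by blast

lemma all_gens_iff:
  "g \<in> all_gens \<longleftrightarrow> (\<exists>u\<in>R - \<Gamma>. g = (u, 0)) \<or> (\<exists>i\<le>k. g = tg i) \<or> (\<exists>i\<le>k. g = sg i)"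
  unfolding all_gens_def lgen_def by blast

lemma lift_gens_subset:
  assumes "lift_index \<sigma> A B"
  shows "lift_gens \<sigma> A B \<subseteq> all_gens"
  using lift_index_subset[OF assms] unfolding lift_gens_def all_gens_def lgen_def by blast

text \<open>The chart of a cone is determined by the rays inside it, so it must be known that the
  hull captures no generators beyond the listed ones.\<close>

lemma all_gens_Int_lift:
  assumes \<sigma>: "lift_index \<sigma> A B"
  shows "all_gens \<inter> convex_cone hull (lift_gens \<sigma> A B) = lift_gens \<sigma> A B"
proof
  show "lift_gens \<sigma> A B \<subseteq> all_gens \<inter> convex_cone hull (lift_gens \<sigma> A B)"
    using lift_gens_subset[OF \<sigma>] by (auto intro: hull_inc)
  show "all_gens \<inter> convex_cone hull (lift_gens \<sigma> A B) \<subseteq> lift_gens \<sigma> A B"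
  proof
    fix g assume g: "g \<in> all_gens \<inter> convex_cone hull (lift_gens \<sigma> A B)"
    then have "g \<in> all_gens" by simp
    then show "g \<in> lift_gens \<sigma> A B"
    proof (cases rule: all_gens_cases)
      case (1 u)
      then have "u \<in> \<sigma>" using g lift_hull_in_cone[OF \<sigma>] by blast
      then show ?thesis using 1 by (auto simp: lift_gens_def lgen_def)
    next
      case (2 i)
      then have "i \<in> A" using g tg_mem_lift[OF \<sigma>] by blast
      then show ?thesis using 2 by (auto simp: lift_gens_def lgen_def)
    next
      case (3 i)
      then have "i \<in> B" using g sg_mem_lift[OF \<sigma>] by blast
      then show ?thesis using 3 by (auto simp: lift_gens_def lgen_def)
    qed
  qed
qed

lemma mem_N'_iff:
  "x \<in> N' \<longleftrightarrow> fst x \<in> N \<and> Poly_Mapping.keys (snd x) \<subseteq> {1..k} \<and> (\<forall>j. Poly_Mapping.lookup (snd x) j \<in> \<int>)"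
  unfolding lifted_lattice_def by (cases x) simp

lemma zero_lattice: "0 \<in> N"
  using lattice_combination[OF lattice \<delta>_lattice \<delta>_lattice, of 0 0] by simp

lemma snd_sg_integral: "i \<le> k \<Longrightarrow> Poly_Mapping.lookup (snd (sg i)) l \<in> \<int>"
proof (cases "l \<in> {1..k}")
  case False
  assume "i \<le> k"
  then have "l \<notin> Poly_Mapping.keys (snd (sg i))" using keys_snd_sg False by blast
  then show ?thesis by (simp add: in_keys_iff)
qed (simp add: lookup_snd_sg)

lemma all_gens_lattice:
  assumes "g \<in> all_gens"
  shows "g \<in> N'"
  using assms
proof (cases rule: all_gens_cases)
  case (1 u)
  then show "g \<in> N'" using rays_subset_lattice by (auto simp: mem_N'_iff)
next
  case (2 i)
  have "e 0 + \<delta> \<in> N" using e_mem[of 1] by (simp add: \<delta>_def)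
  then show "g \<in> N'"
    using 2 keys_snd_sg[of i] \<delta>_lattice snd_sg_integral[of i] by (simp add: mem_N'_iff tg_eq fst_sg)
next
  case (3 i)
  then show "g \<in> N'"
    using keys_snd_sg[of i] e_mem[of 0] zero_lattice snd_sg_integral[of i] by (simp add: mem_N'_iff fst_sg)
qed

lemma ray_primitive: "u \<in> R \<Longrightarrow> 0 < c \<Longrightarrow> c < 1 \<Longrightarrow> c *\<^sub>R u \<notin> N"
  by (simp add: ray_gens_def)

text \<open>For \<open>k \<noteq> 0\<close> some coordinate of \<open>snd (sg i)\<close> is 1 or -1,
  and a proper fraction of it is not an integer.\<close>

lemma snd_sg_primitive:
  assumes "i \<le> k" "k \<noteq> 0" "0 < c" "c < 1" "snd x = c *\<^sub>R snd (sg i)"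
  shows "x \<notin> N'"
proof
  assume x: "x \<in> N'"
  define l where "l = (if i = k then 1 else i + 1)"
  have "l \<in> {1..k}" using assms by (auto simp: l_def)
  then have "Poly_Mapping.lookup (snd x) l = c \<or> Poly_Mapping.lookup (snd x) l = - c"
    unfolding assms(5) lookup_scaleR using lookup_snd_sg[OF assms(1)] by (simp add: l_def)
  moreover have "Poly_Mapping.lookup (snd x) l \<in> \<int>" using x by (simp add: mem_N'_iff)
  ultimately have "c \<in> \<int>" by (metis Ints_minus minus_minus)
  then obtain z where "c = of_int z" by (rule Ints_cases)
  then show False using assms(3,4) by simp
qed

lemma all_gens_primitive:
  assumes g: "g \<in> all_gens" and c: "0 < c" "c < 1"
  shows "c *\<^sub>R g \<notin> N'"
  using g
proof (cases rule: all_gens_cases)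
  case (1 u)
  then show ?thesis using ray_primitive[of u c] c by (simp add: mem_N'_iff)
next
  case (2 i)
  show ?thesis
  proof (cases "k = 0")
    case True
    then have "i = k" using 2(2) by linarith
    then have "fst g = e 1" by (simp add: 2(1) tg_eq fst_sg \<delta>_def)
    then show ?thesis using ray_primitive[of "e 1" c] e_mem[of 1] c by (simp add: mem_N'_iff)
  next
    case False
    have "snd (c *\<^sub>R g) = c *\<^sub>R snd (sg i)" using 2 by (simp add: tg_eq)
    then show ?thesis by (rule snd_sg_primitive[OF 2(2) False c])
  qed
next
  case (3 i)
  show ?thesis
  proof (cases "k = 0")
    case True
    then have "i = k" using 3(2) by linarith
    then have "fst g = e 0" by (simp add: 3(1) fst_sg)
    then show ?thesis using ray_primitive[of "e 0" c] e_mem[of 0] c by (simp add: mem_N'_iff)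
  next
    case False
    have "snd (c *\<^sub>R g) = c *\<^sub>R snd (sg i)" using 3 by simp
    then show ?thesis by (rule snd_sg_primitive[OF 3(2) False c])
  qed
qed

lemma R_Int_ray:
  assumes "u \<in> R"
  shows "R \<inter> convex_cone hull {u} = {u}"
proof -
  have "v = u" if v: "v \<in> R" "v \<in> convex_cone hull {u}" for v
  proof -
    obtain c where c: "v = c *\<^sub>R u" "0 \<le> c" using v(2) unfolding convex_cone_hull_sing by blast
    moreover have "v \<noteq> 0" using v(1) by (simp add: ray_gens_def)
    ultimately have "0 < c" by (cases "c = 0") auto
    then show ?thesis using ray_gens_unique[OF assms v(1) c(1)] by simp
  qed
  then show ?thesis using assms by (auto simp: hull_inc)
qed

text \<open>The ray of \<open>e (k + 1)\<close> lifts to a cone with all t generators, the ray of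
  \<open>e 0\<close> to one with all s generators.\<close>

lemma all_gens_in_lift:
  assumes "g \<in> all_gens"
  shows "\<exists>\<sigma> A B. lift_index \<sigma> A B \<and> g \<in> lift_gens \<sigma> A B"
  using assms
proof (cases rule: all_gens_cases)
  case (1 u)
  let ?\<sigma> = "convex_cone hull {u}"
  have "R \<inter> ?\<sigma> = {u}" using 1 by (intro R_Int_ray) auto
  moreover have "?\<sigma> \<in> \<Sigma>" using 1 by (simp add: ray_gens_def)
  ultimately have "lift_index ?\<sigma> {} {}" "g \<in> lift_gens ?\<sigma> {} {}"
    using 1 by (auto simp: lift_index_def lift_gens_def lgen_def)
  then show ?thesis by blast
next
  case (2 i)
  let ?\<sigma> = "convex_cone hull {e (k + 1)}"
  have em: "e (k + 1) \<in> R" "e (k + 1) \<in> \<Gamma>" using e_mem by auto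
  have "R \<inter> ?\<sigma> \<inter> \<Gamma> = {e (k + 1)}" using R_Int_ray[OF em(1)] em(2) by auto
  moreover have "?\<sigma> \<in> \<Sigma>" using em(1) by (simp add: ray_gens_def)
  ultimately have "lift_index ?\<sigma> {..<k + 1} {k + 1..k}" unfolding lift_index_def by blast
  moreover have "g \<in> lift_gens ?\<sigma> {..<k + 1} {k + 1..k}"
    using 2 by (auto simp: lift_gens_def lgen_def)
  ultimately show ?thesis by blast
next
  case (3 i)
  let ?\<sigma> = "convex_cone hull {e 0}"
  have em: "e 0 \<in> R" "e 0 \<in> \<Gamma>" using e_mem by auto
  have "R \<inter> ?\<sigma> \<inter> \<Gamma> = {e 0}" using R_Int_ray[OF em(1)] em(2) by auto
  moreover have "?\<sigma> \<in> \<Sigma>" using em(1) by (simp add: ray_gens_def)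
  ultimately have "lift_index ?\<sigma> {..<0} {0..k}" unfolding lift_index_def by blast
  moreover have "g \<in> lift_gens ?\<sigma> {..<0} {0..k}"
    using 3 by (auto simp: lift_gens_def lgen_def)
  ultimately show ?thesis by blast
qed

lemma edge_fan_iff:
  "\<tau> \<in> \<Sigma>' \<longleftrightarrow> \<tau> \<noteq> {} \<and> (\<exists>\<sigma> A B. lift_index \<sigma> A B \<and> \<tau> face_of convex_cone hull (lift_gens \<sigma> A B))"
  unfolding edge_fan_def lifted_cones_eq by blast

text \<open>A ray of the fan is a face of a generating cone, hence spanned by one of its generators,
  and primitivity on both sides makes the factor 1. Conversely, independence of the generators makes
  each of them span a face.\<close>

lemma R'_eq: "R' = all_gens"
proof
  show "R' \<subseteq> all_gens"
  proof
    fix u assume u: "u \<in> R'"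
    then have u': "u \<in> N'" "u \<noteq> 0" "convex_cone hull {u} \<in> \<Sigma>'" "\<And>c. 0 < c \<Longrightarrow> c < 1 \<Longrightarrow> c *\<^sub>R u \<notin> N'"
      unfolding ray_gens_def by blast+
    from u'(3) obtain \<sigma> A B where \<sigma>: "lift_index \<sigma> A B"
        and face: "convex_cone hull {u} face_of convex_cone hull (lift_gens \<sigma> A B)"
      unfolding edge_fan_iff by blast
    obtain g c where g: "g \<in> lift_gens \<sigma> A B" "0 < c" "u = c *\<^sub>R g"
      by (rule ray_face_generator[OF finite_lift_gens[OF \<sigma>] face u'(2)])
    have ga: "g \<in> all_gens" using g(1) lift_gens_subset[OF \<sigma>] by blast
    have "\<not> c < 1" using all_gens_primitive[OF ga g(2)] u'(1) g(3) by blast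
    moreover have "\<not> 1 < c"
    proof
      assume "1 < c"
      then have "inverse c *\<^sub>R u \<notin> N'" using u'(4)[of "inverse c"] by (simp add: inverse_less_1_iff)
      moreover have "inverse c *\<^sub>R u = g" using g by simp
      ultimately show False using all_gens_lattice[OF ga] by simp
    qed
    ultimately have "c = 1" by simp
    then show "u \<in> all_gens" using ga g(3) by simp
  qed
  show "all_gens \<subseteq> R'"
  proof
    fix g assume g: "g \<in> all_gens"
    obtain \<sigma> A B where \<sigma>: "lift_index \<sigma> A B" "g \<in> lift_gens \<sigma> A B"
      using all_gens_in_lift[OF g] by blast
    have "convex_cone hull {g} face_of convex_cone hull (lift_gens \<sigma> A B)"
      by (rule independent_ray_face[OF finite_lift_gens[OF \<sigma>(1)] independent_lift_gens[OF \<sigma>(1)] \<sigma>(2)])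
    then have "convex_cone hull {g} \<in> \<Sigma>'"
      using \<sigma>(1) convex_cone_hull_nonempty unfolding edge_fan_iff by blast
    moreover have "g \<noteq> 0"
      using independent_lift_gens[OF \<sigma>(1)] \<sigma>(2) dependent_zero by blast
    ultimately show "g \<in> R'"
      unfolding ray_gens_def using all_gens_lattice[OF g] all_gens_primitive[OF g] by blast
  qed
qed

lemma finite_R': "finite R'"
  unfolding R'_eq all_gens_def by (intro finite_lgen) auto

sublocale lifted: cox_data N' \<Sigma>' by unfold_locales (rule finite_R')

lemma lifted_face_Int:
  assumes "\<tau> \<in> \<Sigma>'"
  shows "\<exists>\<sigma> A B. lift_index \<sigma> A B \<and> R' \<inter> \<tau> \<subseteq> lift_gens \<sigma> A B"
proof -
  obtain \<sigma> A B where \<sigma>: "lift_index \<sigma> A B" "\<tau> face_of convex_cone hull (lift_gens \<sigma> A B)"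
    using assms unfolding edge_fan_iff by blast
  then have "R' \<inter> \<tau> \<subseteq> lift_gens \<sigma> A B"
    using all_gens_Int_lift[OF \<sigma>(1)] face_of_imp_subset[OF \<sigma>(2)] unfolding R'_eq by blast
  with \<sigma>(1) show ?thesis by blast
qed

lemma lifted_cone_mem:
  assumes "lift_index \<sigma> A B"
  shows "convex_cone hull (lift_gens \<sigma> A B) \<in> \<Sigma>'"
  using assms face_of_refl[OF convex_convex_cone_hull] convex_cone_hull_nonempty
  unfolding edge_fan_iff by blast

lemma lifted_semistable_iff:
  "y \<in> semistable N' \<Sigma>' \<longleftrightarrow> y \<in> affine_space R' \<and>
     (\<exists>\<sigma> A B. lift_index \<sigma> A B \<and> (\<forall>g\<in>R'. y g = 0 \<longrightarrow> g \<in> lift_gens \<sigma> A B))"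
  unfolding lifted.semistable_iff
proof (rule conj_cong[OF refl], rule iffI)
  assume "\<exists>\<tau>\<in>\<Sigma>'. \<forall>g\<in>R'. y g = 0 \<longrightarrow> g \<in> \<tau>"
  then obtain \<tau> where "\<tau> \<in> \<Sigma>'" "\<forall>g\<in>R'. y g = 0 \<longrightarrow> g \<in> \<tau>" by blast
  then show "\<exists>\<sigma> A B. lift_index \<sigma> A B \<and> (\<forall>g\<in>R'. y g = 0 \<longrightarrow> g \<in> lift_gens \<sigma> A B)"
    using lifted_face_Int by blast
next
  assume "\<exists>\<sigma> A B. lift_index \<sigma> A B \<and> (\<forall>g\<in>R'. y g = 0 \<longrightarrow> g \<in> lift_gens \<sigma> A B)"
  then obtain \<sigma> A B where \<sigma>: "lift_index \<sigma> A B" "\<forall>g\<in>R'. y g = 0 \<longrightarrow> g \<in> lift_gens \<sigma> A B" by blast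
  then have "\<forall>g\<in>R'. y g = 0 \<longrightarrow> g \<in> convex_cone hull (lift_gens \<sigma> A B)"
    by (blast intro: hull_inc)
  then show "\<exists>\<tau>\<in>\<Sigma>'. \<forall>g\<in>R'. y g = 0 \<longrightarrow> g \<in> \<tau>"
    using lifted_cone_mem[OF \<sigma>(1)] by blast
qed

text \<open>A full cone through \<open>e 0\<close> has \<open>j = 0\<close>, so its lift contains
  all s generators. Their sum recovers \<open>e 0\<close>, and \<open>tg 0 - sg 0\<close> recovers
  \<open>\<delta>\<close> when \<open>e 1\<close> is a ray too, so the span contains the base space.
  In either case \<open>k\<close> more generators come in than edge rays go out.\<close>

lemma full_lift_exists:
  "\<exists>\<sigma> A B. lift_index \<sigma> A B \<and> card (lift_gens \<sigma> A B) = DIM('v) + k \<and>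
     span (lift_gens \<sigma> A B) = span R' \<and> (\<forall>p. (p, 0) \<in> span (lift_gens \<sigma> A B))"
proof -
  obtain \<sigma> where \<sigma>: "\<sigma> \<in> \<Sigma>" "e 0 \<in> \<sigma>" "card (R \<inter> \<sigma>) = DIM('v)" using mem_full_cone by blast
  obtain A B where AB: "lift_index \<sigma> A B" using lift_index_exists[OF \<sigma>(1)] by blast
  have e0: "e 0 \<in> R \<inter> \<sigma> \<inter> \<Gamma>" using \<sigma> e_mem[of 0] by simp
  have fin: "finite (R \<inter> \<sigma>)" using finite_rays by simp
  have "card (R \<inter> \<sigma>) = card (R \<inter> \<sigma> - \<Gamma>) + card (R \<inter> \<sigma> \<inter> \<Gamma>)"
  proof -
    have "card ((R \<inter> \<sigma> - \<Gamma>) \<union> (R \<inter> \<sigma> \<inter> \<Gamma>)) = card (R \<inter> \<sigma> - \<Gamma>) + card (R \<inter> \<sigma> \<inter> \<Gamma>)"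
      by (rule card_Un_disjoint) (use fin in auto)
    moreover have "(R \<inter> \<sigma> - \<Gamma>) \<union> (R \<inter> \<sigma> \<inter> \<Gamma>) = R \<inter> \<sigma>" by blast
    ultimately show ?thesis by simp
  qed
  moreover have "B = {0..k} \<and> card A + card B + 1 = card (R \<inter> \<sigma> \<inter> \<Gamma>) + k + 1"
    using AB unfolding lift_index_def
  proof (elim conjE disjE exE)
    fix j assume *: "j \<le> k + 1" "R \<inter> \<sigma> \<inter> \<Gamma> = {e j}" "A = {..<j}" "B = {j..k}"
    then have "j = 0" using e0 e_inj[of 0 j] by simp
    then show ?thesis using * by simp
  next
    fix j assume *: "j \<le> k" "R \<inter> \<sigma> \<inter> \<Gamma> = {e j, e (j + 1)}" "A = {..j}" "B = {j..k}"
    then have "j = 0" using e0 e_inj[of 0 j] e_inj[of 0 "j + 1"] by simp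
    then show ?thesis using * e_inj[of 0 1] by simp
  qed (use e0 in auto)
  ultimately have B: "B = {0..k}" and card: "card (R \<inter> \<sigma> - \<Gamma>) + card A + card B = DIM('v) + k"
    using \<sigma>(3) by auto
  let ?L = "lift_gens \<sigma> A B"
  have cardL: "card ?L = DIM('v) + k"
    unfolding lift_gens_def using lift_index_subset[OF AB] card by (subst card_lgen) auto
  have sgL: "sg i \<in> span ?L" if "i \<le> k" for i
    using that B by (intro span_base) (auto simp: lift_gens_def lgen_def)
  have "(\<Sum>i\<le>k. 1 *\<^sub>R sg i) \<in> span ?L" using sgL by (intro span_sum) auto
  then have e0L: "(e 0, 0) \<in> span ?L" unfolding sum_sg_const by simp
  have lin: "linear (\<lambda>u::'v. (u, 0 :: nat \<Rightarrow>\<^sub>0 real))" by (rule linearI) auto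
  have edgeL: "(e j, 0) \<in> span ?L" if "e j \<in> R \<inter> \<sigma> \<inter> \<Gamma>" "j \<le> k + 1" for j
    using AB unfolding lift_index_def
  proof (elim conjE disjE exE)
    fix i assume *: "i \<le> k + 1" "R \<inter> \<sigma> \<inter> \<Gamma> = {e i}" "A = {..<i}" "B = {i..k}"
    then have "e j = e 0" using e0 that by simp
    then show ?thesis using e0L by simp
  next
    fix i assume *: "i \<le> k" "R \<inter> \<sigma> \<inter> \<Gamma> = {e i, e (i + 1)}" "A = {..i}" "B = {i..k}"
    then have i: "i = 0" using e0 e_inj[of 0 i] e_inj[of 0 "i + 1"] by simp
    have "tg 0 \<in> span ?L" using * i by (intro span_base) (auto simp: lift_gens_def lgen_def)
    then have "tg 0 - sg 0 \<in> span ?L" by (intro span_diff sgL) auto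
    then have "(\<delta>, 0) \<in> span ?L" by (simp add: tg_eq)
    then have "(e 0, 0) + (\<delta>, 0) \<in> span ?L" by (rule span_add[OF e0L])
    then have "(e 1, 0) \<in> span ?L" by (simp add: \<delta>_def)
    moreover have "j = 0 \<or> j = 1" using that * i e_inj[of j 0] e_inj[of j 1] by auto
    ultimately show ?thesis using e0L by auto
  qed (use that in auto)
  have "(\<lambda>u. (u, 0)) ` (R \<inter> \<sigma>) \<subseteq> span ?L"
  proof safe
    fix u assume u: "u \<in> R" "u \<in> \<sigma>"
    show "(u, 0) \<in> span ?L"
    proof (cases "u \<in> \<Gamma>")
      case True
      then obtain j where "j \<le> k + 1" "u = e j" using R_edge u by blast
      then show ?thesis using edgeL[of j] u True by simp
    next
      case False
      then show ?thesis using u by (intro span_base) (auto simp: lift_gens_def lgen_def)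
    qed
  qed
  then have "span ((\<lambda>u. (u, 0)) ` (R \<inter> \<sigma>)) \<subseteq> span ?L"
    by (rule span_minimal) (rule subspace_span)
  moreover have "span ((\<lambda>u. (u, 0 :: nat \<Rightarrow>\<^sub>0 real)) ` (R \<inter> \<sigma>)) = (\<lambda>u. (u, 0)) ` UNIV"
    using linear_span_image[OF lin, of "R \<inter> \<sigma>"] full_cone_spans[OF \<sigma>(1,3)] by simp
  ultimately have pL: "(p, 0) \<in> span ?L" for p by auto
  have "all_gens \<subseteq> span ?L"
  proof
    fix g assume "g \<in> all_gens"
    then show "g \<in> span ?L"
      by (cases rule: all_gens_cases) (auto simp: pL sgL tg_eq intro!: span_add)
  qed
  then have "span all_gens \<subseteq> span ?L" by (rule span_minimal) (rule subspace_span)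
  then have "span ?L = span R'"
    unfolding R'_eq using span_mono[OF lift_gens_subset[OF AB]] by blast
  then show ?thesis using AB pL cardL by blast
qed

section \<open>The Krull dimension of the lifted variety\<close>

lemma norm_lookup: "\<bar>Poly_Mapping.lookup w j\<bar> \<le> norm (w :: nat \<Rightarrow>\<^sub>0 real)"
proof (cases "j \<in> Poly_Mapping.keys w")
  case True
  have "norm w = (\<Sum>n\<in>Poly_Mapping.keys w. \<bar>Poly_Mapping.lookup w n\<bar>)"
    by (simp add: norm_poly_mapping_def dist_poly_mapping_def)
  moreover have "\<bar>Poly_Mapping.lookup w j\<bar> \<le> (\<Sum>n\<in>Poly_Mapping.keys w. \<bar>Poly_Mapping.lookup w n\<bar>)"
    using True by (intro member_le_sum) auto
  ultimately show ?thesis by simp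
qed (simp add: in_keys_iff)

text \<open>The dual basis of the second lattice factor. Boundedness is not automatic in an
  infinite-dimensional space; it holds because the norm of a finitely supported function dominates
  each coordinate.\<close>

definition coord :: "nat \<Rightarrow> ('v \<times> (nat \<Rightarrow>\<^sub>0 real)) \<Rightarrow>\<^sub>L real" where
  "coord j = Blinfun (\<lambda>x. Poly_Mapping.lookup (snd x) j)"

lemma coord_apply [simp]: "blinfun_apply (coord j) x = Poly_Mapping.lookup (snd x) j"
proof -
  have "bounded_linear (\<lambda>w :: nat \<Rightarrow>\<^sub>0 real. Poly_Mapping.lookup w j)"
    by (rule bounded_linear_intro[where K=1])
      (simp_all add: lookup_add lookup_scaleR norm_lookup)
  then have "bounded_linear (\<lambda>x :: 'v \<times> (nat \<Rightarrow>\<^sub>0 real). Poly_Mapping.lookup (snd x) j)"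
    by (rule bounded_linear_compose[OF _ bounded_linear_snd])
  then show ?thesis
    unfolding coord_def by (simp add: bounded_linear_Blinfun_apply)
qed

definition pull :: "('v \<Rightarrow>\<^sub>L real) \<Rightarrow> ('v \<times> (nat \<Rightarrow>\<^sub>0 real)) \<Rightarrow>\<^sub>L real" where
  "pull m = Blinfun (\<lambda>x. blinfun_apply m (fst x))"

lemma pull_apply [simp]: "blinfun_apply (pull m) x = blinfun_apply m (fst x)"
  unfolding pull_def
  by (simp add: bounded_linear_Blinfun_apply bounded_linear_compose[OF blinfun.bounded_linear_right bounded_linear_fst])

lemma coord_dual: "coord j \<in> dual_lattice N'"
  by (simp add: dual_lattice_def mem_N'_iff)

lemma pull_dual: "m \<in> dual_lattice N \<Longrightarrow> pull m \<in> dual_lattice N'"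
  by (simp add: dual_lattice_def mem_N'_iff)

lemma has_krull_dim_lifted: "has_krull_dim (zar (toric_variety N' \<Sigma>')) (DIM('v) + k)"
proof -
  obtain \<sigma> A B where L: "lift_index \<sigma> A B" "card (lift_gens \<sigma> A B) = DIM('v) + k"
      "span (lift_gens \<sigma> A B) = span R'" "\<forall>p. (p, 0) \<in> span (lift_gens \<sigma> A B)"
    using full_lift_exists by blast
  have dimR': "dim R' = DIM('v) + k"
    using dim_eq_card_independent[OF independent_lift_gens[OF L(1)]] L(2,3) by (metis dim_span)
  show ?thesis
    unfolding has_krull_dim_def
  proof (intro conjI allI impI)
    have "card (R' \<inter> convex_cone hull (lift_gens \<sigma> A B)) = DIM('v) + k"
      unfolding R'_eq all_gens_Int_lift[OF L(1)] by (rule L(2))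
    then show "irreducible_chain (zar (toric_variety N' \<Sigma>')) (DIM('v) + k)"
      by (rule lifted.chain_lower_bound[OF lifted_cone_mem[OF L(1)]])
    fix n assume n: "irreducible_chain (zar (toric_variety N' \<Sigma>')) n"
    have "n \<le> dim R'"
    proof (rule lifted.chain_upper_bound[OF _ _ n])
      show "independent (R' \<inter> \<tau>)" if "\<tau> \<in> \<Sigma>'" for \<tau>
        using lifted_face_Int[OF that] independent_lift_gens independent_mono by blast
      fix S assume S: "S \<subseteq> R'" "independent S" "R' \<subseteq> span S"
      obtain B f where B: "lattice_coords N B f"
        using lattice_coordinates[OF lattice] by blast
      note D = lattice_coordsD[OF B]
      \<comment> \<open>Index set of a dual system for the lifted lattice: a basis of
        \<open>N\<close> with its coordinate functionals, and the standard basis of the second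
        factor with \<open>coord\<close>.\<close>
      define I where "I = Inl ` B \<union> Inr ` {1..k}"
      define l where "l = case_sum (\<lambda>b. pull (Blinfun (f b))) coord"
      define \<beta> where "\<beta> = case_sum (\<lambda>b. (b, 0)) (\<lambda>j :: nat. (0 :: 'v, Poly_Mapping.single j (1::real)))"
      have Blin: "blinfun_apply (Blinfun (f b)) = f b" for b
        using D(5)[of b] by (intro bounded_linear_Blinfun_apply) (simp add: linear_conv_bounded_linear)
      have "span B = UNIV"
        using span_mono[OF D(4)] spanN by (simp add: span_span top.extremum_unique)
      then have "card B = DIM('v)"
        using dim_eq_card_independent[OF D(2)] dim_eq_full[of B] by simp
      then have "card I = DIM('v) + k"
        unfolding I_def using D(1) by (subst card_Un_disjoint) (auto simp: card_image)
      moreover have "card S = dim R'" by (rule basis_card_eq_dim[OF S(1,3,2)])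
      ultimately have card: "card S = card I" using dimR' by simp
      have finI: "finite I" using D(1) by (simp add: I_def)
      have spanS: "span R' \<subseteq> span S" using S(3) by (rule span_minimal) (rule subspace_span)
      have l: "l i \<in> dual_lattice N'" if "i \<in> I" for i
        using that D(7) by (auto simp: I_def l_def coord_dual dual_lattice_def mem_N'_iff Blin)
      have \<beta>1: "\<beta> i \<in> span S" if "i \<in> I" for i
        using that
      proof (cases i)
        case (Inl b)
        have "(b, 0) \<in> span R'" using L(3,4) by metis
        then show ?thesis using spanS Inl by (auto simp: \<beta>_def)
      next
        case (Inr j)
        then have j: "j \<in> {1..k}" using that by (auto simp: I_def)
        \<comment> \<open>The standard basis vector is itself the ray generator
          \<open>s_gen e k j\<close>, so it lies in the span of the rays.\<close>
        then have "sg (j - 1) = (0, Poly_Mapping.single j 1)" by (auto simp: sg_def s_gen_def)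
        moreover have "j - 1 \<le> k" using j by auto
        then have "sg (j - 1) \<in> R'" unfolding R'_eq all_gens_iff by blast
        ultimately have "\<beta> i \<in> R'" using Inr by (simp add: \<beta>_def)
        then show ?thesis using S(3) by blast
      qed
      have zero: "f b 0 = 0" for b using D(5) by (rule linear_0)
      have \<beta>2: "blinfun_apply (l i) (\<beta> i') = (if i = i' then 1 else 0)" if "i \<in> I" "i' \<in> I" for i i'
        using that D(6) zero by (auto simp: I_def l_def \<beta>_def Blin lookup_single when_def split: if_splits)
      obtain M :: nat where "M > 0"
        "\<And>b :: ('v \<times> (nat \<Rightarrow>\<^sub>0 real)) \<Rightarrow> nat. \<exists>m\<in>dual_lattice N'. \<forall>u\<in>S. blinfun_apply m u = real (M * b u)"
        using dual_lattice_multiples[where \<beta>=\<beta> and l=l, OF finI l \<beta>1 \<beta>2 _ finite_subset[OF S(1) finite_R'] card]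
          S(1) lifted.rays_subset_lattice by blast
      then show "\<exists>M>0. \<forall>b :: ('v \<times> (nat \<Rightarrow>\<^sub>0 real)) \<Rightarrow> nat. \<exists>m\<in>dual_lattice N'. \<forall>u\<in>S. blinfun_apply m u = real (M * b u)"
        by blast
    qed
    then show "n \<le> DIM('v) + k" by (simp add: dimR')
  qed
qed

end

section \<open>The morphism in homogeneous coordinates\<close>

context fan_with_edge
begin

definition pair_index :: "'v \<times> (nat \<Rightarrow>\<^sub>0 real) \<Rightarrow> nat" where
  "pair_index g = (THE i. i \<le> k \<and> (g = sg i \<or> g = tg i))"

lemma pair_index_sg: "i \<le> k \<Longrightarrow> pair_index (sg i) = i"
  unfolding pair_index_def by (rule the_equality) (use sg_inj sg_neq_tg in metis)+

lemma pair_index_tg: "i \<le> k \<Longrightarrow> pair_index (tg i) = i"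
  unfolding pair_index_def by (rule the_equality) (use tg_inj sg_neq_tg in metis)+

definition Phi :: "('v \<Rightarrow> complex) \<Rightarrow> ('v \<times> (nat \<Rightarrow>\<^sub>0 real)) \<Rightarrow> complex" where
  "Phi x = (\<lambda>g\<in>R'. if g \<in> sg ` {..k} then \<Prod>l\<le>pair_index g. x (e l)
     else if g \<in> tg ` {..k} then \<Prod>l\<in>{pair_index g + 1..k + 1}. x (e l) else x (fst g))"

lemma sg_mem: "i \<le> k \<Longrightarrow> sg i \<in> R'"
  unfolding R'_eq all_gens_iff by blast

lemma tg_mem: "i \<le> k \<Longrightarrow> tg i \<in> R'"
  unfolding R'_eq all_gens_iff by blast

lemma lifted_mem: "u \<in> R \<Longrightarrow> u \<notin> \<Gamma> \<Longrightarrow> (u, 0) \<in> R'"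
  unfolding R'_eq all_gens_iff by blast

lemma R'_cases:
  assumes "g \<in> R'"
  obtains u where "g = (u, 0)" "u \<in> R" "u \<notin> \<Gamma>" | i where "g = tg i" "i \<le> k" | i where "g = sg i" "i \<le> k"
  using assms unfolding R'_eq all_gens_iff by blast

lemma Phi_sg: "i \<le> k \<Longrightarrow> Phi x (sg i) = (\<Prod>l\<le>i. x (e l))"
  using sg_mem by (simp add: Phi_def pair_index_sg)

lemma Phi_tg: "i \<le> k \<Longrightarrow> Phi x (tg i) = (\<Prod>l\<in>{i + 1..k + 1}. x (e l))"
proof -
  assume i: "i \<le> k"
  then have "tg i \<notin> sg ` {..k}" using sg_neq_tg by (metis atMost_iff imageE)
  then show ?thesis using tg_mem[OF i] i by (simp add: Phi_def pair_index_tg)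
qed

lemma Phi_lifted: "u \<in> R \<Longrightarrow> u \<notin> \<Gamma> \<Longrightarrow> Phi x (u, 0) = x u"
proof -
  assume u: "u \<in> R" "u \<notin> \<Gamma>"
  then have "(u, 0) \<notin> sg ` {..k}" "(u, 0) \<notin> tg ` {..k}"
    using sg_not_lifted tg_not_lifted by (metis atMost_iff imageE)+
  then show ?thesis using lifted_mem[OF u] by (simp add: Phi_def)
qed

lemma Phi_affine: "Phi x \<in> affine_space R'"
  by (simp add: Phi_def affine_space_def)

lemma lifted_eqI:
  assumes "y \<in> affine_space R'" "z \<in> affine_space R'" "\<And>u. u \<in> R \<Longrightarrow> u \<notin> \<Gamma> \<Longrightarrow> y (u, 0) = z (u, 0)"
    "\<And>i. i \<le> k \<Longrightarrow> y (tg i) = z (tg i)" "\<And>i. i \<le> k \<Longrightarrow> y (sg i) = z (sg i)"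
  shows "y = z"
proof (rule lifted.affine_eqI[OF assms(1,2)])
  fix g assume "g \<in> R'"
  then show "y g = z g" by (cases rule: R'_cases) (use assms(3-5) in simp_all)
qed

definition total :: "('v \<Rightarrow> complex) \<Rightarrow> complex" where "total x = (\<Prod>l\<le>k + 1. x (e l))"

lemma Phi_sg_tg: "i \<le> k \<Longrightarrow> Phi x (sg i) * Phi x (tg i) = total x"
proof -
  assume i: "i \<le> k"
  have split: "{..k + 1} = {..i} \<union> {i + 1..k + 1}" using i by auto
  have "total x = (\<Prod>l\<le>i. x (e l)) * (\<Prod>l\<in>{i + 1..k + 1}. x (e l))"
    unfolding total_def split by (rule prod.union_disjoint) auto
  then show ?thesis using i by (simp only: Phi_sg Phi_tg)
qed

definition on_image :: "('v \<times> (nat \<Rightarrow>\<^sub>0 real) \<Rightarrow> complex) \<Rightarrow> bool" where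
  "on_image y \<longleftrightarrow> (\<forall>i\<le>k. y (sg i) * y (tg i) = y (sg 0) * y (tg 0))"

lemma on_image_Phi: "on_image (Phi x)"
  unfolding on_image_def by (simp add: Phi_sg_tg)

text \<open>The domain of the \<open>j\<close>-th local inverse \<open>psi j\<close> of \<open>Phi\<close>.\<close>

definition dom :: "nat \<Rightarrow> ('v \<times> (nat \<Rightarrow>\<^sub>0 real) \<Rightarrow> complex) set" where
  "dom j = {y \<in> affine_space R'. (\<forall>i<j. y (sg i) \<noteq> 0) \<and> (\<forall>i. j < i \<and> i \<le> k \<longrightarrow> y (tg i) \<noteq> 0)}"

text \<open>Here and in \<open>tden\<close> the value at the outer end is 1, the empty product
  before \<open>e 0\<close> or after \<open>e (k + 1)\<close>, so the extreme edge coordinates need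
  no separate formula.\<close>

definition sden :: "('v \<times> (nat \<Rightarrow>\<^sub>0 real) \<Rightarrow> complex) \<Rightarrow> nat \<Rightarrow> complex" where
  "sden y i = (if i = 0 then 1 else y (sg (i - 1)))"

definition tden :: "('v \<times> (nat \<Rightarrow>\<^sub>0 real) \<Rightarrow> complex) \<Rightarrow> nat \<Rightarrow> complex" where
  "tden y i = (if i = k + 1 then 1 else y (tg i))"

definition edge_index :: "'v \<Rightarrow> nat" where "edge_index u = (THE i. i \<le> k + 1 \<and> u = e i)"

lemma edge_index_e: "i \<le> k + 1 \<Longrightarrow> edge_index (e i) = i"
  unfolding edge_index_def by (rule the_equality) (use e_inj in metis)+

definition psi :: "nat \<Rightarrow> ('v \<times> (nat \<Rightarrow>\<^sub>0 real) \<Rightarrow> complex) \<Rightarrow> 'v \<Rightarrow> complex" where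
  "psi j y = (\<lambda>u\<in>R. if u \<notin> \<Gamma> then y (u, 0)
     else if edge_index u \<le> j then y (sg (edge_index u)) / sden y (edge_index u)
     else y (tg (edge_index u - 1)) / tden y (edge_index u))"

lemma psi_affine: "psi j y \<in> affine_space R"
  by (simp add: psi_def affine_space_def)

lemma psi_lifted: "u \<in> R \<Longrightarrow> u \<notin> \<Gamma> \<Longrightarrow> psi j y u = y (u, 0)"
  by (simp add: psi_def)

lemma psi_low: "j \<le> k \<Longrightarrow> i \<le> j \<Longrightarrow> psi j y (e i) = y (sg i) / sden y i"
  using e_mem[of i] by (simp add: psi_def edge_index_e)

lemma psi_high: "j < i \<Longrightarrow> i \<le> k + 1 \<Longrightarrow> psi j y (e i) = y (tg (i - 1)) / tden y i"
  using e_mem[of i] by (simp add: psi_def edge_index_e)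

lemma base_eqI:
  assumes "x \<in> affine_space R" "z \<in> affine_space R" "\<And>u. u \<in> R \<Longrightarrow> u \<notin> \<Gamma> \<Longrightarrow> x u = z u"
    "\<And>i. i \<le> k + 1 \<Longrightarrow> x (e i) = z (e i)"
  shows "x = z"
proof (rule affine_eqI[OF assms(1,2)])
  fix u assume "u \<in> R"
  then show "x u = z u" using assms(3,4) R_edge[of u] by (cases "u \<in> \<Gamma>") auto
qed

lemma sden_Phi: "i \<le> k + 1 \<Longrightarrow> sden (Phi x) i = (\<Prod>l<i. x (e l))"
  unfolding sden_def by (cases i) (auto simp: Phi_sg lessThan_Suc_atMost)

lemma tden_Phi: "i \<le> k + 1 \<Longrightarrow> tden (Phi x) i = (\<Prod>l\<in>{i + 1..k + 1}. x (e l))"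
  unfolding tden_def by (auto simp: Phi_tg)

lemma sden_nonzero: "y \<in> dom j \<Longrightarrow> i \<le> j \<Longrightarrow> sden y i \<noteq> 0"
  by (cases i) (auto simp: sden_def dom_def)

lemma tden_nonzero: "y \<in> dom j \<Longrightarrow> j < i \<Longrightarrow> i \<le> k + 1 \<Longrightarrow> tden y i \<noteq> 0"
  by (auto simp: tden_def dom_def)

lemma psi_Phi:
  assumes j: "j \<le> k" and x: "x \<in> affine_space R" and d: "Phi x \<in> dom j"
  shows "psi j (Phi x) = x"
proof (rule base_eqI[OF psi_affine x])
  show "psi j (Phi x) u = x u" if "u \<in> R" "u \<notin> \<Gamma>" for u
    using that by (simp add: psi_lifted Phi_lifted)
  fix i assume i: "i \<le> k + 1"
  show "psi j (Phi x) (e i) = x (e i)"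
  proof (cases "i \<le> j")
    case True
    have "psi j (Phi x) (e i) = Phi x (sg i) / sden (Phi x) i" by (rule psi_low[OF j True])
    also have "Phi x (sg i) = sden (Phi x) i * x (e i)"
      using True j by (simp add: Phi_sg sden_Phi flip: lessThan_Suc_atMost)
    finally show ?thesis using sden_nonzero[OF d True] by simp
  next
    case False
    then have ji: "j < i" by simp
    have "psi j (Phi x) (e i) = Phi x (tg (i - 1)) / tden (Phi x) i" by (rule psi_high[OF ji i])
    also have "Phi x (tg (i - 1)) = x (e i) * tden (Phi x) i"
    proof -
      have "{i..k + 1} = insert i {i + 1..k + 1}" using i by auto
      then show ?thesis using ji i by (simp add: Phi_tg tden_Phi)
    qed
    finally show ?thesis using tden_nonzero[OF d ji i] by simp
  qed
qed

lemma prod_psi_low: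
  assumes j: "j \<le> k" and y: "y \<in> dom j" and i: "i \<le> j"
  shows "(\<Prod>l\<le>i. psi j y (e l)) = y (sg i)"
  using i
proof (induction i)
  case 0
  then show ?case using psi_low[OF j, of 0] by (simp add: sden_def)
next
  case (Suc i)
  then have "(\<Prod>l\<le>Suc i. psi j y (e l)) = y (sg i) * (y (sg (Suc i)) / sden y (Suc i))"
    using psi_low[OF j, of "Suc i" y] by simp
  then show ?case using sden_nonzero[OF y Suc.prems] by (simp add: sden_def)
qed

lemma prod_psi_high:
  assumes y: "y \<in> dom j" and i: "j \<le> i" "i \<le> k"
  shows "(\<Prod>l\<in>{i + 1..k + 1}. psi j y (e l)) = y (tg i)"
  using i(2,1)
proof (induction i rule: inc_induct)
  case base
  then show ?case using psi_high[of j "k + 1" y] by (simp add: tden_def)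
next
  case (step n)
  have "{n + 1..k + 1} = insert (n + 1) {Suc n + 1..k + 1}" using step.hyps by auto
  then have "(\<Prod>l\<in>{n + 1..k + 1}. psi j y (e l)) = psi j y (e (n + 1)) * (\<Prod>l\<in>{Suc n + 1..k + 1}. psi j y (e l))"
    by simp
  also have "\<dots> = y (tg n) / tden y (n + 1) * y (tg (Suc n))"
    using step psi_high[of j "n + 1" y] by simp
  also have "\<dots> = y (tg n)"
    using tden_nonzero[OF y, of "n + 1"] step by (simp add: tden_def split: if_splits)
  finally show ?case .
qed

text \<open>Telescoping recovers the s coordinates up to \<open>j\<close> and the t coordinates from
  \<open>j\<close> on. Both are known at \<open>j\<close>, which fixes the common product of all
  pairs; the equations then give each remaining coordinate on dividing by its invertible
  partner.\<close>

lemma Phi_psi: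
  assumes j: "j \<le> k" and y: "y \<in> dom j" and eq: "on_image y"
  shows "Phi (psi j y) = y"
proof (rule lifted_eqI[OF Phi_affine])
  show "y \<in> affine_space R'" using y by (simp add: dom_def)
  show "Phi (psi j y) (u, 0) = y (u, 0)" if "u \<in> R" "u \<notin> \<Gamma>" for u
    using that by (simp add: Phi_lifted psi_lifted)
  have low: "Phi (psi j y) (sg i) = y (sg i)" if "i \<le> j" for i
    using that j prod_psi_low[OF j y that] by (simp add: Phi_sg)
  have high: "Phi (psi j y) (tg i) = y (tg i)" if "j \<le> i" "i \<le> k" for i
    using that prod_psi_high[OF y that] by (simp only: Phi_tg)
  have tot: "Phi (psi j y) (sg i) * Phi (psi j y) (tg i) = y (sg i) * y (tg i)" if "i \<le> k" for i
  proof -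
    have "y (sg i) * y (tg i) = y (sg j) * y (tg j)" using eq that j unfolding on_image_def by metis
    also have "\<dots> = Phi (psi j y) (sg j) * Phi (psi j y) (tg j)" using low[of j] high[of j] j by simp
    finally show ?thesis using Phi_sg_tg[OF that] Phi_sg_tg[OF j] by simp
  qed
  show "Phi (psi j y) (sg i) = y (sg i)" if "i \<le> k" for i
  proof (cases "i \<le> j")
    case False
    then have "y (tg i) \<noteq> 0" using y that by (simp add: dom_def)
    then show ?thesis using tot[OF that] high[of i] False that by simp
  qed (rule low)
  show "Phi (psi j y) (tg i) = y (tg i)" if "i \<le> k" for i
  proof (cases "j \<le> i")
    case False
    then have "y (sg i) \<noteq> 0" using y by (simp add: dom_def)
    then show ?thesis using tot[OF that] low[of i] False by simp
  qed (rule high[OF _ that])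
qed

lemma lift_gens_iff:
  assumes "lift_index \<sigma> A B"
  shows "u \<in> R \<Longrightarrow> u \<notin> \<Gamma> \<Longrightarrow> (u, 0) \<in> lift_gens \<sigma> A B \<longleftrightarrow> u \<in> \<sigma>"
    and "i \<le> k \<Longrightarrow> tg i \<in> lift_gens \<sigma> A B \<longleftrightarrow> i \<in> A"
    and "i \<le> k \<Longrightarrow> sg i \<in> lift_gens \<sigma> A B \<longleftrightarrow> i \<in> B"
proof -
  show "(u, 0) \<in> lift_gens \<sigma> A B \<longleftrightarrow> u \<in> \<sigma>" if u: "u \<in> R" "u \<notin> \<Gamma>"
  proof
    assume "(u, 0) \<in> lift_gens \<sigma> A B"
    then have "(u, 0) \<in> convex_cone hull (lift_gens \<sigma> A B)" by (rule hull_inc)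
    then show "u \<in> \<sigma>" by (rule lift_hull_in_cone[OF assms])
  qed (use u in \<open>auto simp: lift_gens_def lgen_def\<close>)
  show "tg i \<in> lift_gens \<sigma> A B \<longleftrightarrow> i \<in> A" if "i \<le> k"
  proof
    show "i \<in> A" if "tg i \<in> lift_gens \<sigma> A B"
      by (rule tg_mem_lift[OF assms \<open>i \<le> k\<close> hull_inc[OF that]])
  qed (simp add: lift_gens_def lgen_def)
  show "sg i \<in> lift_gens \<sigma> A B \<longleftrightarrow> i \<in> B" if "i \<le> k"
  proof
    show "i \<in> B" if "sg i \<in> lift_gens \<sigma> A B"
      by (rule sg_mem_lift[OF assms \<open>i \<le> k\<close> hull_inc[OF that]])
  qed (simp add: lift_gens_def lgen_def)
qed

text \<open>The lift of the cone of \<open>x\<close> works: if a product of edge coordinates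
  vanishes, one of its factors does, so that edge ray belongs to the cone and is \<open>e j\<close>
  or \<open>e (j + 1)\<close>; this places the index of the product in \<open>A\<close> or
  \<open>B\<close>.\<close>

lemma Phi_semistable:
  assumes x: "x \<in> U"
  shows "Phi x \<in> semistable N' \<Sigma>'"
proof -
  obtain \<sigma> where \<sigma>: "\<sigma> \<in> \<Sigma>" "\<And>u. u \<in> R \<Longrightarrow> x u = 0 \<Longrightarrow> u \<in> \<sigma>"
    using x unfolding semistable_iff by blast
  obtain A B where AB: "lift_index \<sigma> A B" using lift_index_exists[OF \<sigma>(1)] by blast
  have edge: "e l \<in> R \<inter> \<sigma> \<inter> \<Gamma>" if "l \<le> k + 1" "x (e l) = 0" for l
    using that \<sigma>(2) e_mem by blast
  have "g \<in> lift_gens \<sigma> A B" if g: "g \<in> R'" and z: "Phi x g = 0" for g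
    using g
  proof (cases rule: R'_cases)
    case (1 u)
    then show ?thesis using z \<sigma>(2) by (simp add: Phi_lifted lift_gens_iff[OF AB])
  next
    case (2 i)
    then obtain l where l: "i + 1 \<le> l" "l \<le> k + 1" "x (e l) = 0" using z by (auto simp: Phi_tg)
    have "i \<in> A"
      using AB unfolding lift_index_def
    proof (elim conjE disjE exE)
      fix j assume *: "j \<le> k + 1" "R \<inter> \<sigma> \<inter> \<Gamma> = {e j}" "A = {..<j}"
      then have "l = j" using edge[OF l(2,3)] l(2) e_inj by simp
      then show ?thesis using * l by simp
    next
      fix j assume *: "j \<le> k" "R \<inter> \<sigma> \<inter> \<Gamma> = {e j, e (j + 1)}" "A = {..j}"
      then have "l = j \<or> l = j + 1" using edge[OF l(2,3)] l(2) e_inj[of l j] e_inj[of l "j + 1"] by simp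
      then show ?thesis using * l by auto
    qed (use edge[OF l(2,3)] in simp)
    then show ?thesis using 2 by (simp add: lift_gens_iff[OF AB])
  next
    case (3 i)
    then obtain l where l: "l \<le> i" "x (e l) = 0" using z by (auto simp: Phi_sg)
    then have lk: "l \<le> k + 1" using 3 by simp
    have "i \<in> B"
      using AB unfolding lift_index_def
    proof (elim conjE disjE exE)
      fix j assume *: "j \<le> k + 1" "R \<inter> \<sigma> \<inter> \<Gamma> = {e j}" "B = {j..k}"
      then have "l = j" using edge[OF lk l(2)] lk e_inj by simp
      then show ?thesis using * l 3 by simp
    next
      fix j assume *: "j \<le> k" "R \<inter> \<sigma> \<inter> \<Gamma> = {e j, e (j + 1)}" "B = {j..k}"
      then have "l = j \<or> l = j + 1" using edge[OF lk l(2)] lk e_inj[of l j] e_inj[of l "j + 1"] by simp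
      then show ?thesis using * l 3 by auto
    qed (use edge[OF lk l(2)] in simp)
    then show ?thesis using 3 by (simp add: lift_gens_iff[OF AB])
  qed
  then show ?thesis
    unfolding lifted_semistable_iff using AB Phi_affine by blast
qed

text \<open>The three kinds of cones are brought to one form with \<open>j \<le> k\<close>, in which
  \<open>psi j\<close> can be applied and its zeros compared with the rays of the base cone.\<close>

lemma lifted_semistable_cases:
  assumes y: "y \<in> semistable N' \<Sigma>'"
  obtains \<sigma> j where "\<sigma> \<in> \<Sigma>" "j \<le> k" "y \<in> dom j"
    "\<And>u. u \<in> R \<Longrightarrow> u \<notin> \<Gamma> \<Longrightarrow> y (u, 0) = 0 \<Longrightarrow> u \<in> \<sigma>"
    "y (sg j) = 0 \<Longrightarrow> e j \<in> \<sigma>" "y (tg j) = 0 \<Longrightarrow> e (j + 1) \<in> \<sigma>"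
proof -
  obtain \<sigma> A B where \<sigma>: "lift_index \<sigma> A B" "\<And>g. g \<in> R' \<Longrightarrow> y g = 0 \<Longrightarrow> g \<in> lift_gens \<sigma> A B"
    and ya: "y \<in> affine_space R'"
    using y unfolding lifted_semistable_iff by blast
  have u: "u \<in> \<sigma>" if "u \<in> R" "u \<notin> \<Gamma>" "y (u, 0) = 0" for u
    using \<sigma>(2)[OF lifted_mem[OF that(1,2)] that(3)] that(1,2) by (simp add: lift_gens_iff[OF \<sigma>(1)])
  have t: "i \<in> A" if "i \<le> k" "y (tg i) = 0" for i
    using \<sigma>(2)[OF tg_mem[OF that(1)] that(2)] that(1) by (simp add: lift_gens_iff[OF \<sigma>(1)])
  have s: "i \<in> B" if "i \<le> k" "y (sg i) = 0" for i
    using \<sigma>(2)[OF sg_mem[OF that(1)] that(2)] that(1) by (simp add: lift_gens_iff[OF \<sigma>(1)])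
  from \<sigma>(1) show ?thesis
    unfolding lift_index_def
  proof (elim conjE disjE exE)
    assume *: "\<sigma> \<in> \<Sigma>" "A = {}" "B = {}"
    show ?thesis
    \<comment> \<open>With no edge ray in the cone all s and t coordinates are nonzero, and the
      index 0 is an arbitrary choice.\<close>
    proof (rule that[of \<sigma> 0])
      show "y \<in> dom 0" using ya t * by (auto simp: dom_def)
      show "u \<in> \<sigma>" if "u \<in> R" "u \<notin> \<Gamma>" "y (u, 0) = 0" for u by (rule u[OF that])
      show "e 0 \<in> \<sigma>" if "y (sg 0) = 0" using s[of 0] that * by simp
      show "e (0 + 1) \<in> \<sigma>" if "y (tg 0) = 0" using t[of 0] that * by simp
    qed (use * in auto)
  next
    fix j assume *: "\<sigma> \<in> \<Sigma>" "j \<le> k + 1" "R \<inter> \<sigma> \<inter> \<Gamma> = {e j}" "A = {..<j}" "B = {j..k}"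
    have ej: "e j \<in> \<sigma>" using *(3) by auto
    show ?thesis
    \<comment> \<open>For the ray \<open>e (k + 1)\<close> the index \<open>j = k + 1\<close> has no
      pair; the last pair \<open>k\<close> serves instead, where only the t coordinate can
      vanish.\<close>
    proof (rule that[of \<sigma> "min j k"])
      have "y (sg i) \<noteq> 0" if "i < min j k" for i
      proof
        assume "y (sg i) = 0"
        then have "i \<in> B" using s[of i] that by simp
        then show False using *(5) that by simp
      qed
      moreover have "y (tg i) \<noteq> 0" if "min j k < i" "i \<le> k" for i
      proof
        assume "y (tg i) = 0"
        then have "i \<in> A" using t[of i] that by simp
        then show False using *(4) that by simp
      qed
      ultimately show "y \<in> dom (min j k)" using ya by (simp add: dom_def)
      show "u \<in> \<sigma>" if "u \<in> R" "u \<notin> \<Gamma>" "y (u, 0) = 0" for u by (rule u[OF that])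
      show "e (min j k) \<in> \<sigma>" if "y (sg (min j k)) = 0"
      proof -
        have "min j k \<in> B" using s[of "min j k"] that by simp
        then have "min j k = j" using * by auto
        then show ?thesis using ej by (simp only:)
      qed
      show "e (min j k + 1) \<in> \<sigma>" if "y (tg (min j k)) = 0"
      proof -
        have "min j k \<in> A" using t[of "min j k"] that by simp
        then have "min j k + 1 = j" using * by auto
        then show ?thesis using ej by (simp only:)
      qed
    qed (use * in auto)
  next
    fix j assume *: "\<sigma> \<in> \<Sigma>" "j \<le> k" "R \<inter> \<sigma> \<inter> \<Gamma> = {e j, e (j + 1)}" "A = {..j}" "B = {j..k}"
    have ej: "e j \<in> \<sigma>" "e (j + 1) \<in> \<sigma>" using *(3) by auto
    show ?thesis
    proof (rule that[of \<sigma> j])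
      have "y (sg i) \<noteq> 0" if "i < j" for i
      proof
        assume "y (sg i) = 0"
        then have "i \<in> B" using s[of i] that *(2) by simp
        then show False using *(5) that by simp
      qed
      moreover have "y (tg i) \<noteq> 0" if "j < i" "i \<le> k" for i
      proof
        assume "y (tg i) = 0"
        then have "i \<in> A" using t[of i] that by simp
        then show False using *(4) that by simp
      qed
      ultimately show "y \<in> dom j" using ya by (simp add: dom_def)
      show "u \<in> \<sigma>" if "u \<in> R" "u \<notin> \<Gamma>" "y (u, 0) = 0" for u by (rule u[OF that])
    qed (use * ej in auto)
  qed
qed

lemma semistable_dom:
  assumes "y \<in> semistable N' \<Sigma>'"
  shows "\<exists>j\<le>k. y \<in> dom j"
  by (rule lifted_semistable_cases[OF assms]) blast

text \<open>The preimage is \<open>psi j y\<close>. It is semistable because among its edge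
  coordinates only those at \<open>e j\<close> and \<open>e (j + 1)\<close> can vanish, together
  with \<open>y (sg j)\<close> and \<open>y (tg j)\<close>.\<close>

lemma Phi_surj:
  assumes y: "y \<in> semistable N' \<Sigma>'" and eq: "on_image y"
  shows "\<exists>x\<in>U. Phi x = y"
proof -
  obtain \<sigma> j where *: "\<sigma> \<in> \<Sigma>" "j \<le> k" "y \<in> dom j"
    "\<And>u. u \<in> R \<Longrightarrow> u \<notin> \<Gamma> \<Longrightarrow> y (u, 0) = 0 \<Longrightarrow> u \<in> \<sigma>"
    "y (sg j) = 0 \<Longrightarrow> e j \<in> \<sigma>" "y (tg j) = 0 \<Longrightarrow> e (j + 1) \<in> \<sigma>"
    by (rule lifted_semistable_cases[OF y]) blast
  have "u \<in> \<sigma>" if u: "u \<in> R" "psi j y u = 0" for u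
  proof (cases "u \<in> \<Gamma>")
    case False
    then show ?thesis using u *(4)[of u] by (simp add: psi_lifted)
  next
    case True
    then obtain i where i: "i \<le> k + 1" "u = e i" using R_edge u(1) by blast
    show ?thesis
    proof (cases "i \<le> j")
      case True
      then have "y (sg i) = 0"
        using u(2) psi_low[OF *(2) True, of y] sden_nonzero[OF *(3) True] i(2) by simp
      moreover have "\<not> i < j" using *(3) calculation by (auto simp: dom_def)
      ultimately show ?thesis using True i(2) *(5) by (metis le_neq_implies_less)
    next
      case False
      then have ji: "j < i" by simp
      then have "y (tg (i - 1)) = 0"
        using u(2) psi_high[OF ji i(1), of y] tden_nonzero[OF *(3) ji i(1)] i(2) by simp
      moreover have "\<not> j < i - 1"
      proof
        assume "j < i - 1"
        then have "y (tg (i - 1)) \<noteq> 0" using *(3) i(1) by (simp add: dom_def)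
        then show False using calculation by simp
      qed
      ultimately have "i = j + 1" using ji by linarith
      moreover from this have "y (tg j) = 0" using \<open>y (tg (i - 1)) = 0\<close> by simp
      ultimately show ?thesis using *(6) i(2) by simp
    qed
  qed
  then have "psi j y \<in> U"
    unfolding semistable_iff using *(1) psi_affine by blast
  then show ?thesis using Phi_psi[OF *(2,3) eq] by blast
qed

lemma Phi_inj:
  assumes x: "x \<in> U" "z \<in> U" and eq: "Phi x = Phi z"
  shows "x = z"
proof -
  obtain j where j: "j \<le> k" "Phi x \<in> dom j" using semistable_dom[OF Phi_semistable[OF x(1)]] by blast
  then have "psi j (Phi x) = x" using x(1) U_affine by (intro psi_Phi) auto
  moreover have "psi j (Phi z) = z" using x(2) U_affine j eq by (intro psi_Phi) auto
  ultimately show ?thesis using eq by metis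
qed

end

section \<open>The correspondence of the two torus groups\<close>

lemma prod_powi: "(\<Prod>i\<in>I. f i) powi n = (\<Prod>i\<in>I. f i powi n :: complex)"
  by (induction I rule: infinite_finite_induct) (simp_all add: power_int_mult_distrib)

lemma powi_sum:
  fixes x :: complex
  assumes "x \<noteq> 0"
  shows "(\<Prod>i\<in>I. x powi a i) = x powi (\<Sum>i\<in>I. a i)"
  by (induction I rule: infinite_finite_induct) (simp_all add: power_int_add assms)

text \<open>The factor \<open>f l\<close> occurs once for each \<open>i < l\<close>. The inner
  products are the t coordinates, and the exponent \<open>l\<close> matches the multiple of
  \<open>\<delta>\<close> in \<open>e l\<close>.\<close>

lemma prod_triangle:
  fixes f :: "nat \<Rightarrow> complex"
  shows "(\<Prod>i\<le>n. \<Prod>l\<in>{i + 1..n + 1}. f l) = (\<Prod>l\<le>n + 1. f l ^ l)"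
proof (induction n)
  case (Suc n)
  have split: "(\<Prod>l\<in>{i + 1..Suc n + 1}. f l) = (\<Prod>l\<in>{i + 1..n + 1}. f l) * f (n + 2)" if "i \<le> n" for i
  proof -
    have "{i + 1..Suc n + 1} = insert (n + 2) {i + 1..n + 1}" using that by auto
    then show ?thesis by (simp add: mult.commute)
  qed
  have "(\<Prod>i\<le>Suc n. \<Prod>l\<in>{i + 1..Suc n + 1}. f l) = (\<Prod>i\<le>n. \<Prod>l\<in>{i + 1..Suc n + 1}. f l) * f (n + 2)"
    by simp
  also have "(\<Prod>i\<le>n. \<Prod>l\<in>{i + 1..Suc n + 1}. f l) = (\<Prod>i\<le>n. (\<Prod>l\<in>{i + 1..n + 1}. f l) * f (n + 2))"
    by (rule prod.cong[OF refl], rule split) simp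
  also have "\<dots> = (\<Prod>l\<le>n + 1. f l ^ l) * f (n + 2) ^ (n + 1)"
    by (simp only: prod.distrib Suc.IH) simp
  finally show ?case by (simp add: mult_ac)
qed simp

context fan_with_edge
begin

abbreviation "G' \<equiv> torus_group N' \<Sigma>'"
abbreviation "U' \<equiv> semistable N' \<Sigma>'"
abbreviation "X' \<equiv> toric_variety N' \<Sigma>'"

lemma prod_R: "(\<Prod>u\<in>R. f u) = (\<Prod>u\<in>R - \<Gamma>. f u) * (\<Prod>l\<le>k + 1. f (e l))"
proof -
  have R: "R = (R - \<Gamma>) \<union> e ` {..k + 1}" using e_mem R_edge by auto
  have "inj_on e {..k + 1}" using e_inj by (auto simp: inj_on_def)
  then have "(\<Prod>u\<in>e ` {..k + 1}. f u) = (\<Prod>l\<le>k + 1. f (e l))" by (simp add: prod.reindex)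
  moreover have "(\<Prod>u\<in>(R - \<Gamma>) \<union> e ` {..k + 1}. f u) = (\<Prod>u\<in>R - \<Gamma>. f u) * (\<Prod>u\<in>e ` {..k + 1}. f u)"
    using finite_rays e_mem by (intro prod.union_disjoint) auto
  ultimately show ?thesis using R by simp
qed

lemma prod_R': "(\<Prod>g\<in>R'. f g) = (\<Prod>u\<in>R - \<Gamma>. f (u, 0)) * (\<Prod>i\<le>k. f (tg i)) * (\<Prod>i\<le>k. f (sg i))"
  unfolding R'_eq all_gens_def by (rule lgen_prod) auto

lemma Phi_nonzero:
  assumes "\<And>u. u \<in> R \<Longrightarrow> x u \<noteq> 0" "g \<in> R'"
  shows "Phi x g \<noteq> 0"
  using assms(2)
proof (cases rule: R'_cases)
  case (1 u)
  then show ?thesis using assms(1) by (simp add: Phi_lifted)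
next
  case (2 i)
  then show ?thesis using assms(1) e_mem by (auto simp: Phi_tg)
next
  case (3 i)
  then show ?thesis using assms(1) e_mem by (auto simp: Phi_sg)
qed

text \<open>In each pair the common part of the two exponents falls on the product
  \<open>total x\<close>, and these parts add up to \<open>E\<close>, the value of \<open>m\<close>
  at \<open>e 0\<close>; the excess \<open>d\<close>, its value at \<open>\<delta>\<close>, falls on
  the t coordinate. So \<open>x (e l)\<close> receives the exponent \<open>E + l d\<close>, which is
  the value of \<open>m\<close> at \<open>e l\<close>.\<close>

lemma char_Phi:
  assumes x: "\<And>u. u \<in> R \<Longrightarrow> x u \<noteq> 0" and m': "m' \<in> dual_lattice N'" and m: "m \<in> dual_lattice N"
    and mm: "\<And>p. blinfun_apply m p = blinfun_apply m' (p, 0)"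
  shows "(\<Prod>g\<in>R'. Phi x g powi \<lfloor>blinfun_apply m' g\<rfloor>) = (\<Prod>u\<in>R. x u powi \<lfloor>blinfun_apply m u\<rfloor>)"
proof -
  define a where "a i = \<lfloor>blinfun_apply m' (sg i)\<rfloor>" for i
  define d where "d = \<lfloor>blinfun_apply m \<delta>\<rfloor>"
  define E where "E = \<lfloor>blinfun_apply m (e 0)\<rfloor>"
  have a: "real_of_int (a i) = blinfun_apply m' (sg i)" if "i \<le> k" for i
    unfolding a_def using dual_lattice_floor[OF m'] sg_mem[OF that] lifted.rays_subset_lattice by blast
  have d: "real_of_int d = blinfun_apply m \<delta>"
    unfolding d_def by (rule dual_lattice_floor[OF m \<delta>_lattice])
  have E: "real_of_int E = blinfun_apply m (e 0)"
    unfolding E_def using dual_lattice_floor[OF m] e_mem[of 0] by blast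
  have tgf: "\<lfloor>blinfun_apply m' (tg i)\<rfloor> = a i + d" if "i \<le> k" for i
  proof -
    have "blinfun_apply m' (tg i) = real_of_int (a i + d)"
      using a[OF that] d mm[of \<delta>] by (simp add: tg_eq blinfun.add_right)
    then show ?thesis by (simp only: floor_of_int)
  qed
  have ef: "\<lfloor>blinfun_apply m (e l)\<rfloor> = E + int l * d" if "l \<le> k + 1" for l
  proof -
    have "blinfun_apply m (e l) = real_of_int (E + int l * d)"
      using E d by (simp add: e_eq[OF that] blinfun.add_right blinfun.scaleR_right)
    then show ?thesis by (simp only: floor_of_int)
  qed
  have suma: "(\<Sum>i\<le>k. a i) = E"
  proof -
    have "real_of_int (\<Sum>i\<le>k. a i) = (\<Sum>i\<le>k. blinfun_apply m' (sg i))"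
      using a by simp
    also have "\<dots> = blinfun_apply m' (\<Sum>i\<le>k. 1 *\<^sub>R sg i)"
      by (simp add: blinfun.sum_right)
    also have "\<dots> = real_of_int E"
      unfolding sum_sg_const using E mm by simp
    finally show ?thesis by (simp only: of_int_eq_iff)
  qed
  have xe: "x (e l) \<noteq> 0" if "l \<le> k + 1" for l using x e_mem[OF that] by blast
  have nz: "total x \<noteq> 0" "\<And>i. i \<le> k \<Longrightarrow> Phi x (tg i) \<noteq> 0" "\<And>i. i \<le> k \<Longrightarrow> Phi x (sg i) \<noteq> 0"
    using xe Phi_nonzero[OF x tg_mem] Phi_nonzero[OF x sg_mem] by (auto simp: total_def)
  have "(\<Prod>i\<le>k. Phi x (tg i) powi \<lfloor>blinfun_apply m' (tg i)\<rfloor>) * (\<Prod>i\<le>k. Phi x (sg i) powi \<lfloor>blinfun_apply m' (sg i)\<rfloor>)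
      = (\<Prod>i\<le>k. Phi x (tg i) powi (a i + d) * Phi x (sg i) powi a i)"
    unfolding prod.distrib[symmetric] by (rule prod.cong) (auto simp: tgf a_def)
  also have "\<dots> = (\<Prod>i\<le>k. total x powi a i * Phi x (tg i) powi d)"
  proof (rule prod.cong)
    fix i assume "i \<in> {..k}"
    then have i: "i \<le> k" by simp
    have "Phi x (tg i) powi (a i + d) * Phi x (sg i) powi a i
        = (Phi x (sg i) * Phi x (tg i)) powi a i * Phi x (tg i) powi d"
      using nz(2)[OF i] by (simp add: power_int_add power_int_mult_distrib mult_ac)
    then show "Phi x (tg i) powi (a i + d) * Phi x (sg i) powi a i = total x powi a i * Phi x (tg i) powi d"
      by (simp only: Phi_sg_tg[OF i])
  qed simp
  also have "\<dots> = total x powi E * (\<Prod>i\<le>k. Phi x (tg i)) powi d"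
    by (simp add: prod.distrib powi_sum[OF nz(1)] suma prod_powi)
  also have "(\<Prod>i\<le>k. Phi x (tg i)) = (\<Prod>l\<le>k + 1. x (e l) ^ l)"
  proof -
    have "(\<Prod>i\<le>k. Phi x (tg i)) = (\<Prod>i\<le>k. \<Prod>l\<in>{i + 1..k + 1}. x (e l))"
      by (rule prod.cong) (simp_all only: Phi_tg atMost_iff)
    then show ?thesis by (simp only: prod_triangle)
  qed
  also have "total x powi E * (\<Prod>l\<le>k + 1. x (e l) ^ l) powi d = (\<Prod>l\<le>k + 1. x (e l) powi \<lfloor>blinfun_apply m (e l)\<rfloor>)"
    unfolding total_def prod_powi prod.distrib[symmetric]
  proof (rule prod.cong)
    fix l assume "l \<in> {..k + 1}"
    then have l: "l \<le> k + 1" by simp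
    show "x (e l) powi E * (x (e l) ^ l) powi d = x (e l) powi \<lfloor>blinfun_apply m (e l)\<rfloor>"
      unfolding ef[OF l] using xe[OF l] by (simp add: power_int_add power_int_mult)
  qed simp
  finally have *: "(\<Prod>i\<le>k. Phi x (tg i) powi \<lfloor>blinfun_apply m' (tg i)\<rfloor>) * (\<Prod>i\<le>k. Phi x (sg i) powi \<lfloor>blinfun_apply m' (sg i)\<rfloor>)
      = (\<Prod>l\<le>k + 1. x (e l) powi \<lfloor>blinfun_apply m (e l)\<rfloor>)" .
  have "(\<Prod>u\<in>R - \<Gamma>. Phi x (u, 0) powi \<lfloor>blinfun_apply m' (u, 0)\<rfloor>) = (\<Prod>u\<in>R - \<Gamma>. x u powi \<lfloor>blinfun_apply m u\<rfloor>)"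
    by (rule prod.cong) (auto simp: Phi_lifted mm)
  then show ?thesis unfolding prod_R prod_R' mult.assoc * by simp
qed

lemma Phi_torus:
  assumes g: "g \<in> G"
  shows "Phi g \<in> G'"
proof (rule lifted.torusI)
  show "Phi g \<in> extensional R'" by (simp add: Phi_def)
  show "Phi g h \<noteq> 0" if "h \<in> R'" for h by (rule Phi_nonzero[OF torus_nonzero[OF g] that])
  fix m' assume m': "m' \<in> dual_lattice N'"
  define m where "m = Blinfun (\<lambda>p. blinfun_apply m' (p, 0))"
  have "bounded_linear (\<lambda>p :: 'v. blinfun_apply m' (p, 0))"
    by (rule bounded_linear_compose[OF blinfun.bounded_linear_right
          bounded_linear_Pair[OF bounded_linear_ident bounded_linear_zero]])
  then have mm: "blinfun_apply m p = blinfun_apply m' (p, 0)" for p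
    by (simp add: m_def bounded_linear_Blinfun_apply)
  have m: "m \<in> dual_lattice N"
    using m' by (simp add: dual_lattice_def mm mem_N'_iff)
  show "(\<Prod>h\<in>R'. Phi g h powi \<lfloor>blinfun_apply m' h\<rfloor>) = 1"
    using char_Phi[OF torus_nonzero[OF g] m' m mm] torus_char[OF g m] by simp
qed

text \<open>For \<open>i < k\<close> the functional \<open>coord (i + 1)\<close> is 1 on both
  generators of pair \<open>i\<close>, -1 on both of pair \<open>k\<close> and 0 on all other rays,
  so its character condition says that these two pairs have equal products.\<close>

lemma torus_on_image:
  assumes h: "h \<in> G'"
  shows "on_image h"
proof -
  have nz: "h g \<noteq> 0" if "g \<in> R'" for g by (rule lifted.torus_nonzero[OF h that])
  have "h (sg i) * h (tg i) = h (sg k) * h (tg k)" if i: "i < k" for i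
  proof -
    have l: "i + 1 \<in> {1..k}" using i by simp
    have c: "\<lfloor>blinfun_apply (coord (i + 1)) (sg j)\<rfloor> = (if j = k then -1 else if j = i then 1 else 0)" if "j \<le> k" for j
    proof -
      have "blinfun_apply (coord (i + 1)) (sg j) = real_of_int (if j = k then -1 else if j = i then 1 else 0)"
        using lookup_snd_sg[OF that l] by auto
      then show ?thesis by (simp only: floor_of_int)
    qed
    have ct: "blinfun_apply (coord (i + 1)) (tg j) = blinfun_apply (coord (i + 1)) (sg j)" for j
      by (simp add: tg_eq)
    have P: "(\<Prod>j\<le>k. f j powi (if j = k then -1 else if j = i then 1 else 0)) = f i / f k"
      if "\<And>j. j \<le> k \<Longrightarrow> f j \<noteq> 0" for f :: "nat \<Rightarrow> complex"
    proof -
      have "(\<Prod>j\<le>k. f j powi (if j = k then -1 else if j = i then 1 else 0))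
          = (\<Prod>j\<le>k. (if j = i then f j else 1) * (if j = k then inverse (f j) else 1))"
        using i by (intro prod.cong) (auto simp: power_int_minus)
      also have "\<dots> = f i * inverse (f k)" using i by (simp add: prod.distrib)
      finally show ?thesis by (simp add: divide_inverse)
    qed
    have "1 = (\<Prod>g\<in>R'. h g powi \<lfloor>blinfun_apply (coord (i + 1)) g\<rfloor>)"
      by (rule lifted.torus_char[OF h coord_dual, symmetric])
    also have "\<dots> = (\<Prod>j\<le>k. h (tg j) powi \<lfloor>blinfun_apply (coord (i + 1)) (tg j)\<rfloor>)
        * (\<Prod>j\<le>k. h (sg j) powi \<lfloor>blinfun_apply (coord (i + 1)) (sg j)\<rfloor>)"
      unfolding prod_R' by simp
    also have "(\<Prod>j\<le>k. h (sg j) powi \<lfloor>blinfun_apply (coord (i + 1)) (sg j)\<rfloor>)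
        = (\<Prod>j\<le>k. h (sg j) powi (if j = k then -1 else if j = i then 1 else 0))"
      by (rule prod.cong[OF refl], subst c) auto
    also have "\<dots> = h (sg i) / h (sg k)" by (rule P) (rule nz[OF sg_mem])
    also have "(\<Prod>j\<le>k. h (tg j) powi \<lfloor>blinfun_apply (coord (i + 1)) (tg j)\<rfloor>)
        = (\<Prod>j\<le>k. h (tg j) powi (if j = k then -1 else if j = i then 1 else 0))"
      by (rule prod.cong[OF refl], subst ct, subst c) auto
    also have "\<dots> = h (tg i) / h (tg k)" by (rule P) (rule nz[OF tg_mem])
    finally show ?thesis
      using nz[OF sg_mem[of k]] nz[OF tg_mem[of k]] by (simp add: field_simps)
  qed
  then have "h (sg i) * h (tg i) = h (sg k) * h (tg k)" if "i \<le> k" for i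
    using that by (cases "i = k") auto
  then show ?thesis unfolding on_image_def by (metis le0)
qed

text \<open>A group element has no zero coordinate, so it lies in \<open>dom k\<close>, and it
  solves the equations; \<open>psi k\<close> inverts \<open>Phi\<close> on it, and
  \<open>char_Phi\<close> for \<open>pull m\<close> turns the conditions of the lifted group into
  those of the base group.\<close>

lemma torus_Phi_surj:
  assumes h: "h \<in> G'"
  shows "\<exists>g\<in>G. Phi g = h"
proof -
  have nz: "h g \<noteq> 0" if "g \<in> R'" for g by (rule lifted.torus_nonzero[OF h that])
  have ha: "h \<in> affine_space R'"
    using h unfolding torus_group_def affine_space_def by auto
  have dom: "h \<in> dom k"
    using ha nz[OF sg_mem] by (auto simp: dom_def)
  define g where "g = psi k h"
  have Pg: "Phi g = h" unfolding g_def by (rule Phi_psi[OF le_refl dom torus_on_image[OF h]])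
  have gnz: "g u \<noteq> 0" if u: "u \<in> R" for u
  proof (cases "u \<in> \<Gamma>")
    case False
    then show ?thesis using Phi_lifted[OF u False, of g] nz[OF lifted_mem[OF u False]] Pg by simp
  next
    case True
    then obtain i where i: "i \<le> k + 1" "u = e i" using R_edge u by blast
    show ?thesis
    proof (cases "i = k + 1")
      case True
      then have "Phi g (tg k) = g u" using i Phi_tg[of k g] by simp
      then show ?thesis using nz[OF tg_mem[of k]] Pg by simp
    next
      case False
      then have ik: "i \<le> k" using i by simp
      have "Phi g (sg i) \<noteq> 0" using nz[OF sg_mem[OF ik]] Pg by simp
      then show ?thesis using i(2) by (auto simp: Phi_sg[OF ik])
    qed
  qed
  have "g \<in> G"
  proof (rule torusI)
    show "g \<in> extensional R" by (simp add: g_def psi_def)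
    show "g u \<noteq> 0" if "u \<in> R" for u by (rule gnz[OF that])
    fix m assume m: "m \<in> dual_lattice N"
    have "(\<Prod>u\<in>R. g u powi \<lfloor>blinfun_apply m u\<rfloor>) = (\<Prod>f\<in>R'. Phi g f powi \<lfloor>blinfun_apply (pull m) f\<rfloor>)"
      by (rule char_Phi[OF gnz pull_dual[OF m] m, symmetric]) simp_all
    also have "\<dots> = 1" unfolding Pg by (rule lifted.torus_char[OF h pull_dual[OF m]])
    finally show "(\<Prod>u\<in>R. g u powi \<lfloor>blinfun_apply m u\<rfloor>) = 1" .
  qed
  then show ?thesis using Pg by blast
qed

section \<open>Equivariance and regularity of the morphism and its local inverses\<close>

lemma Phi_act: "Phi (act R g x) = act R' (Phi g) (Phi x)"
proof (rule lifted_eqI[OF Phi_affine lifted.act_affine])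
  show "Phi (act R g x) (u, 0) = act R' (Phi g) (Phi x) (u, 0)" if "u \<in> R" "u \<notin> \<Gamma>" for u
    using that by (simp add: Phi_lifted act_apply lifted.act_apply lifted_mem)
  have ee: "act R g x (e l) = g (e l) * x (e l)" if "l \<le> k + 1" for l
    using e_mem[OF that] by (simp add: act_apply)
  show "Phi (act R g x) (tg i) = act R' (Phi g) (Phi x) (tg i)" if i: "i \<le> k" for i
  proof -
    have "(\<Prod>l\<in>{i + 1..k + 1}. act R g x (e l)) = (\<Prod>l\<in>{i + 1..k + 1}. g (e l) * x (e l))"
      by (rule prod.cong) (auto simp: ee)
    then show ?thesis using i by (simp only: Phi_tg lifted.act_apply tg_mem prod.distrib)
  qed
  show "Phi (act R g x) (sg i) = act R' (Phi g) (Phi x) (sg i)" if i: "i \<le> k" for i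
  proof -
    have "(\<Prod>l\<le>i. act R g x (e l)) = (\<Prod>l\<le>i. g (e l) * x (e l))"
      using i by (intro prod.cong) (auto simp: ee)
    then show ?thesis using i by (simp only: Phi_sg lifted.act_apply sg_mem prod.distrib)
  qed
qed

text \<open>Numerator and denominator of an edge coordinate scale by products of \<open>g\<close>
  that differ by one factor, so their quotient scales by \<open>g (e i)\<close>.\<close>

lemma psi_act:
  assumes j: "j \<le> k" and g: "\<And>u. u \<in> R \<Longrightarrow> g u \<noteq> 0"
  shows "psi j (act R' (Phi g) y) = act R g (psi j y)"
proof (rule base_eqI[OF psi_affine act_affine])
  show "psi j (act R' (Phi g) y) u = act R g (psi j y) u" if "u \<in> R" "u \<notin> \<Gamma>" for u
    using that by (simp add: psi_lifted act_apply lifted.act_apply lifted_mem Phi_lifted)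
  have ge: "g (e l) \<noteq> 0" if "l \<le> k + 1" for l using e_mem[OF that] g by blast
  fix i assume i: "i \<le> k + 1"
  then have eR: "e i \<in> R" using e_mem by blast
  show "psi j (act R' (Phi g) y) (e i) = act R g (psi j y) (e i)"
  proof (cases "i \<le> j")
    case True
    have "sden (act R' (Phi g) y) i = sden (Phi g) i * sden y i"
      using True j by (cases i) (simp_all add: sden_def lifted.act_apply sg_mem)
    moreover have "Phi g (sg i) = sden (Phi g) i * g (e i)"
      using True j by (simp add: Phi_sg sden_Phi flip: lessThan_Suc_atMost)
    moreover have "sden (Phi g) i \<noteq> 0"
      using ge i by (auto simp: sden_Phi[OF i])
    ultimately show ?thesis
      using True j eR by (simp add: psi_low[OF j True] act_apply lifted.act_apply sg_mem)
  next
    case False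
    then have ji: "j < i" by simp
    have "tden (act R' (Phi g) y) i = tden (Phi g) i * tden y i"
      using i by (simp add: tden_def lifted.act_apply tg_mem)
    moreover have "Phi g (tg (i - 1)) = tden (Phi g) i * g (e i)"
    proof -
      have "{i..k + 1} = insert i {i + 1..k + 1}" using i by auto
      then show ?thesis using ji i by (simp add: Phi_tg tden_Phi)
    qed
    moreover have "tden (Phi g) i \<noteq> 0"
      using ge unfolding tden_Phi[OF i] by auto
    ultimately show ?thesis
      using i eR ji by (simp add: psi_high[OF ji i] act_apply lifted.act_apply tg_mem)
  qed
qed

lemma on_image_act:
  assumes "\<And>u. u \<in> R \<Longrightarrow> g u \<noteq> 0"
  shows "on_image (act R' (Phi g) y) \<longleftrightarrow> on_image y"
proof -
  have "act R' (Phi g) y (sg i) * act R' (Phi g) y (tg i) = total g * (y (sg i) * y (tg i))" if "i \<le> k" for i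
    using Phi_sg_tg[OF that, of g] that by (simp add: lifted.act_apply sg_mem tg_mem)
  moreover have "total g \<noteq> 0" using assms e_mem by (auto simp: total_def)
  ultimately show ?thesis by (simp add: on_image_def)
qed

lemma dom_act: "h \<in> G' \<Longrightarrow> y \<in> dom j \<Longrightarrow> j \<le> k \<Longrightarrow> act R' h y \<in> dom j"
  using lifted.torus_nonzero sg_mem tg_mem by (simp add: dom_def lifted.act_apply)

lemma openin_dom:
  assumes "j \<le> k"
  shows "openin (zariski R') (dom j)"
proof -
  have "openin (zariski R') {y \<in> affine_space R'. (\<Prod>i<j. y (sg i)) * (\<Prod>i\<in>{j<..k}. y (tg i)) \<noteq> 0}"
    using assms by (intro openin_zariski_basic polyfun_mult polyfun_prod polyfun_var sg_mem tg_mem) auto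
  moreover have "{y \<in> affine_space R'. (\<Prod>i<j. y (sg i)) * (\<Prod>i\<in>{j<..k}. y (tg i)) \<noteq> 0} = dom j"
    unfolding dom_def by auto
  ultimately show ?thesis by simp
qed

lemma psi_regular:
  assumes j: "j \<le> k" and W: "openin (zariski R') W" "W \<subseteq> dom j" and u: "u \<in> R"
  shows "regular_on R' W (\<lambda>y. psi j y u)"
proof (cases "u \<in> \<Gamma>")
  case False
  then show ?thesis
    using regular_on_polyfun[OF W(1) polyfun_var[OF lifted_mem[OF u False]]] by (simp add: psi_lifted[OF u False])
next
  case True
  then obtain i where i: "i \<le> k + 1" "u = e i" using R_edge u by blast
  show ?thesis
  proof (cases "i \<le> j")
    case le: True
    have "regular_on R' W (\<lambda>y. sden y i)"
    proof (cases i)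
      case 0
      then show ?thesis using regular_on_const[OF W(1)] by (simp add: sden_def)
    next
      case (Suc l)
      then have "l \<le> k" using le j by simp
      then show ?thesis using Suc regular_on_polyfun[OF W(1) polyfun_var[OF sg_mem]] by (simp add: sden_def)
    qed
    moreover have "regular_on R' W (\<lambda>y. y (sg i))"
      using le j by (intro regular_on_polyfun[OF W(1) polyfun_var[OF sg_mem]]) simp
    ultimately have "regular_on R' W (\<lambda>y. y (sg i) / sden y i)"
      using sden_nonzero[OF _ le] W(2) by (intro regular_on_divide) auto
    then show ?thesis unfolding i(2) using psi_low[OF j le] by simp
  next
    case False
    then have ji: "j < i" by simp
    have "regular_on R' W (\<lambda>y. tden y i)"
    proof (cases "i = k + 1")
      case True
      then show ?thesis using regular_on_const[OF W(1)] by (simp add: tden_def)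
    next
      case False
      then show ?thesis using i regular_on_polyfun[OF W(1) polyfun_var[OF tg_mem]] by (simp add: tden_def)
    qed
    moreover have "regular_on R' W (\<lambda>y. y (tg (i - 1)))"
      using i by (intro regular_on_polyfun[OF W(1) polyfun_var[OF tg_mem]]) simp
    ultimately have "regular_on R' W (\<lambda>y. y (tg (i - 1)) / tden y i)"
      using tden_nonzero[OF _ ji i(1)] W(2) by (intro regular_on_divide) auto
    then show ?thesis unfolding i(2) using psi_high[OF ji i(1)] by simp
  qed
qed

lemma Phi_regular:
  assumes W: "openin (zariski R) W" and g: "g \<in> R'"
  shows "regular_on R W (\<lambda>x. Phi x g)"
  using g
proof (cases rule: R'_cases)
  case (1 u)
  then show ?thesis using regular_on_polyfun[OF W polyfun_var[OF 1(2)]] by (simp add: Phi_lifted)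
next
  case (2 i)
  have "regular_on R W (\<lambda>x. \<Prod>l\<in>{i + 1..k + 1}. x (e l))"
    using e_mem by (intro regular_on_polyfun[OF W] polyfun_prod polyfun_var) auto
  then show ?thesis unfolding 2(1) Phi_tg[OF 2(2)] .
next
  case (3 i)
  have "regular_on R W (\<lambda>x. \<Prod>l\<le>i. x (e l))"
    using e_mem 3(2) by (intro regular_on_polyfun[OF W] polyfun_prod polyfun_var) auto
  then show ?thesis unfolding 3(1) Phi_sg[OF 3(2)] .
qed

section \<open>The closed embedding\<close>

definition phi :: "('v \<Rightarrow> complex) set \<Rightarrow> ('v \<times> (nat \<Rightarrow>\<^sub>0 real) \<Rightarrow> complex) set" where
  "phi p = orbit N' \<Sigma>' (Phi (SOME x. x \<in> U \<and> p = orbit N \<Sigma> x))"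

definition phi_inv :: "('v \<times> (nat \<Rightarrow>\<^sub>0 real) \<Rightarrow> complex) set \<Rightarrow> ('v \<Rightarrow> complex) set" where
  "phi_inv q = orbit N \<Sigma> (SOME x. x \<in> U \<and> q = orbit N' \<Sigma>' (Phi x))"

text \<open>One direction makes \<open>phi\<close> well defined, the other makes it injective and
  \<open>phi_inv\<close> well defined. The latter uses that every lifted group element is some
  \<open>Phi g\<close> and that \<open>Phi\<close> is injective on semistable points.\<close>

lemma orbit_Phi_iff:
  assumes "x \<in> U" "z \<in> U"
  shows "orbit N' \<Sigma>' (Phi x) = orbit N' \<Sigma>' (Phi z) \<longleftrightarrow> orbit N \<Sigma> x = orbit N \<Sigma> z"
proof
  assume "orbit N \<Sigma> x = orbit N \<Sigma> z"
  then obtain g where "g \<in> G" "z = act R g x"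
    using orbit_eq_iff[OF U_affine[OF assms(1)] U_affine[OF assms(2)]] by blast
  then show "orbit N' \<Sigma>' (Phi x) = orbit N' \<Sigma>' (Phi z)"
    using lifted.orbit_eqI[OF Phi_torus Phi_affine] by (simp add: Phi_act)
next
  assume "orbit N' \<Sigma>' (Phi x) = orbit N' \<Sigma>' (Phi z)"
  then obtain h where h: "h \<in> G'" "Phi z = act R' h (Phi x)"
    using lifted.orbit_eq_iff[OF Phi_affine Phi_affine] by blast
  then obtain g where g: "g \<in> G" "Phi g = h" using torus_Phi_surj by blast
  have "Phi z = Phi (act R g x)" using h g by (simp add: Phi_act)
  then have "z = act R g x" by (rule Phi_inj[OF assms(2) act_U[OF g(1) assms(1)]])
  then show "orbit N \<Sigma> x = orbit N \<Sigma> z" using orbit_eqI[OF g(1) U_affine[OF assms(1)]] by simp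
qed

lemma phi_orbit:
  assumes x: "x \<in> U"
  shows "phi (orbit N \<Sigma> x) = orbit N' \<Sigma>' (Phi x)"
proof -
  define z where "z = (SOME z. z \<in> U \<and> orbit N \<Sigma> x = orbit N \<Sigma> z)"
  have "z \<in> U \<and> orbit N \<Sigma> x = orbit N \<Sigma> z"
    unfolding z_def by (rule someI[of _ x]) (simp add: x)
  then show ?thesis
    using orbit_Phi_iff[of z x] x unfolding phi_def z_def[symmetric] by simp
qed

lemma phi_inv_orbit:
  assumes x: "x \<in> U"
  shows "phi_inv (orbit N' \<Sigma>' (Phi x)) = orbit N \<Sigma> x"
proof -
  define z where "z = (SOME z. z \<in> U \<and> orbit N' \<Sigma>' (Phi x) = orbit N' \<Sigma>' (Phi z))"
  have "z \<in> U \<and> orbit N' \<Sigma>' (Phi x) = orbit N' \<Sigma>' (Phi z)"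
    unfolding z_def by (rule someI[of _ x]) (simp add: x)
  then show ?thesis
    using orbit_Phi_iff[of z x] x unfolding phi_inv_def z_def[symmetric] by simp
qed

definition Z where "Z = phi ` points X"

lemma Z_eq: "Z = orbit N' \<Sigma>' ` {y \<in> U'. on_image y}"
proof -
  have "Z = (\<lambda>x. orbit N' \<Sigma>' (Phi x)) ` U"
    unfolding Z_def points_X image_image by (rule image_cong[OF refl phi_orbit])
  also have "\<dots> = orbit N' \<Sigma>' ` {y \<in> U'. on_image y}"
    using Phi_semistable on_image_Phi Phi_surj by blast
  finally show ?thesis .
qed

lemma Z_cases:
  assumes "q \<in> Z"
  obtains x where "x \<in> U" "q = orbit N' \<Sigma>' (Phi x)"
  using assms unfolding Z_def points_X by (auto simp: phi_orbit)

text \<open>Testing the elements \<open>Phi g\<close> suffices because they exhaust the lifted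
  group; for them the equivariance of \<open>psi j\<close> is available.\<close>

lemma lifted_invariantI:
  assumes "W \<subseteq> U'" "\<And>g y. g \<in> G \<Longrightarrow> y \<in> W \<Longrightarrow> act R' (Phi g) y \<in> W"
  shows "lifted.invariant W"
  unfolding lifted.invariant_def using assms torus_Phi_surj by blast

lemma invariant_mem_iff:
  assumes "lifted.invariant W" "y \<in> U'"
  shows "orbit N' \<Sigma>' y \<in> orbit N' \<Sigma>' ` W \<longleftrightarrow> y \<in> W"
  using lifted.preimage_image[OF assms(1)] assms(2) unfolding lifted.cox_preimage_eq by blast

lemma closedin_Z: "closedin (zar X') Z"
  unfolding Z_eq
proof (rule lifted.closedin_X_image)
  show "lifted.invariant {y \<in> U'. on_image y}"
    by (rule lifted_invariantI)
      (auto simp: on_image_act torus_nonzero intro: lifted.act_U Phi_torus)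
  have "U' - {y \<in> U'. on_image y}
      = U' \<inter> (\<Union>i\<in>{..k}. {y \<in> affine_space R'. y (sg i) * y (tg i) - y (sg 0) * y (tg 0) \<noteq> 0})"
    using lifted.U_affine unfolding on_image_def by auto
  moreover have "openin (zariski R') {y \<in> affine_space R'. y (sg i) * y (tg i) - y (sg 0) * y (tg 0) \<noteq> 0}"
    if "i \<in> {..k}" for i
    using that by (intro openin_zariski_basic polyfun_diff polyfun_mult polyfun_var sg_mem tg_mem) auto
  ultimately show "openin (zariski R') (U' - {y \<in> U'. on_image y})"
    using lifted.openin_U by (auto intro!: openin_Int openin_Union)
qed

lemma openin_preimage_Phi:
  assumes W: "openin (zariski R) W" and V: "openin (zariski R') V"
  shows "openin (zariski R) {x \<in> W. Phi x \<in> V}"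
  by (rule regular_preimage_openin[OF W Phi_regular[OF W] Phi_affine V])

lemma regular_on_Phi:
  assumes W: "openin (zariski R) W" and F: "regular_on R' V F" and sub: "\<And>x. x \<in> W \<Longrightarrow> Phi x \<in> V"
  shows "regular_on R W (\<lambda>x. F (Phi x))"
  by (rule regular_on_compose[OF W Phi_regular[OF W] Phi_affine F sub])

lemma preimage_phi:
  "cox_preimage N \<Sigma> {p \<in> points X. phi p \<in> V} = {x \<in> U. Phi x \<in> cox_preimage N' \<Sigma>' V}"
  unfolding cox_preimage_eq lifted.cox_preimage_eq points_X
  using Phi_semistable by (auto simp: phi_orbit)

lemma continuous_phi: "continuous_map (zar X) (zar X') phi"
  unfolding continuous_map_def
proof (intro conjI allI impI)
  show "phi \<in> topspace (zar X) \<rightarrow> topspace (zar X')"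
    unfolding topspace_X lifted.topspace_X using Phi_semistable by (auto simp: phi_orbit)
  fix V assume V: "openin (zar X') V"
  then have "openin (zariski R) {x \<in> U. Phi x \<in> cox_preimage N' \<Sigma>' V}"
    unfolding lifted.openin_X by (intro openin_preimage_Phi openin_U) blast
  then show "openin (zar X) {x \<in> topspace (zar X). phi x \<in> V}"
    unfolding openin_X points_def[symmetric] preimage_phi by (auto simp: points_X)
qed

lemma morphism_phi: "morphism X X' phi"
  unfolding morphism_def
proof (intro conjI allI impI continuous_phi)
  fix V f assume V: "openin (zar X') V" and f: "f \<in> reg X' V"
  let ?W = "{x \<in> U. Phi x \<in> cox_preimage N' \<Sigma>' V}"
  have F: "regular_on R' (cox_preimage N' \<Sigma>' V) (f \<circ> orbit N' \<Sigma>')"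
    using f by (simp add: lifted.reg_X)
  have W: "openin (zariski R) ?W"
    by (rule openin_preimage_Phi[OF openin_U regular_on_imp_openin[OF F]])
  have "regular_on R ?W (\<lambda>x. (f \<circ> orbit N' \<Sigma>') (Phi x))"
    by (rule regular_on_Phi[OF W F]) simp
  then have "regular_on R ?W (f \<circ> phi \<circ> orbit N \<Sigma>)"
    by (rule regular_on_cong) (auto simp: phi_orbit)
  then show "f \<circ> phi \<in> reg X {p \<in> points X. phi p \<in> V}"
    unfolding reg_X preimage_phi .
qed

lemma Z_subset: "Z \<subseteq> topspace (zar X')"
  using closedin_subset[OF closedin_Z] .

lemma points_subvariety: "points (subvariety X' Z) = Z"
  using Z_subset by (auto simp: points_def subvariety_def)

lemma zar_subvariety: "zar (subvariety X' Z) = subtopology (zar X') Z"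
  by (simp add: subvariety_def)

lemma reg_subvariety:
  "f \<in> reg (subvariety X' Z) A \<longleftrightarrow> (\<forall>p\<in>A. \<exists>V g. openin (zar X') V \<and> p \<in> V \<and> g \<in> reg X' V \<and> (\<forall>q\<in>V \<inter> A. f q = g q))"
  by (simp add: subvariety_def)

lemma continuous_phi_Z: "continuous_map (zar X) (subtopology (zar X') Z) phi"
  using continuous_phi unfolding continuous_map_in_subtopology by (simp add: Z_def points_def)

lemma morphism_phi_Z: "morphism X (subvariety X' Z) phi"
  unfolding morphism_def zar_subvariety
proof (intro conjI allI impI continuous_phi_Z)
  fix A f assume A: "openin (subtopology (zar X') Z) A" and f: "f \<in> reg (subvariety X' Z) A"
  have "openin (zar X) {p \<in> points X. phi p \<in> A}"
    using openin_continuous_map_preimage[OF continuous_phi_Z A] by (simp add: points_def)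
  then have W: "openin (zariski R) (cox_preimage N \<Sigma> {p \<in> points X. phi p \<in> A})"
    by (simp add: openin_X)
  show "f \<circ> phi \<in> reg X {p \<in> points X. phi p \<in> A}"
    unfolding reg_X
  proof (rule regular_on_local)
    fix x assume x: "x \<in> cox_preimage N \<Sigma> {p \<in> points X. phi p \<in> A}"
    then have "x \<in> U" "orbit N' \<Sigma>' (Phi x) \<in> A" by (auto simp: cox_preimage_eq phi_orbit)
    then obtain V g where V: "openin (zar X') V" "orbit N' \<Sigma>' (Phi x) \<in> V" "g \<in> reg X' V" "\<forall>q\<in>V \<inter> A. f q = g q"
      using f unfolding reg_subvariety by blast
    define W' where "W' = {z \<in> cox_preimage N \<Sigma> {p \<in> points X. phi p \<in> A}. Phi z \<in> cox_preimage N' \<Sigma>' V}"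
    have F: "regular_on R' (cox_preimage N' \<Sigma>' V) (g \<circ> orbit N' \<Sigma>')"
      using V by (simp add: lifted.reg_X)
    have W': "openin (zariski R) W'"
      unfolding W'_def by (rule openin_preimage_Phi[OF W regular_on_imp_openin[OF F]])
    have "regular_on R W' (\<lambda>x. (g \<circ> orbit N' \<Sigma>') (Phi x))"
      by (rule regular_on_Phi[OF W' F]) (simp add: W'_def)
    moreover have "(f \<circ> phi \<circ> orbit N \<Sigma>) z = (g \<circ> orbit N' \<Sigma>') (Phi z)" if "z \<in> W'" for z
      using that V(4) by (auto simp: W'_def cox_preimage_eq lifted.cox_preimage_eq phi_orbit)
    moreover have "x \<in> W'"
      using x V(2) Phi_semistable \<open>x \<in> U\<close> by (simp add: W'_def lifted.cox_preimage_eq)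
    ultimately show "\<exists>V G. x \<in> V \<and> V \<subseteq> cox_preimage N \<Sigma> {p \<in> points X. phi p \<in> A} \<and> regular_on R V G
        \<and> (\<forall>y\<in>V. (f \<circ> phi \<circ> orbit N \<Sigma>) y = G y)"
      by (intro exI[of _ W'] exI[of _ "\<lambda>x. (g \<circ> orbit N' \<Sigma>') (Phi x)"]) (auto simp: W'_def)
  qed
qed

lemma psi_act_torus: "j \<le> k \<Longrightarrow> g \<in> G \<Longrightarrow> psi j (act R' (Phi g) y) = act R g (psi j y)"
  by (rule psi_act) (auto simp: torus_nonzero)

text \<open>The preimages under the various \<open>psi j\<close> are open and saturated, and their
  union \<open>B\<close> meets \<open>Z\<close> in the desired set because on the image every
  applicable \<open>psi j\<close> inverts \<open>Phi\<close>; away from the image the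
  \<open>psi j\<close> need not agree.\<close>

lemma phi_inv_preimage:
  assumes A: "openin (zar X) A"
  shows "\<exists>B. openin (zar X') B \<and> B \<inter> Z = {q \<in> Z. phi_inv q \<in> A}"
proof -
  define W where "W j = {y \<in> U' \<inter> dom j. psi j y \<in> cox_preimage N \<Sigma> A}" for j
  define B where "B = (\<Union>j\<in>{..k}. W j)"
  have UW: "openin (zariski R') (U' \<inter> dom j)" if "j \<le> k" for j
    using openin_dom[OF that] lifted.openin_U by blast
  have "openin (zariski R') (W j)" if j: "j \<le> k" for j
    unfolding W_def
    by (rule regular_preimage_openin[OF UW[OF j] psi_regular[OF j UW[OF j]] psi_affine])
      (use A in \<open>auto simp: openin_X\<close>)
  then have oB: "openin (zariski R') B"
    unfolding B_def by (intro openin_Union) auto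
  have inv: "act R' (Phi g) y \<in> W j" if "j \<le> k" "g \<in> G" "y \<in> W j" for g y j
    using that invariant_preimage[of A] unfolding W_def invariant_def
    by (auto simp: psi_act_torus intro!: lifted.act_U dom_act Phi_torus)
  have iB: "lifted.invariant B"
    by (rule lifted_invariantI) (use inv in \<open>auto simp: B_def W_def\<close>)
  have mem: "Phi x \<in> B \<longleftrightarrow> orbit N \<Sigma> x \<in> A" if x: "x \<in> U" for x
  proof -
    have "Phi x \<in> W j \<longleftrightarrow> Phi x \<in> dom j \<and> orbit N \<Sigma> x \<in> A" if "j \<le> k" for j
      using psi_Phi[OF that U_affine[OF x]] x Phi_semistable[OF x] by (auto simp: W_def cox_preimage_eq)
    then show ?thesis using semistable_dom[OF Phi_semistable[OF x]] by (auto simp: B_def)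
  qed
  have "q \<in> orbit N' \<Sigma>' ` B \<longleftrightarrow> phi_inv q \<in> A" if q: "q \<in> Z" for q
    using q
  proof (cases rule: Z_cases)
    case (1 x)
    then show ?thesis
      using mem[OF 1(1)] by (simp add: phi_inv_orbit invariant_mem_iff[OF iB Phi_semistable])
  qed
  then have "orbit N' \<Sigma>' ` B \<inter> Z = {q \<in> Z. phi_inv q \<in> A}" by blast
  then show ?thesis using lifted.openin_X_image[OF iB oB] by blast
qed

lemma continuous_phi_inv: "continuous_map (subtopology (zar X') Z) (zar X) phi_inv"
  unfolding continuous_map_def
proof (intro conjI allI impI)
  have tZ: "topspace (subtopology (zar X') Z) = Z" using Z_subset by auto
  show "phi_inv \<in> topspace (subtopology (zar X') Z) \<rightarrow> topspace (zar X)"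
    unfolding tZ topspace_X by (auto elim!: Z_cases simp: phi_inv_orbit)
  fix A assume "openin (zar X) A"
  then obtain B where "openin (zar X') B" "B \<inter> Z = {q \<in> Z. phi_inv q \<in> A}"
    using phi_inv_preimage by blast
  then show "openin (subtopology (zar X') Z) {q \<in> topspace (subtopology (zar X') Z). phi_inv q \<in> A}"
    unfolding tZ openin_subtopology by metis
qed

text \<open>
  The local inverses \<open>psi j\<close> are equivariant but not regular on the whole of \<open>U'\<close>, so a regular
  function is first written as a quotient of two polynomials of the same weight.
\<close>

lemma regular_extension:
  assumes f: "f \<in> reg X A" and x0: "x0 \<in> U" "orbit N \<Sigma> x0 \<in> A"
  shows "\<exists>V g. openin (zar X') V \<and> orbit N' \<Sigma>' (Phi x0) \<in> V \<and> g \<in> reg X' V \<and>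
    (\<forall>x\<in>U. orbit N \<Sigma> x \<in> A \<longrightarrow> orbit N' \<Sigma>' (Phi x) \<in> V \<longrightarrow> g (orbit N' \<Sigma>' (Phi x)) = f (orbit N \<Sigma> x))"
proof -
  have x0A: "x0 \<in> cox_preimage N \<Sigma> A" using x0 by (simp add: cox_preimage_eq)
  have H: "regular_on R (cox_preimage N \<Sigma> A) (f \<circ> orbit N \<Sigma>)" using f by (simp add: reg_X)
  have "\<exists>p q b. semi_invariant b p \<and> semi_invariant b q \<and> peval q x0 \<noteq> 0 \<and>
      (\<forall>x\<in>cox_preimage N \<Sigma> A. (f \<circ> orbit N \<Sigma>) x * peval q x = peval p x)"
  proof (rule invariant_regular_fraction[OF invariant_preimage x0A H])
    show "(f \<circ> orbit N \<Sigma>) (act R g x) = (f \<circ> orbit N \<Sigma>) x" if "g \<in> G" "x \<in> cox_preimage N \<Sigma> A" for g x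
      using that U_affine by (simp add: cox_preimage_eq orbit_eqI)
  qed blast
  then obtain p q b where p: "semi_invariant b p" and q: "semi_invariant b q" "peval q x0 \<noteq> 0"
    and pq: "\<And>x. x \<in> cox_preimage N \<Sigma> A \<Longrightarrow> (f \<circ> orbit N \<Sigma>) x * peval q x = peval p x"
    by blast
  obtain j where j: "j \<le> k" "Phi x0 \<in> dom j" using semistable_dom[OF Phi_semistable[OF x0(1)]] by blast
  \<comment> \<open>The index \<open>j\<close> is fixed by the point \<open>x0\<close>; the
    extension lives where \<open>psi j\<close> is defined and the denominator is nonzero, an open
    saturated set that may reach beyond the image.\<close>
  define V where "V = {y \<in> U' \<inter> dom j. peval q (psi j y) \<noteq> 0}"
  define F where "F y = peval p (psi j y) / peval q (psi j y)" for y
  have UW: "openin (zariski R') (U' \<inter> dom j)"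
    using openin_dom[OF j(1)] lifted.openin_U by blast
  have pR: "p \<in> polys R" "q \<in> polys R" using p q by (auto simp: semi_invariant_def)
  have oV: "openin (zariski R') V"
    unfolding V_def
    by (rule regular_on_nonzero_openin[OF regular_on_polyfun_compose[OF UW psi_regular[OF j(1) UW] pR(2)]]) auto
  have rF: "regular_on R' V F"
    unfolding F_def
    by (rule regular_on_divide[OF regular_on_polyfun_compose[OF oV psi_regular[OF j(1) oV] pR(1)]
          regular_on_polyfun_compose[OF oV psi_regular[OF j(1) oV] pR(2)]]) (auto simp: V_def)
  have w: "peval r (psi j (act R' (Phi g) y)) = mon b g * peval r (psi j y)" if "semi_invariant b r" "g \<in> G" for r g y
    using that psi_affine by (simp add: psi_act_torus[OF j(1)] semi_invariant_def)
  have iV: "lifted.invariant V"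
    by (rule lifted_invariantI)
      (auto simp: V_def w[OF q(1)] semi_invariant_mon_nonzero[OF p] j intro!: lifted.act_U dom_act Phi_torus)
  have Fact: "F (act R' (Phi g) y) = F y" if "g \<in> G" for g y
    using semi_invariant_mon_nonzero[OF p that] by (simp add: F_def w[OF q(1) that] w[OF p that])
  \<comment> \<open>Descends \<open>F\<close> to orbits through a representative in
    \<open>V\<close>; two representatives differ by some \<open>Phi a\<close>, under which
    \<open>F\<close> is unchanged.\<close>
  define g where "g c = F (SOME y. y \<in> V \<and> orbit N' \<Sigma>' y = c)" for c
  have g: "g (orbit N' \<Sigma>' y) = F y" if y: "y \<in> V" for y
  proof -
    define z where "z = (SOME z. z \<in> V \<and> orbit N' \<Sigma>' z = orbit N' \<Sigma>' y)"
    have z: "z \<in> V \<and> orbit N' \<Sigma>' z = orbit N' \<Sigma>' y"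
      unfolding z_def by (rule someI[of _ y]) (simp add: y)
    have "z \<in> affine_space R'" "y \<in> affine_space R'"
      using z y lifted.U_affine by (auto simp: V_def)
    then obtain h where h: "h \<in> G'" "y = act R' h z"
      using z lifted.orbit_eq_iff by blast
    then obtain a where "a \<in> G" "Phi a = h" using torus_Phi_surj by blast
    then have "F z = F y" using Fact[of a z] h by simp
    then show ?thesis by (simp add: g_def z_def)
  qed
  have psi_back: "psi j (Phi x) = x" if "x \<in> U" "Phi x \<in> V" for x
    using that by (intro psi_Phi[OF j(1) U_affine]) (auto simp: V_def)
  have "Phi x0 \<in> V"
    using x0 Phi_semistable psi_Phi[OF j(1) U_affine j(2)] j q(2) by (simp add: V_def)
  moreover have "regular_on R' V (g \<circ> orbit N' \<Sigma>')"
    by (rule regular_on_cong[OF rF]) (simp add: g)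
  then have "g \<in> reg X' (orbit N' \<Sigma>' ` V)"
    by (simp add: lifted.reg_X lifted.preimage_image[OF iV])
  moreover have "g (orbit N' \<Sigma>' (Phi x)) = f (orbit N \<Sigma> x)"
    if x: "x \<in> U" "orbit N \<Sigma> x \<in> A" "orbit N' \<Sigma>' (Phi x) \<in> orbit N' \<Sigma>' ` V" for x
  proof -
    have V: "Phi x \<in> V" using x by (simp add: invariant_mem_iff[OF iV Phi_semistable])
    have "f (orbit N \<Sigma> x) * peval q x = peval p x"
      using pq[of x] x by (simp add: cox_preimage_eq)
    moreover have "peval q x \<noteq> 0" using V psi_back[OF x(1) V] by (simp add: V_def)
    ultimately show ?thesis by (simp add: g[OF V] F_def psi_back[OF x(1) V] field_simps)
  qed
  ultimately show ?thesis
    using lifted.openin_X_image[OF iV oV] by blast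
qed

lemma morphism_phi_inv: "morphism (subvariety X' Z) X phi_inv"
  unfolding morphism_def zar_subvariety points_subvariety
proof (intro conjI allI impI continuous_phi_inv)
  fix A f assume A: "openin (zar X) A" and f: "f \<in> reg X A"
  show "f \<circ> phi_inv \<in> reg (subvariety X' Z) {q \<in> Z. phi_inv q \<in> A}"
    unfolding reg_subvariety
  proof
    fix q assume q: "q \<in> {q \<in> Z. phi_inv q \<in> A}"
    then obtain x0 where x0: "x0 \<in> U" "q = orbit N' \<Sigma>' (Phi x0)" by (auto elim: Z_cases)
    then have "orbit N \<Sigma> x0 \<in> A" using q by (simp add: phi_inv_orbit)
    then obtain V g where V: "openin (zar X') V" "q \<in> V" "g \<in> reg X' V"
      and eq: "\<And>x. x \<in> U \<Longrightarrow> orbit N \<Sigma> x \<in> A \<Longrightarrow> orbit N' \<Sigma>' (Phi x) \<in> V \<Longrightarrow>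
        g (orbit N' \<Sigma>' (Phi x)) = f (orbit N \<Sigma> x)"
      using regular_extension[OF f x0(1)] x0(2) by blast
    have "(f \<circ> phi_inv) c = g c" if c: "c \<in> V" "c \<in> Z" "phi_inv c \<in> A" for c
      using c(2)
    proof (cases rule: Z_cases)
      case (1 x)
      then show ?thesis using eq[OF 1(1)] c by (simp add: phi_inv_orbit)
    qed
    then show "\<exists>V g. openin (zar X') V \<and> q \<in> V \<and> g \<in> reg X' V \<and>
        (\<forall>c\<in>V \<inter> {q \<in> Z. phi_inv q \<in> A}. (f \<circ> phi_inv) c = g c)"
      using V by (intro exI[of _ V] exI[of _ g]) auto
  qed
qed

lemma phi_inv_phi: "p \<in> points X \<Longrightarrow> phi_inv (phi p) = p"
  unfolding points_X by (auto simp: phi_orbit phi_inv_orbit)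

lemma phi_phi_inv: "q \<in> Z \<Longrightarrow> phi (phi_inv q) = q"
  by (auto elim!: Z_cases simp: phi_orbit phi_inv_orbit)

lemma closed_embedding_phi: "closed_embedding X X' phi"
  unfolding closed_embedding_def isomorphism_def Z_def[symmetric] points_subvariety
  using morphism_phi closedin_Z morphism_phi_Z morphism_phi_inv phi_inv_phi phi_phi_inv by blast

lemma has_krull_dim_Z: "has_krull_dim (subtopology (zar X') Z) DIM('v)"
proof (rule has_krull_dim_homeomorphic[OF _ has_krull_dim_X])
  have "homeomorphic_maps (zar X) (subtopology (zar X') Z) phi phi_inv"
    unfolding homeomorphic_maps_def
    using continuous_phi_Z continuous_phi_inv phi_inv_phi phi_phi_inv
    by (auto simp: points_def)
  then show "homeomorphic_map (zar X) (subtopology (zar X') Z) phi"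
    using homeomorphic_maps_map by blast
qed

end

section \<open>The equations\<close>

lemma partial_binomial:
  "partial u (var a * var b - var c * var d) x
     = (if a = u then x b else 0) + (if b = u then x a else 0)
       - ((if c = u then x d else 0) + (if d = u then x c else 0))"
proof -
  have D: "((\<lambda>z. (x(u := z)) a) has_field_derivative (if a = u then 1 else 0)) (at w)" for a w
    by (cases "a = u") (auto intro: derivative_eq_intros)
  have "((\<lambda>z. (x(u := z)) a * (x(u := z)) b - (x(u := z)) c * (x(u := z)) d) has_field_derivative
      ((if a = u then 1 else 0) * (x(u := x u)) b + (if b = u then 1 else 0) * (x(u := x u)) a)
       - ((if c = u then 1 else 0) * (x(u := x u)) d + (if d = u then 1 else 0) * (x(u := x u)) c)) (at (x u))"
    by (intro DERIV_diff DERIV_mult D)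
  then have "partial u (var a * var b - var c * var d) x =
      ((if a = u then 1 else 0) * (x(u := x u)) b + (if b = u then 1 else 0) * (x(u := x u)) a)
       - ((if c = u then 1 else 0) * (x(u := x u)) d + (if d = u then 1 else 0) * (x(u := x u)) c)"
    unfolding partial_def peval_diff peval_mult peval_var by (rule DERIV_imp_deriv)
  then show ?thesis by (simp del: fun_upd_apply)
qed

text \<open>On the rays \<open>m\<close> is the difference of the two exponent vectors, so both
  monomials have the same class. The support is only included in \<open>{p, q}\<close>, since
  coinciding monomials would cancel.\<close>

lemma homogeneous_binomial:
  assumes u: "{a, b, c, d} \<subseteq> ray_gens N \<Sigma>"
    and m: "m \<in> dual_lattice N"
      "\<And>u. u \<in> ray_gens N \<Sigma> \<Longrightarrow> blinfun_apply m u = (if a = u then 1 else 0) + (if b = u then 1 else 0)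
         - ((if c = u then 1 else 0) + (if d = u then 1 else 0))"
  shows "homogeneous N \<Sigma> (var a * var b - var c * var d)"
  unfolding homogeneous_def
proof (intro conjI ballI)
  show "var a * var b - var c * var d \<in> polys (ray_gens N \<Sigma>)"
    using u by (intro polys_diff polys_mult polys_var) auto
  define p q where "p = Poly_Mapping.single a (1::nat) + Poly_Mapping.single b 1"
    and "q = Poly_Mapping.single c (1::nat) + Poly_Mapping.single d 1"
  have "var a * var b - var c * var d = Poly_Mapping.single p 1 - Poly_Mapping.single q 1"
    by (simp add: var_def mult_single p_def q_def)
  then have keys: "Poly_Mapping.keys (var a * var b - var c * var d) \<subseteq> {p, q}"
    using keys_diff[of "Poly_Mapping.single p (1::complex)" "Poly_Mapping.single q 1"] by auto
  have pq: "real_of_int (int (Poly_Mapping.lookup p u) - int (Poly_Mapping.lookup q u)) = blinfun_apply m u"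
    if "u \<in> ray_gens N \<Sigma>" for u
    by (simp add: m(2)[OF that] p_def q_def lookup_add lookup_single when_def)
  have m': "0 \<in> dual_lattice N" "- m \<in> dual_lattice N"
    using m(1) by (auto simp: dual_lattice_def blinfun.minus_left)
  fix x y assume "x \<in> Poly_Mapping.keys (var a * var b - var c * var d)"
    "y \<in> Poly_Mapping.keys (var a * var b - var c * var d)"
  then consider "x = y" | "x = p" "y = q" | "x = q" "y = p" using keys by blast
  then show "same_class N \<Sigma> (\<lambda>u. int (Poly_Mapping.lookup x u)) (\<lambda>u. int (Poly_Mapping.lookup y u))"
  proof cases
    case 1
    then show ?thesis using m'(1) unfolding same_class_def by (intro bexI[of _ 0]) auto
  next
    case 2
    then show ?thesis using m(1) pq unfolding same_class_def by blast
  next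
    case 3
    then show ?thesis using m'(2) pq unfolding same_class_def
      by (intro bexI[of _ "- m"]) (auto simp: blinfun.minus_left simp flip: pq)
  qed
qed

context fan_with_edge
begin

definition eqn :: "nat \<Rightarrow> ('v \<times> (nat \<Rightarrow>\<^sub>0 real)) mpoly" where
  "eqn j = var (s_gen e k (j + 1)) * var (t_gen e k j) - var (s_gen e k j) * var (t_gen e k (j - 1))"

lemma eqn_eq: "1 \<le> j \<Longrightarrow> eqn j = var (sg j) * var (tg j) - var (sg (j - 1)) * var (tg (j - 1))"
  by (simp add: eqn_def sg_def tg_def)

lemma eqn_zero_iff: "(\<forall>j\<in>{1..k}. peval (eqn j) y = 0) \<longleftrightarrow> on_image y"
proof
  assume z: "\<forall>j\<in>{1..k}. peval (eqn j) y = 0"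
  have "y (sg i) * y (tg i) = y (sg 0) * y (tg 0)" if "i \<le> k" for i
    using that
  proof (induction i)
    case (Suc i)
    then have "peval (eqn (Suc i)) y = 0" using z by simp
    then show ?case using Suc by (simp add: eqn_eq)
  qed simp
  then show "on_image y" unfolding on_image_def by blast
next
  assume y: "on_image y"
  have "y (sg j) * y (tg j) = y (sg (j - 1)) * y (tg (j - 1))" if "j \<in> {1..k}" for j
  proof -
    have "j \<le> k" "j - 1 \<le> k" using that by auto
    then show ?thesis using y unfolding on_image_def by metis
  qed
  then show "\<forall>j\<in>{1..k}. peval (eqn j) y = 0" by (simp add: eqn_eq)
qed

lemma eqn_homogeneous:
  assumes j: "j \<in> {1..k}"
  shows "homogeneous N' \<Sigma>' (eqn j)"
proof -
  have jk: "1 \<le> j" "j \<le> k" "j - 1 \<le> k" using j by auto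
  \<comment> \<open>Takes the value 1 on pair \<open>j\<close>, -1 on pair \<open>j - 1\<close> and
    0 on all other rays. Each \<open>coord\<close> involved is also -1 on pair \<open>k\<close>:
    this cancels in the difference, and for \<open>j = k\<close> it supplies the value 1 after the
    sign change.\<close>
  define m where "m = (if j = k then - coord k else coord (j + 1) - coord j)"
  have m: "m \<in> dual_lattice N'"
    using coord_dual unfolding m_def dual_lattice_def
    by (auto simp: blinfun.minus_left blinfun.diff_left simp del: coord_apply)
  have ms: "blinfun_apply m (sg i) = (if j = i then 1 else 0) - (if j - 1 = i then 1 else 0)" if i: "i \<le> k" for i
  proof (cases "j = k")
    case True
    then show ?thesis using lookup_snd_sg[OF i, of j] j by (auto simp: m_def blinfun.minus_left)
  next
    case False
    then show ?thesis using lookup_snd_sg[OF i, of j] lookup_snd_sg[OF i, of "j + 1"] j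
      by (auto simp: m_def blinfun.diff_left)
  qed
  have mt: "blinfun_apply m (tg i) = blinfun_apply m (sg i)" for i
    by (simp add: m_def tg_eq blinfun.minus_left blinfun.diff_left)
  have ml: "blinfun_apply m (u, 0) = 0" for u
    by (simp add: m_def blinfun.minus_left blinfun.diff_left)
  show ?thesis
    unfolding eqn_eq[OF jk(1)]
  proof (rule homogeneous_binomial[OF _ m])
    show "{sg j, tg j, sg (j - 1), tg (j - 1)} \<subseteq> R'" using jk sg_mem tg_mem by auto
    fix g assume "g \<in> R'"
    then show "blinfun_apply m g = (if sg j = g then 1 else 0) + (if tg j = g then 1 else 0)
        - ((if sg (j - 1) = g then 1 else 0) + (if tg (j - 1) = g then 1 else 0))"
    proof (cases rule: R'_cases)
      case (1 u)
      then show ?thesis using jk sg_not_lifted tg_not_lifted by (auto simp: ml)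
    next
      case (2 i)
      have "sg j \<noteq> tg i" "sg (j - 1) \<noteq> tg i" "tg j = tg i \<longleftrightarrow> j = i" "tg (j - 1) = tg i \<longleftrightarrow> j - 1 = i"
        using sg_neq_tg tg_inj jk 2(2) by blast+
      then show ?thesis unfolding 2(1) mt ms[OF 2(2)] by simp
    next
      case (3 i)
      have "tg j \<noteq> sg i" "tg (j - 1) \<noteq> sg i" "sg j = sg i \<longleftrightarrow> j = i" "sg (j - 1) = sg i \<longleftrightarrow> j - 1 = i"
        using sg_neq_tg sg_inj jk 3(2) by (metis, metis, blast, blast)
      then show ?thesis unfolding 3(1) ms[OF 3(2)] by simp
    qed
  qed
qed

lemma jacobian_eqn:
  assumes y: "y \<in> U'"
  shows "jacobian_full_rank R' k eqn y"
  unfolding jacobian_full_rank_def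
proof (intro allI impI)
  fix c assume c: "\<forall>u\<in>R'. (\<Sum>j\<in>{1..k}. c j * partial u (eqn j) y) = 0"
  \<comment> \<open>Extension by 0 to the indices \<open>0\<close> and \<open>k + 1\<close>: it
    gives the two end pairs the same formula as the others and the starting values for the
    propagation below.\<close>
  define C where "C j = (if j \<in> {1..k} then c j else 0)" for j
  have shift: "(\<Sum>j\<in>{1..k}. c j * ((if j = i then a else 0) - (if j = i + 1 then a else 0))) = (C i - C (i + 1)) * a"
    for i and a :: complex
  proof -
    have "(\<Sum>j\<in>{1..k}. c j * (if j = l then a else 0)) = C l * a" for l
    proof -
      have "(\<Sum>j\<in>{1..k}. c j * (if j = l then a else 0)) = (\<Sum>j\<in>{1..k}. if j = l then c l * a else 0)"
        by (rule sum.cong) auto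
      then show ?thesis by (simp add: C_def)
    qed
    then show ?thesis by (simp only: right_diff_distrib sum_subtractf left_diff_distrib)
  qed
  have s: "(C i - C (i + 1)) * y (tg i) = 0" if i: "i \<le> k" for i
  proof -
    have "partial (sg i) (eqn j) y = (if j = i then y (tg i) else 0) - (if j = i + 1 then y (tg i) else 0)"
      if j: "j \<in> {1..k}" for j
    proof -
      have jk: "1 \<le> j" "j \<le> k" "j - 1 \<le> k" using j by auto
      then have "j - 1 = i \<longleftrightarrow> j = i + 1" by auto
      then have "sg j = sg i \<longleftrightarrow> j = i" "sg (j - 1) = sg i \<longleftrightarrow> j = i + 1"
        unfolding sg_inj[OF jk(2) i] sg_inj[OF jk(3) i] by blast+
      moreover have "tg j \<noteq> sg i" "tg (j - 1) \<noteq> sg i"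
        using sg_neq_tg[OF i jk(2)] sg_neq_tg[OF i jk(3)] by metis+
      moreover have "j = i \<Longrightarrow> j - 1 = i \<Longrightarrow> False" using jk by simp
      ultimately show ?thesis unfolding eqn_eq[OF jk(1)] partial_binomial by auto
    qed
    then have "(\<Sum>j\<in>{1..k}. c j * ((if j = i then y (tg i) else 0) - (if j = i + 1 then y (tg i) else 0))) = 0"
      using c sg_mem[OF i] by (metis (no_types, lifting) sum.cong)
    then show ?thesis by (simp only: shift)
  qed
  have t: "(C i - C (i + 1)) * y (sg i) = 0" if i: "i \<le> k" for i
  proof -
    have "partial (tg i) (eqn j) y = (if j = i then y (sg i) else 0) - (if j = i + 1 then y (sg i) else 0)"
      if j: "j \<in> {1..k}" for j
    proof -
      have jk: "1 \<le> j" "j \<le> k" "j - 1 \<le> k" using j by auto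
      then have "j - 1 = i \<longleftrightarrow> j = i + 1" by auto
      then have "tg j = tg i \<longleftrightarrow> j = i" "tg (j - 1) = tg i \<longleftrightarrow> j = i + 1"
        unfolding tg_inj[OF jk(2) i] tg_inj[OF jk(3) i] by blast+
      moreover have "sg j \<noteq> tg i" "sg (j - 1) \<noteq> tg i"
        using sg_neq_tg[OF jk(2) i] sg_neq_tg[OF jk(3) i] by metis+
      moreover have "j = i \<Longrightarrow> j - 1 = i \<Longrightarrow> False" using jk by simp
      ultimately show ?thesis unfolding eqn_eq[OF jk(1)] partial_binomial by auto
    qed
    then have "(\<Sum>j\<in>{1..k}. c j * ((if j = i then y (sg i) else 0) - (if j = i + 1 then y (sg i) else 0))) = 0"
      using c tg_mem[OF i] by (metis (no_types, lifting) sum.cong)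
    then show ?thesis by (simp only: shift)
  qed
  obtain j0 where j0: "j0 \<le> k" "y \<in> dom j0" using semistable_dom[OF y] by blast
  \<comment> \<open>Neighbouring values \<open>C i\<close> and \<open>C (i + 1)\<close> agree when a
    coordinate of pair \<open>i\<close> is nonzero: upwards from \<open>C 0\<close> through the s
    coordinates below \<open>j0\<close>, and downwards from \<open>C (k + 1)\<close> through the t
    coordinates above \<open>j0\<close>.\<close>
  have low: "C i = 0" if "i \<le> j0" for i
    using that
  proof (induction i)
    case (Suc i)
    then show ?case using t[of i] j0 by (simp add: dom_def)
  qed (simp add: C_def)
  have high: "C i = 0" if "i \<le> k + 1" "j0 < i" for i
    using that
  proof (induction i rule: inc_induct)
    case (step i)
    then show ?case using s[of i] j0 by (simp add: dom_def)
  qed (simp add: C_def)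
  have "C j = 0" if "j \<in> {1..k}" for j
    using low[of j] high[of j] that by (cases "j \<le> j0") auto
  then show "\<forall>j\<in>{1..k}. c j = 0" by (metis C_def)
qed

lemma quasismooth_Z: "quasismooth_complete_intersection N' \<Sigma>' k eqn Z"
  unfolding quasismooth_complete_intersection_def complete_intersection_def zero_locus_def eqn_zero_iff
  using eqn_homogeneous Z_eq has_krull_dim_Z has_krull_dim_lifted jacobian_eqn by blast

end

theorem theorem4p2:
  fixes N :: "'v::euclidean_space set" and \<Sigma> :: "'v set set"
    and \<Gamma> :: "'v set" and e :: "nat \<Rightarrow> 'v" and k :: nat
  defines "\<Delta> \<equiv> anticanonical_polytope N \<Sigma>"
    and "N' \<equiv> lifted_lattice N k"
    and "\<Sigma>' \<equiv> edge_fan N \<Sigma> \<Gamma> e k"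
  assumes "is_lattice N" and "span N = UNIV"
    and "is_fan N \<Sigma>" and "complete_fan N \<Sigma>" and "simplicial_fan \<Sigma>"
    and "semiample_anticanonical N \<Sigma>"
    and "reflexive N \<Delta>"
    and "ray_gens N \<Sigma> \<subseteq> frontier (polar_polytope \<Delta>)"
    and "\<Gamma> edge_of polar_polytope \<Delta>"
    and "\<Gamma> \<inter> N \<subseteq> ray_gens N \<Sigma>"
    and "consecutive_lattice_points N \<Gamma> e k"
  shows "\<exists>\<Phi> \<phi>.
    (\<forall>x\<in>semistable N \<Sigma>.
       \<Phi> x \<in> semistable N' \<Sigma>' \<and>
       (\<forall>j\<in>{1..k + 1}. \<Phi> x (s_gen e k j) = (\<Prod>l\<in>{0..<j}. x (e l))) \<and>
       (\<forall>j\<in>{0..k}. \<Phi> x (t_gen e k j) = (\<Prod>l\<in>{j + 1..k + 1}. x (e l))) \<and>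
       (\<forall>u\<in>ray_gens N \<Sigma> - \<Gamma>. \<Phi> x (u, 0) = x u) \<and>
       \<phi> (orbit N \<Sigma> x) = orbit N' \<Sigma>' (\<Phi> x)) \<and>
    closed_embedding (toric_variety N \<Sigma>) (toric_variety N' \<Sigma>') \<phi> \<and>
    quasismooth_complete_intersection N' \<Sigma>' k
      (\<lambda>j. var (s_gen e k (j + 1)) * var (t_gen e k j) - var (s_gen e k j) * var (t_gen e k (j - 1)))
      (\<phi> ` points (toric_variety N \<Sigma>))"
proof -
  have "convex \<Gamma>"
    using assms(12) face_of_imp_convex unfolding edge_of_def by blast
  then interpret E: fan_with_edge N \<Sigma> \<Gamma> e k
    by unfold_locales (use assms in auto)
  have s: "E.Phi x (s_gen e k j) = (\<Prod>l\<in>{0..<j}. x (e l))" if "j \<in> {1..k + 1}" for x j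
  proof -
    have "{0..<j} = {..j - 1}" "j - 1 \<le> k" "s_gen e k j = E.sg (j - 1)"
      using that by (auto simp: E.sg_def)
    then show ?thesis by (simp add: E.Phi_sg)
  qed
  have t: "E.Phi x (t_gen e k j) = (\<Prod>l\<in>{j + 1..k + 1}. x (e l))" if "j \<in> {0..k}" for x j
    using that E.Phi_tg[of j x] unfolding E.tg_def by simp
  have lifts: "\<forall>x\<in>semistable N \<Sigma>. E.Phi x \<in> semistable N' \<Sigma>' \<and>
       (\<forall>j\<in>{1..k + 1}. E.Phi x (s_gen e k j) = (\<Prod>l\<in>{0..<j}. x (e l))) \<and>
       (\<forall>j\<in>{0..k}. E.Phi x (t_gen e k j) = (\<Prod>l\<in>{j + 1..k + 1}. x (e l))) \<and>
       (\<forall>u\<in>ray_gens N \<Sigma> - \<Gamma>. E.Phi x (u, 0) = x u) \<and>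
       E.phi (orbit N \<Sigma> x) = orbit N' \<Sigma>' (E.Phi x)"
    unfolding N'_def \<Sigma>'_def
    by (intro ballI conjI E.Phi_semistable s t E.Phi_lifted E.phi_orbit) auto
  show ?thesis
    by (rule exI[of _ E.Phi], rule exI[of _ E.phi], intro conjI lifts)
      (unfold N'_def \<Sigma>'_def, rule E.closed_embedding_phi, rule E.quasismooth_Z[unfolded E.Z_def E.eqn_def[abs_def]])
qed

end
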